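(* Let $n\ge1$. For measurable functions $f_1,\dots,f_n$ on $\mathbb R^d$, define the family $\{\omega_{k\dots \ell}^\prec(x,y)\}_{1\le k\le \ell\le n}$ of two parameter functions on $\mathbb R^d\times\mathbb R^d$ by the recursive formula $$\omega^\prec_{k\dots\ell}(x,y)=f^\prec_{k\dots \ell}(y)-f^\prec_{k\dots\ell}(x)-\sum_{m=k}^{\ell-1}f^\prec_{k\dots m}(x)\,\omega^\prec_{(m+1)\dots \ell}(x,y).$$ Let $\alpha_1,\dots,\alpha_n\in(0,1)$, $p_1,\dots,p_n,q_1,\dots,q_n\in[1,\infty]$, and $f_i\in B_{p_i,q_i}^{\alpha_i}$ for each $i$. If $\alpha:=\alpha_1+\cdots+\alpha_n<1$, $\frac1p:=\frac1{p_1}+\cdots+\frac1{p_n}\le1$, and $\frac1q:=\frac1{q_1}+\cdots+\frac1{q_n}\le1$, then $\omega_{1\dots n}^\prec\in D_{p,q}^\alpha$ and $$\|\omega_{1\dots n}^\prec\|_{D_{p,q}^\alpha}\lesssim\|f_1\|_{B_{p_1,q_1}^{\alpha_1}}\cdots\|f_n\|_{B_{p_n,q_n}^{\alpha_n}}.$$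
   Context: Let $\mathcal S=\mathcal S(\mathbb R^d)$ be the Schwartz space and $\mathcal S'$ its dual. Fix smooth radial functions $\chi,\rho$ on $\mathbb R^d$ with $\operatorname{supp}\chi\subset\{|x|<\frac43\}$, $\operatorname{supp}\rho\subset\{\frac34<|x|<\frac83\}$ and $\chi(x)+\sum_{j\ge0}\rho(2^{-j}x)=1$ for all $x$. Set $\rho_{-1}=\chi$, $\rho_j=\rho(2^{-j}\cdot)$ for $j\ge0$, and $\Delta_jf=\mathcal F^{-1}(\rho_j\mathcal Ff)$ for $f\in\mathcal S'$, $j\ge-1$. Besov spaces: $B_{p,q}^\alpha$ is the space of $f\in\mathcal S'$ with $\|f\|_{B_{p,q}^\alpha}:=\|\{2^{j\alpha}\|\Delta_jf\|_{L^p}\}_{j\ge-1}\|_{\ell^q}<\infty$. Two parameter norm: for measurable $\omega(x,y)$ on $\mathbb R^d\times\mathbb R^d$, $$\|\omega\|_{D_{p,q}^\alpha}:=\Big\||h|^{-\alpha}\|\omega(x,x+h)\|_{L^p(dx)}\Big\|_{L^q(dh/|h|^d)},$$ and $\omega\in D_{p,q}^\alpha$ means this is finite. Paraproduct: $f\prec g:=\sum_{j,k\ge-1,\ j<k-1}\Delta_jf\,\Delta_kg$. Iterated paraproducts: $(f_1)^\prec:=f_1$, $(f_1,\dots,f_n)^\prec:=(f_1,\dots,f_{n-1})^\prec\prec f_n$, and $f_{k\dots\ell}^\prec:=(f_k,\dots,f_\ell)^\prec$. The symbol $\lesssim$ means inequality up to a multiplicative constant independent of the functions $f_1,\dots,f_n$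 (it may depend on $d$, $n$, $\chi,\rho$ and the exponents). *)

theory Defs
  imports "HOL-Analysis.Analysis" "HOL-Probability.Essential_Supremum"
begin

text \<open>Throughout, \<open>'a\<close> of class \<open>euclidean_space\<close> plays the role of \<open>\<real>\<^sup>d\<close> with \<open>d = DIM('a)\<close>,
  and functions are complex-valued.\<close>

section \<open>Schwartz functions and tempered distributions\<close>

primrec iter_deriv :: "'a::euclidean_space list \<Rightarrow> ('a \<Rightarrow> complex) \<Rightarrow> 'a \<Rightarrow> complex" where
  "iter_deriv [] f = f"
| "iter_deriv (b # bs) f = (\<lambda>x. frechet_derivative (iter_deriv bs f) (at x) b)"

definition smooth_fun :: "('a::euclidean_space \<Rightarrow> complex) \<Rightarrow> bool" where
  "smooth_fun f \<longleftrightarrow> (\<forall>bs x. set bs \<subseteq> Basis \<longrightarrow> iter_deriv bs f differentiable at x)"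

definition schwartz_values :: "nat \<Rightarrow> ('a::euclidean_space \<Rightarrow> complex) \<Rightarrow> real set" where
  "schwartz_values N \<phi> =
     {(1 + norm x) ^ N * norm (iter_deriv bs \<phi> x) | bs x. set bs \<subseteq> Basis \<and> length bs \<le> N}"

definition schwartz :: "('a::euclidean_space \<Rightarrow> complex) set" where
  "schwartz = {\<phi>. smooth_fun \<phi> \<and> (\<forall>N. bdd_above (schwartz_values N \<phi>))}"

definition schwartz_seminorm :: "nat \<Rightarrow> ('a::euclidean_space \<Rightarrow> complex) \<Rightarrow> real" where
  "schwartz_seminorm N \<phi> = Sup (schwartz_values N \<phi>)"

text \<open>A distribution is a functional of which only the values on \<^const>\<open>schwartz\<close> matter.
  The seminorms above increase with \<open>N\<close>, so continuity means being dominated by one of them.\<close>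

type_synonym 'a distr = "('a \<Rightarrow> complex) \<Rightarrow> complex"

definition tempered :: "'a::euclidean_space distr set" where
  "tempered = {u.
     (\<forall>\<phi>\<in>schwartz. \<forall>\<psi>\<in>schwartz. u (\<lambda>x. \<phi> x + \<psi> x) = u \<phi> + u \<psi>) \<and>
     (\<forall>\<phi>\<in>schwartz. \<forall>c. u (\<lambda>x. c * \<phi> x) = c * u \<phi>) \<and>
     (\<exists>C N. \<forall>\<phi>\<in>schwartz. norm (u \<phi>) \<le> C * schwartz_seminorm N \<phi>)}"

definition regular_fun :: "('a::euclidean_space \<Rightarrow> complex) \<Rightarrow> bool" where
  "regular_fun f \<longleftrightarrow> f \<in> borel_measurable lebesgue \<and>
     (\<forall>\<phi>\<in>schwartz. integrable lebesgue (\<lambda>x. f x * \<phi> x))"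

definition distr_of :: "('a::euclidean_space \<Rightarrow> complex) \<Rightarrow> 'a distr" where
  "distr_of f = (\<lambda>\<phi>. LINT x|lebesgue. f x * \<phi> x)"

text \<open>The function, unique up to null sets, that represents a regular distribution.  All norms
  below depend only on almost-everywhere classes, so the choice is immaterial.\<close>

definition fun_of :: "'a::euclidean_space distr \<Rightarrow> 'a \<Rightarrow> complex" where
  "fun_of u = (SOME g. regular_fun g \<and> (\<forall>\<phi>\<in>schwartz. distr_of g \<phi> = u \<phi>))"


section \<open>Fourier transform and Littlewood--Paley blocks\<close>

text \<open>Convention: the kernel is \<open>exp (- \<i> x \<bullet> \<xi>)\<close>, with the factor \<open>(2 \<pi>) ^ (- d)\<close> in the inverse.\<close>

definition fourier :: "('a::euclidean_space \<Rightarrow> complex) \<Rightarrow> 'a \<Rightarrow> complex" where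
  "fourier \<phi> \<xi> = (LINT x|lebesgue. \<phi> x * cis (- (x \<bullet> \<xi>)))"

definition inv_fourier :: "('a::euclidean_space \<Rightarrow> complex) \<Rightarrow> 'a \<Rightarrow> complex" where
  "inv_fourier \<phi> x = (LINT \<xi>|lebesgue. \<phi> \<xi> * cis (x \<bullet> \<xi>)) / of_real ((2 * pi) ^ DIM('a))"

definition fourier_distr :: "'a::euclidean_space distr \<Rightarrow> 'a distr" where
  "fourier_distr u = (\<lambda>\<phi>. u (fourier \<phi>))"

definition inv_fourier_distr :: "'a::euclidean_space distr \<Rightarrow> 'a distr" where
  "inv_fourier_distr u = (\<lambda>\<phi>. u (inv_fourier \<phi>))"

definition mult_distr :: "('a::euclidean_space \<Rightarrow> complex) \<Rightarrow> 'a distr \<Rightarrow> 'a distr" where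
  "mult_distr m u = (\<lambda>\<phi>. u (\<lambda>x. m x * \<phi> x))"

definition radial :: "('a::euclidean_space \<Rightarrow> complex) \<Rightarrow> bool" where
  "radial f \<longleftrightarrow> (\<forall>x y. norm x = norm y \<longrightarrow> f x = f y)"

text \<open>At each point only finitely many terms of the series are nonzero.\<close>

definition dyadic_partition ::
    "('a::euclidean_space \<Rightarrow> complex) \<Rightarrow> ('a \<Rightarrow> complex) \<Rightarrow> bool" where
  "dyadic_partition chi rho \<longleftrightarrow>
     smooth_fun chi \<and> radial chi \<and> smooth_fun rho \<and> radial rho \<and>
     closure {x. chi x \<noteq> 0} \<subseteq> {x. norm x < 4 / 3} \<and>
     closure {x. rho x \<noteq> 0} \<subseteq> {x. 3 / 4 < norm x \<and> norm x < 8 / 3} \<and>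
     (\<forall>x. chi x + (\<Sum>j. rho (x /\<^sub>R 2 ^ j)) = 1)"

definition dyadic :: "('a::euclidean_space \<Rightarrow> complex) \<Rightarrow> ('a \<Rightarrow> complex) \<Rightarrow> int \<Rightarrow> 'a \<Rightarrow> complex" where
  "dyadic chi rho j = (if j = -1 then chi else (\<lambda>x. rho ((2 powr (- real_of_int j)) *\<^sub>R x)))"

definition lp_block ::
    "('a::euclidean_space \<Rightarrow> complex) \<Rightarrow> ('a \<Rightarrow> complex) \<Rightarrow> int \<Rightarrow> 'a distr \<Rightarrow> 'a distr" where
  "lp_block chi rho j u = inv_fourier_distr (mult_distr (dyadic chi rho j) (fourier_distr u))"

text \<open>The block as a function: by Paley--Wiener it is a smooth function of polynomial growth.\<close>

definition lp_fun ::
    "('a::euclidean_space \<Rightarrow> complex) \<Rightarrow> ('a \<Rightarrow> complex) \<Rightarrow> int \<Rightarrow> 'a distr \<Rightarrow> 'a \<Rightarrow> complex" where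
  "lp_fun chi rho j u = fun_of (lp_block chi rho j u)"


section \<open>Norms\<close>

definition ennpowr :: "ennreal \<Rightarrow> real \<Rightarrow> ennreal" where
  "ennpowr a r = (if a = \<infinity> then \<infinity> else ennreal (enn2real a powr r))"

text \<open>The \<open>L\<^sup>p\<close> norm of \<open>g \<ge> 0\<close> for \<open>1 \<le> p \<le> \<infinity>\<close>; with a counting measure it is the \<open>\<ell>\<^sup>p\<close> norm.\<close>

definition Lnorm :: "'b measure \<Rightarrow> ennreal \<Rightarrow> ('b \<Rightarrow> ennreal) \<Rightarrow> ennreal" where
  "Lnorm M p g = (if p = \<infinity> then esssup M g
     else ennpowr (\<integral>\<^sup>+ x. ennpowr (g x) (enn2real p) \<partial>M) (1 / enn2real p))"

definition besov_norm ::
    "('a::euclidean_space \<Rightarrow> complex) \<Rightarrow> ('a \<Rightarrow> complex) \<Rightarrow> real \<Rightarrow> ennreal \<Rightarrow> ennreal \<Rightarrow> 'a distr \<Rightarrow> ennreal"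
  where
  "besov_norm chi rho \<alpha> p q u =
     Lnorm (count_space {-1::int..}) q
       (\<lambda>j. ennreal (2 powr (real_of_int j * \<alpha>))
              * Lnorm lebesgue p (\<lambda>x. ennreal (norm (lp_fun chi rho j u x))))"

definition besov ::
    "('a::euclidean_space \<Rightarrow> complex) \<Rightarrow> ('a \<Rightarrow> complex) \<Rightarrow> real \<Rightarrow> ennreal \<Rightarrow> ennreal \<Rightarrow> 'a distr set"
  where
  "besov chi rho \<alpha> p q = {u \<in> tempered. besov_norm chi rho \<alpha> p q u < \<infinity>}"

definition two_param_norm ::
    "real \<Rightarrow> ennreal \<Rightarrow> ennreal \<Rightarrow> ('a::euclidean_space \<Rightarrow> 'a \<Rightarrow> complex) \<Rightarrow> ennreal" where
  "two_param_norm \<alpha> p q \<omega> =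
     Lnorm (density lebesgue (\<lambda>h::'a. ennreal (norm h powr (- real DIM('a))))) q
       (\<lambda>h. ennreal (norm h powr (- \<alpha>))
              * Lnorm lebesgue p (\<lambda>x. ennreal (norm (\<omega> x (x + h)))))"

definition two_param ::
    "real \<Rightarrow> ennreal \<Rightarrow> ennreal \<Rightarrow> ('a::euclidean_space \<Rightarrow> 'a \<Rightarrow> complex) set" where
  "two_param \<alpha> p q = {\<omega>. (\<lambda>(x, y). \<omega> x y) \<in> borel_measurable (lebesgue :: ('a \<times> 'a) measure) \<and>
                          two_param_norm \<alpha> p q \<omega> < \<infinity>}"


section \<open>Iterated paraproducts\<close>

text \<open>The double series converges in the sense of distributions; the terms are integrated
  against the test function.\<close>

definition paraprod ::
    "('a::euclidean_space \<Rightarrow> complex) \<Rightarrow> ('a \<Rightarrow> complex) \<Rightarrow> 'a distr \<Rightarrow> 'a distr \<Rightarrow> 'a distr" where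
  "paraprod chi rho u v = (\<lambda>\<phi>.
     \<Sum>\<^sub>\<infinity>(j, k)\<in>{(j, k). -1 \<le> j \<and> -1 \<le> k \<and> j < k - 1}.
       distr_of (\<lambda>x. lp_fun chi rho j u x * lp_fun chi rho k v x) \<phi>)"

text \<open>\<open>iter_paraprod chi rho u k l\<close> is \<open>(u\<^sub>k, \<dots>, u\<^sub>l)\<^sup>\<prec>\<close> for \<open>k \<le> l\<close>.\<close>

definition iter_paraprod ::
    "('a::euclidean_space \<Rightarrow> complex) \<Rightarrow> ('a \<Rightarrow> complex) \<Rightarrow> (nat \<Rightarrow> 'a distr) \<Rightarrow> nat \<Rightarrow> nat \<Rightarrow> 'a distr"
  where
  "iter_paraprod chi rho u k l = foldl (paraprod chi rho) (u k) (map u [Suc k..<Suc l])"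

definition iter_para_fun ::
    "('a::euclidean_space \<Rightarrow> complex) \<Rightarrow> ('a \<Rightarrow> complex) \<Rightarrow> (nat \<Rightarrow> 'a \<Rightarrow> complex) \<Rightarrow>
     nat \<Rightarrow> nat \<Rightarrow> 'a \<Rightarrow> complex" where
  "iter_para_fun chi rho f k l =
     (if k = l then f k else fun_of (iter_paraprod chi rho (\<lambda>i. distr_of (f i)) k l))"

function para_remainder ::
    "('a::euclidean_space \<Rightarrow> complex) \<Rightarrow> ('a \<Rightarrow> complex) \<Rightarrow> (nat \<Rightarrow> 'a \<Rightarrow> complex) \<Rightarrow>
     nat \<Rightarrow> nat \<Rightarrow> 'a \<Rightarrow> 'a \<Rightarrow> complex" where
  "para_remainder chi rho f k l x y =
     iter_para_fun chi rho f k l y - iter_para_fun chi rho f k l x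
     - (\<Sum>m\<in>{k..<l}. iter_para_fun chi rho f k m x * para_remainder chi rho f (m + 1) l x y)"
  by pat_completeness auto
termination
  by (relation "Wellfounded.measure (\<lambda>(chi, rho, f, k, l, x, y). l - k)") auto

declare para_remainder.simps [simp del]

end

theory Submission
  imports Defs "HOL-Probability.Characteristic_Functions" "HOL-Probability.Sinc_Integral" "HOL-Library.Nat_Bijection"
begin

text \<open>
  Write \<open>F\<^bsub>ab\<^esub>\<close> for the iterated paraproduct of \<open>f\<^bsub>a+1\<^esub>, \<dots>, f\<^bsub>b\<^esub>\<close> and \<open>\<omega>\<^bsub>ab\<^esub>\<close> for its remainder.
  The recursion says that \<open>\<omega>\<close> solves a unitriangular linear system with coefficients \<open>F(x)\<close> and
  right-hand side \<open>F(y) - F(x)\<close>.  Expanding each paraproduct with last factor \<open>f\<^bsub>b\<^esub>\<close> into the blocks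
  \<open>d\<^bsub>J\<^esub>\<close> of \<open>f\<^bsub>b\<^esub>\<close> gives \<open>\<omega>\<^bsub>ab\<^esub>(x,y) = \<Sum>\<^bsub>J\<^esub> A\<^bsub>J\<^esub>(x,y) d\<^bsub>J\<^esub>(y) - A\<^bsub>J\<^esub>(x,x) d\<^bsub>J\<^esub>(x)\<close>, where \<open>A\<^bsub>J\<^esub>(x,y)\<close>
  solves the same system with the low-frequency parts of \<open>F\<^bsub>m,b-1\<^esub>(y)\<close> on the right.  The kernel that
  produces these low-frequency parts has integral 1, so \<open>A\<^bsub>J\<^esub>(x,\<cdot>)\<close> is the mollification of
  \<open>\<omega>\<^bsub>a,b-1\<^esub>(x,\<cdot>)\<close> at scale \<open>2\<^bsup>-J\<^esup>\<close> and inherits its size by induction.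

  With \<open>y = x + h\<close>, if \<open>2\<^bsup>J\<^esup>|h| \<le> 1\<close> then the increments of \<open>A\<^bsub>J\<^esub>\<close> and of \<open>d\<^bsub>J\<^esub>\<close> gain a factor
  \<open>2\<^bsup>J\<^esup>|h|\<close>; otherwise Chen's relation moves the base point of \<open>A\<^bsub>J\<^esub>(x,y)\<close> from \<open>x\<close> to \<open>y\<close>, at the
  expense of products of lower-order remainders.  Schur's test for the kernel \<open>min(1, 2\<^bsup>J\<^esup>|h|)\<close>, which
  needs \<open>0 < \<alpha> < 1\<close>, and Hoelder's inequality close the induction.  The same induction bounds the norms
  of \<open>F\<^bsub>ab\<^esub>\<close> and the sum of the norms of its blocks; the latter makes the paraproducts
  almost everywhere convergent series.\<close>

section \<open>Lebesgue norms\<close>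

text \<open>Mollifying \<omega>(x,.) controls the coefficient A_J only on the diagonal and within
  distance 2^(-J) of it. For larger |h| the value at (x, x + h) involves \<omega> at distance |h|,
  with no gain in J; hence the change of base point. The mollification rests on the gap j < k - 1 in
  the paraproduct: the part in front of block J is the convolution with \<open>P (J - 2)\<close>,
  smooth at scale 2^(-J). It degenerates to 0 for the two lowest blocks, which are therefore
  estimated separately.

  A second obstacle lies in the definitions: blocks and paraproducts are functionals, and functions
  enter through a choice among representatives. Testing with Schwartz functions alone would require
  that the Fourier transform preserves the Schwartz space. All functionals here are tested against
  arbitrary rapidly decreasing measurable functions, where decay is all that has to be checked;
  Fourier inversion is then needed for compactly supported smooth symbols only.\<close>

lemma ennpowr_top [simp]: "ennpowr \<infinity> r = \<infinity>" "ennpowr top r = top"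
  by (simp_all add: ennpowr_def)

lemma ennpowr_ennreal: "0 \<le> x \<Longrightarrow> ennpowr (ennreal x) r = ennreal (x powr r)"
  by (simp add: ennpowr_def)

lemma ennpowr_0 [simp]: "ennpowr 0 r = 0"
  by (simp add: ennpowr_def)

lemma ennpowr_1 [simp]: "ennpowr 1 r = 1"
  by (simp add: ennpowr_def)

lemma ennpowr_exp_1 [simp]: "ennpowr a 1 = a"
  by (cases a rule: ennreal_cases) (auto simp: ennpowr_ennreal)

lemma ennpowr_eq_0_iff [simp]: "ennpowr a r = 0 \<longleftrightarrow> a = 0"
  by (cases a rule: ennreal_cases) (auto simp: ennpowr_ennreal)

lemma ennpowr_eq_top_iff [simp]: "ennpowr a r = top \<longleftrightarrow> a = top"
  by (cases a rule: ennreal_cases) (auto simp: ennpowr_ennreal)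

lemma ennpowr_mono: "a \<le> b \<Longrightarrow> 0 \<le> r \<Longrightarrow> ennpowr a r \<le> ennpowr b r"
  by (cases a rule: ennreal_cases; cases b rule: ennreal_cases)
     (auto simp: ennpowr_ennreal powr_mono2 top_unique intro!: ennreal_leI)

lemma ennpowr_mult: "0 < r \<Longrightarrow> ennpowr (a * b) r = ennpowr a r * ennpowr b r"
proof (cases a rule: ennreal_cases; cases b rule: ennreal_cases)
  fix x y assume "0 < r" "0 \<le> x" "a = ennreal x" "0 \<le> y" "b = ennreal y"
  then show ?thesis by (simp add: ennpowr_ennreal powr_mult flip: ennreal_mult)
qed (auto simp: ennreal_mult_top ennreal_top_mult ennpowr_ennreal)

text \<open>The conventions \<open>0 powr r = 0\<close> and \<open>ennpowr top r = top\<close> for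
  every real \<open>r\<close>, negative ones included, make the exponent laws hold on all of
  [0, top].\<close>

lemma ennpowr_ennpowr: "ennpowr (ennpowr a r) s = ennpowr a (r * s)"
  by (cases a rule: ennreal_cases) (auto simp: ennpowr_ennreal powr_powr)

lemma ennpowr_add: "ennpowr a (r + s) = ennpowr a r * ennpowr a s"
  by (cases a rule: ennreal_cases)
     (auto simp: ennpowr_ennreal powr_add ennreal_mult)

lemma borel_measurable_ennpowr [measurable (raw)]:
  assumes [measurable]: "f \<in> borel_measurable M"
  shows "(\<lambda>x. ennpowr (f x) r) \<in> borel_measurable M"
  unfolding ennpowr_def by measurable

section \<open>Young's and Hoelder's inequalities\<close>

lemma ennpowr_young:
  assumes "0 < \<theta>" "\<theta> < 1"
  shows "ennpowr x \<theta> * ennpowr y (1 - \<theta>) \<le> ennreal \<theta> * x + ennreal (1 - \<theta>) * y"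
proof (cases x rule: ennreal_cases; cases y rule: ennreal_cases)
  fix a b assume *: "0 \<le> a" "x = ennreal a" "0 \<le> b" "y = ennreal b"
  have "a powr \<theta> * b powr (1 - \<theta>) \<le> \<theta> * a + (1 - \<theta>) * b"
  proof (cases "a = 0 \<or> b = 0")
    case False
    then show ?thesis using Youngs_inequality_0[of \<theta> "1 - \<theta>" a b] assms * by auto
  qed (use assms * in auto)
  then show ?thesis using * assms
    by (simp add: ennpowr_ennreal ennreal_leI flip: ennreal_mult ennreal_plus)
qed (use assms in \<open>auto simp: ennreal_mult_top\<close>)

text \<open>Hoelder's inequality with weights: after \<open>F\<close> and \<open>G\<close> are
  scaled to integral 1, Young's inequality is integrated. The integrals 0 and top are split off
  because they cannot be scaled.\<close>

lemma nn_integral_ennpowr_mult_le: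
  assumes [measurable]: "F \<in> borel_measurable M" "G \<in> borel_measurable M"
    and \<theta>: "0 < \<theta>" "\<theta> < 1"
  shows "(\<integral>\<^sup>+x. ennpowr (F x) \<theta> * ennpowr (G x) (1 - \<theta>) \<partial>M)
           \<le> ennpowr (\<integral>\<^sup>+x. F x \<partial>M) \<theta> * ennpowr (\<integral>\<^sup>+x. G x \<partial>M) (1 - \<theta>)"
proof -
  let ?A = "\<integral>\<^sup>+x. F x \<partial>M" and ?B = "\<integral>\<^sup>+x. G x \<partial>M"
  consider "?A = 0 \<or> ?B = 0" | "?A \<noteq> 0" "?B \<noteq> 0" "?A = top \<or> ?B = top"
    | "?A \<noteq> 0" "?B \<noteq> 0" "?A \<noteq> top" "?B \<noteq> top" by blast
  then show ?thesis
  proof cases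
    case 1
    then have "AE x in M. F x = 0 \<or> G x = 0"
      by (auto simp: nn_integral_0_iff_AE)
    then have "AE x in M. ennpowr (F x) \<theta> * ennpowr (G x) (1 - \<theta>) = 0"
      by eventually_elim auto
    then have "(\<integral>\<^sup>+x. ennpowr (F x) \<theta> * ennpowr (G x) (1 - \<theta>) \<partial>M) = 0"
      by (subst nn_integral_0_iff_AE) auto
    then show ?thesis by simp
  next
    case 2
    then have "ennpowr ?A \<theta> * ennpowr ?B (1 - \<theta>) = top"
      by (auto simp: ennreal_mult_eq_top_iff)
    then show ?thesis by simp
  next
    case 3
    obtain a where a: "?A = ennreal a" "0 < a"
      using 3 by (cases ?A rule: ennreal_cases) (auto simp: less_le)
    obtain b where b: "?B = ennreal b" "0 < b"
      using 3 by (cases ?B rule: ennreal_cases) (auto simp: less_le)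
    have resc: "ennreal c * (x * ennreal (1 / c)) = x" if "c > 0" for c x
    proof -
      have "ennreal c * (x * ennreal (1 / c)) = x * (ennreal c * ennreal (1 / c))"
        by (simp add: mult_ac)
      also have "ennreal c * ennreal (1 / c) = 1"
        using that by (simp flip: ennreal_mult)
      finally show ?thesis by simp
    qed
    let ?K = "ennpowr ?A \<theta> * ennpowr ?B (1 - \<theta>)"
    have "(\<integral>\<^sup>+x. ennpowr (F x) \<theta> * ennpowr (G x) (1 - \<theta>) \<partial>M)
       \<le> (\<integral>\<^sup>+x. ?K * (ennreal \<theta> * (F x * ennreal (1 / a)) + ennreal (1 - \<theta>) * (G x * ennreal (1 / b))) \<partial>M)"
    proof (rule nn_integral_mono)
      fix x
      have "ennpowr (F x) \<theta> * ennpowr (G x) (1 - \<theta>)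
        = ennpowr (?A * (F x * ennreal (1 / a))) \<theta> * ennpowr (?B * (G x * ennreal (1 / b))) (1 - \<theta>)"
        using resc[OF a(2)] resc[OF b(2)] a b by simp
      also have "\<dots> = ?K * (ennpowr (F x * ennreal (1 / a)) \<theta> * ennpowr (G x * ennreal (1 / b)) (1 - \<theta>))"
        using \<theta> by (simp add: ennpowr_mult mult_ac)
      also have "\<dots> \<le> ?K * (ennreal \<theta> * (F x * ennreal (1 / a)) + ennreal (1 - \<theta>) * (G x * ennreal (1 / b)))"
        by (intro mult_left_mono ennpowr_young \<theta>) auto
      finally show "ennpowr (F x) \<theta> * ennpowr (G x) (1 - \<theta>) \<le> \<dots>" .
    qed
    also have "\<dots> = ?K * (ennreal \<theta> * (?A * ennreal (1 / a)) + ennreal (1 - \<theta>) * (?B * ennreal (1 / b)))"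
      by (simp add: nn_integral_cmult nn_integral_add nn_integral_multc)
    also have "ennreal \<theta> * (?A * ennreal (1 / a)) + ennreal (1 - \<theta>) * (?B * ennreal (1 / b)) = 1"
      using a b \<theta> by (simp flip: ennreal_mult ennreal_plus)
    finally show ?thesis by simp
  qed
qed

text \<open>The norm is indexed by the reciprocal \<open>s = 1 / p\<close> of the exponent, so that the exponents in
  Hoelder's inequality add up.\<close>

definition rnorm :: "'b measure \<Rightarrow> real \<Rightarrow> ('b \<Rightarrow> ennreal) \<Rightarrow> ennreal" where
  "rnorm M s g = (if s = 0 then esssup M g else ennpowr (\<integral>\<^sup>+x. ennpowr (g x) (1 / s) \<partial>M) s)"

lemma rnorm_1: "rnorm M 1 g = (\<integral>\<^sup>+x. g x \<partial>M)"
  by (simp add: rnorm_def)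

lemma enn2real_inverse_bounds:
  assumes "1 \<le> p" shows "enn2real (1 / p) \<in> {0..1}" "1 / p = ennreal (enn2real (1 / p))"
proof -
  have "1 / p \<le> 1" using assms by (cases p rule: ennreal_cases) (auto simp: divide_ennreal simp flip: ennreal_1)
  then show "enn2real (1 / p) \<in> {0..1}"
    by (metis atLeastAtMost_iff enn2real_1 enn2real_mono enn2real_nonneg ennreal_one_less_top)
  show "1 / p = ennreal (enn2real (1 / p))"
    using \<open>1 / p \<le> 1\<close> by (metis ennreal_enn2real ennreal_one_less_top order_le_less_trans)
qed

lemma Lnorm_eq_rnorm:
  assumes "1 \<le> p" shows "Lnorm M p g = rnorm M (enn2real (1 / p)) g"
proof (cases p rule: ennreal_cases)
  case (real r)
  then have "r \<ge> 1" using assms by simp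
  then have "enn2real (1 / p) = 1 / r"
    using real by (simp add: divide_ennreal flip: ennreal_1)
  then show ?thesis using real \<open>r \<ge> 1\<close> by (simp add: Lnorm_def rnorm_def)
next
  case top
  then show ?thesis by (simp add: Lnorm_def rnorm_def)
qed

lemma AE_le_rnorm_0: "AE x in M. g x \<le> rnorm M 0 g"
  by (simp add: rnorm_def esssup_AE)

lemma rnorm_mono_AE:
  assumes "f \<in> borel_measurable M" "AE x in M. f x \<le> g x" "0 \<le> s"
  shows "rnorm M s f \<le> rnorm M s g"
proof (cases "s = 0")
  case False
  then show ?thesis using assms
    by (auto simp: rnorm_def intro!: ennpowr_mono nn_integral_mono_AE elim: eventually_mono)
qed (use assms in \<open>auto simp: rnorm_def esssup_AE_mono\<close>)

lemma rnorm_cong_AE: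
  assumes "f \<in> borel_measurable M" "g \<in> borel_measurable M" "AE x in M. f x = g x" "0 \<le> s"
  shows "rnorm M s f = rnorm M s g"
  by (intro antisym rnorm_mono_AE assms) (use assms(3) in \<open>auto elim: eventually_mono\<close>)

lemma rnorm_const_le_1: "rnorm M 0 (\<lambda>_. 1) \<le> 1"
  by (simp add: rnorm_def esssup_I)

lemma rnorm_mult_le:
  assumes [measurable]: "f \<in> borel_measurable M" "g \<in> borel_measurable M"
    and "0 \<le> s" "0 \<le> t"
  shows "rnorm M (s + t) (\<lambda>x. f x * g x) \<le> rnorm M s f * rnorm M t g"
proof -
  \<comment> \<open>The endpoint 0 stands for the essential supremum and needs its own argument; it
    is proved for arbitrary \<open>f\<close> and \<open>g\<close>, so that either factor can be the
    bounded one.\<close>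
  have zero: "rnorm M t (\<lambda>x. f x * g x) \<le> rnorm M 0 f * rnorm M t g"
    if [measurable]: "f \<in> borel_measurable M" "g \<in> borel_measurable M" and "0 \<le> t" for t f g
  proof (cases "t = 0")
    case True
    have "AE x in M. f x * g x \<le> rnorm M 0 f * rnorm M 0 g"
      using AE_le_rnorm_0[of f M] AE_le_rnorm_0[of g M]
      by eventually_elim (intro mult_mono, auto)
    then show ?thesis using True that by (subst rnorm_def) auto
  next
    case False
    then have "t > 0" using that by simp
    have "rnorm M t (\<lambda>x. f x * g x) \<le> rnorm M t (\<lambda>x. rnorm M 0 f * g x)"
      using AE_le_rnorm_0[of f M] \<open>0 \<le> t\<close>
      by (intro rnorm_mono_AE) (auto elim!: eventually_mono intro!: mult_right_mono)
    also have "\<dots> = rnorm M 0 f * rnorm M t g"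
      using \<open>t > 0\<close>
      by (simp add: rnorm_def[of _ t] ennpowr_mult nn_integral_cmult ennpowr_ennpowr)
    finally show ?thesis .
  qed
  show ?thesis
  proof (cases "s = 0 \<or> t = 0")
    case True
    then show ?thesis
      using zero[of f g t] zero[of g f s] assms by (auto simp: mult.commute)
  next
    case False
    then have st: "s > 0" "t > 0" using assms by auto
    \<comment> \<open>With this weight
      \<open>\<theta> / s = 1 / (s + t) = (1 - \<theta>) / t\<close>, so the weighted inequality
      applies to the powers \<open>1 / s\<close> of \<open>f\<close> and \<open>1 / t\<close> of
      \<open>g\<close>.\<close>
    define \<theta> where "\<theta> = s / (s + t)"
    have \<theta>: "0 < \<theta>" "\<theta> < 1" "1 - \<theta> = t / (s + t)"
      using st by (auto simp: \<theta>_def field_simps)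
    have "(\<integral>\<^sup>+x. ennpowr (f x * g x) (1 / (s + t)) \<partial>M)
        = (\<integral>\<^sup>+x. ennpowr (ennpowr (f x) (1 / s)) \<theta> * ennpowr (ennpowr (g x) (1 / t)) (1 - \<theta>) \<partial>M)"
      using st unfolding \<theta>(3) by (simp add: ennpowr_mult ennpowr_ennpowr \<theta>_def)
    also have "\<dots> \<le> ennpowr (\<integral>\<^sup>+x. ennpowr (f x) (1 / s) \<partial>M) \<theta> * ennpowr (\<integral>\<^sup>+x. ennpowr (g x) (1 / t) \<partial>M) (1 - \<theta>)"
      by (rule nn_integral_ennpowr_mult_le) (use \<theta> in auto)
    finally have "rnorm M (s + t) (\<lambda>x. f x * g x) \<le> ennpowr (\<dots>) (s + t)"
      using st by (auto simp: rnorm_def intro!: ennpowr_mono)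
    also have "\<dots> = rnorm M s f * rnorm M t g"
      using st unfolding \<theta>(3) by (simp add: rnorm_def ennpowr_mult ennpowr_ennpowr \<theta>_def)
    finally show ?thesis .
  qed
qed

lemma rnorm_cmult:
  assumes [measurable]: "g \<in> borel_measurable M" and "0 \<le> s"
  shows "rnorm M s (\<lambda>x. c * g x) \<le> c * rnorm M s g"
proof -
  have "rnorm M 0 (\<lambda>_. c) \<le> c" by (simp add: rnorm_def esssup_I)
  then show ?thesis
    using rnorm_mult_le[of "\<lambda>_. c" M g 0 s] assms
    by (simp, meson mult_right_mono order_trans zero_le)
qed

text \<open>Jensen's inequality for the kernel \<open>k\<close>; it drives both Minkowski's inequality and Schur's test.\<close>

lemma nn_integral_kernel_le:
  assumes [measurable]: "k \<in> borel_measurable M" "f \<in> borel_measurable M"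
    and s: "0 < s" "s \<le> 1"
  shows "(\<integral>\<^sup>+x. k x * f x \<partial>M)
           \<le> ennpowr (\<integral>\<^sup>+x. k x * ennpowr (f x) (1 / s) \<partial>M) s * ennpowr (\<integral>\<^sup>+x. k x \<partial>M) (1 - s)
         \<or> s = 1"
proof (cases "s = 1")
  case False
  then have s1: "s < 1" using s by simp
  have "(\<integral>\<^sup>+x. k x * f x \<partial>M) = (\<integral>\<^sup>+x. ennpowr (k x * ennpowr (f x) (1 / s)) s * ennpowr (k x) (1 - s) \<partial>M)"
  proof (rule nn_integral_cong)
    fix x
    have "ennpowr (k x * ennpowr (f x) (1 / s)) s * ennpowr (k x) (1 - s)
        = (ennpowr (k x) s * ennpowr (k x) (1 - s)) * f x"
      using s by (simp add: ennpowr_mult ennpowr_ennpowr mult_ac)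
    also have "ennpowr (k x) s * ennpowr (k x) (1 - s) = k x"
      by (simp flip: ennpowr_add)
    finally show "k x * f x = ennpowr (k x * ennpowr (f x) (1 / s)) s * ennpowr (k x) (1 - s)" by simp
  qed
  also have "\<dots> \<le> ennpowr (\<integral>\<^sup>+x. k x * ennpowr (f x) (1 / s) \<partial>M) s * ennpowr (\<integral>\<^sup>+x. k x \<partial>M) (1 - s)"
    by (rule nn_integral_ennpowr_mult_le) (use s s1 in auto)
  finally show ?thesis by simp
qed simp

text \<open>The essential supremum exceeds \<open>c\<close> exactly when the set where
  \<open>g w\<close> exceeds \<open>c\<close> has positive measure, and that measure is measurable
  in \<open>w\<close> by Tonelli.\<close>

lemma esssup_borel_measurable:
  fixes g :: "'a \<Rightarrow> 'b \<Rightarrow> ennreal"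
  assumes "sigma_finite_measure M" and [measurable]: "(\<lambda>(w, x). g w x) \<in> borel_measurable (N \<Otimes>\<^sub>M M)"
  shows "(\<lambda>w. esssup M (g w)) \<in> borel_measurable N"
proof (rule borel_measurableI_greater)
  interpret sigma_finite_measure M by fact
  fix c :: ennreal
  have [measurable]: "g w \<in> borel_measurable M" if "w \<in> space N" for w
    using measurable_Pair2[OF assms(2) that] by simp
  have *: "c < esssup M (g w) \<longleftrightarrow> (\<integral>\<^sup>+x. indicator {c<..} (g w x) \<partial>M) \<noteq> 0" if "w \<in> space N" for w
  proof -
    have "esssup M (g w) \<le> c \<longleftrightarrow> (AE x in M. g w x \<le> c)"
      using esssup_AE[of "g w" M] that by (auto elim: eventually_mono intro: esssup_I)
    also have "\<dots> \<longleftrightarrow> (AE x in M. indicator {c<..} (g w x) = (0::ennreal))"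
      by (intro AE_cong) (auto simp: indicator_def not_less)
    also have "\<dots> \<longleftrightarrow> (\<integral>\<^sup>+x. indicator {c<..} (g w x) \<partial>M) = 0"
      using that by (subst nn_integral_0_iff_AE) auto
    finally show ?thesis by (simp add: not_le[symmetric])
  qed
  have "(\<lambda>w. \<integral>\<^sup>+x. indicator {c<..} (g w x) \<partial>M) \<in> borel_measurable N"
    by measurable
  from measurable_sets[OF this, of "- {0}"]
  show "{w \<in> space N. c < esssup M (g w)} \<in> sets N"
    using * by (simp add: vimage_def Int_def conj_commute cong: conj_cong)
qed

lemma rnorm_borel_measurable:
  assumes "sigma_finite_measure M" and [measurable]: "(\<lambda>(w, x). g w x) \<in> borel_measurable (N \<Otimes>\<^sub>M M)"
  shows "(\<lambda>w. rnorm M s (g w)) \<in> borel_measurable N"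
proof -
  interpret sigma_finite_measure M by fact
  show ?thesis
  proof (cases "s = 0")
    case True
    then show ?thesis using esssup_borel_measurable[OF assms] by (simp add: rnorm_def)
  next
    case False
    then show ?thesis by (simp add: rnorm_def)
  qed
qed

lemma rnorm_eq_0_imp_AE:
  assumes [measurable]: "g \<in> borel_measurable M" and "rnorm M s g = 0"
  shows "AE x in M. g x = 0"
proof (cases "s = 0")
  case True
  then show ?thesis using AE_le_rnorm_0[of g M] assms by auto
next
  case False
  then have "(\<integral>\<^sup>+x. ennpowr (g x) (1 / s) \<partial>M) = 0" using assms by (simp add: rnorm_def)
  then show ?thesis by (subst (asm) nn_integral_0_iff_AE) auto
qed

lemma rnorm_finite_imp_AE:
  assumes [measurable]: "g \<in> borel_measurable M" and "rnorm M s g < top"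
  shows "AE x in M. g x < top"
proof (cases "s = 0")
  case True
  then show ?thesis using AE_le_rnorm_0[of g M] assms by (auto elim!: eventually_mono)
next
  case False
  then have "(\<integral>\<^sup>+x. ennpowr (g x) (1 / s) \<partial>M) \<noteq> top" using assms by (auto simp: rnorm_def)
  from nn_integral_PInf_AE[OF _ this[folded infinity_ennreal_def]] show ?thesis
    by (auto simp: less_top)
qed

text \<open>Minkowski's integral inequality without duality: with \<open>n w\<close> the norm of
  \<open>g\<close> in the first variable, Hoelder in \<open>w\<close> is applied to g = (g^(1/s)
  n^(1 - 1/s))^s n^(1 - s). After integration in \<open>x\<close> both factors are powers of the
  integral of \<open>n\<close>.\<close>

theorem rnorm_nn_integral_le:
  assumes M: "sigma_finite_measure M" and N: "sigma_finite_measure N"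
    and g[measurable]: "(\<lambda>(x, w). g x w) \<in> borel_measurable (M \<Otimes>\<^sub>M N)"
    and s: "0 \<le> s" "s \<le> 1"
  shows "rnorm M s (\<lambda>x. \<integral>\<^sup>+w. g x w \<partial>N) \<le> (\<integral>\<^sup>+w. rnorm M s (\<lambda>x. g x w) \<partial>N)"
proof -
  interpret pair_sigma_finite M N
    using M N by (simp add: pair_sigma_finite_def)
  have swap[measurable]: "(\<lambda>(w, x). g x w) \<in> borel_measurable (N \<Otimes>\<^sub>M M)"
    by measurable
  define n where "n w = rnorm M s (\<lambda>x. g x w)" for w
  have n[measurable]: "n \<in> borel_measurable N"
    unfolding n_def by (rule rnorm_borel_measurable[OF M swap])
  have gx[measurable]: "g x \<in> borel_measurable N" if "x \<in> space M" for x
    using measurable_Pair2[OF g that] by simp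
  have gw[measurable]: "(\<lambda>x. g x w) \<in> borel_measurable M" if "w \<in> space N" for w
    using measurable_Pair2[OF swap that] by simp
  show ?thesis
  proof (cases "(\<integral>\<^sup>+w. n w \<partial>N) = top")
    case True then show ?thesis by (simp add: n_def)
  next
    case fin: False
    then have n_fin: "AE w in N. n w < top"
      using nn_integral_PInf_AE[of n N] by (auto simp: less_top)
    consider "s = 0" | "s = 1" | "0 < s" "s < 1" using s by fastforce
    then show ?thesis
    proof cases
      case 1
      have "AE w in N. AE x in M. g x w \<le> n w"
        unfolding n_def 1 by (intro AE_I2 AE_le_rnorm_0)
      then have "AE x in M. AE w in N. g x w \<le> n w"
        by (subst AE_commute) auto
      then have "AE x in M. (\<integral>\<^sup>+w. g x w \<partial>N) \<le> (\<integral>\<^sup>+w. n w \<partial>N)"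
        by eventually_elim (rule nn_integral_mono_AE)
      then show ?thesis unfolding n_def[symmetric] by (subst rnorm_def) (use 1 in auto)
    next
      case 2
      then show ?thesis by (simp add: rnorm_1 Fubini'[OF g])
    next
      case 3
      \<comment> \<open>The negative power of \<open>n\<close> below needs 0 < \<open>n w\<close> <
        top. Replacing \<open>g\<close> by 0 elsewhere changes it only almost everywhere: where
        \<open>n w = 0\<close> the function vanishes almost everywhere, and \<open>n w = top\<close>
        is a null set.\<close>
      define g' where "g' x w = (if 0 < n w \<and> n w < top then g x w else 0)" for x w
      have g'[measurable]: "(\<lambda>(x, w). g' x w) \<in> borel_measurable (M \<Otimes>\<^sub>M N)"
        unfolding g'_def by measurable
      have swap'[measurable]: "(\<lambda>(w, x). g' x w) \<in> borel_measurable (N \<Otimes>\<^sub>M M)"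
        by measurable
      have "AE w in N. AE x in M. g x w = g' x w"
        using n_fin AE_space
      proof eventually_elim
        case (elim w)
        show ?case
        proof (cases "n w = 0")
          case True
          then show ?thesis using rnorm_eq_0_imp_AE[OF gw[of w], of s] elim by (auto simp: n_def g'_def)
        next
          case False
          then show ?thesis using elim by (auto simp: g'_def zero_less_iff_neq_zero)
        qed
      qed
      then have "AE x in M. AE w in N. g x w = g' x w"
        by (subst AE_commute) auto
      then have eq: "AE x in M. (\<integral>\<^sup>+w. g x w \<partial>N) = (\<integral>\<^sup>+w. g' x w \<partial>N)"
        by eventually_elim (rule nn_integral_cong_AE)
      define v where "v w = (if 0 < n w \<and> n w < top then ennreal (enn2real (n w) powr (1 - 1 / s)) else 0)" for w
      have v[measurable]: "v \<in> borel_measurable N" unfolding v_def by measurable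
      have vn: "ennpowr (ennpowr y (1 / s) * v w) s * ennpowr (n w) (1 - s) = y"
        if nw: "0 < n w" "n w < top" for y w
      proof -
        obtain r where r: "n w = ennreal r" "r > 0"
          using nw by (cases "n w" rule: ennreal_cases) auto
        have "v w = ennreal (r powr (1 - 1 / s))" using r by (simp add: v_def)
        then have "ennpowr (v w) s * ennpowr (n w) (1 - s) = ennreal (r powr ((1 - 1 / s) * s) * r powr (1 - s))"
          using r by (simp add: ennpowr_ennreal powr_powr ennreal_mult)
        also have "r powr ((1 - 1 / s) * s) * r powr (1 - s) = r powr ((1 - 1 / s) * s + (1 - s))"
          by (simp add: powr_add)
        also have "(1 - 1 / s) * s + (1 - s) = 0" using 3 by (simp add: field_simps)
        also have "r powr 0 = 1" using r by simp
        finally have "ennpowr (v w) s * ennpowr (n w) (1 - s) = 1" by simp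
        then show ?thesis using 3 by (simp add: ennpowr_mult ennpowr_ennpowr mult.assoc)
      qed
      have vn1: "v w * ennpowr (n w) (1 / s) \<le> n w" for w
      proof (cases "0 < n w \<and> n w < top")
        case True
        then obtain r where r: "n w = ennreal r" "r > 0"
          by (cases "n w" rule: ennreal_cases) auto
        then have "v w * ennpowr (n w) (1 / s) = ennreal (r powr (1 - 1 / s) * r powr (1 / s))"
          by (simp add: v_def ennpowr_ennreal ennreal_mult)
        also have "r powr (1 - 1 / s) * r powr (1 / s) = r"
          using r by (simp flip: powr_add)
        finally show ?thesis using r by simp
      qed (auto simp: v_def)
      let ?T = "\<integral>\<^sup>+w. n w \<partial>N"
      have le: "(\<integral>\<^sup>+w. g' x w \<partial>N) \<le> ennpowr (\<integral>\<^sup>+w. ennpowr (g x w) (1 / s) * v w \<partial>N) s * ennpowr ?T (1 - s)"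
        if x: "x \<in> space M" for x
      proof -
        have "(\<integral>\<^sup>+w. g' x w \<partial>N) \<le> (\<integral>\<^sup>+w. ennpowr (ennpowr (g x w) (1 / s) * v w) s * ennpowr (n w) (1 - s) \<partial>N)"
          by (intro nn_integral_mono) (auto simp: g'_def vn)
        also have "\<dots> \<le> ennpowr (\<integral>\<^sup>+w. ennpowr (g x w) (1 / s) * v w \<partial>N) s * ennpowr ?T (1 - s)"
          by (rule nn_integral_ennpowr_mult_le) (use 3 x in auto)
        finally show ?thesis .
      qed
      have "AE x in M. (\<integral>\<^sup>+w. g x w \<partial>N) \<le> ennpowr (\<integral>\<^sup>+w. ennpowr (g x w) (1 / s) * v w \<partial>N) s * ennpowr ?T (1 - s)"
        using eq AE_space by eventually_elim (use le in auto)
      then have "rnorm M s (\<lambda>x. \<integral>\<^sup>+w. g x w \<partial>N)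
           \<le> rnorm M s (\<lambda>x. ennpowr (\<integral>\<^sup>+w. ennpowr (g x w) (1 / s) * v w \<partial>N) s * ennpowr ?T (1 - s))"
        by (intro rnorm_mono_AE) (use s in auto)
      also have "\<dots> = ennpowr ((\<integral>\<^sup>+x. (\<integral>\<^sup>+w. ennpowr (g x w) (1 / s) * v w \<partial>N) \<partial>M) * ennpowr ?T ((1 - s) / s)) s"
        using 3 by (simp add: rnorm_def ennpowr_mult ennpowr_ennpowr nn_integral_multc)
      also have "(\<integral>\<^sup>+x. (\<integral>\<^sup>+w. ennpowr (g x w) (1 / s) * v w \<partial>N) \<partial>M)
            = (\<integral>\<^sup>+w. (\<integral>\<^sup>+x. ennpowr (g x w) (1 / s) * v w \<partial>M) \<partial>N)"
        by (rule Fubini'[symmetric]) measurable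
      also have "\<dots> = (\<integral>\<^sup>+w. v w * ennpowr (n w) (1 / s) \<partial>N)"
        using 3 by (intro nn_integral_cong) (simp add: nn_integral_cmult n_def rnorm_def ennpowr_ennpowr mult.commute)
      also have "ennpowr (\<dots> * ennpowr ?T ((1 - s) / s)) s \<le> ennpowr (?T * ennpowr ?T ((1 - s) / s)) s"
        using 3 by (intro ennpowr_mono mult_right_mono nn_integral_mono vn1) auto
      also have "\<dots> = ?T"
      proof -
        have "?T * ennpowr ?T ((1 - s) / s) = ennpowr ?T (1 + (1 - s) / s)"
          by (simp only: ennpowr_add ennpowr_exp_1)
        also have "1 + (1 - s) / s = 1 / s" using 3 by (simp add: field_simps)
        finally show ?thesis using 3 by (simp add: ennpowr_ennpowr)
      qed
      finally show ?thesis by (simp add: n_def)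
    qed
  qed
qed


corollary rnorm_nn_integral_count_space_le:
  fixes g :: "'i \<Rightarrow> 'b \<Rightarrow> ennreal"
  assumes M: "sigma_finite_measure M" and I: "countable I"
    and [measurable]: "\<And>i. i \<in> I \<Longrightarrow> g i \<in> borel_measurable M"
    and s: "0 \<le> s" "s \<le> 1"
  shows "rnorm M s (\<lambda>x. \<integral>\<^sup>+i. g i x \<partial>count_space I) \<le> (\<integral>\<^sup>+i. rnorm M s (g i) \<partial>count_space I)"
proof -
  have "(\<lambda>(x, i). g i x) \<in> borel_measurable (M \<Otimes>\<^sub>M count_space I)"
  proof -
    have "(\<lambda>(i, x). g i x) \<in> borel_measurable (count_space I \<Otimes>\<^sub>M M)"
      by (rule measurable_pair_measure_countable1) (use I in auto)
    from measurable_pair_swap[OF this] show ?thesis by (simp add: case_prod_beta)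
  qed
  then show ?thesis
    using rnorm_nn_integral_le[OF M sigma_finite_measure_count_space_countable[OF I], of "\<lambda>x i. g i x"] s
    by simp
qed

lemma rnorm_suminf_le:
  assumes M: "sigma_finite_measure M"
    and "\<And>i::nat. g i \<in> borel_measurable M" "0 \<le> s" "s \<le> 1"
  shows "rnorm M s (\<lambda>x. \<Sum>i. g i x) \<le> (\<Sum>i. rnorm M s (g i))"
  using rnorm_nn_integral_count_space_le[OF M, of UNIV g s] assms
  by (simp add: nn_integral_count_space_nat)

lemma rnorm_sum_le:
  assumes M: "sigma_finite_measure M" and "finite I"
    and "\<And>i. i \<in> I \<Longrightarrow> g i \<in> borel_measurable M" "0 \<le> s" "s \<le> 1"
  shows "rnorm M s (\<lambda>x. \<Sum>i\<in>I. g i x) \<le> (\<Sum>i\<in>I. rnorm M s (g i))"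
  using rnorm_nn_integral_count_space_le[OF M, of I g s] assms
  by (simp add: nn_integral_count_space_finite countable_finite)

lemma rnorm_add_le:
  assumes M: "sigma_finite_measure M"
    and f: "f \<in> borel_measurable M" and g: "g \<in> borel_measurable M" and s: "0 \<le> s" "s \<le> 1"
  shows "rnorm M s (\<lambda>x. f x + g x) \<le> rnorm M s f + rnorm M s g"
  using rnorm_sum_le[OF M, of "UNIV :: bool set" "\<lambda>b. if b then f else g" s] assms
  by (simp add: UNIV_bool add.commute)

text \<open>Jensen's inequality for a kernel of mass at most \<open>C\<close> bounds the power
  \<open>1 / s\<close> of the integral by C^((1 - s)/s) times the integral of \<open>k\<close>
  against f^(1/s). Tonelli with the second mass bound contributes another \<open>C\<close>, and C^(1
  - s) C^s = C.\<close>

theorem rnorm_schur: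
  assumes M: "sigma_finite_measure M" and N: "sigma_finite_measure N"
    and k[measurable]: "(\<lambda>(x, y). k x y) \<in> borel_measurable (M \<Otimes>\<^sub>M N)"
    and f[measurable]: "f \<in> borel_measurable N"
    and A: "\<And>x. x \<in> space M \<Longrightarrow> (\<integral>\<^sup>+y. k x y \<partial>N) \<le> C"
    and B: "\<And>y. y \<in> space N \<Longrightarrow> (\<integral>\<^sup>+x. k x y \<partial>M) \<le> C"
    and s: "0 \<le> s" "s \<le> 1"
  shows "rnorm M s (\<lambda>x. \<integral>\<^sup>+y. k x y * f y \<partial>N) \<le> C * rnorm N s f"
proof -
  interpret pair_sigma_finite M N
    using M N by (simp add: pair_sigma_finite_def)
  have [measurable]: "(\<lambda>(y, x). k x y) \<in> borel_measurable (N \<Otimes>\<^sub>M M)"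
    by measurable
  have kx[measurable]: "k x \<in> borel_measurable N" if "x \<in> space M" for x
    using measurable_Pair2[OF k that] by simp
  have ky[measurable]: "(\<lambda>x. k x y) \<in> borel_measurable M" if "y \<in> space N" for y
    using measurable_Pair1[OF k that] by simp
  have tonelli: "(\<integral>\<^sup>+x. \<integral>\<^sup>+y. k x y * g y \<partial>N \<partial>M) \<le> C * (\<integral>\<^sup>+y. g y \<partial>N)"
    if [measurable]: "g \<in> borel_measurable N" for g
  proof -
    have "(\<integral>\<^sup>+x. \<integral>\<^sup>+y. k x y * g y \<partial>N \<partial>M) = (\<integral>\<^sup>+y. \<integral>\<^sup>+x. k x y * g y \<partial>M \<partial>N)"
      by (rule Fubini'[symmetric]) measurable
    also have "\<dots> = (\<integral>\<^sup>+y. (\<integral>\<^sup>+x. k x y \<partial>M) * g y \<partial>N)"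
      by (intro nn_integral_cong) (simp add: nn_integral_multc)
    also have "\<dots> \<le> (\<integral>\<^sup>+y. C * g y \<partial>N)"
      by (intro nn_integral_mono mult_right_mono B) auto
    finally show ?thesis by (simp add: nn_integral_cmult)
  qed
  consider "s = 0" | "s = 1" | "0 < s" "s < 1" using s by fastforce
  then show ?thesis
  proof cases
    case 1
    have "(\<integral>\<^sup>+y. k x y * f y \<partial>N) \<le> C * rnorm N 0 f" if x: "x \<in> space M" for x
    proof -
      have "(\<integral>\<^sup>+y. k x y * f y \<partial>N) \<le> (\<integral>\<^sup>+y. k x y * rnorm N 0 f \<partial>N)"
        using AE_le_rnorm_0[of f N]
        by (intro nn_integral_mono_AE) (auto elim!: eventually_mono intro: mult_left_mono)
      also have "\<dots> = (\<integral>\<^sup>+y. k x y \<partial>N) * rnorm N 0 f"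
        using x by (simp add: nn_integral_multc)
      also have "\<dots> \<le> C * rnorm N 0 f" by (intro mult_right_mono A x) auto
      finally show ?thesis .
    qed
    then show ?thesis using 1 by (subst rnorm_def) auto
  next
    case 2
    then show ?thesis using tonelli[OF f] by (simp add: rnorm_1)
  next
    case 3
    have le: "(\<integral>\<^sup>+y. k x y * f y \<partial>N)
        \<le> ennpowr (\<integral>\<^sup>+y. k x y * ennpowr (f y) (1 / s) \<partial>N) s * ennpowr C (1 - s)" if x: "x \<in> space M" for x
    proof -
      have "(\<integral>\<^sup>+y. k x y * f y \<partial>N) \<le> ennpowr (\<integral>\<^sup>+y. k x y * ennpowr (f y) (1 / s) \<partial>N) s
          * ennpowr (\<integral>\<^sup>+y. k x y \<partial>N) (1 - s)"
        using nn_integral_kernel_le[of "k x" N f s] x 3 by auto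
      also have "\<dots> \<le> ennpowr (\<integral>\<^sup>+y. k x y * ennpowr (f y) (1 / s) \<partial>N) s * ennpowr C (1 - s)"
        using 3 by (intro mult_left_mono ennpowr_mono A x) auto
      finally show ?thesis .
    qed
    have "rnorm M s (\<lambda>x. \<integral>\<^sup>+y. k x y * f y \<partial>N)
        \<le> rnorm M s (\<lambda>x. ennpowr (\<integral>\<^sup>+y. k x y * ennpowr (f y) (1 / s) \<partial>N) s * ennpowr C (1 - s))"
      using le s by (intro rnorm_mono_AE AE_I2) auto
    also have "\<dots> = ennpowr ((\<integral>\<^sup>+x. \<integral>\<^sup>+y. k x y * ennpowr (f y) (1 / s) \<partial>N \<partial>M) * ennpowr C ((1 - s) / s)) s"
      using 3 by (simp add: rnorm_def ennpowr_mult ennpowr_ennpowr nn_integral_multc)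
    also have "\<dots> \<le> ennpowr ((C * (\<integral>\<^sup>+y. ennpowr (f y) (1 / s) \<partial>N)) * ennpowr C ((1 - s) / s)) s"
      using 3 by (intro ennpowr_mono mult_right_mono tonelli) auto
    also have "\<dots> = ennpowr (C * ennpowr C ((1 - s) / s)) s * rnorm N s f"
      using 3 by (simp add: rnorm_def ennpowr_mult mult_ac)
    also have "C * ennpowr C ((1 - s) / s) = ennpowr C (1 + (1 - s) / s)"
      by (simp only: ennpowr_add ennpowr_exp_1)
    also have "1 + (1 - s) / s = 1 / s" using 3 by (simp add: field_simps)
    finally show ?thesis using 3 by (simp add: ennpowr_ennpowr)
  qed
qed

lemma le_rnorm_count_space:
  assumes "i \<in> I" "0 \<le> s"
  shows "e i \<le> rnorm (count_space I) s e"
proof (cases "s = 0")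
  case True
  then show ?thesis using AE_le_rnorm_0[of e "count_space I"] assms by (simp add: AE_count_space)
next
  case False
  have "ennpowr (e i) (1 / s) = (\<integral>\<^sup>+j. ennpowr (e j) (1 / s) * indicator {i} j \<partial>count_space I)"
    using assms by (simp add: nn_integral_count_space_indicator[symmetric] nn_integral_indicator_singleton' one_ennreal_def[symmetric])
  also have "\<dots> \<le> (\<integral>\<^sup>+j. ennpowr (e j) (1 / s) \<partial>count_space I)"
    by (intro nn_integral_mono) (auto simp: indicator_def)
  finally have "ennpowr (ennpowr (e i) (1 / s)) s \<le> rnorm (count_space I) s e"
    using False assms by (auto simp: rnorm_def intro!: ennpowr_mono)
  then show ?thesis using False by (simp add: ennpowr_ennpowr)
qed

section \<open>Norms and null sets under image measures, translations and completion\<close>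

lemma rnorm_distr:
  assumes [measurable]: "T \<in> measurable M N" "g \<in> borel_measurable N"
  shows "rnorm (distr M N T) s g = rnorm M s (\<lambda>x. g (T x))"
proof -
  have "esssup (distr M N T) g = esssup M (\<lambda>x. g (T x))"
    by (simp add: esssup_eq_AE AE_distr_iff)
  then show ?thesis by (simp add: rnorm_def nn_integral_distr)
qed

lemma rnorm_translate:
  fixes g :: "'a::euclidean_space \<Rightarrow> ennreal"
  assumes "g \<in> borel_measurable borel"
  shows "rnorm lborel s (\<lambda>x. g (x + h)) = rnorm lborel s g"
  using rnorm_distr[of "(+) h" lborel borel g s] assms lborel_distr_plus[of h]
  by (simp add: add.commute)

text \<open>\<open>P\<close> need not be measurable, so what is translated is a measurable null set
  containing the exceptional points.\<close>

lemma AE_lborel_translate: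
  fixes P :: "'a::euclidean_space \<Rightarrow> bool"
  assumes "AE x in lborel. P x"
  shows "AE x in lborel. P (x + h)"
proof -
  from assms obtain N where N: "{x. \<not> P x} \<subseteq> N" "N \<in> null_sets lborel"
    by (auto elim!: AE_E simp: null_sets_def)
  have "AE x in lborel. x \<notin> N" using N by (simp add: AE_not_in)
  then have "AE x in distr lborel borel ((+) h). x \<notin> N" by (subst lborel_distr_plus)
  then have "AE x in lborel. h + x \<notin> N" using N by (subst (asm) AE_distr_iff) (auto simp: null_sets_def)
  then show ?thesis by eventually_elim (use N in \<open>auto simp: add.commute\<close>)
qed

lemma rnorm_completion:
  assumes [measurable]: "g \<in> borel_measurable M"
  shows "rnorm (completion M) s g = rnorm M s g"
proof -
  have "esssup (completion M) g = esssup M g"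
    by (simp add: esssup_eq_AE AE_completion_iff measurable_completion)
  then show ?thesis by (simp add: rnorm_def nn_integral_completion)
qed

lemma rnorm_density_completion:
  assumes [measurable]: "g \<in> borel_measurable M" "w \<in> borel_measurable M"
  shows "rnorm (density (completion M) w) s g = rnorm (density M w) s g"
proof -
  have [measurable]: "g \<in> borel_measurable (completion M)" "w \<in> borel_measurable (completion M)"
    by (auto intro: measurable_completion)
  have "esssup (density (completion M) w) g = esssup (density M w) g"
    by (simp add: esssup_eq_AE AE_completion_iff AE_density)
  then show ?thesis by (simp add: rnorm_def nn_integral_completion nn_integral_density)
qed

section \<open>Smooth functions\<close>

lemma iter_deriv_append: "iter_deriv (as @ bs) f = iter_deriv as (iter_deriv bs f)"
  by (induction as) auto

text \<open>A class of differentiable functions that is closed under partial derivatives consists of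
  smooth functions. Smoothness proofs thus exhibit an invariant class instead of formulas for higher
  derivatives.\<close>

lemma smooth_fun_coinduct:
  assumes "f \<in> X" "\<And>g x. g \<in> X \<Longrightarrow> g differentiable at x"
    "\<And>g b. g \<in> X \<Longrightarrow> b \<in> Basis \<Longrightarrow> iter_deriv [b] g \<in> X"
  shows "smooth_fun f"
proof -
  have "iter_deriv bs f \<in> X" if "set bs \<subseteq> Basis" for bs
    using that
  proof (induction bs)
    case (Cons b bs)
    then show ?case using assms(3)[of "iter_deriv bs f" b] by simp
  qed (use assms in simp)
  then show ?thesis using assms(2) by (auto simp: smooth_fun_def)
qed

lemma smooth_fun_differentiable: "smooth_fun f \<Longrightarrow> f differentiable at x"
  using iter_deriv.simps(1) by (fastforce simp: smooth_fun_def dest: spec[of _ "[]"])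

lemma smooth_fun_iter_deriv: "smooth_fun f \<Longrightarrow> set bs \<subseteq> Basis \<Longrightarrow> smooth_fun (iter_deriv bs f)"
  by (auto simp: smooth_fun_def iter_deriv_append[symmetric])

lemma smooth_fun_continuous: "smooth_fun f \<Longrightarrow> continuous_on S f"
  using smooth_fun_differentiable differentiable_imp_continuous_within
  by (metis continuous_at_imp_continuous_on)

lemma smooth_fun_borel: "smooth_fun f \<Longrightarrow> f \<in> borel_measurable borel"
  by (intro borel_measurable_continuous_onI smooth_fun_continuous)

text \<open>The invariant class for products: products alone are not closed under differentiation,
  but by the Leibniz rule the algebra generated by the smooth functions is.\<close>

inductive_set smooth_alg :: "('a::euclidean_space \<Rightarrow> complex) set" where
  "smooth_fun f \<Longrightarrow> f \<in> smooth_alg"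
| "f \<in> smooth_alg \<Longrightarrow> g \<in> smooth_alg \<Longrightarrow> (\<lambda>x. f x + g x) \<in> smooth_alg"
| "f \<in> smooth_alg \<Longrightarrow> g \<in> smooth_alg \<Longrightarrow> (\<lambda>x. f x * g x) \<in> smooth_alg"

lemma smooth_alg_deriv:
  assumes "f \<in> smooth_alg"
  shows "(\<forall>x. f differentiable at x) \<and> (\<forall>b\<in>Basis. iter_deriv [b] f \<in> smooth_alg)"
  using assms
proof induction
  case (1 f)
  then show ?case
    using smooth_fun_iter_deriv[of f "[b]" for b]
    by (auto simp: smooth_fun_differentiable intro: smooth_alg.intros)
next
  case (2 f g)
  have "iter_deriv [b] (\<lambda>x. f x + g x) = (\<lambda>x. iter_deriv [b] f x + iter_deriv [b] g x)" for b
  proof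
    fix x
    have "((\<lambda>x. f x + g x) has_derivative (\<lambda>h. frechet_derivative f (at x) h + frechet_derivative g (at x) h)) (at x)"
      by (intro has_derivative_add frechet_derivative_works[THEN iffD1]) (use 2 in auto)
    from frechet_derivative_at[OF this]
    show "iter_deriv [b] (\<lambda>x. f x + g x) x = iter_deriv [b] f x + iter_deriv [b] g x"
      by (simp add: fun_eq_iff)
  qed
  then show ?case using 2 by (auto intro: smooth_alg.intros)
next
  case (3 f g)
  have "iter_deriv [b] (\<lambda>x. f x * g x) = (\<lambda>x. f x * iter_deriv [b] g x + iter_deriv [b] f x * g x)" for b
  proof
    fix x
    have "((\<lambda>x. f x * g x) has_derivative (\<lambda>h. f x * frechet_derivative g (at x) h + frechet_derivative f (at x) h * g x)) (at x)"
      by (intro has_derivative_mult frechet_derivative_works[THEN iffD1]) (use 3 in auto)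
    from frechet_derivative_at[OF this]
    show "iter_deriv [b] (\<lambda>x. f x * g x) x = f x * iter_deriv [b] g x + iter_deriv [b] f x * g x"
      by (simp add: fun_eq_iff)
  qed
  then show ?case using 3 by (auto intro!: smooth_alg.intros(2,3))
qed

lemma smooth_fun_mult: "smooth_fun f \<Longrightarrow> smooth_fun g \<Longrightarrow> smooth_fun (\<lambda>x. f x * g x)"
  by (rule smooth_fun_coinduct[of _ smooth_alg])
     (use smooth_alg_deriv in \<open>auto intro: smooth_alg.intros\<close>)

lemma smooth_fun_bounded_linear:
  assumes "bounded_linear f" shows "smooth_fun f"
proof -
  have c: "iter_deriv [b] (\<lambda>_. c) = (\<lambda>_. 0)" for c :: complex and b :: 'a
    by (simp add: fun_eq_iff)
  have "iter_deriv [b] f = (\<lambda>_. f b)" for b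
    using frechet_derivative_at[OF bounded_linear_imp_has_derivative[OF assms]] by (simp add: fun_eq_iff)
  then show ?thesis
    using c assms
    by (intro smooth_fun_coinduct[of _ "insert f (range (\<lambda>c _. c))"])
       (auto simp: bounded_linear_imp_differentiable)
qed

lemma smooth_fun_const: "smooth_fun (\<lambda>_. c)"
  by (intro smooth_fun_coinduct[of _ "range (\<lambda>c _. c)"]) auto

text \<open>Real linearity of \<open>L\<close> is the right generality here: it covers complex
  conjugation, which makes the squared modulus of a smooth function smooth.\<close>

lemma smooth_fun_compose_linear:
  fixes f :: "'a::euclidean_space \<Rightarrow> complex" and L :: "complex \<Rightarrow> complex"
  assumes L: "bounded_linear L" and f: "smooth_fun f"
  shows "smooth_fun (\<lambda>x. L (f x))"
proof (rule smooth_fun_coinduct[of _ "{\<lambda>x. L (g x) |g. smooth_fun g}"])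
  have der: "((\<lambda>x. L (g x)) has_derivative (\<lambda>h. L (frechet_derivative g (at x) h))) (at x)"
    if "smooth_fun g" for g :: "'a \<Rightarrow> complex" and x
    using bounded_linear.has_derivative[OF L frechet_derivative_works[THEN iffD1, OF smooth_fun_differentiable[OF that]]] .
  fix g :: "'a \<Rightarrow> complex" and x b :: 'a
  assume g: "g \<in> {\<lambda>x. L (g x) |g. smooth_fun g}"
  then show "g differentiable at x" using der by (auto simp: differentiable_def)
  assume b: "b \<in> Basis"
  from g obtain u where u: "g = (\<lambda>x. L (u x))" "smooth_fun u" by auto
  have "iter_deriv [b] g = (\<lambda>x. L (iter_deriv [b] u x))"
    using u(1) by (simp add: frechet_derivative_at[OF der[OF u(2)], symmetric])
  moreover have "smooth_fun (iter_deriv [b] u)" using u b smooth_fun_iter_deriv[of u "[b]"] by simp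
  ultimately show "iter_deriv [b] g \<in> {\<lambda>x. L (g x) |g. smooth_fun g}" by blast
qed (use f in auto)

lemma iter_deriv_affine:
  fixes f :: "'a::euclidean_space \<Rightarrow> complex"
  assumes f: "smooth_fun f" and bs: "set bs \<subseteq> Basis"
  shows "iter_deriv bs (\<lambda>x. f (t + c *\<^sub>R x)) = (\<lambda>x. of_real c ^ length bs * iter_deriv bs f (t + c *\<^sub>R x))
       \<and> smooth_fun (\<lambda>x. f (t + c *\<^sub>R x))"
proof -
  have *: "iter_deriv bs (\<lambda>x. f (t + c *\<^sub>R x)) = (\<lambda>x. of_real c ^ length bs * iter_deriv bs f (t + c *\<^sub>R x))
     \<and> (\<forall>x. iter_deriv bs (\<lambda>x. f (t + c *\<^sub>R x)) differentiable at x)" if "set bs \<subseteq> Basis" for bs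
    using that
  proof (induction bs)
    case Nil
    have "(\<lambda>x. f (t + c *\<^sub>R x)) differentiable at x" for x
      by (intro differentiable_compose[of f "\<lambda>x. t + c *\<^sub>R x"] smooth_fun_differentiable f derivative_intros)
    then show ?case by simp
  next
    case (Cons b bs)
    let ?g = "iter_deriv bs f"
    have g: "smooth_fun ?g" using f Cons smooth_fun_iter_deriv by auto
    have der: "((\<lambda>x. of_real c ^ length bs * h (t + c *\<^sub>R x)) has_derivative
       (\<lambda>v. of_real c ^ length bs * frechet_derivative h (at (t + c *\<^sub>R x)) (c *\<^sub>R v))) (at x)"
      if "smooth_fun h" for h :: "'a \<Rightarrow> complex" and x
    proof -
      have "((\<lambda>x. h (t + c *\<^sub>R x)) has_derivative (\<lambda>v. frechet_derivative h (at (t + c *\<^sub>R x)) (c *\<^sub>R v))) (at x)"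
        by (rule has_derivative_compose[of "\<lambda>x. t + c *\<^sub>R x" "\<lambda>v. c *\<^sub>R v" _ _ h])
           (auto intro!: derivative_eq_intros frechet_derivative_works[THEN iffD1] smooth_fun_differentiable that)
      then show ?thesis by (intro has_derivative_mult_right)
    qed
    have lin: "frechet_derivative ?g (at y) (c *\<^sub>R b) = of_real c * frechet_derivative ?g (at y) b" for y
      using linear_frechet_derivative[OF smooth_fun_differentiable[OF g]]
      by (simp add: linear_scale scaleR_conv_of_real)
    have "iter_deriv (b # bs) (\<lambda>x. f (t + c *\<^sub>R x)) = (\<lambda>x. of_real c ^ length (b # bs) * iter_deriv (b # bs) f (t + c *\<^sub>R x))"
    proof
      fix x
      have eq: "iter_deriv bs (\<lambda>x. f (t + c *\<^sub>R x)) = (\<lambda>x. of_real c ^ length bs * ?g (t + c *\<^sub>R x))"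
        using Cons by simp
      show "iter_deriv (b # bs) (\<lambda>x. f (t + c *\<^sub>R x)) x = of_real c ^ length (b # bs) * iter_deriv (b # bs) f (t + c *\<^sub>R x)"
        unfolding iter_deriv.simps eq frechet_derivative_at[OF der[OF g], symmetric] lin by simp
    qed
    moreover have "smooth_fun (iter_deriv (b # bs) f)" using f Cons.prems smooth_fun_iter_deriv by blast
    then have "(\<lambda>x. of_real c * (of_real c ^ length bs * iter_deriv (b # bs) f (t + c *\<^sub>R x))) differentiable at x" for x
      by (intro differentiable_mult differentiable_const differentiable_compose[of "iter_deriv (b # bs) f" "\<lambda>x. t + c *\<^sub>R x"]
          smooth_fun_differentiable differentiable_add differentiable_scaleR differentiable_ident)
    ultimately show ?case by (simp add: mult.assoc del: iter_deriv.simps)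
  qed
  then show ?thesis using bs unfolding smooth_fun_def by blast
qed

lemma smooth_fun_affine: "smooth_fun f \<Longrightarrow> smooth_fun (\<lambda>x. f (t + c *\<^sub>R x))"
  using iter_deriv_affine[of f "[]"] by simp

section \<open>Smooth functions of compact support\<close>

definition test_fun :: "('a::euclidean_space \<Rightarrow> complex) \<Rightarrow> bool" where
  "test_fun f \<longleftrightarrow> smooth_fun f \<and> (\<exists>R. \<forall>x. R < norm x \<longrightarrow> f x = 0)"

lemma test_fun_smooth: "test_fun f \<Longrightarrow> smooth_fun f"
  by (simp add: test_fun_def)

lemma test_fun_borel [measurable_dest]: "test_fun f \<Longrightarrow> f \<in> borel_measurable borel"
  by (simp add: test_fun_def smooth_fun_borel)

lemma test_fun_iter_deriv:
  assumes "test_fun f" "set bs \<subseteq> Basis"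
  shows "test_fun (iter_deriv bs f)"
proof -
  from assms obtain R where R: "\<And>x. R < norm x \<Longrightarrow> f x = 0" by (auto simp: test_fun_def)
  have "\<forall>x. R < norm x \<longrightarrow> iter_deriv bs f x = 0"
    using assms(2)
  proof (induction bs)
    case (Cons b bs)
    show ?case
    proof safe
      fix x :: 'a assume x: "R < norm x"
      have "((\<lambda>_. 0) has_derivative (\<lambda>_. 0 :: complex)) (at x)" by simp
      then have "(iter_deriv bs f has_derivative (\<lambda>_. 0)) (at x)"
        by (rule has_derivative_transform_within_open[of _ _ _ _ "{x. R < norm x}"])
           (use Cons x in \<open>auto intro!: open_Collect_less continuous_intros\<close>)
      from frechet_derivative_at[OF this] show "iter_deriv (b # bs) f x = 0"
        by (simp add: fun_eq_iff)
    qed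
  qed (use R in auto)
  then show ?thesis using assms smooth_fun_iter_deriv by (auto simp: test_fun_def)
qed

lemma test_fun_mult: "test_fun f \<Longrightarrow> smooth_fun g \<Longrightarrow> test_fun (\<lambda>x. g x * f x)"
  by (auto simp: test_fun_def smooth_fun_mult)

lemma compact_support_bounded:
  fixes f :: "'a::euclidean_space \<Rightarrow> complex"
  assumes "continuous_on UNIV f" "\<And>x. R < norm x \<Longrightarrow> f x = 0"
  shows "\<exists>B\<ge>0. \<forall>x. norm (f x) \<le> B"
proof -
  have "bounded (f ` cball 0 R)"
    by (intro compact_imp_bounded compact_continuous_image continuous_on_subset[OF assms(1)]) auto
  then obtain B where B: "\<And>x. x \<in> cball 0 R \<Longrightarrow> norm (f x) \<le> B" by (fastforce simp: bounded_iff)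
  have "norm (f x) \<le> max B 0" for x
    using B[of x] assms(2)[of x] by (cases "norm x \<le> R") (auto simp: le_max_iff_disj not_le)
  then show ?thesis by (meson max.cobounded2)
qed

lemma compact_support_integrable:
  fixes f :: "'a::euclidean_space \<Rightarrow> complex"
  assumes "continuous_on UNIV f" "\<And>x. R < norm x \<Longrightarrow> f x = 0"
  shows "integrable lborel f"
proof -
  obtain B where B: "\<And>x. norm (f x) \<le> B" using compact_support_bounded[OF assms] by blast
  have [measurable]: "f \<in> borel_measurable borel" by (rule borel_measurable_continuous_onI) fact
  have "integrable lborel (\<lambda>x. indicator (cball 0 R) x *\<^sub>R f x)"
    by (rule integrableI_bounded_set_indicator[of _ _ _ B]) (use B emeasure_lborel_cball_finite in auto)
  also have "(\<lambda>x. indicator (cball 0 R) x *\<^sub>R f x) = f"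
    using assms(2) by (fastforce simp: indicator_def not_le)
  finally show ?thesis .
qed

lemma test_fun_integrable: "test_fun f \<Longrightarrow> integrable lborel f"
  by (metis compact_support_integrable smooth_fun_continuous test_fun_def)

lemma test_fun_bounded: "test_fun f \<Longrightarrow> \<exists>B\<ge>0. \<forall>x. norm (f x) \<le> B"
  by (metis compact_support_bounded smooth_fun_continuous test_fun_def)


section \<open>Rapid decrease\<close>

text \<open>Decay without smoothness or measurability, so that absolute values, indicators of boxes
  and suprema of families belong to the class as well.\<close>

definition rapid :: "('a::euclidean_space \<Rightarrow> 'b::real_normed_vector) \<Rightarrow> bool" where
  "rapid r \<longleftrightarrow> (\<forall>N::nat. \<exists>C. \<forall>x. (1 + norm x) ^ N * norm (r x) \<le> C)"

lemma rapid_ex: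
  assumes "rapid r" shows "\<exists>C>0. \<forall>x. norm (r x) \<le> C / (1 + norm x) ^ N"
proof -
  from assms obtain C where C: "\<And>x. (1 + norm x) ^ N * norm (r x) \<le> C" by (auto simp: rapid_def)
  have p: "(1 + norm x) ^ N > 0" for x :: 'a by (simp add: add_pos_nonneg)
  have "norm (r x) \<le> max C 1 / (1 + norm x) ^ N" for x
    using C[of x] p[of x] by (simp add: pos_le_divide_eq mult.commute)
  then show ?thesis by (intro exI[of _ "max C 1"]) auto
qed

lemma rapidI:
  assumes "\<And>N::nat. \<exists>C. \<forall>x. norm (r x) \<le> C / (1 + norm x) ^ N" shows "rapid r"
proof -
  have p: "(1 + norm x) ^ N > 0" for x :: 'a and N by (simp add: add_pos_nonneg)
  show ?thesis using assms p by (simp add: rapid_def pos_le_divide_eq mult.commute)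
qed

lemma rapid_bound:
  assumes "rapid r" "\<And>x. norm (s x) \<le> c * norm (r x)" shows "rapid s"
proof (rule rapidI)
  fix N :: nat
  obtain C where C: "C > 0" "\<And>x. norm (r x) \<le> C / (1 + norm x) ^ N" using rapid_ex[OF assms(1), of "N"] by blast
  have "norm (s x) \<le> \<bar>c\<bar> * C / (1 + norm x) ^ N" for x
  proof -
    have "norm (s x) \<le> \<bar>c\<bar> * norm (r x)" using assms(2)[of x] by (smt (verit) mult_right_mono norm_ge_zero)
    also have "\<dots> \<le> \<bar>c\<bar> * (C / (1 + norm x) ^ N)" by (intro mult_left_mono C) auto
    finally show ?thesis by simp
  qed
  then show "\<exists>C. \<forall>x. norm (s x) \<le> C / (1 + norm x) ^ N" by blast
qed

lemma rapid_norm: "rapid r \<Longrightarrow> rapid (\<lambda>x. norm (r x))"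
  by (simp add: rapid_def)

lemma rapid_bounded: "rapid r \<Longrightarrow> \<exists>B\<ge>0. \<forall>x. norm (r x) \<le> B"
  using rapid_ex[of r 0] by (metis div_by_1 less_imp_le power_0)

text \<open>Its powers move polynomial weights from one point to another, which yields the decay of
  convolutions and of translates.\<close>

lemma peetre: "1 + norm (x::'a::real_normed_vector) \<le> (1 + norm (x - y)) * (1 + norm y)"
proof -
  have "norm x \<le> norm (x - y) + norm y" by (metis diff_add_cancel norm_triangle_ineq)
  moreover have "0 \<le> norm (x - y) * norm y" by simp
  ultimately show ?thesis by (simp only: distrib_left distrib_right mult_1_left mult_1_right)
qed

lemma integrable_inverse_one_plus_square: "integrable lborel (\<lambda>t::real. inverse (1 + t\<^sup>2))"
  using integrable_inverse_1_plus_square by (simp add: set_integrable_def)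

text \<open>Each factor 1 + (x . b)^2 is at most (1 + |x|)^2, so the weight with exponent
  \<open>2 * DIM('a)\<close> lies below a product of the integrable one-dimensional functions 1 / (1
  + t^2).\<close>

lemma rapid_weight_integrable: "integrable lborel (\<lambda>x::'a::euclidean_space. 1 / (1 + norm x) ^ (2 * DIM('a)))"
proof -
  let ?g = "\<lambda>x::'a. \<Prod>b\<in>Basis. inverse (1 + (x \<bullet> b)\<^sup>2)"
  have "(\<integral>\<^sup>+x. ennreal (norm (?g x)) \<partial>lborel) = (\<integral>\<^sup>+x. (\<Prod>b\<in>Basis. ennreal (inverse (1 + ((x::'a) \<bullet> b)\<^sup>2))) \<partial>lborel)"
    by (intro nn_integral_cong, subst prod_ennreal) (auto simp: prod_nonneg)
  also have "\<dots> = (\<Prod>b\<in>(Basis::'a set). \<integral>\<^sup>+t. ennreal (inverse (1 + t\<^sup>2)) \<partial>lborel)"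
    by (rule nn_integral_lborel_prod) auto
  also have "\<dots> < top"
  proof -
    have "(\<integral>\<^sup>+t. ennreal (inverse (1 + t\<^sup>2)) \<partial>lborel) < top"
      using integrable_inverse_one_plus_square by (auto simp: integrable_iff_bounded)
    then show ?thesis by (simp add: power_less_top_ennreal)
  qed
  finally have g: "integrable lborel ?g" by (intro integrableI_bounded) auto
  have "1 / (1 + norm x) ^ (2 * DIM('a)) \<le> ?g x" for x :: 'a
  proof -
    have "(\<Prod>b\<in>(Basis::'a set). 1 + (x \<bullet> b)\<^sup>2) \<le> (\<Prod>b\<in>(Basis::'a set). (1 + norm x)\<^sup>2)"
    proof (intro prod_mono conjI)
      fix b :: 'a assume "b \<in> Basis"
      then have "\<bar>x \<bullet> b\<bar> \<le> norm x" by (rule Basis_le_norm)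
      then have "(x \<bullet> b)\<^sup>2 \<le> (norm x)\<^sup>2" by (simp add: abs_le_square_iff[symmetric])
      moreover have "(1 + norm x)\<^sup>2 = 1 + 2 * norm x + (norm x)\<^sup>2" by (simp add: power2_sum)
      ultimately show "1 + (x \<bullet> b)\<^sup>2 \<le> (1 + norm x)\<^sup>2" using norm_ge_zero[of x] by linarith
    qed (simp add: add_nonneg_nonneg)
    also have "\<dots> = (1 + norm x) ^ (2 * DIM('a))" by (simp add: power_mult)
    finally have *: "(\<Prod>b\<in>(Basis::'a set). 1 + (x \<bullet> b)\<^sup>2) \<le> (1 + norm x) ^ (2 * DIM('a))" .
    have "?g x = 1 / (\<Prod>b\<in>(Basis::'a set). 1 + (x \<bullet> b)\<^sup>2)"
      by (simp add: prod_inversef[symmetric] divide_inverse comp_def)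
    moreover have "(\<Prod>b\<in>(Basis::'a set). 1 + (x \<bullet> b)\<^sup>2) > 0"
      by (intro prod_pos) (simp add: add_pos_nonneg)
    ultimately show ?thesis using * by (simp add: frac_le)
  qed
  then show ?thesis
    by (intro Bochner_Integration.integrable_bound[OF g])
       (auto simp: abs_of_nonneg prod_nonneg)
qed

lemma rapid_integrable:
  fixes r :: "'a::euclidean_space \<Rightarrow> 'b::{banach, second_countable_topology}"
  assumes "rapid r" "r \<in> borel_measurable borel"
  shows "integrable lborel r"
proof -
  obtain C where C: "C > 0" "\<And>x. norm (r x) \<le> C / (1 + norm x) ^ (2 * DIM('a))"
    using rapid_ex[OF assms(1), of "(2 * DIM('a))"] by blast
  have "integrable lborel (\<lambda>x::'a. C * (1 / (1 + norm x) ^ (2 * DIM('a))))"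
    by (intro integrable_mult_right rapid_weight_integrable)
  then show ?thesis
    by (rule Bochner_Integration.integrable_bound) (use assms C in auto)
qed

lemma rapid_convolution:
  fixes r :: "'a::euclidean_space \<Rightarrow> real" and s :: "'a \<Rightarrow> real"
  assumes r: "rapid r" "r \<in> borel_measurable borel" "\<And>x. 0 \<le> r x"
    and s: "rapid s" "s \<in> borel_measurable borel" "\<And>x. 0 \<le> s x"
  shows "rapid (\<lambda>x. LINT y|lborel. r (x - y) * s y)"
proof (rule rapidI)
  fix N :: nat
  let ?M = "2 * DIM('a)"
  obtain C where C: "C > 0" "\<And>x. norm (r x) \<le> C / (1 + norm x) ^ N" using rapid_ex[OF r(1), of "N"] by blast
  \<comment> \<open>Of the decay of \<open>s\<close>, \<open>N\<close> powers are spent on Peetre's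
    inequality and the other \<open>?M\<close> make the integral in \<open>y\<close>
    converge.\<close>
  obtain D where D: "D > 0" "\<And>x. norm (s x) \<le> D / (1 + norm x) ^ (N + ?M)" using rapid_ex[OF s(1), of "(N + ?M)"] by blast
  let ?I = "LINT y|lborel. 1 / (1 + norm (y::'a)) ^ ?M"
  note [measurable] = r(2) s(2)
  have "norm (LINT y|lborel. r (x - y) * s y) \<le> (C * D * ?I) / (1 + norm x) ^ N" for x
  proof -
    have le: "norm (r (x - y) * s y) \<le> (C * D / (1 + norm x) ^ N) * (1 / (1 + norm y) ^ ?M)" for y
    proof -
      have "norm (r (x - y) * s y) \<le> C / (1 + norm (x - y)) ^ N * (D / (1 + norm y) ^ (N + ?M))"
        unfolding norm_mult by (intro mult_mono C D) (use C in auto)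
      also have "\<dots> = C * D * (1 / ((1 + norm (x - y)) * (1 + norm y)) ^ N) * (1 / (1 + norm y) ^ ?M)"
        by (simp add: power_add power_mult_distrib)
      also have "\<dots> \<le> C * D * (1 / (1 + norm x) ^ N) * (1 / (1 + norm y) ^ ?M)"
        using C D peetre[of x y]
        by (intro mult_right_mono mult_left_mono frac_le power_mono) (auto simp: add_pos_nonneg)
      finally show ?thesis by simp
    qed
    have int: "integrable lborel (\<lambda>y::'a. (C * D / (1 + norm x) ^ N) * (1 / (1 + norm y) ^ ?M))"
      by (intro integrable_mult_right rapid_weight_integrable)
    have int': "integrable lborel (\<lambda>y. r (x - y) * s y)"
      by (rule Bochner_Integration.integrable_bound[OF int], measurable, intro AE_I2 order_trans[OF le])
         (simp only: real_norm_def abs_ge_self)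
    have "norm (LINT y|lborel. r (x - y) * s y) \<le> (LINT y|lborel. norm (r (x - y) * s y))"
      by (rule integral_norm_bound)
    also have "\<dots> \<le> (LINT y|lborel. (C * D / (1 + norm x) ^ N) * (1 / (1 + norm (y::'a)) ^ ?M))"
      by (rule integral_mono[OF integrable_norm[OF int'] int]) (rule le)
    also have "\<dots> = (C * D / (1 + norm x) ^ N) * ?I" by (rule Bochner_Integration.integral_mult_right_zero)
    finally show ?thesis by simp
  qed
  then show "\<exists>C. \<forall>x. norm (LINT y|lborel. r (x - y) * s y) \<le> C / (1 + norm x) ^ N" by blast
qed

lemma test_fun_rapid:
  assumes "test_fun f" shows "rapid f"
proof (rule rapidI)
  fix N :: nat
  obtain R where R: "\<And>x. R < norm x \<Longrightarrow> f x = 0" using assms by (auto simp: test_fun_def)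
  obtain B where B: "B \<ge> 0" "\<And>x. norm (f x) \<le> B" using test_fun_bounded[OF assms] by blast
  have "norm (f x) \<le> B * (1 + \<bar>R\<bar>) ^ N / (1 + norm x) ^ N" for x
  proof (cases "R < norm x")
    case True
    then show ?thesis using R[OF True] B by simp
  next
    case False
    then have "1 \<le> (1 + \<bar>R\<bar>) ^ N / (1 + norm x) ^ N"
      by (simp add: power_divide[symmetric] one_le_power add_pos_nonneg)
    then have "B * 1 \<le> B * ((1 + \<bar>R\<bar>) ^ N / (1 + norm x) ^ N)" by (intro mult_left_mono B)
    then show ?thesis using B(2)[of x] by simp
  qed
  then show "\<exists>C. \<forall>x. norm (f x) \<le> C / (1 + norm x) ^ N" by blast
qed

lemma schwartzI:
  fixes f :: "'a::euclidean_space \<Rightarrow> complex"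
  assumes "smooth_fun f" and rap: "\<And>bs. set bs \<subseteq> Basis \<Longrightarrow> rapid (iter_deriv bs f)"
  shows "f \<in> schwartz"
proof -
  have "bdd_above (schwartz_values N f)" for N
  proof -
    let ?L = "{bs::'a list. set bs \<subseteq> Basis \<and> length bs \<le> N}"
    have fin: "finite ?L" by (rule finite_lists_length_le) auto
    have "\<exists>C. \<forall>x. (1 + norm x) ^ N * norm (iter_deriv bs f x) \<le> C" if "bs \<in> ?L" for bs
      using rap[of bs] that by (auto simp: rapid_def)
    then obtain C where C: "\<And>bs x. bs \<in> ?L \<Longrightarrow> (1 + norm x) ^ N * norm (iter_deriv bs f x) \<le> C bs"
      by metis
    have "(1 + norm x) ^ N * norm (iter_deriv bs f x) \<le> (\<Sum>bs\<in>?L. \<bar>C bs\<bar>)" if "bs \<in> ?L" for bs x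
      using C[OF that, of x] member_le_sum[OF that _ fin, of "\<lambda>bs. \<bar>C bs\<bar>"] by simp
    then show ?thesis by (auto simp: bdd_above_def schwartz_values_def)
  qed
  then show ?thesis using assms by (auto simp: schwartz_def)
qed

lemma test_fun_schwartz: "test_fun f \<Longrightarrow> f \<in> schwartz"
  by (intro schwartzI test_fun_smooth test_fun_rapid test_fun_iter_deriv)

lemma schwartz_rapid:
  assumes "\<phi> \<in> schwartz" shows "rapid \<phi>" "\<phi> \<in> borel_measurable borel"
proof -
  show "rapid \<phi>" unfolding rapid_def
  proof
    fix N
    have "bdd_above (schwartz_values N \<phi>)" using assms by (simp add: schwartz_def)
    then obtain C where C: "\<And>y. y \<in> schwartz_values N \<phi> \<Longrightarrow> y \<le> C" by (auto simp: bdd_above_def)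
    have "(1 + norm x) ^ N * norm (\<phi> x) \<in> schwartz_values N \<phi>" for x
      unfolding schwartz_values_def by (rule CollectI, rule exI[of _ "[]"]) auto
    with C show "\<exists>C. \<forall>x. (1 + norm x) ^ N * norm (\<phi> x) \<le> C" by blast
  qed
  show "\<phi> \<in> borel_measurable borel" using assms by (simp add: schwartz_def smooth_fun_borel)
qed


section \<open>Fourier transform of test functions\<close>

lemma integral_lborel_affine:
  fixes f :: "'a::euclidean_space \<Rightarrow> 'b::{banach, second_countable_topology}"
  assumes c: "c \<noteq> 0" and [measurable]: "f \<in> borel_measurable borel"
  shows "(LINT x|lborel. f x) = \<bar>c\<bar> ^ DIM('a) *\<^sub>R (LINT x|lborel. f (t + c *\<^sub>R x))"
    and "integrable lborel (\<lambda>x. f (t + c *\<^sub>R x)) \<longleftrightarrow> integrable lborel f"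
proof -
  have [measurable]: "(\<lambda>x. t + c *\<^sub>R x) \<in> borel \<rightarrow>\<^sub>M borel" by measurable
  show "(LINT x|lborel. f x) = \<bar>c\<bar> ^ DIM('a) *\<^sub>R (LINT x|lborel. f (t + c *\<^sub>R x))"
    by (subst lborel_affine[OF c, of t]) (simp add: integral_density integral_distr)
  have "integrable lborel f \<longleftrightarrow> integrable (density (distr lborel borel (\<lambda>x. t + c *\<^sub>R x)) (\<lambda>_. \<bar>c\<bar> ^ DIM('a))) f"
    using lborel_affine[OF c, of t] by simp
  also have "\<dots> \<longleftrightarrow> integrable lborel (\<lambda>x. \<bar>c\<bar> ^ DIM('a) *\<^sub>R f (t + c *\<^sub>R x))"
    by (simp add: integrable_density integrable_distr_eq)
  also have "\<dots> \<longleftrightarrow> integrable lborel (\<lambda>x. f (t + c *\<^sub>R x))"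
    using c integrable_scaleR_right[of "inverse (\<bar>c\<bar> ^ DIM('a))" lborel "\<lambda>x. \<bar>c\<bar> ^ DIM('a) *\<^sub>R f (t + c *\<^sub>R x)"]
    by (auto intro!: integrable_scaleR_right)
  finally show "integrable lborel (\<lambda>x. f (t + c *\<^sub>R x)) \<longleftrightarrow> integrable lborel f" by simp
qed

lemma nn_integral_lborel_affine:
  fixes f :: "'a::euclidean_space \<Rightarrow> ennreal"
  assumes c: "c \<noteq> 0" and [measurable]: "f \<in> borel_measurable borel"
  shows "(\<integral>\<^sup>+x. f x \<partial>lborel) = ennreal (\<bar>c\<bar> ^ DIM('a)) * (\<integral>\<^sup>+x. f (t + c *\<^sub>R x) \<partial>lborel)"
  by (subst lborel_affine[OF c, of t]) (simp add: nn_integral_density nn_integral_distr nn_integral_cmult)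

lemma inv_fourier_lborel:
  fixes f :: "'a::euclidean_space \<Rightarrow> complex"
  assumes [measurable]: "f \<in> borel_measurable borel"
  shows "inv_fourier f x = (LINT \<xi>|lborel. f \<xi> * cis (x \<bullet> \<xi>)) / of_real ((2 * pi) ^ DIM('a))"
proof -
  have [measurable]: "(\<lambda>\<xi>. cis (x \<bullet> \<xi>)) \<in> borel_measurable borel"
    by (intro borel_measurable_continuous_onI continuous_intros)
  show ?thesis by (simp add: inv_fourier_def integral_completion)
qed

lemma fourier_lborel:
  fixes f :: "'a::euclidean_space \<Rightarrow> complex"
  assumes [measurable]: "f \<in> borel_measurable borel"
  shows "fourier f \<xi> = (LINT x|lborel. f x * cis (- (x \<bullet> \<xi>)))"
proof -
  have [measurable]: "(\<lambda>x. cis (- (x \<bullet> \<xi>))) \<in> borel_measurable borel"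
    by (intro borel_measurable_continuous_onI continuous_intros)
  show ?thesis by (simp add: fourier_def integral_completion)
qed

lemma borel_measurable_cis [measurable (raw)]:
  assumes "f \<in> borel_measurable M" shows "(\<lambda>x. cis (f x)) \<in> borel_measurable M"
  by (rule measurable_compose[OF assms]) (intro borel_measurable_continuous_onI continuous_intros)

text \<open>Integration by parts without boundary terms: by translation invariance every difference
  quotient has integral zero, and dominated convergence passes to the derivative.\<close>

lemma integral_directional_derivative:
  fixes g :: "'a::euclidean_space \<Rightarrow> complex"
  assumes g: "\<And>x. (g has_derivative g' x) (at x)" and cont: "continuous_on UNIV (\<lambda>x. g' x b)"
    and R: "\<And>x. R < norm x \<Longrightarrow> g x = 0"
  shows "(LINT x|lborel. g' x b) = 0"
proof -
  have contg: "continuous_on UNIV g"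
    using g by (meson continuous_at_imp_continuous_on has_derivative_continuous)
  have [measurable]: "g \<in> borel_measurable borel" "(\<lambda>x. g' x b) \<in> borel_measurable borel"
    by (intro borel_measurable_continuous_onI contg cont)+
  have R': "g' x b = 0" if "R < norm x" for x
  proof -
    have "((\<lambda>_. 0) has_derivative (\<lambda>_. 0 :: complex)) (at x)" by simp
    then have "(g has_derivative (\<lambda>_. 0)) (at x)"
      by (rule has_derivative_transform_within_open[of _ _ _ _ "{x. R < norm x}"])
         (use R that in \<open>auto intro!: open_Collect_less continuous_intros\<close>)
    from has_derivative_unique[OF this g] show ?thesis by (simp add: fun_eq_iff)
  qed
  obtain B where B: "B \<ge> 0" "\<And>x. norm (g' x b) \<le> B" using compact_support_bounded[OF cont R'] by blast
  have lip: "norm (g (x + t *\<^sub>R b) - g x) \<le> B * \<bar>t\<bar>" for x t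
  proof -
    have d: "((\<lambda>s. g (x + s *\<^sub>R b)) has_derivative (\<lambda>h. h *\<^sub>R g' (x + s *\<^sub>R b) b)) (at s within S)" for s S
    proof -
      have "((\<lambda>s. g (x + s *\<^sub>R b)) has_derivative (\<lambda>h. g' (x + s *\<^sub>R b) (h *\<^sub>R b))) (at s within S)"
        by (rule has_derivative_compose[of "\<lambda>s. x + s *\<^sub>R b" "\<lambda>h. h *\<^sub>R b" _ _ g])
           (auto intro!: derivative_eq_intros g)
      moreover have "linear (g' (x + s *\<^sub>R b))" using g has_derivative_linear by blast
      ultimately show ?thesis by (simp add: linear_scale)
    qed
    have "norm (g (x + t *\<^sub>R b) - g (x + 0 *\<^sub>R b)) \<le> B * norm (t - 0)"
      by (rule differentiable_bound[OF convex_UNIV d])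
         (auto intro!: onorm_le mult_right_mono B simp: mult.commute[of _ "norm (g' _ b)"])
    then show ?thesis by simp
  qed
  define q where "q n x = (g (x + (1 / Suc n) *\<^sub>R b) - g x) /\<^sub>R (1 / Suc n)" for n x
  have [measurable]: "q n \<in> borel_measurable borel" for n unfolding q_def by measurable
  have int_g: "integrable lborel g" using compact_support_integrable[OF contg R] by blast
  then have int_gt: "integrable lborel (\<lambda>x. g (x + t))" for t
    using integral_lborel_affine(2)[of 1 g t] by (simp add: add.commute)
  have eq: "(LINT x|lborel. g (x + t)) = (LINT x|lborel. g x)" for t
    using integral_lborel_affine(1)[of 1 g t] by (simp add: add.commute)
  have q0: "(LINT x|lborel. q n x) = 0" for n
    unfolding q_def using int_g int_gt by (simp add: eq)
  have lim: "(\<lambda>n. q n x) \<longlonglongrightarrow> g' x b" for x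
  proof -
    have "((\<lambda>s. g (x + s *\<^sub>R b)) has_vector_derivative g' x b) (at 0)"
    proof -
      have "((\<lambda>s. g (x + s *\<^sub>R b)) has_derivative (\<lambda>h. g' x (h *\<^sub>R b))) (at 0)"
        by (rule has_derivative_compose[of "\<lambda>s. x + s *\<^sub>R b" "\<lambda>h. h *\<^sub>R b" _ _ g, simplified])
           (auto intro!: derivative_eq_intros g)
      moreover have "linear (g' x)" using g has_derivative_linear by blast
      ultimately show ?thesis by (simp add: linear_scale has_vector_derivative_def)
    qed
    then have "((\<lambda>h. inverse \<bar>h\<bar> * cmod (g (x + h *\<^sub>R b) - g x - h *\<^sub>R g' x b)) \<longlongrightarrow> 0) (at 0)"
      by (simp add: has_vector_derivative_def has_derivative_at divide_inverse_commute)
    moreover have "\<forall>\<^sub>F h in at 0. inverse \<bar>h\<bar> * cmod (g (x + h *\<^sub>R b) - g x - h *\<^sub>R g' x b)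
        = norm ((g (x + h *\<^sub>R b) - g x) /\<^sub>R h - g' x b)"
    proof (rule eventually_at_ball'[of 1, THEN eventually_mono])
      fix h :: real assume "h \<in> ball 0 1 \<and> h \<noteq> 0 \<and> h \<in> UNIV"
      then have "(g (x + h *\<^sub>R b) - g x) /\<^sub>R h - g' x b = inverse h *\<^sub>R (g (x + h *\<^sub>R b) - g x - h *\<^sub>R g' x b)"
        by (simp add: scaleR_diff_right)
      then show "inverse \<bar>h\<bar> * cmod (g (x + h *\<^sub>R b) - g x - h *\<^sub>R g' x b)
        = norm ((g (x + h *\<^sub>R b) - g x) /\<^sub>R h - g' x b)" by simp
    qed simp
    ultimately have "((\<lambda>h. norm ((g (x + h *\<^sub>R b) - g x) /\<^sub>R h - g' x b)) \<longlongrightarrow> 0) (at 0)"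
      by (rule Lim_transform_eventually)
    then have "((\<lambda>h. (g (x + h *\<^sub>R b) - g x) /\<^sub>R h) \<longlongrightarrow> g' x b) (at 0)"
      by (simp add: tendsto_norm_zero_iff LIM_zero_iff)
    moreover have "filterlim (\<lambda>n. 1 / real (Suc n)) (at 0) sequentially"
      using LIMSEQ_inverse_real_of_nat by (auto simp: filterlim_at inverse_eq_divide)
    ultimately show ?thesis unfolding q_def by (rule filterlim_compose)
  qed
  \<comment> \<open>The steps \<open>1 / Suc n\<close> are at most 1, so all difference quotients
    live in the support enlarged by \<open>norm b\<close>; the Lipschitz constant bounds them
    there.\<close>
  have bd: "norm (q n x) \<le> B * indicator (cball 0 (\<bar>R\<bar> + norm b)) x" for n x
  proof (cases "x \<in> cball 0 (\<bar>R\<bar> + norm b)")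
    case True
    have "norm (q n x) = norm (g (x + (1 / Suc n) *\<^sub>R b) - g x) * Suc n"
      unfolding q_def by (simp add: mult.commute)
    also have "\<dots> \<le> (B * \<bar>1 / Suc n\<bar>) * Suc n" by (intro mult_right_mono lip) auto
    finally show ?thesis using True by simp
  next
    case False
    then have "norm x > \<bar>R\<bar> + norm b" by simp
    moreover have "norm ((1 / Suc n) *\<^sub>R b) \<le> norm b"
      by (simp add: mult_left_le_one_le divide_le_eq field_simps)
    moreover have "norm x \<le> norm (x + (1 / Suc n) *\<^sub>R b) + norm ((1 / Suc n) *\<^sub>R b)"
      by (metis add_diff_cancel_right' norm_triangle_ineq4)
    moreover have "0 \<le> norm b" by simp
    ultimately have "R < norm x" "R < norm (x + (1 / Suc n) *\<^sub>R b)" by linarith+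
    then show ?thesis using B by (simp add: q_def R)
  qed
  have "integrable lborel (\<lambda>x. B * indicator (cball 0 (\<bar>R\<bar> + norm b)) x :: real)"
    by (intro integrable_mult_right integrable_real_indicator) (use emeasure_lborel_cball_finite[of 0 "\<bar>R\<bar> + norm b"] in auto)
  then have "(\<lambda>n. LINT x|lborel. q n x) \<longlonglongrightarrow> (LINT x|lborel. g' x b)"
    by (intro integral_dominated_convergence[where w="\<lambda>x. B * indicator (cball 0 (\<bar>R\<bar> + norm b)) x"])
       (use lim bd in auto)
  then have "(\<lambda>n. 0) \<longlonglongrightarrow> (LINT x|lborel. g' x b)" by (simp add: q0)
  then show ?thesis using LIMSEQ_unique[OF tendsto_const] by metis
qed

section \<open>Decay and regularity of inverse Fourier transforms of test functions\<close>

lemma norm_inv_fourier_le: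
  fixes f :: "'a::euclidean_space \<Rightarrow> complex"
  assumes "f \<in> borel_measurable borel"
  shows "norm (inv_fourier f x) \<le> (LINT \<xi>|lborel. norm (f \<xi>)) / (2 * pi) ^ DIM('a)"
proof -
  have "norm (LINT \<xi>|lborel. f \<xi> * cis (x \<bullet> \<xi>)) \<le> (LINT \<xi>|lborel. norm (f \<xi> * cis (x \<bullet> \<xi>)))"
    by (rule integral_norm_bound)
  then show ?thesis
    by (simp add: inv_fourier_lborel[OF assms] norm_divide norm_mult norm_power divide_right_mono)
qed

lemma inv_fourier_iter_deriv:
  fixes f :: "'a::euclidean_space \<Rightarrow> complex"
  assumes f: "test_fun f" and b: "b \<in> Basis"
  shows "inv_fourier (iter_deriv [b] f) x = - \<i> * of_real (x \<bullet> b) * inv_fourier f x"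
proof -
  have tf: "test_fun (iter_deriv [b] f)" using test_fun_iter_deriv[OF f, of "[b]"] b by simp
  note [measurable] = test_fun_borel[OF f] test_fun_borel[OF tf]
  obtain R where R: "\<And>x. R < norm x \<Longrightarrow> f x = 0" using f by (auto simp: test_fun_def)
  let ?e = "\<lambda>\<xi>. cis (x \<bullet> \<xi>)"
  let ?g' = "\<lambda>\<xi> h. f \<xi> * ((x \<bullet> h) *\<^sub>R (\<i> * ?e \<xi>)) + frechet_derivative f (at \<xi>) h * ?e \<xi>"
  have e: "((\<lambda>\<xi>. ?e \<xi>) has_derivative (\<lambda>h. (x \<bullet> h) *\<^sub>R (\<i> * ?e \<xi>))) (at \<xi>)" for \<xi>
    by (auto intro!: derivative_eq_intros)
  have "(LINT \<xi>|lborel. ?g' \<xi> b) = 0"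
  proof (rule integral_directional_derivative[where g="\<lambda>\<xi>. f \<xi> * ?e \<xi>" and g'="?g'" and b=b and R=R])
    show "((\<lambda>\<xi>. f \<xi> * ?e \<xi>) has_derivative ?g' \<xi>) (at \<xi>)" for \<xi>
      by (intro has_derivative_mult e frechet_derivative_works[THEN iffD1] smooth_fun_differentiable test_fun_smooth f)
    have "continuous_on UNIV (iter_deriv [b] f)" by (intro smooth_fun_continuous test_fun_smooth tf)
    moreover have "continuous_on UNIV f" by (intro smooth_fun_continuous test_fun_smooth f)
    ultimately show "continuous_on UNIV (\<lambda>\<xi>. ?g' \<xi> b)"
      by (auto intro!: continuous_intros)
    show "\<And>\<xi>. R < norm \<xi> \<Longrightarrow> f \<xi> * ?e \<xi> = 0" using R by simp
  qed
  also have "(LINT \<xi>|lborel. ?g' \<xi> b) = (LINT \<xi>|lborel. \<i> * of_real (x \<bullet> b) * (f \<xi> * ?e \<xi>)) + (LINT \<xi>|lborel. iter_deriv [b] f \<xi> * ?e \<xi>)"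
  proof -
    have i: "integrable lborel (\<lambda>\<xi>. g \<xi> * ?e \<xi>)" if "test_fun g" for g
    proof -
      note [measurable] = test_fun_borel[OF that]
      show ?thesis
        by (rule Bochner_Integration.integrable_bound[OF test_fun_integrable[OF that]]) (auto simp: norm_mult)
    qed
    have "(LINT \<xi>|lborel. ?g' \<xi> b) = (LINT \<xi>|lborel. \<i> * of_real (x \<bullet> b) * (f \<xi> * ?e \<xi>) + iter_deriv [b] f \<xi> * ?e \<xi>)"
      by (simp add: scaleR_conv_of_real mult_ac)
    also have "\<dots> = (LINT \<xi>|lborel. \<i> * of_real (x \<bullet> b) * (f \<xi> * ?e \<xi>)) + (LINT \<xi>|lborel. iter_deriv [b] f \<xi> * ?e \<xi>)"
      by (intro Bochner_Integration.integral_add integrable_mult_right i f tf)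
    finally show ?thesis .
  qed
  finally have "(LINT \<xi>|lborel. iter_deriv [b] f \<xi> * ?e \<xi>) = - (\<i> * of_real (x \<bullet> b) * (LINT \<xi>|lborel. f \<xi> * ?e \<xi>))"
    by (simp add: add_eq_0_iff2)
  then show ?thesis
    using test_fun_borel[OF f] test_fun_borel[OF tf] by (simp only: inv_fourier_lborel) simp
qed

lemma inv_fourier_iter_deriv_power:
  fixes f :: "'a::euclidean_space \<Rightarrow> complex"
  assumes f: "test_fun f" and b: "b \<in> Basis"
  shows "inv_fourier (iter_deriv (replicate N b) f) x = (- \<i> * of_real (x \<bullet> b)) ^ N * inv_fourier f x"
proof (induction N)
  case (Suc N)
  have "test_fun (iter_deriv (replicate N b) f)" using f b by (intro test_fun_iter_deriv) auto
  from inv_fourier_iter_deriv[OF this b, of x] show ?case using Suc by (simp add: mult_ac)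
qed simp

text \<open>The largest coordinate of \<open>x\<close> is at least |x| / \<open>DIM('a)\<close>, and
  its \<open>N\<close>-th power is produced by \<open>N\<close> derivatives in that one direction;
  so pure partial derivatives suffice.\<close>

lemma inv_fourier_rapid:
  fixes f :: "'a::euclidean_space \<Rightarrow> complex"
  assumes f: "test_fun f"
  shows "rapid (inv_fourier f)"
  unfolding rapid_def
proof
  fix N :: nat
  let ?A = "\<lambda>g. (LINT \<xi>|lborel. norm (g \<xi>)) / (2 * pi) ^ DIM('a)"
  define A where "A b = ?A (iter_deriv (replicate N b) f)" for b
  have le: "\<bar>x \<bullet> b\<bar> ^ N * norm (inv_fourier f x) \<le> A b" if b: "b \<in> Basis" for x b
  proof -
    have "test_fun (iter_deriv (replicate N b) f)" using f b by (intro test_fun_iter_deriv) auto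
    from norm_inv_fourier_le[OF test_fun_borel[OF this], of x]
    show ?thesis
      unfolding A_def inv_fourier_iter_deriv_power[OF f b] by (simp add: norm_mult norm_power)
  qed
  have le0: "norm (inv_fourier f x) \<le> ?A f" for x
    using norm_inv_fourier_le[OF test_fun_borel[OF f]] .
  have "(1 + norm x) ^ N * norm (inv_fourier f x) \<le> 2 ^ N * ?A f + 2 ^ N * real (DIM('a)) ^ N * (\<Sum>b\<in>Basis. A b)" for x
  proof (cases "norm x \<le> 1")
    case True
    then have "(1 + norm x) ^ N \<le> 2 ^ N" by (intro power_mono) auto
    then have "(1 + norm x) ^ N * norm (inv_fourier f x) \<le> 2 ^ N * ?A f" by (intro mult_mono le0) auto
    moreover have "0 \<le> (\<Sum>b\<in>Basis. A b)" unfolding A_def by (intro sum_nonneg) auto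
    then have "0 \<le> 2 ^ N * real (DIM('a)) ^ N * (\<Sum>b\<in>Basis. A b)" by (intro mult_nonneg_nonneg) auto
    ultimately show ?thesis by linarith
  next
    case False
    obtain b where b: "b \<in> Basis" "\<And>c. c \<in> Basis \<Longrightarrow> \<bar>x \<bullet> c\<bar> \<le> \<bar>x \<bullet> b\<bar>"
      using Max_in[of "(\<lambda>c. \<bar>x \<bullet> c\<bar>) ` Basis"] Max_ge[of "(\<lambda>c. \<bar>x \<bullet> c\<bar>) ` Basis"]
      by fastforce
    have "norm x \<le> (\<Sum>c\<in>Basis. \<bar>x \<bullet> c\<bar>)" by (rule norm_le_l1)
    also have "\<dots> \<le> DIM('a) * \<bar>x \<bullet> b\<bar>" using sum_bounded_above[of Basis "\<lambda>c. \<bar>x \<bullet> c\<bar>"] b by simp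
    finally have "1 + norm x \<le> 2 * (DIM('a) * \<bar>x \<bullet> b\<bar>)" using False by simp
    then have "(1 + norm x) ^ N \<le> (2 * (DIM('a) * \<bar>x \<bullet> b\<bar>)) ^ N" by (intro power_mono) auto
    then have "(1 + norm x) ^ N * norm (inv_fourier f x) \<le> (2 * (DIM('a) * \<bar>x \<bullet> b\<bar>)) ^ N * norm (inv_fourier f x)"
      by (intro mult_right_mono) auto
    also have "\<dots> = 2 ^ N * real (DIM('a)) ^ N * (\<bar>x \<bullet> b\<bar> ^ N * norm (inv_fourier f x))"
      by (simp add: power_mult_distrib mult_ac)
    also have "\<dots> \<le> 2 ^ N * real (DIM('a)) ^ N * (\<Sum>b\<in>Basis. A b)"
    proof (intro mult_left_mono)
      have "A b \<le> (\<Sum>b\<in>Basis. A b)" by (rule member_le_sum) (auto simp: A_def b)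
      with le[OF b(1)] show "\<bar>x \<bullet> b\<bar> ^ N * norm (inv_fourier f x) \<le> (\<Sum>b\<in>Basis. A b)" by (rule order_trans)
    qed auto
    also have "\<dots> \<le> 2 ^ N * ?A f + \<dots>" by simp
    finally show ?thesis .
  qed
  then show "\<exists>C. \<forall>x. (1 + norm x) ^ N * norm (inv_fourier f x) \<le> C" by blast
qed

lemma norm_cis_minus_one_minus: "norm (cis t - 1 - \<i> * of_real t) \<le> t\<^sup>2"
proof -
  have "norm (cis t - 1 - \<i> * of_real t) \<le> t\<^sup>2 / 2"
    using iexp_approx1[of t 1] by (simp add: cis_conv_exp algebra_simps power2_eq_square fact_numeral)
  also have "\<dots> \<le> t\<^sup>2" by simp
  finally show ?thesis .
qed

text \<open>The quadratic remainder of \<open>cis\<close>, integrated against |f(\<xi>)| |\<xi>|^2,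
  gives a remainder of order |h|^2; compact support makes that integral finite.\<close>

lemma inv_fourier_has_derivative:
  fixes f :: "'a::euclidean_space \<Rightarrow> complex"
  assumes f: "test_fun f"
  shows "(inv_fourier f has_derivative
     (\<lambda>h. \<Sum>b\<in>Basis. (h \<bullet> b) *\<^sub>R inv_fourier (\<lambda>\<xi>. \<i> * of_real (\<xi> \<bullet> b) * f \<xi>) x)) (at x)"
proof -
  note fb[measurable] = test_fun_borel[OF f]
  have cf: "continuous_on UNIV f" by (intro smooth_fun_continuous test_fun_smooth f)
  let ?c = "(2 * pi) ^ DIM('a)"
  define \<psi> where "\<psi> b \<xi> = \<i> * of_real (\<xi> \<bullet> b) * f \<xi>" for b \<xi>
  have \<psi>: "test_fun (\<psi> b)" for b
  proof -
    have "bounded_linear (\<lambda>\<xi>. \<i> * of_real (\<xi> \<bullet> b) :: complex)"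
      by (intro bounded_linear_compose[OF bounded_linear_mult_right] bounded_linear_compose[OF bounded_linear_of_real]
          bounded_linear_inner_left)
    then show ?thesis unfolding \<psi>_def by (intro test_fun_mult f smooth_fun_bounded_linear)
  qed
  note [measurable] = test_fun_borel[OF \<psi>]
  have int: "integrable lborel (\<lambda>\<xi>. g \<xi> * cis (x \<bullet> \<xi>))" if "test_fun g" for g and x :: 'a
  proof -
    note [measurable] = test_fun_borel[OF that]
    show ?thesis
      by (rule Bochner_Integration.integrable_bound[OF test_fun_integrable[OF that]]) (auto simp: norm_mult)
  qed
  define K where "K = (LINT \<xi>|lborel. norm (f \<xi>) * (norm \<xi>)\<^sup>2)"
  obtain R where R: "\<And>x. R < norm x \<Longrightarrow> f x = 0" using f by (auto simp: test_fun_def)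
  have intK: "integrable lborel (\<lambda>\<xi>. norm (f \<xi>) * (norm \<xi>)\<^sup>2)"
  proof -
    have "integrable lborel (\<lambda>\<xi>. f \<xi> * of_real ((norm \<xi>)\<^sup>2))"
      by (rule compact_support_integrable[of _ R]) (auto intro!: continuous_intros cf simp: R)
    from integrable_norm[OF this] show ?thesis by (simp add: norm_mult norm_power)
  qed
  have K: "0 \<le> K" unfolding K_def by simp
  let ?D = "\<lambda>h. \<Sum>b\<in>Basis. (h \<bullet> b) *\<^sub>R inv_fourier (\<psi> b) x"
  have lin: "bounded_linear ?D"
    by (intro bounded_linear_sum bounded_linear_compose[OF bounded_linear_scaleR_left] bounded_linear_inner_left)
  have D: "?D h = (LINT \<xi>|lborel. f \<xi> * cis (x \<bullet> \<xi>) * (\<i> * of_real (h \<bullet> \<xi>))) / of_real ?c" for h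
  proof -
    have "?D h = (\<Sum>b\<in>Basis. (LINT \<xi>|lborel. of_real (h \<bullet> b) * (\<psi> b \<xi> * cis (x \<bullet> \<xi>)))) / of_real ?c"
      by (simp add: inv_fourier_lborel scaleR_conv_of_real sum_divide_distrib)
    also have "(\<Sum>b\<in>Basis. (LINT \<xi>|lborel. of_real (h \<bullet> b) * (\<psi> b \<xi> * cis (x \<bullet> \<xi>))))
        = (LINT \<xi>|lborel. (\<Sum>b\<in>Basis. of_real (h \<bullet> b) * (\<psi> b \<xi> * cis (x \<bullet> \<xi>))))"
      by (rule Bochner_Integration.integral_sum[symmetric]) (intro integrable_mult_right int \<psi>)
    also have "\<dots> = (LINT \<xi>|lborel. f \<xi> * cis (x \<bullet> \<xi>) * (\<i> * of_real (h \<bullet> \<xi>)))"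
    proof (rule Bochner_Integration.integral_cong[OF refl])
      fix \<xi> :: 'a
      have "h \<bullet> \<xi> = (\<Sum>b\<in>Basis. (h \<bullet> b) * (\<xi> \<bullet> b))" by (rule euclidean_inner)
      then show "(\<Sum>b\<in>Basis. of_real (h \<bullet> b) * (\<psi> b \<xi> * cis (x \<bullet> \<xi>))) = f \<xi> * cis (x \<bullet> \<xi>) * (\<i> * of_real (h \<bullet> \<xi>))"
        by (simp add: \<psi>_def sum_distrib_left mult_ac)
    qed
    finally show ?thesis .
  qed
  have rem: "norm (inv_fourier f (x + h) - inv_fourier f x - ?D h) \<le> K / ?c * (norm h)\<^sup>2" for h
  proof -
    have i2: "integrable lborel (\<lambda>\<xi>. f \<xi> * cis (x \<bullet> \<xi>) * (\<i> * of_real (h \<bullet> \<xi>)))"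
    proof (rule compact_support_integrable[of _ R])
      show "continuous_on UNIV (\<lambda>\<xi>. f \<xi> * cis (x \<bullet> \<xi>) * (\<i> * of_real (h \<bullet> \<xi>)))"
        by (intro continuous_intros cf)
    qed (simp add: R)
    have "inv_fourier f (x + h) - inv_fourier f x - ?D h
       = (LINT \<xi>|lborel. f \<xi> * cis ((x + h) \<bullet> \<xi>) - f \<xi> * cis (x \<bullet> \<xi>) - f \<xi> * cis (x \<bullet> \<xi>) * (\<i> * of_real (h \<bullet> \<xi>))) / of_real ?c"
      unfolding D inv_fourier_lborel[OF fb] diff_divide_distrib[symmetric]
        Bochner_Integration.integral_diff[OF int[OF f] int[OF f], symmetric]
      by (subst Bochner_Integration.integral_diff[symmetric]) (intro Bochner_Integration.integrable_diff int f i2 refl)+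
    also have "(\<lambda>\<xi>. f \<xi> * cis ((x + h) \<bullet> \<xi>) - f \<xi> * cis (x \<bullet> \<xi>) - f \<xi> * cis (x \<bullet> \<xi>) * (\<i> * of_real (h \<bullet> \<xi>)))
       = (\<lambda>\<xi>. f \<xi> * cis (x \<bullet> \<xi>) * (cis (h \<bullet> \<xi>) - 1 - \<i> * of_real (h \<bullet> \<xi>)))"
      by (simp add: fun_eq_iff inner_add_left cis_mult[symmetric] algebra_simps)
    also have "norm ((LINT \<xi>|lborel. f \<xi> * cis (x \<bullet> \<xi>) * (cis (h \<bullet> \<xi>) - 1 - \<i> * of_real (h \<bullet> \<xi>))) / of_real ?c)
       \<le> (LINT \<xi>|lborel. norm (f \<xi>) * (norm \<xi>)\<^sup>2 * (norm h)\<^sup>2) / ?c"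
      unfolding norm_divide norm_of_real
    proof (rule frac_le)
      show "norm (LINT \<xi>|lborel. f \<xi> * cis (x \<bullet> \<xi>) * (cis (h \<bullet> \<xi>) - 1 - \<i> * of_real (h \<bullet> \<xi>)))
        \<le> (LINT \<xi>|lborel. norm (f \<xi>) * (norm \<xi>)\<^sup>2 * (norm h)\<^sup>2)"
      proof (rule order_trans[OF integral_norm_bound integral_mono[OF integrable_norm]])
        show "integrable lborel (\<lambda>\<xi>. f \<xi> * cis (x \<bullet> \<xi>) * (cis (h \<bullet> \<xi>) - 1 - \<i> * of_real (h \<bullet> \<xi>)))"
        proof (rule compact_support_integrable[of _ R])
          show "continuous_on UNIV (\<lambda>\<xi>. f \<xi> * cis (x \<bullet> \<xi>) * (cis (h \<bullet> \<xi>) - 1 - \<i> * of_real (h \<bullet> \<xi>)))"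
            by (intro continuous_intros cf)
        qed (simp add: R)
        show "integrable lborel (\<lambda>\<xi>. norm (f \<xi>) * (norm \<xi>)\<^sup>2 * (norm h)\<^sup>2)" using intK by simp
        fix \<xi> :: 'a
        have "(h \<bullet> \<xi>)\<^sup>2 \<le> (norm h * norm \<xi>)\<^sup>2"
          using Cauchy_Schwarz_ineq2[of h \<xi>] by (simp only: abs_le_square_iff[symmetric] abs_mult abs_norm_cancel)
        then have "norm (cis (h \<bullet> \<xi>) - 1 - \<i> * of_real (h \<bullet> \<xi>)) \<le> (norm \<xi>)\<^sup>2 * (norm h)\<^sup>2"
          using norm_cis_minus_one_minus[of "h \<bullet> \<xi>"] by (simp add: power_mult_distrib mult.commute)
        then show "norm (f \<xi> * cis (x \<bullet> \<xi>) * (cis (h \<bullet> \<xi>) - 1 - \<i> * of_real (h \<bullet> \<xi>))) \<le> norm (f \<xi>) * (norm \<xi>)\<^sup>2 * (norm h)\<^sup>2"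
          by (simp add: norm_mult mult.assoc mult_left_mono)
      qed
    qed auto
    finally show ?thesis unfolding K_def by (simp add: mult.commute)
  qed
  have "((\<lambda>h. norm (inv_fourier f (x + h) - inv_fourier f x - ?D h) / norm h) \<longlongrightarrow> 0) (at 0)"
  proof (rule tendsto_sandwich[of "\<lambda>_. 0" _ _ "\<lambda>h. K / ?c * norm h"])
    show "\<forall>\<^sub>F h in at 0. norm (inv_fourier f (x + h) - inv_fourier f x - ?D h) / norm h \<le> K / ?c * norm h"
    proof (rule always_eventually, rule allI)
      fix h :: 'a
      show "norm (inv_fourier f (x + h) - inv_fourier f x - ?D h) / norm h \<le> K / ?c * norm h"
        using rem[of h] K by (cases "h = 0") (auto simp: pos_divide_le_eq power2_eq_square mult.assoc)
    qed
    show "((\<lambda>h. K / ?c * norm h) \<longlongrightarrow> 0) (at (0::'a))"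
      by (auto intro!: tendsto_eq_intros)
  qed auto
  then show ?thesis using lin unfolding has_derivative_at \<psi>_def by simp
qed

text \<open>The mean value inequality on the segment from \<open>x\<close> to \<open>x + h\<close>.
  For \<open>norm h \<le> 1\<close> the weights at all its points are comparable with the weight at
  \<open>x\<close>, at the price of \<open>2 ^ N\<close>.\<close>

lemma inv_fourier_lipschitz:
  fixes f :: "'a::euclidean_space \<Rightarrow> complex"
  assumes f: "test_fun f"
  shows "\<exists>C>0. \<forall>x h. norm h \<le> 1 \<longrightarrow> norm (inv_fourier f (x + h) - inv_fourier f x) \<le> C * norm h / (1 + norm x) ^ N"
proof -
  define \<psi> where "\<psi> b \<xi> = \<i> * of_real (\<xi> \<bullet> b) * f \<xi>" for b \<xi>
  have \<psi>: "test_fun (\<psi> b)" for b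
  proof -
    have "bounded_linear (\<lambda>\<xi>. \<i> * of_real (\<xi> \<bullet> b) :: complex)"
      by (intro bounded_linear_compose[OF bounded_linear_mult_right] bounded_linear_compose[OF bounded_linear_of_real]
          bounded_linear_inner_left)
    then show ?thesis unfolding \<psi>_def by (intro test_fun_mult f smooth_fun_bounded_linear)
  qed
  have "\<exists>C>0. \<forall>x. norm (inv_fourier (\<psi> b) x) \<le> C / (1 + norm x) ^ N" for b
    by (rule rapid_ex[OF inv_fourier_rapid[OF \<psi>]])
  then obtain C where C: "\<And>b. C b > 0" "\<And>b x. norm (inv_fourier (\<psi> b) x) \<le> C b / (1 + norm x) ^ N"
    by metis
  let ?S = "\<Sum>b\<in>(Basis::'a set). C b"
  have S: "?S > 0" by (intro sum_pos) (use C in auto)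
  have "norm (inv_fourier f (x + h) - inv_fourier f x) \<le> 2 ^ N * ?S * norm h / (1 + norm x) ^ N"
    if h: "norm h \<le> 1" for x h
  proof -
    have "norm (inv_fourier f (x + h) - inv_fourier f x) \<le> 2 ^ N * ?S / (1 + norm x) ^ N * norm (x + h - x)"
    proof (rule differentiable_bound[of "closed_segment x (x + h)" "inv_fourier f"])
      fix z assume z: "z \<in> closed_segment x (x + h)"
      show "(inv_fourier f has_derivative
         (\<lambda>h. \<Sum>b\<in>Basis. (h \<bullet> b) *\<^sub>R inv_fourier (\<psi> b) z)) (at z within closed_segment x (x + h))"
        using inv_fourier_has_derivative[OF f, of z] unfolding \<psi>_def by (rule has_derivative_at_withinI)
      show "onorm (\<lambda>h. \<Sum>b\<in>Basis. (h \<bullet> b) *\<^sub>R inv_fourier (\<psi> b) z) \<le> 2 ^ N * ?S / (1 + norm x) ^ N"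
      proof (rule onorm_le)
        fix v :: 'a
        have "norm (x - z) \<le> 1"
          using segment_bound1[OF z] h by (simp add: norm_minus_commute)
        then have "1 + norm x \<le> 2 * (1 + norm z)"
          using peetre[of x z] mult_right_mono[of "1 + norm (x - z)" 2 "1 + norm z"] by simp
        then have "(1 + norm x) ^ N \<le> 2 ^ N * (1 + norm z) ^ N"
          by (metis power_mono power_mult_distrib add_nonneg_nonneg norm_ge_zero zero_le_one)
        moreover have "(1 + norm x) ^ N > 0" "(1 + norm z) ^ N > 0" by (auto intro!: zero_less_power add_pos_nonneg)
        ultimately have *: "1 / (1 + norm z) ^ N \<le> 2 ^ N / (1 + norm x) ^ N"
          by (simp add: field_simps)
        have "norm (\<Sum>b\<in>Basis. (v \<bullet> b) *\<^sub>R inv_fourier (\<psi> b) z) \<le> (\<Sum>b\<in>Basis. norm v * (C b * (2 ^ N / (1 + norm x) ^ N)))"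
        proof (rule sum_norm_le)
          fix b :: 'a assume b: "b \<in> Basis"
          have "norm (inv_fourier (\<psi> b) z) \<le> C b * (1 / (1 + norm z) ^ N)" using C(2)[of b z] by simp
          also have "\<dots> \<le> C b * (2 ^ N / (1 + norm x) ^ N)" using C(1)[of b] by (intro mult_left_mono *) auto
          finally show "norm ((v \<bullet> b) *\<^sub>R inv_fourier (\<psi> b) z) \<le> norm v * (C b * (2 ^ N / (1 + norm x) ^ N))"
            using Basis_le_norm[OF b, of v] by (simp only: norm_scaleR) (intro mult_mono, auto)
        qed
        also have "\<dots> = 2 ^ N * ?S / (1 + norm x) ^ N * norm v"
          by (simp add: sum_distrib_left sum_distrib_right sum_divide_distrib mult_ac)
        finally show "norm (\<Sum>b\<in>Basis. (v \<bullet> b) *\<^sub>R inv_fourier (\<psi> b) z) \<le> 2 ^ N * ?S / (1 + norm x) ^ N * norm v" .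
      qed
    qed auto
    then show ?thesis by simp
  qed
  then show ?thesis using S by (intro exI[of _ "2 ^ N * ?S"]) auto
qed


lemma cis_diff: "cis (s - t) = cis s * cis (- t)"
  by (simp add: cis_mult)

lemma inv_fourier_continuous: "test_fun f \<Longrightarrow> continuous_on S (inv_fourier f)"
  by (meson inv_fourier_has_derivative continuous_at_imp_continuous_on has_derivative_continuous)

lemma inv_fourier_borel: "test_fun f \<Longrightarrow> inv_fourier f \<in> borel_measurable borel"
  by (intro borel_measurable_continuous_onI inv_fourier_continuous)

lemma integrable_pair_bound:
  fixes H :: "'a::euclidean_space \<Rightarrow> 'b::euclidean_space \<Rightarrow> complex" and u :: "'a \<Rightarrow> complex" and v :: "'b \<Rightarrow> complex"
  assumes [measurable]: "(\<lambda>(x, y). H x y) \<in> borel_measurable (lborel \<Otimes>\<^sub>M lborel)"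
    and u: "integrable lborel u" and v: "integrable lborel v"
    and le: "\<And>x y. norm (H x y) \<le> norm (u x) * norm (v y)"
  shows "integrable (lborel \<Otimes>\<^sub>M lborel) (\<lambda>(x, y). H x y)"
proof (rule integrableI_bounded)
  note [measurable] = borel_measurable_integrable[OF u] borel_measurable_integrable[OF v]
  have "(\<integral>\<^sup>+z. ennreal (norm (case z of (x, y) \<Rightarrow> H x y)) \<partial>(lborel \<Otimes>\<^sub>M lborel))
      = (\<integral>\<^sup>+x. \<integral>\<^sup>+y. ennreal (norm (H x y)) \<partial>lborel \<partial>lborel)"
    by (subst lborel.nn_integral_fst[symmetric]) auto
  also have "\<dots> \<le> (\<integral>\<^sup>+x. \<integral>\<^sup>+y. ennreal (norm (u x)) * ennreal (norm (v y)) \<partial>lborel \<partial>lborel)"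
    using le by (intro nn_integral_mono) (auto simp: ennreal_leI simp flip: ennreal_mult)
  also have "\<dots> = (\<integral>\<^sup>+x. ennreal (norm (u x)) \<partial>lborel) * (\<integral>\<^sup>+y. ennreal (norm (v y)) \<partial>lborel)"
    by (simp add: nn_integral_cmult nn_integral_multc)
  also have "\<dots> < top"
    using u v by (simp add: integrable_iff_bounded ennreal_mult_less_top)
  finally show "(\<integral>\<^sup>+z. ennreal (norm (case z of (x, y) \<Rightarrow> H x y)) \<partial>(lborel \<Otimes>\<^sub>M lborel)) < \<infinity>" by simp
qed simp

section \<open>The Gaussian and Fourier inversion\<close>

lemma gaussian_fourier_real:
  fixes t :: real
  shows "integrable lborel (\<lambda>x::real. of_real (exp (- x\<^sup>2 / 2)) * cis (x * t))" (is ?I)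
    and "(LINT x|lborel. of_real (exp (- x\<^sup>2 / 2)) * cis (x * t)) = of_real (sqrt (2 * pi) * exp (- t\<^sup>2 / 2))"
proof -
  let ?g = "\<lambda>x::real. complex_of_real (exp (- x\<^sup>2 / 2)) * cis (x * t)"
  have eq: "std_normal_density x *\<^sub>R iexp (t * x) = of_real (1 / sqrt (2 * pi)) * ?g x" for x
    by (simp add: normal_density_def scaleR_conv_of_real cis_conv_exp mult_ac)
  have n: "integrable lborel std_normal_density" by (rule integrable_normal_density) simp
  have "integrable lborel (\<lambda>x. std_normal_density x *\<^sub>R iexp (t * x))"
    by (rule Bochner_Integration.integrable_bound[OF n]) auto
  then have "integrable lborel (\<lambda>x. of_real (1 / sqrt (2 * pi)) * ?g x)" by (simp only: eq)
  then have "integrable lborel (\<lambda>x. of_real (sqrt (2 * pi)) * (of_real (1 / sqrt (2 * pi)) * ?g x))"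
    by (rule integrable_mult_right)
  also have "(\<lambda>x. of_real (sqrt (2 * pi)) * (of_real (1 / sqrt (2 * pi)) * ?g x)) = ?g"
  proof -
    have "complex_of_real (sqrt (2 * pi)) * of_real (1 / sqrt (2 * pi)) = 1" by (simp flip: of_real_mult)
    then show ?thesis by (simp only: mult.assoc[symmetric] mult_1_left)
  qed
  finally show ?I .
  \<comment> \<open>The transform is the characteristic function of the standard normal
    distribution, up to the normalisation of the density.\<close>
  have "of_real (exp (- t\<^sup>2 / 2)) = char std_normal_distribution t"
    by (simp add: char_std_normal_distribution)
  also have "\<dots> = (LINT x|lborel. std_normal_density x *\<^sub>R iexp (t * x))"
    unfolding char_def by (subst integral_density) auto
  also have "\<dots> = of_real (1 / sqrt (2 * pi)) * (LINT x|lborel. ?g x)"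
    by (simp only: eq Bochner_Integration.integral_mult_right_zero)
  finally have "of_real (sqrt (2 * pi)) * of_real (exp (- t\<^sup>2 / 2)) = (of_real (sqrt (2 * pi)) * of_real (1 / sqrt (2 * pi))) * (LINT x|lborel. ?g x)"
    by (simp add: mult.assoc)
  also have "(of_real (sqrt (2 * pi)) * of_real (1 / sqrt (2 * pi)) :: complex) = 1"
    by (simp flip: of_real_mult)
  finally show "(LINT x|lborel. ?g x) = of_real (sqrt (2 * pi) * exp (- t\<^sup>2 / 2))" by simp
qed

definition gauss :: "'a::euclidean_space \<Rightarrow> complex" where
  "gauss z = of_real (exp (- (norm z)\<^sup>2 / 2))"

lemma gauss_borel [measurable]: "gauss \<in> borel_measurable borel"
  unfolding gauss_def by measurable

lemma gauss_fourier:
  fixes w :: "'a::euclidean_space"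
  shows "integrable lborel (\<lambda>z. gauss z * cis (z \<bullet> w))"
    and "(LINT z|lborel. gauss z * cis (z \<bullet> w)) = of_real (sqrt (2 * pi) ^ DIM('a)) * gauss w"
proof -
  interpret product_sigma_finite "\<lambda>_::'a. lborel :: real measure" ..
  let ?G = "\<lambda>b x. complex_of_real (exp (- x\<^sup>2 / 2)) * cis (x * (w \<bullet> b))"
  have eq: "gauss z * cis (z \<bullet> w) = (\<Prod>b\<in>Basis. ?G b (z \<bullet> b))" for z
  proof -
    have "(norm z)\<^sup>2 = (\<Sum>b\<in>Basis. (z \<bullet> b)\<^sup>2)"
      unfolding power2_norm_eq_inner by (subst euclidean_inner) (simp add: power2_eq_square)
    then have "exp (- (norm z)\<^sup>2 / 2) = (\<Prod>b\<in>Basis. exp (- (z \<bullet> b)\<^sup>2 / 2))"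
      by (simp add: exp_sum[symmetric] sum_negf sum_divide_distrib)
    moreover have "cis (z \<bullet> w) = (\<Prod>b\<in>Basis. cis ((z \<bullet> b) * (w \<bullet> b)))"
      unfolding cis_conv_exp euclidean_inner[of z w]
      by (simp add: exp_sum[symmetric] sum_distrib_left)
    ultimately show ?thesis by (simp add: gauss_def prod.distrib)
  qed
  have comp: "(\<Sum>b\<in>Basis. f b *\<^sub>R b) \<bullet> c = f c" if "c \<in> Basis" for f :: "'a \<Rightarrow> real" and c
    using that by simp
  have eq': "(\<Prod>b\<in>Basis. ?G b ((\<Sum>b\<in>Basis. f b *\<^sub>R b) \<bullet> b)) = (\<Prod>b\<in>Basis. ?G b (f b))" for f :: "'a \<Rightarrow> real"
    by (intro prod.cong refl) (simp add: comp)
  let ?PM = "\<Pi>\<^sub>M b\<in>(Basis::'a set). (lborel :: real measure)"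
  have m: "(\<lambda>f. \<Sum>b\<in>Basis. f b *\<^sub>R b) \<in> ?PM \<rightarrow>\<^sub>M (borel :: 'a measure)" by measurable
  have mg: "(\<lambda>z. \<Prod>b\<in>Basis. ?G b (z \<bullet> b)) \<in> borel_measurable borel" by measurable
  have i: "integrable ?PM (\<lambda>f. \<Prod>b\<in>Basis. ?G b (f b))"
    by (rule product_integrable_prod) (simp, rule gaussian_fourier_real(1))
  show "integrable lborel (\<lambda>z. gauss z * cis (z \<bullet> w))"
    unfolding eq by (subst lborel_eq, subst integrable_distr_eq[OF m mg]) (simp only: eq' i)
  have "(LINT z|lborel. gauss z * cis (z \<bullet> w)) = (LINT f|?PM. (\<Prod>b\<in>Basis. ?G b (f b)))"
    unfolding eq by (subst lborel_eq, subst integral_distr[OF m mg]) (simp only: eq')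
  also have "\<dots> = (\<Prod>b\<in>Basis. (LINT x|lborel. ?G b x))"
    by (rule product_integral_prod) (simp, rule gaussian_fourier_real(1))
  also have "\<dots> = (\<Prod>b\<in>(Basis::'a set). of_real (sqrt (2 * pi) * exp (- (w \<bullet> b)\<^sup>2 / 2)))"
    by (simp only: gaussian_fourier_real(2))
  also have "\<dots> = of_real (sqrt (2 * pi) ^ DIM('a)) * gauss w"
  proof -
    have "(norm w)\<^sup>2 = (\<Sum>b\<in>Basis. (w \<bullet> b)\<^sup>2)"
      unfolding power2_norm_eq_inner by (subst euclidean_inner) (simp add: power2_eq_square)
    then have "exp (- (norm w)\<^sup>2 / 2) = (\<Prod>b\<in>Basis. exp (- (w \<bullet> b)\<^sup>2 / 2))"
      by (simp add: exp_sum[symmetric] sum_negf sum_divide_distrib)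
    then show ?thesis by (simp add: gauss_def prod.distrib)
  qed
  finally show "(LINT z|lborel. gauss z * cis (z \<bullet> w)) = of_real (sqrt (2 * pi) ^ DIM('a)) * gauss w" .
qed

lemma gauss_integral:
  "integrable lborel (gauss :: 'a::euclidean_space \<Rightarrow> complex)"
  "(LINT z|lborel. gauss (z::'a)) = of_real (sqrt (2 * pi) ^ DIM('a))"
  using gauss_fourier[of "0::'a"] by (simp_all add: gauss_def[of 0])

text \<open>The double integral for \<open>fourier (inv_fourier f)\<close> does not converge
  absolutely. A wide Gaussian factor \<open>gauss (e n *\<^sub>R y)\<close> repairs this, and after
  Fubini it reappears as an approximate identity concentrating at \<zeta>.\<close>

theorem fourier_inv_fourier:
  fixes f :: "'a::euclidean_space \<Rightarrow> complex"
  assumes f: "test_fun f"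
  shows "fourier (inv_fourier f) \<zeta> = f \<zeta>"
proof -
  note fb[measurable] = test_fun_borel[OF f]
  have cf: "continuous_on UNIV f" by (intro smooth_fun_continuous test_fun_smooth f)
  let ?K = "inv_fourier f"
  let ?c = "(2 * pi) ^ DIM('a)"
  let ?s = "sqrt (2 * pi) ^ DIM('a)"
  \<comment> \<open>One factor \<open>?s\<close> is the mass of the Gaussian, the other comes from
    its Fourier transform; together they cancel the constant of the inverse transform.\<close>
  have "?s * ?s = (sqrt (2 * pi) * sqrt (2 * pi)) ^ DIM('a)" by (rule power_mult_distrib[symmetric])
  then have sc: "?s * ?s = ?c" by simp
  have s0: "?s \<noteq> 0" "?c \<noteq> 0" by auto
  note [measurable] = inv_fourier_borel[OF f]
  have K: "integrable lborel ?K" by (rule rapid_integrable[OF inv_fourier_rapid[OF f]]) simp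
  define e where "e n = 1 / real (Suc n)" for n
  have e: "e n > 0" "e n \<le> 1" for n by (auto simp: e_def)
  have e0: "e \<longlonglongrightarrow> 0" unfolding e_def using LIMSEQ_inverse_real_of_nat by (simp add: inverse_eq_divide)
  define I where "I n = (LINT y|lborel. ?K y * cis (- (y \<bullet> \<zeta>)) * gauss (e n *\<^sub>R y))" for n
  have "I \<longlonglongrightarrow> (LINT y|lborel. ?K y * cis (- (y \<bullet> \<zeta>)))"
    unfolding I_def
  proof (rule integral_dominated_convergence[where w="\<lambda>y. norm (?K y)"])
    show "integrable lborel (\<lambda>y. norm (?K y))" using K by (rule integrable_norm)
    show "AE y in lborel. (\<lambda>n. ?K y * cis (- (y \<bullet> \<zeta>)) * gauss (e n *\<^sub>R y)) \<longlonglongrightarrow> ?K y * cis (- (y \<bullet> \<zeta>))"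
    proof (rule AE_I2)
      fix y :: 'a
      have "(\<lambda>n. gauss (e n *\<^sub>R y)) \<longlonglongrightarrow> of_real (exp (- (norm (0 *\<^sub>R y))\<^sup>2 / 2))"
        unfolding gauss_def by (intro tendsto_intros e0) auto
      then have "(\<lambda>n. ?K y * cis (- (y \<bullet> \<zeta>)) * gauss (e n *\<^sub>R y)) \<longlonglongrightarrow> ?K y * cis (- (y \<bullet> \<zeta>)) * 1"
        by (intro tendsto_mult tendsto_const) simp
      then show "(\<lambda>n. ?K y * cis (- (y \<bullet> \<zeta>)) * gauss (e n *\<^sub>R y)) \<longlonglongrightarrow> ?K y * cis (- (y \<bullet> \<zeta>))" by simp
    qed
    show "AE y in lborel. norm (?K y * cis (- (y \<bullet> \<zeta>)) * gauss (e n *\<^sub>R y)) \<le> norm (?K y)" for n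
      by (intro AE_I2) (simp add: norm_mult gauss_def mult_left_le)
  qed measurable
  then have lim1: "I \<longlonglongrightarrow> fourier ?K \<zeta>" by (simp add: fourier_lborel)
  have I: "I n = (LINT z|lborel. f (\<zeta> + e n *\<^sub>R z) * gauss z) / of_real ?s" for n
  proof -
    let ?H = "\<lambda>y \<xi>. f \<xi> * cis (y \<bullet> (\<xi> - \<zeta>)) * gauss (e n *\<^sub>R y)"
    have ig: "integrable lborel (\<lambda>y::'a. gauss (e n *\<^sub>R y))"
      using integral_lborel_affine(2)[of "e n" "gauss :: 'a \<Rightarrow> complex" 0] gauss_integral(1) e[of n] by simp
    have int: "integrable (lborel \<Otimes>\<^sub>M lborel) (\<lambda>(y, \<xi>). ?H y \<xi>)"
      by (rule integrable_pair_bound[OF _ ig test_fun_integrable[OF f]]) (auto simp: norm_mult)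
    have "I n = (LINT y|lborel. LINT \<xi>|lborel. ?H y \<xi>) / of_real ?c"
    proof -
      have "?K y * cis (- (y \<bullet> \<zeta>)) * gauss (e n *\<^sub>R y) = (LINT \<xi>|lborel. ?H y \<xi>) / of_real ?c" for y
      proof -
        have "(LINT \<xi>|lborel. ?H y \<xi>) = (LINT \<xi>|lborel. (f \<xi> * cis (y \<bullet> \<xi>)) * (cis (- (y \<bullet> \<zeta>)) * gauss (e n *\<^sub>R y)))"
          by (intro Bochner_Integration.integral_cong refl) (simp add: inner_diff_right cis_diff mult_ac)
        also have "\<dots> = (LINT \<xi>|lborel. f \<xi> * cis (y \<bullet> \<xi>)) * (cis (- (y \<bullet> \<zeta>)) * gauss (e n *\<^sub>R y))"
          by (rule Bochner_Integration.integral_mult_left_zero)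
        finally have hh: "(LINT \<xi>|lborel. ?H y \<xi>) = \<dots>" .
        show ?thesis unfolding inv_fourier_lborel[OF fb] hh by (simp only: times_divide_eq_left mult.assoc)
      qed
      then show ?thesis unfolding I_def by simp
    qed
    also have "(LINT y|lborel. LINT \<xi>|lborel. ?H y \<xi>) = (LINT \<xi>|lborel. LINT y|lborel. ?H y \<xi>)"
      using lborel_pair.Fubini_integral[OF int] by simp
    \<comment> \<open>Rescaling around \<zeta> by \<open>e n\<close> turns the inner integral into
      the Fourier transform of the Gaussian at \<open>z\<close>.\<close>
    also have "\<dots> = e n ^ DIM('a) *\<^sub>R (LINT z|lborel. LINT y|lborel. ?H y (\<zeta> + e n *\<^sub>R z))"
      using e[of n] by (subst integral_lborel_affine(1)[of "e n" _ \<zeta>]) auto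
    also have "(\<lambda>z. LINT y|lborel. ?H y (\<zeta> + e n *\<^sub>R z)) = (\<lambda>z. f (\<zeta> + e n *\<^sub>R z) * (LINT y|lborel. gauss (e n *\<^sub>R y) * cis ((e n *\<^sub>R y) \<bullet> z)))"
    proof
      fix z
      have "(LINT y|lborel. ?H y (\<zeta> + e n *\<^sub>R z)) = (LINT y|lborel. f (\<zeta> + e n *\<^sub>R z) * (gauss (e n *\<^sub>R y) * cis ((e n *\<^sub>R y) \<bullet> z)))"
        by (intro Bochner_Integration.integral_cong refl) (simp add: mult_ac)
      then show "(LINT y|lborel. ?H y (\<zeta> + e n *\<^sub>R z)) = f (\<zeta> + e n *\<^sub>R z) * (LINT y|lborel. gauss (e n *\<^sub>R y) * cis ((e n *\<^sub>R y) \<bullet> z))"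
        by (simp only: Bochner_Integration.integral_mult_right_zero)
    qed
    also have "(LINT z|lborel. f (\<zeta> + e n *\<^sub>R z) * (LINT y|lborel. gauss (e n *\<^sub>R y) * cis ((e n *\<^sub>R y) \<bullet> z)))
      = (LINT z|lborel. (of_real ?s / of_real (e n ^ DIM('a))) * (f (\<zeta> + e n *\<^sub>R z) * gauss z))"
    proof (intro Bochner_Integration.integral_cong refl)
      fix z :: 'a
      have "of_real (?s) * gauss z = (LINT u|lborel. gauss u * cis (u \<bullet> z))" by (simp add: gauss_fourier(2))
      also have "\<dots> = e n ^ DIM('a) *\<^sub>R (LINT y|lborel. gauss (e n *\<^sub>R y) * cis ((e n *\<^sub>R y) \<bullet> z))"
        using e[of n] by (subst integral_lborel_affine(1)[of "e n" _ 0]) auto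
      finally have "(LINT y|lborel. gauss (e n *\<^sub>R y) * cis ((e n *\<^sub>R y) \<bullet> z)) = of_real ?s / of_real (e n ^ DIM('a)) * gauss z"
        using e[of n] by (simp add: scaleR_conv_of_real field_simps)
      then show "f (\<zeta> + e n *\<^sub>R z) * (LINT y|lborel. gauss (e n *\<^sub>R y) * cis ((e n *\<^sub>R y) \<bullet> z))
          = (of_real ?s / of_real (e n ^ DIM('a))) * (f (\<zeta> + e n *\<^sub>R z) * gauss z)" by (simp only: mult_ac)
    qed
    also have "\<dots> = (of_real ?s / of_real (e n ^ DIM('a))) * (LINT z|lborel. f (\<zeta> + e n *\<^sub>R z) * gauss z)"
      by (rule Bochner_Integration.integral_mult_right_zero)
    also have "(e n ^ DIM('a) *\<^sub>R ((of_real ?s / of_real (e n ^ DIM('a))) * (LINT z|lborel. f (\<zeta> + e n *\<^sub>R z) * gauss z))) / of_real ?c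
       = (of_real ?s * (LINT z|lborel. f (\<zeta> + e n *\<^sub>R z) * gauss z)) / (of_real ?s * of_real ?s)"
      using e[of n] by (simp only: sc[symmetric] of_real_mult scaleR_conv_of_real) simp
    finally show ?thesis using s0 by simp
  qed
  obtain B where B: "B \<ge> 0" "\<And>x. norm (f x) \<le> B" using test_fun_bounded[OF f] by blast
  have "(\<lambda>n. LINT z|lborel. f (\<zeta> + e n *\<^sub>R z) * gauss z) \<longlonglongrightarrow> (LINT z|lborel. f \<zeta> * gauss (z::'a))"
  proof (rule integral_dominated_convergence[where w="\<lambda>z::'a. B * norm (gauss z)"])
    show "integrable lborel (\<lambda>z::'a. B * norm (gauss z))" by (intro integrable_mult_right integrable_norm gauss_integral)
    show "AE z in lborel. (\<lambda>n. f (\<zeta> + e n *\<^sub>R z) * gauss z) \<longlonglongrightarrow> f \<zeta> * gauss z"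
    proof (rule AE_I2)
      fix z :: 'a
      have "(\<lambda>n. \<zeta> + e n *\<^sub>R z) \<longlonglongrightarrow> \<zeta> + 0 *\<^sub>R z" by (intro tendsto_intros e0)
      then have "(\<lambda>n. f (\<zeta> + e n *\<^sub>R z)) \<longlonglongrightarrow> f \<zeta>"
        using continuous_on_tendsto_compose[OF cf, of "\<lambda>n. \<zeta> + e n *\<^sub>R z" \<zeta> sequentially] by simp
      then show "(\<lambda>n. f (\<zeta> + e n *\<^sub>R z) * gauss z) \<longlonglongrightarrow> f \<zeta> * gauss z" by (intro tendsto_intros)
    qed
  qed (auto simp: norm_mult intro!: mult_right_mono B)
  then have "(\<lambda>n. (LINT z|lborel. f (\<zeta> + e n *\<^sub>R z) * gauss z) / of_real ?s) \<longlonglongrightarrow> (LINT z|lborel. f \<zeta> * gauss (z::'a)) / of_real ?s"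
    by (intro tendsto_divide tendsto_const) (use s0 in auto)
  moreover have "(LINT z|lborel. f \<zeta> * gauss (z::'a)) / of_real ?s = f \<zeta>"
    using gauss_integral(2)[where 'a='a] s0 by simp
  moreover have "I = (\<lambda>n. (LINT z|lborel. f (\<zeta> + e n *\<^sub>R z) * gauss z) / of_real ?s)"
    by (rule ext, rule I)
  ultimately have "I \<longlonglongrightarrow> f \<zeta>" by (simp only:)
  with lim1 show ?thesis by (rule LIMSEQ_unique)
qed

text \<open>Only the transform of \<open>b\<close> is written out as an integral. The integral over
  \<open>y\<close> is then the Fourier transform of \<open>inv_fourier a\<close>, which inversion
  turns back into \<open>a\<close>.\<close>

lemma inv_fourier_convolution:
  fixes a b :: "'a::euclidean_space \<Rightarrow> complex"
  assumes a: "test_fun a" and b: "test_fun b"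
  shows "(LINT y|lborel. inv_fourier a (x - y) * inv_fourier b y) = inv_fourier (\<lambda>\<xi>. a \<xi> * b \<xi>) x"
proof -
  note [measurable] = test_fun_borel[OF a] test_fun_borel[OF b] inv_fourier_borel[OF a]
  let ?A = "inv_fourier a"
  let ?c = "(2 * pi) ^ DIM('a)"
  have A: "integrable lborel ?A" by (rule rapid_integrable[OF inv_fourier_rapid[OF a]]) simp
  then have A': "integrable lborel (\<lambda>y. ?A (x - y))"
    using integral_lborel_affine(2)[of "-1" ?A x] by simp
  let ?H = "\<lambda>y \<xi>. ?A (x - y) * (b \<xi> * cis (y \<bullet> \<xi>))"
  have int: "integrable (lborel \<Otimes>\<^sub>M lborel) (\<lambda>(y, \<xi>). ?H y \<xi>)"
    by (rule integrable_pair_bound[OF _ A' test_fun_integrable[OF b]]) (auto simp: norm_mult)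
  have "(LINT y|lborel. ?A (x - y) * inv_fourier b y) = (LINT y|lborel. (LINT \<xi>|lborel. ?H y \<xi>)) / of_real ?c"
    by (simp add: inv_fourier_lborel[of b])
  also have "(LINT y|lborel. (LINT \<xi>|lborel. ?H y \<xi>)) = (LINT \<xi>|lborel. (LINT y|lborel. ?H y \<xi>))"
    using lborel_pair.Fubini_integral[OF int] by simp
  also have "\<dots> = (LINT \<xi>|lborel. a \<xi> * b \<xi> * cis (x \<bullet> \<xi>))"
  proof (intro Bochner_Integration.integral_cong refl)
    fix \<xi> :: 'a
    have "(LINT y|lborel. ?H y \<xi>) = (LINT z|lborel. ?A z * (b \<xi> * cis ((x - z) \<bullet> \<xi>)))"
      by (subst integral_lborel_affine(1)[of "-1" _ x]) auto
    also have "\<dots> = (LINT z|lborel. (b \<xi> * cis (x \<bullet> \<xi>)) * (?A z * cis (- (z \<bullet> \<xi>))))"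
      by (intro Bochner_Integration.integral_cong refl)
         (simp add: inner_diff_left cis_diff mult_ac)
    also have "\<dots> = (b \<xi> * cis (x \<bullet> \<xi>)) * fourier ?A \<xi>"
      by (simp only: Bochner_Integration.integral_mult_right_zero fourier_lborel[OF inv_fourier_borel[OF a]])
    finally show "(LINT y|lborel. ?H y \<xi>) = a \<xi> * b \<xi> * cis (x \<bullet> \<xi>)"
      by (simp add: fourier_inv_fourier[OF a])
  qed
  finally show ?thesis by (simp add: inv_fourier_lborel)
qed


section \<open>Littlewood--Paley kernels\<close>

definition dilate :: "nat \<Rightarrow> ('a::euclidean_space \<Rightarrow> complex) \<Rightarrow> 'a \<Rightarrow> complex" where
  "dilate J f x = of_real (2 ^ (J * DIM('a))) * f (2 ^ J *\<^sub>R x)"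

lemma inv_fourier_scale:
  fixes f :: "'a::euclidean_space \<Rightarrow> complex"
  assumes [measurable]: "f \<in> borel_measurable borel"
  shows "inv_fourier (\<lambda>\<xi>. f (\<xi> /\<^sub>R 2 ^ J)) = dilate J (inv_fourier f)"
proof
  fix x
  have "(LINT \<xi>|lborel. f (\<xi> /\<^sub>R 2 ^ J) * cis (x \<bullet> \<xi>)) = 2 ^ (J * DIM('a)) *\<^sub>R (LINT \<xi>|lborel. f \<xi> * cis ((2 ^ J *\<^sub>R x) \<bullet> \<xi>))"
    by (subst integral_lborel_affine(1)[of "2 ^ J" _ 0]) (auto simp: power_mult)
  then show "inv_fourier (\<lambda>\<xi>. f (\<xi> /\<^sub>R 2 ^ J)) x = dilate J (inv_fourier f) x"
    by (simp add: inv_fourier_lborel dilate_def scaleR_conv_of_real)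
qed

lemma dilate_borel [measurable]:
  assumes [measurable]: "f \<in> borel_measurable borel"
  shows "dilate J f \<in> borel_measurable borel"
  unfolding dilate_def[abs_def] by measurable

lemma dilate_rapid:
  fixes f :: "'a::euclidean_space \<Rightarrow> complex"
  assumes "rapid f" shows "rapid (dilate J f)"
proof (rule rapidI)
  fix N :: nat
  obtain C where C: "C > 0" "\<And>x. norm (f x) \<le> C / (1 + norm x) ^ N" using rapid_ex[OF assms, of N] by blast
  have "norm (dilate J f x) \<le> 2 ^ (J * DIM('a)) * C / (1 + norm x) ^ N" for x :: 'a
  proof -
    have "norm (f (2 ^ J *\<^sub>R x)) \<le> C / (1 + norm (2 ^ J *\<^sub>R x)) ^ N" by (rule C)
    also have "\<dots> \<le> C / (1 + norm x) ^ N"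
    proof (intro divide_left_mono power_mono)
      show "1 + norm x \<le> 1 + norm (2 ^ J *\<^sub>R x)" using mult_right_mono[of 1 "2 ^ J" "norm x"] by simp
      show "0 < (1 + norm (2 ^ J *\<^sub>R x)) ^ N * (1 + norm x) ^ N" by (intro mult_pos_pos zero_less_power add_pos_nonneg) auto
    qed (use C in auto)
    finally have "2 ^ (J * DIM('a)) * norm (f (2 ^ J *\<^sub>R x)) \<le> 2 ^ (J * DIM('a)) * (C / (1 + norm x) ^ N)"
      by (rule mult_left_mono) simp
    then show ?thesis by (simp add: dilate_def norm_mult norm_power)
  qed
  then show "\<exists>C. \<forall>x. norm (dilate J f x) \<le> C / (1 + norm x) ^ N" by blast
qed

section \<open>The dyadic partition of unity and the kernels of its blocks and partial sums\<close>

locale dyadic_setting =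
  fixes chi rho :: "'a::euclidean_space \<Rightarrow> complex"
  assumes dp: "dyadic_partition chi rho"
begin

lemma smooth_chi: "smooth_fun chi" and smooth_rho: "smooth_fun rho"
  using dp by (auto simp: dyadic_partition_def)

lemma chi_eq_0: assumes "4 / 3 \<le> norm x" shows "chi x = 0"
proof (rule ccontr)
  assume "chi x \<noteq> 0"
  then have "x \<in> closure {x. chi x \<noteq> 0}" by (intro subsetD[OF closure_subset]) simp
  moreover have "closure {x. chi x \<noteq> 0} \<subseteq> {x. norm x < 4 / 3}" using dp by (simp add: dyadic_partition_def)
  ultimately show False using assms by auto
qed

lemma rho_nz: assumes "rho x \<noteq> 0" shows "3 / 4 < norm x \<and> norm x < 8 / 3"
proof -
  have "x \<in> closure {x. rho x \<noteq> 0}" using assms by (intro subsetD[OF closure_subset]) simp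
  moreover have "closure {x. rho x \<noteq> 0} \<subseteq> {x. 3 / 4 < norm x \<and> norm x < 8 / 3}"
    using dp by (simp add: dyadic_partition_def)
  ultimately show ?thesis by blast
qed

lemma chi_test: "test_fun chi"
  unfolding test_fun_def using smooth_chi chi_eq_0 by (auto intro!: exI[of _ "4/3"])

lemma rho_scale_summable: "summable (\<lambda>j. rho (x /\<^sub>R 2 ^ j))"
proof -
  obtain n where n: "norm x * 4 / 3 < 2 ^ n" using real_arch_pow[of 2 "norm x * 4 / 3"] by auto
  have "rho (x /\<^sub>R 2 ^ j) = 0" if "j \<ge> n" for j
  proof (rule ccontr)
    assume "rho (x /\<^sub>R 2 ^ j) \<noteq> 0"
    then have "3 / 4 < norm x / 2 ^ j" using rho_nz[of "x /\<^sub>R 2 ^ j"] by (simp add: field_simps)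
    then have "2 ^ j < norm x * 4 / 3" by (simp add: field_simps)
    moreover have "(2::real) ^ n \<le> 2 ^ j" using that by (intro power_increasing) auto
    ultimately show False using n by linarith
  qed
  then show ?thesis by (intro summable_finite[of "{..<n}"]) (auto simp: not_less)
qed

lemma partition_sum: "chi x + (\<Sum>j. rho (x /\<^sub>R 2 ^ j)) = 1"
  using dp by (auto simp: dyadic_partition_def)

text \<open>None of the annuli carrying the dilates of \<open>rho\<close> meets this ball, so
  \<open>chi\<close> alone has to sum to 1.\<close>

lemma chi_eq_1: assumes "norm x \<le> 3 / 4" shows "chi x = 1"
proof -
  have "rho (x /\<^sub>R 2 ^ j) = 0" for j
  proof (rule ccontr)
    assume "rho (x /\<^sub>R 2 ^ j) \<noteq> 0"
    then have "3 / 4 < norm x / 2 ^ j" using rho_nz[of "x /\<^sub>R 2 ^ j"] by (simp add: field_simps)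
    also have "\<dots> \<le> norm x / 1" by (intro divide_left_mono) auto
    finally show False using assms by simp
  qed
  then show ?thesis using partition_sum[of x] by simp
qed

text \<open>The partition series at \<open>x / 2\<close> is the series at \<open>x\<close> without
  its first term; subtracting the two identities leaves this. It makes the sums of blocks
  telescope.\<close>

lemma rho_eq: "rho x = chi (x /\<^sub>R 2) - chi x"
proof -
  have "(\<Sum>j. rho (x /\<^sub>R 2 ^ j)) = rho x + (\<Sum>j. rho ((x /\<^sub>R 2) /\<^sub>R 2 ^ j))"
    using suminf_split_head[OF rho_scale_summable[of x]] by (simp add: mult.commute)
  then have "chi x + rho x + (\<Sum>j. rho ((x /\<^sub>R 2) /\<^sub>R 2 ^ j)) = chi (x /\<^sub>R 2) + (\<Sum>j. rho ((x /\<^sub>R 2) /\<^sub>R 2 ^ j))"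
    using partition_sum[of x] partition_sum[of "x /\<^sub>R 2"] by (simp only: add.assoc)
  then have "chi x + rho x = chi (x /\<^sub>R 2)" by (rule add_right_imp_eq)
  then show ?thesis by (metis add_diff_cancel_left')
qed

text \<open>The kernel of the sum of the blocks 0 to \<open>J\<close>, see \<open>B_sum\<close>. All
  \<open>P J\<close> are dilates of one function, whereas the block kernels have an exceptional
  member at index 0.\<close>

definition P :: "nat \<Rightarrow> 'a \<Rightarrow> complex" where
  "P J = dilate J (inv_fourier chi)"

text \<open>The block with index \<open>j \<ge> -1\<close> of the statement has index \<open>J = j + 1\<close> here.\<close>

definition kap :: "nat \<Rightarrow> 'a \<Rightarrow> complex" where
  "kap J = inv_fourier (dyadic chi rho (int J - 1))"

lemma dyadic_0: "dyadic chi rho (int 0 - 1) = chi"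
  by (simp add: dyadic_def)

lemma dyadic_Suc: "dyadic chi rho (int (Suc J) - 1) = (\<lambda>\<xi>. rho (\<xi> /\<^sub>R 2 ^ J))"
proof -
  have "(2::real) powr (- real_of_int (int (Suc J) - 1)) = inverse (2 ^ J)"
    by (simp add: powr_minus powr_realpow)
  moreover have "int (Suc J) - 1 \<noteq> -1" by simp
  ultimately show ?thesis unfolding dyadic_def by (simp only: if_False)
qed

lemma test_scale: "test_fun f \<Longrightarrow> test_fun (\<lambda>\<xi>. f (\<xi> /\<^sub>R 2 ^ J))"
proof -
  assume f: "test_fun f"
  then obtain R where R: "\<And>x. R < norm x \<Longrightarrow> f x = 0" by (auto simp: test_fun_def)
  have "f (\<xi> /\<^sub>R 2 ^ J) = 0" if "2 ^ J * R < norm \<xi>" for \<xi>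
    using that by (intro R) (simp add: field_simps)
  moreover have "smooth_fun (\<lambda>\<xi>. f (\<xi> /\<^sub>R 2 ^ J))"
    using smooth_fun_affine[OF test_fun_smooth[OF f], of 0 "inverse (2 ^ J)"] by simp
  ultimately show ?thesis by (auto simp: test_fun_def)
qed

lemma dyadic_test: "test_fun (dyadic chi rho (int J - 1))"
proof (cases J)
  case 0
  then show ?thesis using chi_test dyadic_0 by simp
next
  case (Suc i)
  have "rho x = 0" if "8 / 3 < norm x" for x using rho_nz[of x] that by (cases "rho x = 0") auto
  then have "test_fun rho" unfolding test_fun_def using smooth_rho by blast
  from test_scale[OF this] show ?thesis using Suc dyadic_Suc by simp
qed

lemma dyadic_Suc_diff:
  "dyadic chi rho (int (Suc J) - 1) = (\<lambda>\<xi>. chi (\<xi> /\<^sub>R 2 ^ Suc J) - chi (\<xi> /\<^sub>R 2 ^ J))"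
proof
  fix \<xi> :: 'a
  have "\<xi> /\<^sub>R 2 ^ J /\<^sub>R 2 = \<xi> /\<^sub>R 2 ^ Suc J" by simp
  then show "dyadic chi rho (int (Suc J) - 1) \<xi> = chi (\<xi> /\<^sub>R 2 ^ Suc J) - chi (\<xi> /\<^sub>R 2 ^ J)"
    using rho_eq[of "\<xi> /\<^sub>R 2 ^ J"] by (simp only: dyadic_Suc)
qed

lemma P_eq: "P J = inv_fourier (\<lambda>\<xi>. chi (\<xi> /\<^sub>R 2 ^ J))"
  unfolding P_def by (rule inv_fourier_scale[symmetric]) (rule test_fun_borel[OF chi_test])

lemma kap_0: "kap 0 = P 0"
  unfolding kap_def P_eq dyadic_0 by simp

lemma kap_Suc: "kap (Suc J) x = P (Suc J) x - P J x"
proof -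
  have i: "integrable lborel (\<lambda>\<xi>. chi (\<xi> /\<^sub>R 2 ^ J) * cis (x \<bullet> \<xi>))" for J
  proof -
    note [measurable] = test_fun_borel[OF test_scale[OF chi_test, of J]]
    show ?thesis
      by (rule Bochner_Integration.integrable_bound[OF test_fun_integrable[OF test_scale[OF chi_test, of J]]])
         (auto simp: norm_mult)
  qed
  note [measurable] = test_fun_borel[OF test_scale[OF chi_test]] test_fun_borel[OF chi_test]
  show ?thesis
    unfolding kap_def P_eq dyadic_Suc_diff
    by (simp add: inv_fourier_lborel left_diff_distrib Bochner_Integration.integral_diff[OF i i] diff_divide_distrib
        del: power_Suc)
qed

lemma P_borel [measurable]: "P J \<in> borel_measurable borel"
  unfolding P_def by (intro dilate_borel inv_fourier_borel chi_test)

lemma kap_borel [measurable]: "kap J \<in> borel_measurable borel"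
  unfolding kap_def by (intro inv_fourier_borel dyadic_test)

lemma P_rapid: "rapid (P J)"
  unfolding P_def by (intro dilate_rapid inv_fourier_rapid chi_test)

lemma kap_rapid: "rapid (kap J)"
  unfolding kap_def by (intro inv_fourier_rapid dyadic_test)

text \<open>The integral is the symbol at frequency 0, by Fourier inversion.\<close>

lemma P_integral: "(LINT x|lborel. P J x) = 1"
proof -
  have "fourier (inv_fourier (\<lambda>\<xi>. chi (\<xi> /\<^sub>R 2 ^ J))) 0 = chi (0 /\<^sub>R 2 ^ J)"
    by (rule fourier_inv_fourier[OF test_scale[OF chi_test]])
  then show ?thesis
    using P_borel[of J] by (simp add: P_eq[symmetric] fourier_lborel chi_eq_1)
qed

text \<open>The symbol of \<open>P (Suc J)\<close> equals 1 on the support of the symbol of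
  \<open>kap J\<close>; for \<open>J = Suc i\<close> the radii compare as 8/3 * 2^i \<le> 3/4 * 2^(i
  + 2). Increments of a block can therefore be put on the kernel \<open>P (Suc J)\<close>.\<close>

lemma P_kap: "(LINT y|lborel. P (Suc J) (x - y) * kap J y) = kap J x"
proof -
  have eq: "chi (\<xi> /\<^sub>R 2 ^ Suc J) * dyadic chi rho (int J - 1) \<xi> = dyadic chi rho (int J - 1) \<xi>" for \<xi>
  proof (cases "dyadic chi rho (int J - 1) \<xi> = 0")
    case False
    have "norm (\<xi> /\<^sub>R 2 ^ Suc J) \<le> 3 / 4"
    proof (cases J)
      case 0
      then have "chi \<xi> \<noteq> 0" using False dyadic_0 by simp
      then have "norm \<xi> < 4 / 3" using chi_eq_0[of \<xi>] by (auto simp: not_le[symmetric])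
      then show ?thesis using 0 by simp
    next
      case (Suc i)
      then have "rho (\<xi> /\<^sub>R 2 ^ i) \<noteq> 0" using False dyadic_Suc[of i] by simp
      then have "norm (\<xi> /\<^sub>R 2 ^ i) < 8 / 3" using rho_nz by blast
      then have "norm \<xi> * 3 < 8 * 2 ^ i" by (simp add: field_simps)
      moreover have "(0::real) < 2 ^ i" by simp
      ultimately have "norm \<xi> \<le> 3 * 2 ^ i" by linarith
      then show ?thesis using Suc by (simp add: field_simps)
    qed
    then show ?thesis using chi_eq_1 by simp
  qed simp
  then show ?thesis
    unfolding P_eq kap_def
    using inv_fourier_convolution[OF test_scale[OF chi_test, of "Suc J"] dyadic_test[of J], of x]
    by (simp only: eq)
qed

end

section \<open>Convolution with rapidly decreasing kernels\<close>

definition conv :: "('a::euclidean_space \<Rightarrow> complex) \<Rightarrow> ('a \<Rightarrow> complex) \<Rightarrow> 'a \<Rightarrow> complex" where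
  "conv k g x = (LINT y|lborel. k (x - y) * g y)"

text \<open>Stands in for slowly increasing functions: it covers every Borel function of finite
  \<open>lnorm\<close> with exponent in [0, 1] (\<open>moderate_lnorm\<close>) and is stable under
  convolution with rapidly decreasing kernels (\<open>moderate_conv\<close>).\<close>

definition moderate :: "('a::euclidean_space \<Rightarrow> complex) \<Rightarrow> bool" where
  "moderate g \<longleftrightarrow> g \<in> borel_measurable borel \<and>
     (\<forall>r::'a \<Rightarrow> complex. rapid r \<longrightarrow> r \<in> borel_measurable borel \<longrightarrow> integrable lborel (\<lambda>x. g x * r x))"

lemma moderate_borel: "moderate g \<Longrightarrow> g \<in> borel_measurable borel"
  by (simp add: moderate_def)

lemma moderate_integrable:
  "moderate g \<Longrightarrow> rapid r \<Longrightarrow> r \<in> borel_measurable borel \<Longrightarrow> integrable lborel (\<lambda>x. g x * r x)"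
  by (simp add: moderate_def)

lemma moderate_diff: "moderate f \<Longrightarrow> moderate g \<Longrightarrow> moderate (\<lambda>x. f x - g x)"
  by (auto simp: moderate_def left_diff_distrib)

lemma conv_borel [measurable]:
  assumes [measurable]: "k \<in> borel_measurable borel" "g \<in> borel_measurable borel"
  shows "conv k g \<in> borel_measurable borel"
  unfolding conv_def[abs_def] by measurable

lemma conv_flip:
  fixes k g :: "'a::euclidean_space \<Rightarrow> complex"
  assumes [measurable]: "k \<in> borel_measurable borel" "g \<in> borel_measurable borel"
  shows "conv k g x = (LINT w|lborel. k w * g (x - w))"
  unfolding conv_def by (subst integral_lborel_affine(1)[of "-1" _ x]) auto

lemma rapid_reflect:
  fixes r :: "'a::euclidean_space \<Rightarrow> 'b::real_normed_vector"
  assumes "rapid r" shows "rapid (\<lambda>y. r (x - y))" "rapid (\<lambda>y. r (y - x))"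
proof -
  have *: "\<exists>C. \<forall>y. norm (r (t *\<^sub>R (x - y))) \<le> C / (1 + norm y) ^ N" if t: "\<bar>t\<bar> = 1" for t :: real and N :: nat
  proof -
    obtain C where C: "C > 0" "\<And>x. norm (r x) \<le> C / (1 + norm x) ^ N" using rapid_ex[OF assms, of N] by blast
    have "norm (r (t *\<^sub>R (x - y))) \<le> C * (1 + norm x) ^ N / (1 + norm y) ^ N" for y
    proof -
      have "1 + norm y \<le> (1 + norm (x - y)) * (1 + norm x)"
        using peetre[of y x] by (simp add: norm_minus_commute)
      then have "(1 + norm y) ^ N \<le> (1 + norm (x - y)) ^ N * (1 + norm x) ^ N"
        unfolding power_mult_distrib[symmetric] by (intro power_mono) auto
      moreover have "(1 + norm y) ^ N > 0" "(1 + norm (x - y)) ^ N > 0" by (auto intro!: zero_less_power add_pos_nonneg)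
      ultimately have "C / (1 + norm (x - y)) ^ N \<le> C * (1 + norm x) ^ N / (1 + norm y) ^ N"
        using C(1) by (simp add: field_simps)
      moreover have "norm (r (t *\<^sub>R (x - y))) \<le> C / (1 + norm (x - y)) ^ N"
        using C(2)[of "t *\<^sub>R (x - y)"] t by simp
      ultimately show ?thesis by linarith
    qed
    then show ?thesis by blast
  qed
  show "rapid (\<lambda>y. r (x - y))" by (rule rapidI) (use *[of 1] in simp)
  show "rapid (\<lambda>y. r (y - x))" by (rule rapidI) (use *[of "-1"] in simp)
qed

lemma conv_integrable:
  assumes g: "moderate g" and k: "rapid k" and [measurable]: "k \<in> borel_measurable borel"
  shows "integrable lborel (\<lambda>y. k (x - y) * g y)"
  using moderate_integrable[OF g rapid_reflect(1)[OF k, of x]] by (simp add: mult.commute)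

lemma rapid_conv_norm:
  fixes k r :: "'a::euclidean_space \<Rightarrow> complex"
  assumes k: "rapid k" and [measurable]: "k \<in> borel_measurable borel"
    and r: "rapid r" and [measurable]: "r \<in> borel_measurable borel"
  shows "rapid (\<lambda>y. LINT x|lborel. norm (k (x - y)) * norm (r x))"
proof -
  have "rapid (\<lambda>y. LINT x|lborel. norm (k (- (y - x))) * norm (r x))"
    by (rule rapid_convolution[of "\<lambda>z. norm (k (- z))" "\<lambda>x. norm (r x)"])
       (use rapid_reflect(1)[OF k, of 0] r in \<open>auto intro!: rapid_norm\<close>)
  then show ?thesis by simp
qed

lemma rapid_conv:
  fixes k r :: "'a::euclidean_space \<Rightarrow> complex"
  assumes k: "rapid k" and [measurable]: "k \<in> borel_measurable borel"
    and r: "rapid r" and [measurable]: "r \<in> borel_measurable borel"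
  shows "rapid (\<lambda>y. LINT x|lborel. k (x - y) * r x)"
proof (rule rapid_bound[OF rapid_conv_norm[OF assms], of _ 1])
  fix y
  have "norm (LINT x|lborel. k (x - y) * r x) \<le> (LINT x|lborel. norm (k (x - y) * r x))" by (rule integral_norm_bound)
  then show "norm (LINT x|lborel. k (x - y) * r x) \<le> 1 * norm (LINT x|lborel. norm (k (x - y)) * norm (r x))"
    by (simp add: norm_mult)
qed

text \<open>Integrating |k| |r| over \<open>x\<close> first leaves \<open>g\<close> against a
  rapidly decreasing function, to which the definition of \<open>moderate\<close> applies.\<close>

lemma moderate_triple_integrable:
  fixes g k r :: "'a::euclidean_space \<Rightarrow> complex"
  assumes g: "moderate g" and k: "rapid k" and [measurable]: "k \<in> borel_measurable borel"
    and r: "rapid r" and [measurable]: "r \<in> borel_measurable borel"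
  shows "integrable (lborel \<Otimes>\<^sub>M lborel) (\<lambda>(y, x). g y * k (x - y) * r x)"
proof (rule integrableI_bounded)
  note [measurable] = moderate_borel[OF g]
  show "(\<lambda>(y, x). g y * k (x - y) * r x) \<in> borel_measurable (lborel \<Otimes>\<^sub>M lborel)" by measurable
  let ?R = "\<lambda>y. LINT x|lborel. norm (k (x - y)) * norm (r x)"
  have int: "integrable lborel (\<lambda>x. norm (k (x - y)) * norm (r x))" for y
  proof -
    obtain B where "B \<ge> 0" "\<And>x. norm (k x) \<le> B" using rapid_bounded[OF k] by blast
    then show ?thesis
      by (intro Bochner_Integration.integrable_bound[OF integrable_mult_right[OF integrable_norm[OF rapid_integrable[OF r]], of B]])
         (auto intro!: mult_right_mono simp: abs_mult)
  qed
  have "(\<integral>\<^sup>+z. ennreal (norm (case z of (y, x) \<Rightarrow> g y * k (x - y) * r x)) \<partial>(lborel \<Otimes>\<^sub>M lborel))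
      = (\<integral>\<^sup>+y. \<integral>\<^sup>+x. ennreal (norm (g y)) * ennreal (norm (k (x - y)) * norm (r x)) \<partial>lborel \<partial>lborel)"
    by (subst lborel.nn_integral_fst[symmetric]) (auto simp: norm_mult ennreal_mult mult.assoc)
  also have "\<dots> = (\<integral>\<^sup>+y. ennreal (norm (g y)) * ennreal (?R y) \<partial>lborel)"
    using int by (intro nn_integral_cong) (simp add: nn_integral_cmult nn_integral_eq_integral)
  also have "\<dots> = (\<integral>\<^sup>+y. ennreal (norm (g y * of_real (?R y))) \<partial>lborel)"
    by (intro nn_integral_cong) (simp add: norm_mult ennreal_mult integral_nonneg)
  also have "\<dots> < \<infinity>"
  proof -
    have "rapid (\<lambda>y. complex_of_real (?R y))"
      by (rule rapid_bound[OF rapid_conv_norm[OF k _ r], of _ 1]) auto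
    from moderate_integrable[OF g this] show ?thesis by (simp add: integrable_iff_bounded)
  qed
  finally show "(\<integral>\<^sup>+z. ennreal (norm (case z of (y, x) \<Rightarrow> g y * k (x - y) * r x)) \<partial>(lborel \<Otimes>\<^sub>M lborel)) < \<infinity>" .
qed

lemma conv_duality:
  fixes g k r :: "'a::euclidean_space \<Rightarrow> complex"
  assumes g: "moderate g" and k: "rapid k" and [measurable]: "k \<in> borel_measurable borel"
    and r: "rapid r" and [measurable]: "r \<in> borel_measurable borel"
  shows "(LINT x|lborel. conv k g x * r x) = (LINT y|lborel. g y * (LINT x|lborel. k (x - y) * r x))"
    and "integrable lborel (\<lambda>x. conv k g x * r x)"
proof -
  note int = moderate_triple_integrable[OF assms]
  have int': "integrable (lborel \<Otimes>\<^sub>M lborel) (\<lambda>(x, y). g y * k (x - y) * r x)"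
    using lborel_pair.integrable_product_swap[OF int] by (simp add: case_prod_beta)
  have eq: "(LINT y|lborel. g y * k (x - y) * r x) = conv k g x * r x" for x
    unfolding conv_def by (subst Bochner_Integration.integral_mult_left_zero[symmetric]) (simp add: mult_ac)
  have "(LINT x|lborel. conv k g x * r x) = (LINT x|lborel. LINT y|lborel. g y * k (x - y) * r x)"
    by (simp only: eq)
  also have "\<dots> = (LINT y|lborel. LINT x|lborel. g y * k (x - y) * r x)"
    using lborel_pair.Fubini_integral[OF int] by simp
  also have "\<dots> = (LINT y|lborel. g y * (LINT x|lborel. k (x - y) * r x))"
    by (simp only: mult.assoc Bochner_Integration.integral_mult_right_zero)
  finally show "(LINT x|lborel. conv k g x * r x) = (LINT y|lborel. g y * (LINT x|lborel. k (x - y) * r x))" .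
  have "integrable lborel (\<lambda>x. LINT y|lborel. g y * k (x - y) * r x)"
    using lborel_pair.integrable_fst'[OF int'] by simp
  then show "integrable lborel (\<lambda>x. conv k g x * r x)" by (simp only: eq)
qed

lemma moderate_conv:
  assumes g: "moderate g" and k: "rapid k" and [measurable]: "k \<in> borel_measurable borel"
  shows "moderate (conv k g)"
  using conv_duality(2)[OF g k assms(3)] moderate_borel[OF g] by (simp add: moderate_def)

text \<open>This is \<open>conv_duality\<close> with the reflected and translated kernel
  \<open>k\<close> in the place of the test function.\<close>

lemma conv_assoc:
  fixes g k l :: "'a::euclidean_space \<Rightarrow> complex"
  assumes g: "moderate g" and k: "rapid k" and [measurable]: "k \<in> borel_measurable borel"
    and l: "rapid l" and [measurable]: "l \<in> borel_measurable borel"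
  shows "conv k (conv l g) x = conv (conv k l) g x"
proof -
  have "conv k (conv l g) x = (LINT y|lborel. conv l g y * k (x - y))"
    by (simp add: conv_def[of k] mult.commute)
  also have "\<dots> = (LINT z|lborel. g z * (LINT y|lborel. l (y - z) * k (x - y)))"
    by (rule conv_duality(1)[OF g l _ rapid_reflect(1)[OF k]]) auto
  also have "\<dots> = (LINT z|lborel. conv k l (x - z) * g z)"
  proof (intro Bochner_Integration.integral_cong refl)
    fix z
    have "(LINT y|lborel. l (y - z) * k (x - y)) = (LINT u|lborel. l u * k (x - z - u))"
      by (subst integral_lborel_affine(1)[of 1 _ z]) (auto simp: algebra_simps)
    then show "g z * (LINT y|lborel. l (y - z) * k (x - y)) = conv k l (x - z) * g z"
      by (simp add: conv_def mult.commute)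
  qed
  finally show ?thesis by (simp add: conv_def[of "conv k l"])
qed

section \<open>Norms of kernel integrals and of rapidly decreasing functions\<close>

definition lnorm :: "real \<Rightarrow> ('a::euclidean_space \<Rightarrow> complex) \<Rightarrow> ennreal" where
  "lnorm s g = rnorm lborel s (\<lambda>x. ennreal (norm (g x)))"

lemma lnorm_kernel_le:
  fixes H :: "'a::euclidean_space \<Rightarrow> 'a \<Rightarrow> complex"
  assumes [measurable]: "m \<in> borel_measurable borel" "(\<lambda>(x, w). H x w) \<in> borel_measurable (lborel \<Otimes>\<^sub>M lborel)"
    and s: "0 \<le> s" "s \<le> 1"
  shows "lnorm s (\<lambda>x. LINT w|lborel. m w * H x w)
           \<le> (\<integral>\<^sup>+w. ennreal (norm (m w)) * lnorm s (\<lambda>x. H x w) \<partial>lborel)"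
proof -
  have [measurable]: "(\<lambda>x. H x w) \<in> borel_measurable borel" for w
    using measurable_Pair1[of "\<lambda>(x, w). H x w" lborel lborel borel w] by simp
  have "lnorm s (\<lambda>x. LINT w|lborel. m w * H x w)
      \<le> rnorm lborel s (\<lambda>x. \<integral>\<^sup>+w. ennreal (norm (m w)) * ennreal (norm (H x w)) \<partial>lborel)"
    unfolding lnorm_def
  proof (rule rnorm_mono_AE)
    show "AE x in lborel. ennreal (norm (LINT w|lborel. m w * H x w))
        \<le> (\<integral>\<^sup>+w. ennreal (norm (m w)) * ennreal (norm (H x w)) \<partial>lborel)"
    proof (rule AE_I2)
      fix x
      show "ennreal (norm (LINT w|lborel. m w * H x w)) \<le> (\<integral>\<^sup>+w. ennreal (norm (m w)) * ennreal (norm (H x w)) \<partial>lborel)"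
      proof (cases "integrable lborel (\<lambda>w. m w * H x w)")
        case True
        from integral_norm_bound_ennreal[OF True] show ?thesis by (simp add: norm_mult ennreal_mult)
      \<comment> \<open>Where the integrand is not integrable, the integral has the default value 0
        and the bound is trivial.\<close>
      qed (simp add: not_integrable_integral_eq)
    qed
  qed (use s in auto)
  also have "\<dots> \<le> (\<integral>\<^sup>+w. rnorm lborel s (\<lambda>x. ennreal (norm (m w)) * ennreal (norm (H x w))) \<partial>lborel)"
    by (rule rnorm_nn_integral_le) (use s lborel.sigma_finite_measure_axioms in auto)
  also have "\<dots> \<le> (\<integral>\<^sup>+w. ennreal (norm (m w)) * lnorm s (\<lambda>x. H x w) \<partial>lborel)"
    unfolding lnorm_def by (intro nn_integral_mono rnorm_cmult) (use s in auto)
  finally show ?thesis .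
qed

lemma lnorm_translate:
  "g \<in> borel_measurable borel \<Longrightarrow> lnorm s (\<lambda>x. g (x + h)) = lnorm s g"
  unfolding lnorm_def by (subst rnorm_translate[symmetric, of _ s h]) auto

lemma lnorm_conv_le:
  assumes [measurable]: "k \<in> borel_measurable borel" "g \<in> borel_measurable borel" and s: "0 \<le> s" "s \<le> 1"
  shows "lnorm s (conv k g) \<le> (\<integral>\<^sup>+w. ennreal (norm (k w)) \<partial>lborel) * lnorm s g"
proof -
  have "lnorm s (conv k g) = lnorm s (\<lambda>x. LINT w|lborel. k w * g (x + - w))"
    by (intro arg_cong[where f="lnorm s"] ext) (simp add: conv_flip)
  also have "\<dots> \<le> (\<integral>\<^sup>+w. ennreal (norm (k w)) * lnorm s (\<lambda>x. g (x + - w)) \<partial>lborel)"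
    by (rule lnorm_kernel_le) (use s in auto)
  also have "\<dots> = (\<integral>\<^sup>+w. ennreal (norm (k w)) \<partial>lborel) * lnorm s g"
    by (simp add: lnorm_translate[of g s "- _"] nn_integral_multc del: add_uminus_conv_diff)
  finally show ?thesis .
qed

text \<open>Interpolation between the sup bound and integrability: |r|^(1/t) \<le> B^(1/t - 1)
  |r|.\<close>

lemma rapid_lnorm_finite:
  assumes r: "rapid r" and [measurable]: "r \<in> borel_measurable borel" and t: "0 \<le> t" "t \<le> 1"
  shows "lnorm t r < top"
proof -
  obtain B where B: "B \<ge> 0" "\<And>x. norm (r x) \<le> B" using rapid_bounded[OF r] by blast
  show ?thesis
  proof (cases "t = 0")
    case True
    have "lnorm t r \<le> ennreal B" unfolding True lnorm_def rnorm_def by (auto intro!: esssup_I ennreal_leI B)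
    then show ?thesis by (metis ennreal_less_top order_le_less_trans)
  next
    case False
    then have t0: "t > 0" using t by simp
    have "(\<integral>\<^sup>+x. ennpowr (ennreal (norm (r x))) (1 / t) \<partial>lborel) \<le> (\<integral>\<^sup>+x. ennreal (B powr (1 / t - 1)) * ennreal (norm (r x)) \<partial>lborel)"
    proof (rule nn_integral_mono)
      fix x
      have "norm (r x) powr (1 / t) = norm (r x) powr (1 / t - 1) * norm (r x) powr 1"
        by (simp only: powr_add[symmetric]) simp
      also have "\<dots> \<le> B powr (1 / t - 1) * norm (r x)"
        using t t0 B by (simp del: powr_one_gt_zero_iff) (intro mult_right_mono powr_mono2, auto simp: field_simps)
      finally show "ennpowr (ennreal (norm (r x))) (1 / t) \<le> ennreal (B powr (1 / t - 1)) * ennreal (norm (r x))"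
        by (simp add: ennpowr_ennreal ennreal_leI flip: ennreal_mult)
    qed
    also have "\<dots> = ennreal (B powr (1 / t - 1)) * (\<integral>\<^sup>+x. ennreal (norm (r x)) \<partial>lborel)"
      by (simp add: nn_integral_cmult)
    also have "\<dots> < top"
      using rapid_integrable[OF r] by (auto simp: integrable_iff_bounded ennreal_mult_less_top)
    finally have "(\<integral>\<^sup>+x. ennpowr (ennreal (norm (r x))) (1 / t) \<partial>lborel) \<noteq> top" by (rule less_imp_neq)
    then show ?thesis using t0 unfolding lnorm_def rnorm_def by (simp flip: less_top)
  qed
qed

text \<open>Hoelder's inequality, since rapidly decreasing functions lie in the space with the dual
  exponent \<open>1 - s\<close>.\<close>

lemma moderate_lnorm:
  assumes [measurable]: "g \<in> borel_measurable borel" and fin: "lnorm s g < top" and s: "0 \<le> s" "s \<le> 1"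
  shows "moderate g"
  unfolding moderate_def
proof (intro conjI allI impI)
  fix r :: "'a \<Rightarrow> complex" assume r: "rapid r" and [measurable]: "r \<in> borel_measurable borel"
  have "(\<integral>\<^sup>+x. ennreal (norm (g x * r x)) \<partial>lborel) = rnorm lborel (s + (1 - s)) (\<lambda>x. ennreal (norm (g x)) * ennreal (norm (r x)))"
    by (simp add: rnorm_1 norm_mult ennreal_mult)
  also have "\<dots> \<le> lnorm s g * lnorm (1 - s) r"
    unfolding lnorm_def by (rule rnorm_mult_le) (use s in auto)
  also have "\<dots> < top"
    using rapid_lnorm_finite[OF r, of "1 - s"] fin s by (simp add: ennreal_mult_less_top)
  finally show "integrable lborel (\<lambda>x. g x * r x)" by (intro integrableI_bounded) auto
qed simp


section \<open>Schwartz majorants and the fundamental lemma\<close>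

text \<open>First and second order Taylor bounds that are uniform in the base point. The second one
  allows a convolution with a merely integrable function to be differentiated under the
  integral.\<close>

lemma test_fun_lipschitz:
  fixes f :: "'a::euclidean_space \<Rightarrow> complex"
  assumes f: "test_fun f"
  shows "\<exists>L\<ge>0. \<forall>x h. norm (f (x + h) - f x) \<le> L * norm h
     \<and> norm (f (x + h) - f x - frechet_derivative f (at x) h) \<le> L * (norm h)\<^sup>2"
proof -
  have lip: "\<exists>L\<ge>0. \<forall>x h. norm (g (x + h) - g x) \<le> L * norm h" if g: "test_fun g" for g :: "'a \<Rightarrow> complex"
  proof -
    let ?D = "\<lambda>x. frechet_derivative g (at x)"
    have der: "(g has_derivative ?D x) (at x within S)" for x S
      by (rule has_derivative_at_withinI) (intro frechet_derivative_works[THEN iffD1] smooth_fun_differentiable test_fun_smooth g)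
    have "\<exists>B\<ge>0. \<forall>x. norm (?D x b) \<le> B" if "b \<in> Basis" for b
      using test_fun_bounded[OF test_fun_iter_deriv[OF g, of "[b]"]] that by simp
    then obtain B where B: "\<And>b. b \<in> Basis \<Longrightarrow> B b \<ge> 0" "\<And>b x. b \<in> Basis \<Longrightarrow> norm (?D x b) \<le> B b"
      by metis
    have on: "onorm (?D x) \<le> (\<Sum>b\<in>Basis. B b)" for x
    proof (rule onorm_le)
      fix v :: 'a
      have lin: "linear (?D x)" using der has_derivative_linear by blast
      have "norm (?D x v) = norm (?D x (\<Sum>b\<in>Basis. (v \<bullet> b) *\<^sub>R b))" by (simp add: euclidean_representation)
      also have "\<dots> = norm (\<Sum>b\<in>Basis. (v \<bullet> b) *\<^sub>R ?D x b)" by (simp add: linear_sum[OF lin] linear_scale[OF lin])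
      also have "\<dots> \<le> (\<Sum>b\<in>Basis. norm v * B b)"
        using B by (intro sum_norm_le) (auto intro!: mult_mono Basis_le_norm)
      finally show "norm (?D x v) \<le> (\<Sum>b\<in>Basis. B b) * norm v" by (simp add: sum_distrib_left mult.commute)
    qed
    have "norm (g (x + h) - g x) \<le> (\<Sum>b\<in>Basis. B b) * norm (x + h - x)" for x h
      by (rule differentiable_bound[OF convex_UNIV der on]) auto
    moreover have "0 \<le> (\<Sum>b\<in>Basis. B b)" using B by (intro sum_nonneg) auto
    ultimately show ?thesis by (intro exI[of _ "\<Sum>b\<in>Basis. B b"]) simp
  qed
  obtain L0 where L0: "L0 \<ge> 0" "\<And>x h. norm (f (x + h) - f x) \<le> L0 * norm h" using lip[OF f] by blast
  let ?D = "\<lambda>x. frechet_derivative f (at x)"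
  have der: "(f has_derivative ?D x) (at x within S)" for x S
    by (rule has_derivative_at_withinI) (intro frechet_derivative_works[THEN iffD1] smooth_fun_differentiable test_fun_smooth f)
  have lin: "linear (?D x)" for x using der has_derivative_linear by blast
  have "\<exists>B\<ge>0. \<forall>x h. norm (?D (x + h) b - ?D x b) \<le> B * norm h" if "b \<in> Basis" for b
    using lip[OF test_fun_iter_deriv[OF f, of "[b]"]] that by simp
  then obtain B where B: "\<And>b. b \<in> Basis \<Longrightarrow> B b \<ge> 0"
    "\<And>b x h. b \<in> Basis \<Longrightarrow> norm (?D (x + h) b - ?D x b) \<le> B b * norm h"
    by metis
  let ?S = "\<Sum>b\<in>Basis. B b"
  have S: "0 \<le> ?S" using B by (intro sum_nonneg) auto
  have second: "norm (f (x + h) - f x - ?D x h) \<le> ?S * (norm h)\<^sup>2" for x h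
  proof -
    \<comment> \<open>The mean value inequality is applied to \<open>f\<close> minus its
      linearisation at \<open>x\<close> on the ball of radius \<open>norm h\<close>, where the
      derivative of the difference is of size \<open>norm h\<close>.\<close>
    have "norm ((f (x + h) - ?D x h) - (f (x + 0) - ?D x 0)) \<le> (?S * norm h) * norm (h - 0)"
    proof (rule differentiable_bound[of "cball 0 (norm h)" "\<lambda>u. f (x + u) - ?D x u" "\<lambda>u v. ?D (x + u) v - ?D x v"])
      fix u :: 'a assume u: "u \<in> cball 0 (norm h)"
      show "((\<lambda>u. f (x + u) - ?D x u) has_derivative (\<lambda>v. ?D (x + u) v - ?D x v)) (at u within cball 0 (norm h))"
      proof (intro has_derivative_diff)
        show "((\<lambda>u. f (x + u)) has_derivative ?D (x + u)) (at u within cball 0 (norm h))"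
        proof (rule has_derivative_compose[of "\<lambda>u. x + u" "\<lambda>v. v" u "cball 0 (norm h)" f "?D (x + u)"])
          show "((\<lambda>u. x + u) has_derivative (\<lambda>v. v)) (at u within cball 0 (norm h))"
            by (auto intro!: derivative_eq_intros)
        qed (rule der)
        show "(?D x has_derivative ?D x) (at u within cball 0 (norm h))"
          using der has_derivative_bounded_linear bounded_linear_imp_has_derivative by blast
      qed
      show "onorm (\<lambda>v. ?D (x + u) v - ?D x v) \<le> ?S * norm h"
      proof (rule onorm_le)
        fix v :: 'a
        have "?D y v = (\<Sum>b\<in>Basis. (v \<bullet> b) *\<^sub>R ?D y b)" for y
        proof -
          have "?D y v = ?D y (\<Sum>b\<in>Basis. (v \<bullet> b) *\<^sub>R b)" by (simp add: euclidean_representation)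
          then show ?thesis by (simp add: linear_sum[OF lin] linear_scale[OF lin])
        qed
        then have "norm (?D (x + u) v - ?D x v) = norm (\<Sum>b\<in>Basis. (v \<bullet> b) *\<^sub>R (?D (x + u) b - ?D x b))"
          by (simp add: scaleR_diff_right sum_subtractf)
        also have "\<dots> \<le> (\<Sum>b\<in>Basis. norm v * (B b * norm u))"
          using B by (intro sum_norm_le) (auto intro!: mult_mono Basis_le_norm)
        also have "\<dots> = ?S * norm u * norm v" by (simp add: sum_distrib_left sum_distrib_right mult_ac)
        also have "\<dots> \<le> ?S * norm h * norm v" using u S by (intro mult_right_mono mult_left_mono) auto
        finally show "norm (?D (x + u) v - ?D x v) \<le> ?S * norm h * norm v" .
      qed
    qed auto
    also have "(f (x + h) - ?D x h) - (f (x + 0) - ?D x 0) = f (x + h) - f x - ?D x h"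
      by (simp add: linear_0[OF lin])
    finally show ?thesis by (simp add: power2_eq_square mult.assoc)
  qed
  have "norm (f (x + h) - f x) \<le> max L0 ?S * norm h" "norm (f (x + h) - f x - ?D x h) \<le> max L0 ?S * (norm h)\<^sup>2" for x h
    using order_trans[OF L0(2)[of x h] mult_right_mono[of L0 "max L0 ?S" "norm h"]]
      order_trans[OF second[of x h] mult_right_mono[of ?S "max L0 ?S" "(norm h)\<^sup>2"]] by auto
  then show ?thesis using L0(1) by (intro exI[of _ "max L0 ?S"]) auto
qed

lemma conv_test_fun_derivative:
  fixes f R :: "'a::euclidean_space \<Rightarrow> complex"
  assumes f: "test_fun f" and R: "integrable lborel R"
  shows "(conv f R has_derivative (\<lambda>h. conv (\<lambda>z. frechet_derivative f (at z) h) R x)) (at x)"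
proof -
  note [measurable] = borel_measurable_integrable[OF R] test_fun_borel[OF f]
  let ?D = "\<lambda>x. frechet_derivative f (at x)"
  have der: "(f has_derivative ?D x) (at x)" for x
    by (intro frechet_derivative_works[THEN iffD1] smooth_fun_differentiable test_fun_smooth f)
  have lin: "linear (?D x)" for x using der has_derivative_linear by blast
  have Dsum: "?D y v = (\<Sum>b\<in>Basis. (v \<bullet> b) *\<^sub>R ?D y b)" for y v
  proof -
    have "?D y v = ?D y (\<Sum>b\<in>Basis. (v \<bullet> b) *\<^sub>R b)" by (simp add: euclidean_representation)
    then show ?thesis by (simp add: linear_sum[OF lin] linear_scale[OF lin])
  qed
  have tb: "test_fun (\<lambda>z. ?D z b)" if "b \<in> Basis" for b
    using test_fun_iter_deriv[OF f, of "[b]"] that by simp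
  have int: "integrable lborel (\<lambda>y. g (x - y) * R y)" if g: "test_fun g" for g x
  proof -
    note [measurable] = test_fun_borel[OF g]
    obtain B where "B \<ge> 0" "\<And>x. norm (g x) \<le> B" using test_fun_bounded[OF g] by blast
    then show ?thesis
      by (intro Bochner_Integration.integrable_bound[OF integrable_mult_right[OF integrable_norm[OF R], of B]])
         (auto intro!: mult_right_mono simp: norm_mult)
  qed
  have D: "conv (\<lambda>z. ?D z h) R x = (\<Sum>b\<in>Basis. (h \<bullet> b) *\<^sub>R conv (\<lambda>z. ?D z b) R x)"
    and intD: "integrable lborel (\<lambda>y. ?D (x - y) h * R y)" for h
  proof -
    have eq: "?D (x - y) h * R y = (\<Sum>b\<in>Basis. (h \<bullet> b) *\<^sub>R (?D (x - y) b * R y))" for y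
      by (subst Dsum) (simp add: sum_distrib_right)
    have i: "integrable lborel (\<lambda>y. (h \<bullet> b) *\<^sub>R (?D (x - y) b * R y))" if "b \<in> Basis" for b
      by (intro integrable_scaleR_right int[OF tb[OF that]])
    show "conv (\<lambda>z. ?D z h) R x = (\<Sum>b\<in>Basis. (h \<bullet> b) *\<^sub>R conv (\<lambda>z. ?D z b) R x)"
      unfolding conv_def eq using i by (simp add: Bochner_Integration.integral_sum)
    show "integrable lborel (\<lambda>y. ?D (x - y) h * R y)"
      unfolding eq by (intro Bochner_Integration.integrable_sum i)
  qed
  have blin: "bounded_linear (\<lambda>h. conv (\<lambda>z. ?D z h) R x)"
  proof -
    have eq: "(\<lambda>h. conv (\<lambda>z. ?D z h) R x) = (\<lambda>h. \<Sum>b\<in>Basis. (h \<bullet> b) *\<^sub>R conv (\<lambda>z. ?D z b) R x)" by (rule ext, rule D)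
    show ?thesis
      by (subst eq) (intro bounded_linear_sum bounded_linear_compose[OF bounded_linear_scaleR_left] bounded_linear_inner_left)
  qed
  obtain L where L: "L \<ge> 0" "\<And>x h. norm (f (x + h) - f x - ?D x h) \<le> L * (norm h)\<^sup>2"
    using test_fun_lipschitz[OF f] by blast
  let ?K = "L * (LINT y|lborel. norm (R y))"
  have K: "0 \<le> ?K" using L by simp
  have rem: "norm (conv f R (x + h) - conv f R x - conv (\<lambda>z. ?D z h) R x) \<le> ?K * (norm h)\<^sup>2" for h
  proof -
    have e1: "(f (x - y + h) - f (x - y) - ?D (x - y) h) * R y = f (x + h - y) * R y - f (x - y) * R y - ?D (x - y) h * R y" for y
    proof -
      have "x + h - y = x - y + h" by simp
      then show ?thesis by (simp only: left_diff_distrib)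
    qed
    have "conv f R (x + h) - conv f R x - conv (\<lambda>z. ?D z h) R x
        = (LINT y|lborel. f (x + h - y) * R y - f (x - y) * R y - ?D (x - y) h * R y)"
      unfolding conv_def
      by (simp only: Bochner_Integration.integral_diff Bochner_Integration.integrable_diff int[OF f] intD)
    also have "\<dots> = (LINT y|lborel. (f (x - y + h) - f (x - y) - ?D (x - y) h) * R y)"
      by (simp only: e1)
    finally have "norm (conv f R (x + h) - conv f R x - conv (\<lambda>z. ?D z h) R x)
        = norm (LINT y|lborel. (f (x - y + h) - f (x - y) - ?D (x - y) h) * R y)" by (rule arg_cong)
    also have "\<dots> \<le> (LINT y|lborel. norm ((f (x - y + h) - f (x - y) - ?D (x - y) h) * R y))"
      by (rule integral_norm_bound)
    also have "\<dots> \<le> (LINT y|lborel. L * (norm h)\<^sup>2 * norm (R y))"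
    proof (rule integral_mono[of lborel "\<lambda>y. norm ((f (x - y + h) - f (x - y) - ?D (x - y) h) * R y)" "\<lambda>y. L * (norm h)\<^sup>2 * norm (R y)"])
      have "integrable lborel (\<lambda>y. f (x + h - y) * R y - f (x - y) * R y - ?D (x - y) h * R y)"
        by (rule Bochner_Integration.integrable_diff[OF Bochner_Integration.integrable_diff[OF int[OF f] int[OF f]] intD])
      then have "integrable lborel (\<lambda>y. (f (x - y + h) - f (x - y) - ?D (x - y) h) * R y)"
        by (simp only: e1)
      then show "integrable lborel (\<lambda>y. norm ((f (x - y + h) - f (x - y) - ?D (x - y) h) * R y))"
        by (rule integrable_norm)
      show "integrable lborel (\<lambda>y. L * (norm h)\<^sup>2 * norm (R y))"
        by (intro integrable_mult_right integrable_norm R)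
      show "norm ((f (x - y + h) - f (x - y) - ?D (x - y) h) * R y) \<le> L * (norm h)\<^sup>2 * norm (R y)" for y
        unfolding norm_mult by (intro mult_right_mono L norm_ge_zero)
    qed
    also have "\<dots> = L * (norm h)\<^sup>2 * (LINT y|lborel. norm (R y))" by (rule Bochner_Integration.integral_mult_right_zero)
    finally show ?thesis by (simp only: mult_ac)
  qed
  have "((\<lambda>h. norm (conv f R (x + h) - conv f R x - conv (\<lambda>z. ?D z h) R x) / norm h) \<longlongrightarrow> 0) (at 0)"
  proof (rule tendsto_sandwich[of "\<lambda>_. 0" _ _ "\<lambda>h. ?K * norm h"])
    show "\<forall>\<^sub>F h in at 0. norm (conv f R (x + h) - conv f R x - conv (\<lambda>z. ?D z h) R x) / norm h \<le> ?K * norm h"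
    proof (rule always_eventually, rule allI)
      fix h :: 'a
      show "norm (conv f R (x + h) - conv f R x - conv (\<lambda>z. ?D z h) R x) / norm h \<le> ?K * norm h"
        using rem[of h] by (cases "h = 0") (auto simp: pos_divide_le_eq power2_eq_square mult.assoc)
    qed
    show "((\<lambda>h. ?K * norm h) \<longlongrightarrow> 0) (at (0::'a))"
      by (auto intro!: tendsto_eq_intros)
  qed auto
  then show ?thesis using blin unfolding has_derivative_at by simp
qed

text \<open>All derivatives fall on the test function \<open>f\<close>, so decay of \<open>R\<close>
  is enough: mollifying a rapidly decreasing function produces a Schwartz function.\<close>

lemma conv_test_fun_schwartz:
  fixes f R :: "'a::euclidean_space \<Rightarrow> complex"
  assumes f: "test_fun f" and R: "rapid R" and [measurable]: "R \<in> borel_measurable borel"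
  shows "conv f R \<in> schwartz"
proof -
  have intR: "integrable lborel R" by (rule rapid_integrable[OF R]) simp
  have it: "iter_deriv bs (conv f R) = conv (iter_deriv bs f) R" if "set bs \<subseteq> Basis" for bs
    using that
  proof (induction bs)
    case (Cons b bs)
    have t: "test_fun (iter_deriv bs f)" using f Cons.prems by (intro test_fun_iter_deriv) auto
    show ?case
    proof
      fix x
      have eq: "iter_deriv bs (conv f R) = conv (iter_deriv bs f) R" using Cons by simp
      show "iter_deriv (b # bs) (conv f R) x = conv (iter_deriv (b # bs) f) R x"
        unfolding iter_deriv.simps eq frechet_derivative_at[OF conv_test_fun_derivative[OF t intR, of x], symmetric] ..
    qed
  qed simp
  have "smooth_fun (conv f R)"
    unfolding smooth_fun_def
  proof (intro allI impI)
    fix bs :: "'a list" and x assume bs: "set bs \<subseteq> Basis"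
    have t: "test_fun (iter_deriv bs f)" using f bs by (intro test_fun_iter_deriv)
    show "iter_deriv bs (conv f R) differentiable at x"
      using conv_test_fun_derivative[OF t intR] it[OF bs] by (auto simp: differentiable_def)
  qed
  moreover have "rapid (iter_deriv bs (conv f R))" if "set bs \<subseteq> Basis" for bs
  proof -
    have t: "test_fun (iter_deriv bs f)" using f that by (intro test_fun_iter_deriv)
    have "rapid (\<lambda>x. LINT y|lborel. iter_deriv bs f (- (y - x)) * R y)"
      by (rule rapid_conv[of "\<lambda>z. iter_deriv bs f (- z)"])
         (use rapid_reflect(1)[OF test_fun_rapid[OF t], of 0] test_fun_borel[OF t] R in auto)
    then show ?thesis unfolding it[OF that] by (simp add: conv_def[abs_def])
  qed
  ultimately show ?thesis by (rule schwartzI)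
qed


context dyadic_setting
begin

text \<open>\<open>chi\<close> is complex valued and may oscillate; its squared modulus is a
  nonnegative smooth bump of the same support that equals 1 near the origin, and serves as
  mollifier.\<close>

definition theta :: "'a \<Rightarrow> complex" where
  "theta x = of_real ((norm (chi x))\<^sup>2)"

lemma theta_test: "test_fun theta"
proof -
  have "theta = (\<lambda>x. cnj (chi x) * chi x)"
    by (rule ext) (simp only: theta_def complex_norm_square mult.commute)
  moreover have "test_fun (\<lambda>x. cnj (chi x) * chi x)"
    by (rule test_fun_mult[OF chi_test smooth_fun_compose_linear[OF bounded_linear_cnj smooth_chi]])
  ultimately show ?thesis by simp
qed

lemma theta_borel [measurable]: "theta \<in> borel_measurable borel"
  by (rule test_fun_borel[OF theta_test])

lemma theta_eq_0: "4 / 3 \<le> norm x \<Longrightarrow> theta x = 0"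
  by (simp add: theta_def chi_eq_0)

lemma theta_nonneg: "theta x = of_real (norm (theta x))"
  by (simp add: theta_def norm_power)

definition ctheta :: real where "ctheta = (LINT x|lborel. norm (theta x))"

lemma theta_integrable: "integrable lborel theta"
  by (rule test_fun_integrable[OF theta_test])

lemma ctheta: "ctheta > 0" "(LINT x|lborel. theta x) = of_real ctheta"
proof -
  have "ctheta \<ge> 0" unfolding ctheta_def by simp
  moreover have "ctheta \<noteq> 0"
  proof
    assume "ctheta = 0"
    then have "AE x in lborel. norm (theta x) = 0"
      unfolding ctheta_def using integral_nonneg_eq_0_iff_AE[OF integrable_norm[OF theta_integrable]] by simp
    then have "AE x in lborel. x \<notin> ball (0::'a) (3/4)"
    proof eventually_elim
      case (elim x)
      then show ?case using chi_eq_1[of x] by (auto simp: theta_def)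
    qed
    then have "emeasure lborel (ball (0::'a) (3/4)) = 0"
      by (subst (asm) AE_iff_measurable[of "ball (0::'a) (3/4)"]) auto
    then show False using emeasure_ball[of "3/4" "0::'a"] unit_ball_vol_pos[of "real DIM('a)"] by simp
  qed
  ultimately show "ctheta > 0" by simp
  show "(LINT x|lborel. theta x) = of_real ctheta"
    unfolding ctheta_def by (subst theta_nonneg) simp
qed

text \<open>\<open>m t\<close> is the supremum of |r| outside the ball of radius \<open>t\<close>.
  The shift by 2 in the last claim leaves room for mollification with \<open>theta\<close>, which
  vanishes beyond radius 4/3.\<close>

lemma rapid_decreasing_majorant:
  fixes r :: "'a \<Rightarrow> complex"
  assumes r: "rapid r"
  shows "\<exists>m. antimono m \<and> (\<forall>t. 0 \<le> m t) \<and> (\<forall>x t. t \<le> norm x \<longrightarrow> norm (r x) \<le> m t)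
     \<and> rapid (\<lambda>x::'a. complex_of_real (m (norm x - 2)))"
proof -
  define q where "q t z = (if t \<le> norm z then norm (r z) else 0)" for t z
  define m where "m t = (SUP z. q t z)" for t
  obtain B where B: "B \<ge> 0" "\<And>x. norm (r x) \<le> B" using rapid_bounded[OF r] by blast
  have bdd: "bdd_above (range (q t))" for t
    by (rule bdd_aboveI[of _ B]) (auto simp: q_def B)
  have q: "q t z \<le> m t" for t z unfolding m_def by (rule cSUP_upper) (use bdd in auto)
  have "antimono m"
  proof (rule antimonoI)
    fix s t :: real assume "s \<le> t"
    show "m t \<le> m s" unfolding m_def
      by (rule cSUP_mono) (use bdd \<open>s \<le> t\<close> in \<open>auto simp: q_def\<close>)
  qed
  moreover have "0 \<le> m t" for t using q[of t 0] by (auto simp: q_def split: if_splits intro: order_trans[OF norm_ge_zero])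
  moreover have "norm (r x) \<le> m t" if "t \<le> norm x" for x t using q[of t x] that by (simp add: q_def)
  moreover have "rapid (\<lambda>x::'a. complex_of_real (m (norm x - 2)))"
  proof (rule rapidI)
    fix N :: nat
    obtain C where C: "C > 0" "\<And>x. norm (r x) \<le> C / (1 + norm x) ^ N" using rapid_ex[OF r, of N] by blast
    have "m (norm x - 2) \<le> 3 ^ N * C / (1 + norm x) ^ N" for x :: 'a
      unfolding m_def
    proof (rule cSUP_least)
      fix z :: 'a
      show "q (norm x - 2) z \<le> 3 ^ N * C / (1 + norm x) ^ N"
      proof (cases "norm x - 2 \<le> norm z")
        case True
        have "(1 + norm x) ^ N \<le> (3 * (1 + norm z)) ^ N" using True norm_ge_zero[of z] by (intro power_mono) (simp_all only: distrib_left, auto)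
        then have le: "(1 + norm x) ^ N \<le> 3 ^ N * (1 + norm z) ^ N" by (simp only: power_mult_distrib)
        have "(1 + norm z) ^ N > 0" "(1 + norm x) ^ N > 0" by (auto intro!: zero_less_power add_pos_nonneg)
        then have "C / (1 + norm z) ^ N \<le> 3 ^ N * C / (1 + norm x) ^ N"
          using le C(1) by (simp add: field_simps)
        then show ?thesis using C(2)[of z] True by (simp add: q_def)
      next
        case False
        then show ?thesis using C by (simp add: q_def)
      qed
    qed simp
    moreover have "norm (complex_of_real (m (norm x - 2))) = m (norm x - 2)" for x :: 'a
      using \<open>\<And>t. 0 \<le> m t\<close> by simp
    ultimately show "\<exists>C. \<forall>x::'a. norm (complex_of_real (m (norm x - 2))) \<le> C / (1 + norm x) ^ N" by metis
  qed
  ultimately show ?thesis by blast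
qed

text \<open>Mollifying the shifted radial majorant keeps it above \<open>r\<close>, because
  \<open>norm (x - w) - 2 \<le> norm x\<close> on the support of \<open>theta\<close>. Integrability
  against Schwartz functions thereby upgrades to integrability against all rapidly decreasing
  functions.\<close>

lemma schwartz_majorant:
  fixes r :: "'a \<Rightarrow> complex"
  assumes r: "rapid r"
  shows "\<exists>\<phi>\<in>schwartz. \<forall>x. norm (r x) \<le> norm (\<phi> x)"
proof -
  obtain m where m: "antimono m" "\<And>t. 0 \<le> m t" "\<And>x t. t \<le> norm x \<Longrightarrow> norm (r x) \<le> m t"
    and mr: "rapid (\<lambda>x::'a. complex_of_real (m (norm x - 2)))"
    using rapid_decreasing_majorant[OF r] by blast
  have [measurable]: "m \<in> borel_measurable borel"
  proof -
    have "(\<lambda>t. - m t) \<in> borel_measurable borel"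
      using m(1) by (intro borel_measurable_mono) (auto simp: mono_def antimono_def)
    then show ?thesis by simp
  qed
  let ?R = "\<lambda>x::'a. complex_of_real (m (norm x - 2) / ctheta)"
  have R: "rapid ?R" "?R \<in> borel_measurable borel"
    by (rule rapid_bound[OF mr, of _ "1 / ctheta"]) (use ctheta(1) in \<open>auto simp: norm_divide\<close>)
  have \<phi>: "conv theta ?R \<in> schwartz" by (rule conv_test_fun_schwartz[OF theta_test R])
  have "norm (r x) \<le> norm (conv theta ?R x)" for x
  proof -
    have int: "integrable lborel (\<lambda>w. norm (theta w) * (m (norm (x - w) - 2) / ctheta))"
    proof -
      obtain B where "B \<ge> 0" "\<And>x. norm (?R x) \<le> B" using rapid_bounded[OF R(1)] by blast
      then have le: "\<bar>m (norm (x - w) - 2) / ctheta\<bar> \<le> \<bar>B\<bar>" for w by (metis norm_of_real abs_of_nonneg)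
      show ?thesis
      proof (rule Bochner_Integration.integrable_bound[OF integrable_mult_left[OF integrable_norm[OF theta_integrable], of B]])
        show "AE w in lborel. norm (norm (theta w) * (m (norm (x - w) - 2) / ctheta)) \<le> norm (norm (theta w) * B)"
          by (simp only: norm_mult real_norm_def abs_mult) (intro AE_I2 mult_left_mono le abs_ge_zero)
      qed measurable
    qed
    have "conv theta ?R x = (LINT w|lborel. theta w * ?R (x - w))"
      by (rule conv_flip) measurable
    also have "\<dots> = (LINT w|lborel. of_real (norm (theta w) * (m (norm (x - w) - 2) / ctheta)))"
      by (subst theta_nonneg) simp
    also have "\<dots> = of_real (LINT w|lborel. norm (theta w) * (m (norm (x - w) - 2) / ctheta))"
      by (rule integral_complex_of_real)
    finally have eq: "conv theta ?R x = \<dots>" .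
    have "norm (r x) = (LINT w|lborel. norm (theta w) * (norm (r x) / ctheta))"
      using ctheta(1) by (simp add: ctheta_def[symmetric])
    also have "\<dots> \<le> (LINT w|lborel. norm (theta w) * (m (norm (x - w) - 2) / ctheta))"
    proof (rule integral_mono)
      show "integrable lborel (\<lambda>w. norm (theta w) * (norm (r x) / ctheta))"
        by (intro integrable_mult_left integrable_norm theta_integrable)
      fix w
      show "norm (theta w) * (norm (r x) / ctheta) \<le> norm (theta w) * (m (norm (x - w) - 2) / ctheta)"
      proof (cases "4 / 3 \<le> norm w")
        case False
        then have "norm (x - w) - 2 \<le> norm x" using norm_triangle_ineq4[of x w] by simp
        then show ?thesis using ctheta(1) m(3)[of "norm (x - w) - 2" x] by (intro mult_left_mono divide_right_mono) auto
      qed (simp add: theta_eq_0)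
    qed (rule int)
    also have "\<dots> \<le> norm (conv theta ?R x)" unfolding eq norm_of_real by (rule abs_ge_self)
    finally show ?thesis .
  qed
  then show ?thesis using \<phi> by blast
qed

end

section \<open>Functions that annihilate all Schwartz functions\<close>

text \<open>The positive and negative parts of \<open>h\<close> are densities of two measures that
  agree on boxes. Boxes form an intersection-stable generator, so the densities agree almost
  everywhere.\<close>

lemma AE_eq_0_if_box_integrals_eq_0_real:
  fixes h :: "'a::euclidean_space \<Rightarrow> real"
  assumes int: "\<And>a b. integrable lborel (\<lambda>x. h x * indicator (box a b) x)"
    and zero: "\<And>a b. (LINT x|lborel. h x * indicator (box a b) x) = 0"
    and [measurable]: "h \<in> borel_measurable borel"
  shows "AE x in lborel. h x = 0"
proof -
  let ?M = "density lborel (\<lambda>x. ennreal (h x))" and ?N = "density lborel (\<lambda>x. ennreal (- h x))"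
  let ?E = "range (\<lambda>(a, b). box a b :: 'a set)"
  have fin: "emeasure ?M (box a b) = emeasure ?N (box a b) \<and> emeasure ?M (box a b) \<noteq> \<infinity>" for a b
  proof -
    let ?f = "\<lambda>x. h x * indicator (box a b) x"
    have M: "emeasure ?M (box a b) = (\<integral>\<^sup>+x. ennreal (?f x) \<partial>lborel)"
      by (subst emeasure_density) (auto intro!: nn_integral_cong simp: indicator_def)
    have N: "emeasure ?N (box a b) = (\<integral>\<^sup>+x. ennreal (- ?f x) \<partial>lborel)"
      by (subst emeasure_density) (auto intro!: nn_integral_cong simp: indicator_def)
    have f: "(\<integral>\<^sup>+x. ennreal (?f x) \<partial>lborel) \<noteq> \<infinity>" "(\<integral>\<^sup>+x. ennreal (- ?f x) \<partial>lborel) \<noteq> \<infinity>"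
      using int[of a b] by (auto simp: real_integrable_def)
    have "enn2real (\<integral>\<^sup>+x. ennreal (?f x) \<partial>lborel) = enn2real (\<integral>\<^sup>+x. ennreal (- ?f x) \<partial>lborel)"
      using zero[of a b] real_lebesgue_integral_def[OF int[of a b]] by simp
    then show ?thesis using f M N by (metis ennreal_enn2real infinity_ennreal_def less_top)
  qed
  have "?M = ?N"
  proof (rule measure_eqI_generator_eq)
    let ?A = "\<lambda>i::nat. box (- (real i *\<^sub>R One)) (real i *\<^sub>R One) :: 'a set"
    show "Int_stable ?E" by (auto simp: Int_stable_def box_Int_box)
    show "?E \<subseteq> Pow UNIV" "sets ?M = sigma_sets UNIV ?E" "sets ?N = sigma_sets UNIV ?E"
      by (simp_all add: borel_eq_box sets_borel)
    show "range ?A \<subseteq> ?E" "(\<Union>i. ?A i) = UNIV" unfolding UN_box_eq_UNIV by auto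
    show "\<And>X. X \<in> ?E \<Longrightarrow> emeasure ?M X = emeasure ?N X" using fin by auto
    show "\<And>i. emeasure ?M (?A i) \<noteq> \<infinity>" using fin by blast
  qed
  then have "AE x in lborel. ennreal (h x) = ennreal (- h x)"
    by (intro sigma_finite_measure.density_unique[OF sigma_finite_lborel]) auto
  then show ?thesis
  proof eventually_elim
    case (elim x)
    then show ?case
      using ennreal_neg[of "h x"] ennreal_neg[of "- h x"] ennreal_eq_0_iff[of "h x"] ennreal_eq_0_iff[of "- h x"]
      by (cases "0 \<le> h x") auto
  qed
qed

lemma AE_eq_0_if_box_integrals_eq_0:
  fixes h :: "'a::euclidean_space \<Rightarrow> complex"
  assumes int: "\<And>a b. integrable lborel (\<lambda>x. h x * indicator (box a b) x)"
    and zero: "\<And>a b. (LINT x|lborel. h x * indicator (box a b) x) = 0"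
    and [measurable]: "h \<in> borel_measurable borel"
  shows "AE x in lborel. h x = 0"
proof -
  have re: "Re (h x * indicator (box a b) x) = Re (h x) * indicator (box a b) x"
    and im: "Im (h x * indicator (box a b) x) = Im (h x) * indicator (box a b) x" for x a b
    by (simp_all add: indicator_def)
  have "integrable lborel (\<lambda>x. Re (h x) * indicator (box a b) x)" "(LINT x|lborel. Re (h x) * indicator (box a b) x) = 0"
    "integrable lborel (\<lambda>x. Im (h x) * indicator (box a b) x)" "(LINT x|lborel. Im (h x) * indicator (box a b) x) = 0" for a b
    using integrable_Re[OF int[of a b]] integral_Re[OF int[of a b]] integrable_Im[OF int[of a b]] integral_Im[OF int[of a b]]
    by (simp_all only: re im zero zero_complex.sel)
  then have "AE x in lborel. Re (h x) = 0" "AE x in lborel. Im (h x) = 0"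
    by (auto intro!: AE_eq_0_if_box_integrals_eq_0_real)
  then show ?thesis by eventually_elim (simp add: complex_eq_iff)
qed

lemma compact_support_rapid:
  fixes r :: "'a::euclidean_space \<Rightarrow> complex"
  assumes "\<And>x. norm (r x) \<le> B" "\<And>x. R < norm x \<Longrightarrow> r x = 0"
  shows "rapid r"
proof (rule rapidI)
  fix N :: nat
  have B: "0 \<le> B" using assms(1)[of 0] norm_ge_zero order_trans by blast
  have "norm (r x) \<le> B * (1 + \<bar>R\<bar>) ^ N / (1 + norm x) ^ N" for x
  proof (cases "R < norm x")
    case False
    then have "1 \<le> (1 + \<bar>R\<bar>) ^ N / (1 + norm x) ^ N"
      by (simp add: power_divide[symmetric] one_le_power add_pos_nonneg)
    then have "B * 1 \<le> B * ((1 + \<bar>R\<bar>) ^ N / (1 + norm x) ^ N)" by (intro mult_left_mono B)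
    then show ?thesis using assms(1)[of x] by simp
  qed (use assms(2) B in simp)
  then show "\<exists>C. \<forall>x. norm (r x) \<le> C / (1 + norm x) ^ N" by blast
qed

context dyadic_setting
begin

lemma mollifier_test: "test_fun (\<lambda>y. dilate n theta (x - y))"
proof -
  have eq: "(\<lambda>y. dilate n theta (x - y)) = (\<lambda>y. of_real (2 ^ (n * DIM('a))) * theta (2 ^ n *\<^sub>R x + (- (2 ^ n)) *\<^sub>R y))"
    by (simp add: dilate_def scaleR_diff_right)
  have "theta (2 ^ n *\<^sub>R x + (- (2 ^ n)) *\<^sub>R y) = 0" if "norm x + 4 / 3 < norm y" for y
  proof (rule theta_eq_0)
    have "4 / 3 \<le> norm (x - y)" using that norm_triangle_ineq2[of y x] by (simp add: norm_minus_commute)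
    also have "\<dots> \<le> 2 ^ n * norm (x - y)" using mult_right_mono[of 1 "2 ^ n" "norm (x - y)"] by simp
    also have "\<dots> = norm (2 ^ n *\<^sub>R x + (- (2 ^ n)) *\<^sub>R y)" by (simp flip: scaleR_diff_right)
    finally show "4 / 3 \<le> norm (2 ^ n *\<^sub>R x + (- (2 ^ n)) *\<^sub>R y)" .
  qed
  then show ?thesis
    unfolding eq test_fun_def
    by (intro conjI smooth_fun_mult smooth_fun_const smooth_fun_affine test_fun_smooth theta_test exI[of _ "norm x + 4 / 3"]) simp
qed

text \<open>Translates of the dilated bump \<open>theta\<close> are test functions, so every
  mollification of \<open>g\<close> vanishes. Paired with the indicator of a box, the mollifier
  moves to the indicator; as the scale tends to 0, the integral of \<open>g\<close> over the box is
  seen to be zero.\<close>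

theorem fundamental_lemma:
  fixes g :: "'a \<Rightarrow> complex"
  assumes g: "moderate g" and zero: "\<And>\<phi>. \<phi> \<in> schwartz \<Longrightarrow> (LINT x|lborel. g x * \<phi> x) = 0"
  shows "AE x in lborel. g x = 0"
proof -
  note gb[measurable] = moderate_borel[OF g]
  have key: "integrable lborel (\<lambda>x. g x * indicator (box a b) x) \<and> (LINT x|lborel. g x * indicator (box a b) x) = 0" for a b
  proof -
    let ?r = "\<lambda>x. indicator (box a b) x :: complex"
    obtain R where R: "\<And>x. x \<in> box a b \<Longrightarrow> norm x \<le> R"
      using bounded_box[of a b] by (auto simp: bounded_iff)
    have r: "rapid ?r" by (rule compact_support_rapid[of _ 1 R]) (auto simp: indicator_def dest!: R)
    have int: "integrable lborel (\<lambda>x. g x * ?r x)" by (rule moderate_integrable[OF g r]) simp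
    let ?J = "\<lambda>n y. LINT z|lborel. theta z * ?r (y + z /\<^sub>R 2 ^ n)"
    have J0: "(LINT y|lborel. g y * ?J n y) = 0" for n
    proof -
      have "conv (dilate n theta) g x = 0" for x
        using zero[OF test_fun_schwartz[OF mollifier_test[of n x]]] by (simp add: conv_def mult.commute)
      then have "0 = (LINT x|lborel. conv (dilate n theta) g x * ?r x)" by simp
      also have "\<dots> = (LINT y|lborel. g y * (LINT x|lborel. dilate n theta (x - y) * ?r x))"
        by (rule conv_duality(1)[OF g dilate_rapid[OF test_fun_rapid[OF theta_test]] _ r]) auto
      also have "(\<lambda>y. LINT x|lborel. dilate n theta (x - y) * ?r x) = ?J n"
      proof
        fix y
        have "(LINT x|lborel. dilate n theta (x - y) * ?r x) = inverse (2 ^ n) ^ DIM('a) *\<^sub>R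
            (LINT z|lborel. dilate n theta (y + inverse (2 ^ n) *\<^sub>R z - y) * ?r (y + inverse (2 ^ n) *\<^sub>R z))"
          by (subst integral_lborel_affine(1)[of "inverse (2 ^ n)" _ y]) auto
        also have "\<dots> = inverse (2 ^ n) ^ DIM('a) *\<^sub>R (LINT z|lborel. of_real (2 ^ (n * DIM('a))) * (theta z * ?r (y + z /\<^sub>R 2 ^ n)))"
          by (simp add: dilate_def mult.assoc)
        also have "\<dots> = inverse (2 ^ n) ^ DIM('a) *\<^sub>R (of_real (2 ^ (n * DIM('a))) * ?J n y)"
          by (simp only: Bochner_Integration.integral_mult_right_zero)
        also have "\<dots> = ?J n y" by (simp add: scaleR_conv_of_real power_mult power_inverse)
        finally show "(LINT x|lborel. dilate n theta (x - y) * ?r x) = ?J n y" .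
      qed
      finally show ?thesis by simp
    qed
    \<comment> \<open>The mollified indicators are bounded by \<open>ctheta\<close> and vanish
      outside the box enlarged by the support of \<open>theta\<close>, hence outside the ball of
      radius \<open>\<bar>R\<bar> + 2\<close>; since \<open>g\<close> is moderate, this gives an
      integrable majorant.\<close>
    let ?w = "\<lambda>y. norm (g y * (of_real ctheta * indicator (cball 0 (\<bar>R\<bar> + 2)) y))"
    have "(\<lambda>n. LINT y|lborel. g y * ?J n y) \<longlonglongrightarrow> (LINT y|lborel. g y * (of_real ctheta * ?r y))"
    proof (rule integral_dominated_convergence[where w="?w"])
      have "rapid (\<lambda>y. of_real ctheta * indicator (cball 0 (\<bar>R\<bar> + 2)) y :: complex)"
        by (rule compact_support_rapid[of _ "ctheta" "\<bar>R\<bar> + 2"]) (use ctheta(1) in \<open>auto simp: indicator_def\<close>)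
      then show "integrable lborel ?w" 
        by (intro integrable_norm moderate_integrable[OF g])
           (auto intro!: borel_measurable_times borel_measurable_indicator)
      \<comment> \<open>Off the boundary of the box, a null set, the indicator is locally constant,
        and its mollifications converge.\<close>
      have "AE y in lborel. y \<notin> frontier (box a b)"
      proof -
        have "negligible (frontier (box a b))" by (rule negligible_convex_frontier) simp
        then have "AE y in lebesgue. y \<notin> frontier (box a b)" by (simp add: negligible_iff_null_sets AE_not_in)
        then show ?thesis by (simp add: AE_completion_iff)
      qed
      then show "AE y in lborel. (\<lambda>n. g y * ?J n y) \<longlonglongrightarrow> g y * (of_real ctheta * ?r y)"
      proof eventually_elim
        case (elim y)
        have "(\<lambda>n. ?J n y) \<longlonglongrightarrow> (LINT z|lborel. theta z * ?r y)"
        proof (rule integral_dominated_convergence[where w="\<lambda>z. norm (theta z)"])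
          show "integrable lborel (\<lambda>z. norm (theta z))" by (intro integrable_norm theta_integrable)
          show "AE z in lborel. (\<lambda>n. theta z * ?r (y + z /\<^sub>R 2 ^ n)) \<longlonglongrightarrow> theta z * ?r y"
          proof (intro AE_I2 tendsto_mult tendsto_const)
            fix z :: 'a
            have "(\<lambda>n. y + inverse (2 ^ n) *\<^sub>R z) \<longlonglongrightarrow> y + 0 *\<^sub>R z"
              by (intro tendsto_intros LIMSEQ_inverse_realpow_zero) simp
            then have lim: "(\<lambda>n. y + z /\<^sub>R 2 ^ n) \<longlonglongrightarrow> y" by simp
            have "\<forall>\<^sub>F n in sequentially. ?r (y + z /\<^sub>R 2 ^ n) = ?r y"
            proof (cases "y \<in> box a b")
              case True
              from topological_tendstoD[OF lim open_box this] show ?thesis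
                by eventually_elim (simp add: True)
            next
              case False
              then have "y \<in> - closure (box a b)" using elim interior_subset[of "box a b"] by (auto simp: frontier_def)
              from topological_tendstoD[OF lim open_Compl[OF closed_closure] this] show ?thesis
                using closure_subset[of "box a b"] False by (auto elim!: eventually_mono simp: indicator_def)
            qed
            then show "(\<lambda>n. ?r (y + z /\<^sub>R 2 ^ n)) \<longlonglongrightarrow> ?r y" by (rule tendsto_eventually)
          qed
        qed (auto simp: norm_mult indicator_def)
        then have "(\<lambda>n. ?J n y) \<longlonglongrightarrow> of_real ctheta * ?r y" by (simp add: ctheta(2))
        then show ?case by (intro tendsto_intros)
      qed
      show "AE y in lborel. norm (g y * ?J n y) \<le> ?w y" for n
      proof (rule AE_I2)
        fix y
        have "norm (?J n y) \<le> norm (of_real ctheta * indicator (cball 0 (\<bar>R\<bar> + 2)) y :: complex)"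
        proof (cases "y \<in> cball 0 (\<bar>R\<bar> + 2)")
          case True
          have "norm (?J n y) \<le> (LINT z|lborel. norm (theta z * ?r (y + z /\<^sub>R 2 ^ n)))" by (rule integral_norm_bound)
          also have "\<dots> \<le> (LINT z|lborel. norm (theta z))"
          proof (rule integral_mono)
            show "integrable lborel (\<lambda>z. norm (theta z * ?r (y + z /\<^sub>R 2 ^ n)))"
              by (rule Bochner_Integration.integrable_bound[OF integrable_norm[OF theta_integrable]])
                 (auto simp: norm_mult indicator_def)
          qed (auto intro!: integrable_norm theta_integrable simp: norm_mult indicator_def)
          finally show ?thesis using True ctheta(1) by (simp add: ctheta_def norm_mult)
        next
          case False
          have z0: "theta z * ?r (y + z /\<^sub>R 2 ^ n) = 0" for z
          proof (cases "4 / 3 \<le> norm z")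
            case nz: False
            have "norm z / 2 ^ n \<le> norm z / 1" by (intro divide_left_mono) auto
            moreover have "norm (z /\<^sub>R 2 ^ n) = norm z / 2 ^ n" by (simp add: field_simps)
            ultimately have "norm (z /\<^sub>R 2 ^ n) \<le> norm z" by simp
            then have "norm (y + z /\<^sub>R 2 ^ n) > R"
              using norm_triangle_ineq2[of y "- (z /\<^sub>R 2 ^ n)"] nz False by simp
            then show ?thesis using R[of "y + z /\<^sub>R 2 ^ n"] by (auto simp: indicator_def)
          qed (simp add: theta_eq_0)
          have "?J n y = (LINT z|(lborel :: 'a measure). (0::complex))" by (simp only: z0)
          then show ?thesis by simp
        qed
        then show "norm (g y * ?J n y) \<le> ?w y" unfolding norm_mult by (rule mult_left_mono) simp
      qed
    qed auto
    then have "(\<lambda>n. 0) \<longlonglongrightarrow> (LINT y|lborel. g y * (of_real ctheta * ?r y))" by (simp only: J0)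
    then have "(LINT y|lborel. g y * (of_real ctheta * ?r y)) = 0"
      using LIMSEQ_unique[OF tendsto_const] by metis
    then have "(LINT y|lborel. of_real ctheta * (g y * ?r y)) = 0" by (simp only: mult.left_commute)
    then have "of_real ctheta * (LINT y|lborel. g y * ?r y) = 0" by (simp only: Bochner_Integration.integral_mult_right_zero)
    then show ?thesis using int ctheta(1) by simp
  qed
  show ?thesis by (rule AE_eq_0_if_box_integrals_eq_0) (use key gb in auto)
qed

section \<open>Functionals that are represented by functions\<close>

lemma borel_representative:
  fixes f :: "'a \<Rightarrow> complex"
  assumes "f \<in> borel_measurable lebesgue"
  shows "\<exists>g\<in>borel_measurable borel. AE x in lebesgue. f x = g x"
proof -
  have "(\<lambda>x. Re (f x)) \<in> borel_measurable lebesgue" "(\<lambda>x. Im (f x)) \<in> borel_measurable lebesgue"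
    using assms by measurable
  then obtain g1 g2 where g: "g1 \<in> borel_measurable lborel" "AE x in lborel. Re (f x) = g1 x"
    "g2 \<in> borel_measurable lborel" "AE x in lborel. Im (f x) = g2 x"
    using completion_ex_borel_measurable_real by metis
  have "AE x in lebesgue. f x = Complex (g1 x) (g2 x)"
    unfolding AE_completion_iff using g(2,4) by eventually_elim (simp add: complex_eq_iff)
  moreover have "(\<lambda>x. Complex (g1 x) (g2 x)) \<in> borel_measurable borel"
    using g(1,3) by (simp add: Complex_eq)
  ultimately show ?thesis by (intro bexI)
qed

lemma regular_fun_moderate:
  fixes f :: "'a \<Rightarrow> complex"
  assumes f: "regular_fun f"
  shows "\<exists>g. moderate g \<and> (AE x in lebesgue. f x = g x)"
proof -
  have fm: "f \<in> borel_measurable lebesgue" using f by (simp add: regular_fun_def)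
  then obtain g where g: "g \<in> borel_measurable borel" "AE x in lebesgue. f x = g x"
    using borel_representative by blast
  have "moderate g"
    unfolding moderate_def
  proof (intro conjI allI impI)
    fix r :: "'a \<Rightarrow> complex" assume r: "rapid r" "r \<in> borel_measurable borel"
    obtain \<phi> where \<phi>: "\<phi> \<in> schwartz" "\<And>x. norm (r x) \<le> norm (\<phi> x)" using schwartz_majorant[OF r(1)] by blast
    have \<phi>b: "\<phi> \<in> borel_measurable borel" using schwartz_rapid[OF \<phi>(1)] by simp
    have "integrable lebesgue (\<lambda>x. f x * \<phi> x)" using f \<phi>(1) by (simp add: regular_fun_def)
    moreover have "AE x in lebesgue. f x * \<phi> x = g x * \<phi> x" using g(2) by eventually_elim simp
    moreover have "(\<lambda>x. g x * \<phi> x) \<in> borel_measurable lebesgue"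
      using g(1) \<phi>b by (intro measurable_completion) simp
    ultimately have "integrable lebesgue (\<lambda>x. g x * \<phi> x)"
      using integrable_cong_AE_imp by blast
    then have "integrable lborel (\<lambda>x. g x * \<phi> x)"
      using g(1) \<phi>b by (subst (asm) integrable_completion) auto
    then show "integrable lborel (\<lambda>x. g x * r x)"
      by (rule Bochner_Integration.integrable_bound) (use g(1) r(2) \<phi>(2) in \<open>auto simp: norm_mult intro!: mult_left_mono\<close>)
  qed (rule g)
  then show ?thesis using g(2) by blast
qed

text \<open>The functional \<open>u\<close> is tested against the class of all rapidly decreasing measurable functions,
  which contains the functions \<open>fourier (m * inv_fourier \<phi>)\<close> entering the definition of a block.\<close>

definition represents :: "'a distr \<Rightarrow> ('a \<Rightarrow> complex) \<Rightarrow> bool" where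
  "represents u g \<longleftrightarrow> moderate g \<and>
     (\<forall>r. rapid r \<longrightarrow> r \<in> borel_measurable borel \<longrightarrow> u r = (LINT x|lborel. g x * r x))"

lemma distr_of_cong:
  fixes f :: "'a \<Rightarrow> complex"
  assumes "AE x in lebesgue. f x = g x" "f \<in> borel_measurable lebesgue" "g \<in> borel_measurable borel" "r \<in> borel_measurable borel"
  shows "distr_of f r = (LINT x|lborel. g x * r x)"
proof -
  have [measurable]: "r \<in> borel_measurable lebesgue" "g \<in> borel_measurable lebesgue" "f \<in> borel_measurable lebesgue"
    using assms(2-4) by (auto intro!: measurable_completion)
  have "distr_of f r = (LINT x|lebesgue. g x * r x)"
    unfolding distr_of_def using assms(1) by (intro integral_cong_AE) auto
  also have "\<dots> = (LINT x|lborel. g x * r x)"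
    using assms(3,4) by (intro integral_completion) auto
  finally show ?thesis .
qed

lemma represents_distr_of:
  assumes "regular_fun f" "AE x in lebesgue. f x = g x" "moderate g"
  shows "represents (distr_of f) g"
  unfolding represents_def
  using assms distr_of_cong[OF assms(2)] moderate_borel[OF assms(3)] by (auto simp: regular_fun_def)

text \<open>The choice in \<open>fun_of\<close> ranges over regular functions with the same pairings
  with Schwartz functions, and by the fundamental lemma these agree almost everywhere.\<close>

lemma fun_of_represents:
  assumes u: "represents u g"
  shows "AE x in lebesgue. fun_of u x = g x" "fun_of u \<in> borel_measurable lebesgue"
proof -
  have g: "moderate g" using u by (simp add: represents_def)
  note [measurable] = moderate_borel[OF g]
  have u\<phi>: "u \<phi> = (LINT x|lborel. g x * \<phi> x)" if "\<phi> \<in> schwartz" for \<phi>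
    using u schwartz_rapid[OF that] by (simp add: represents_def)
  have "regular_fun g"
    unfolding regular_fun_def
  proof (intro conjI ballI)
    fix \<phi> :: "'a \<Rightarrow> complex" assume "\<phi> \<in> schwartz"
    note \<phi> = schwartz_rapid[OF this]
    show "integrable lebesgue (\<lambda>x. g x * \<phi> x)"
      using moderate_integrable[OF g \<phi>] \<phi>(2) by (subst integrable_completion) auto
  qed (auto intro!: measurable_completion)
  moreover have "distr_of g \<phi> = u \<phi>" if "\<phi> \<in> schwartz" for \<phi>
    using u\<phi>[OF that] schwartz_rapid(2)[OF that] by (subst distr_of_cong[of g g]) (auto intro!: measurable_completion)
  ultimately have "\<exists>h. regular_fun h \<and> (\<forall>\<phi>\<in>schwartz. distr_of h \<phi> = u \<phi>)" by blast
  from someI_ex[OF this] have h: "regular_fun (fun_of u)" "\<And>\<phi>. \<phi> \<in> schwartz \<Longrightarrow> distr_of (fun_of u) \<phi> = u \<phi>"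
    unfolding fun_of_def by auto
  then show hm: "fun_of u \<in> borel_measurable lebesgue" by (simp add: regular_fun_def)
  obtain h' where h': "moderate h'" "AE x in lebesgue. fun_of u x = h' x" using regular_fun_moderate[OF h(1)] by blast
  have "AE x in lborel. g x - h' x = 0"
  proof (rule fundamental_lemma)
    show "moderate (\<lambda>x. g x - h' x)" by (rule moderate_diff[OF g h'(1)])
    fix \<phi> :: "'a \<Rightarrow> complex" assume \<phi>: "\<phi> \<in> schwartz"
    have "(LINT x|lborel. h' x * \<phi> x) = (LINT x|lborel. g x * \<phi> x)"
      using u\<phi>[OF \<phi>] h(2)[OF \<phi>] distr_of_cong[OF h'(2) hm moderate_borel[OF h'(1)] schwartz_rapid(2)[OF \<phi>]] by simp
    then show "(LINT x|lborel. (g x - h' x) * \<phi> x) = 0"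
      using moderate_integrable[OF g schwartz_rapid[OF \<phi>]] moderate_integrable[OF h'(1) schwartz_rapid[OF \<phi>]]
      by (simp add: left_diff_distrib)
  qed
  then have "AE x in lebesgue. g x - h' x = 0" by (rule AE_completion)
  with h'(2) show "AE x in lebesgue. fun_of u x = g x" by eventually_elim simp
qed

text \<open>By Fubini, \<open>fourier\<close> of the symbol times \<open>inv_fourier r\<close> is
  \<open>r\<close> convolved with the reflected kernel \<open>kap J\<close>. This is again rapidly
  decreasing, so the representation of \<open>u\<close> applies to it, and duality moves the kernel
  onto \<open>g\<close>.\<close>

lemma lp_block_represents:
  assumes u: "represents u g"
  shows "represents (lp_block chi rho (int J - 1) u) (conv (kap J) g)"
  unfolding represents_def
proof (intro conjI allI impI)
  have g: "moderate g" using u by (simp add: represents_def)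
  show "moderate (conv (kap J) g)" by (rule moderate_conv[OF g kap_rapid]) simp
  fix r :: "'a \<Rightarrow> complex" assume r: "rapid r" and [measurable]: "r \<in> borel_measurable borel"
  let ?m = "dyadic chi rho (int J - 1)"
  let ?c = "of_real ((2 * pi) ^ DIM('a)) :: complex"
  note mt = dyadic_test[of J]
  note [measurable] = test_fun_borel[OF mt]
  have ir: "integrable lborel r" by (rule rapid_integrable[OF r]) simp
  have [measurable]: "inv_fourier r \<in> borel_measurable borel"
  proof -
    have "inv_fourier r = (\<lambda>\<xi>. (LINT y|lborel. r y * cis (\<xi> \<bullet> y)) / ?c)"
      by (rule ext) (simp add: inv_fourier_lborel)
    then show ?thesis by simp
  qed
  have eq: "fourier (\<lambda>\<xi>. ?m \<xi> * inv_fourier r \<xi>) = (\<lambda>x. LINT y|lborel. kap J (y - x) * r y)"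
  proof
    fix x
    let ?H = "\<lambda>\<xi> y. ?m \<xi> * r y * cis ((y - x) \<bullet> \<xi>)"
    have int: "integrable (lborel \<Otimes>\<^sub>M lborel) (\<lambda>(\<xi>, y). ?H \<xi> y)"
      by (rule integrable_pair_bound[OF _ test_fun_integrable[OF mt] ir]) (auto simp: norm_mult)
    have "fourier (\<lambda>\<xi>. ?m \<xi> * inv_fourier r \<xi>) x = (LINT \<xi>|lborel. (LINT y|lborel. ?H \<xi> y) / ?c)"
    proof -
      have "?m \<xi> * inv_fourier r \<xi> * cis (- (\<xi> \<bullet> x)) = (LINT y|lborel. ?H \<xi> y) / ?c" for \<xi>
      proof -
        have "(LINT y|lborel. ?H \<xi> y) = (LINT y|lborel. (?m \<xi> * cis (- (\<xi> \<bullet> x))) * (r y * cis (\<xi> \<bullet> y)))"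
          by (intro Bochner_Integration.integral_cong refl) (simp add: inner_diff_left cis_diff inner_commute[of \<xi>] mult_ac)
        also have "\<dots> = (?m \<xi> * cis (- (\<xi> \<bullet> x))) * (LINT y|lborel. r y * cis (\<xi> \<bullet> y))"
          by (rule Bochner_Integration.integral_mult_right_zero)
        finally have hh: "(LINT y|lborel. ?H \<xi> y) = \<dots>" .
        show ?thesis unfolding hh by (simp add: inv_fourier_lborel)
      qed
      then show ?thesis by (simp add: fourier_lborel)
    qed
    also have "\<dots> = (LINT \<xi>|lborel. (LINT y|lborel. ?H \<xi> y)) / ?c"
      by (rule Bochner_Integration.integral_divide_zero)
    also have "(LINT \<xi>|lborel. (LINT y|lborel. ?H \<xi> y)) = (LINT y|lborel. (LINT \<xi>|lborel. ?H \<xi> y))"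
      using lborel_pair.Fubini_integral[OF int] by simp
    also have "(\<lambda>y. LINT \<xi>|lborel. ?H \<xi> y) = (\<lambda>y. ?c * (kap J (y - x) * r y))"
    proof
      fix y
      have "(LINT \<xi>|lborel. ?H \<xi> y) = (LINT \<xi>|lborel. r y * (?m \<xi> * cis ((y - x) \<bullet> \<xi>)))"
        by (intro Bochner_Integration.integral_cong refl) (simp add: mult_ac)
      also have "\<dots> = r y * (LINT \<xi>|lborel. ?m \<xi> * cis ((y - x) \<bullet> \<xi>))"
        by (rule Bochner_Integration.integral_mult_right_zero)
      finally have hh: "(LINT \<xi>|lborel. ?H \<xi> y) = \<dots>" .
      show "(LINT \<xi>|lborel. ?H \<xi> y) = ?c * (kap J (y - x) * r y)"
        unfolding hh kap_def by (simp add: inv_fourier_lborel)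
    qed
    also have "(LINT y|lborel. ?c * (kap J (y - x) * r y)) / ?c = (LINT y|lborel. kap J (y - x) * r y)"
      by (simp only: Bochner_Integration.integral_mult_right_zero) simp
    finally show "fourier (\<lambda>\<xi>. ?m \<xi> * inv_fourier r \<xi>) x = (LINT y|lborel. kap J (y - x) * r y)" .
  qed
  have "lp_block chi rho (int J - 1) u r = u (\<lambda>x. LINT y|lborel. kap J (y - x) * r y)"
    unfolding lp_block_def inv_fourier_distr_def mult_distr_def fourier_distr_def eq ..
  also have "\<dots> = (LINT x|lborel. g x * (LINT y|lborel. kap J (y - x) * r y))"
    using u rapid_conv[OF kap_rapid _ r, of J] by (simp add: represents_def)
  also have "\<dots> = (LINT x|lborel. conv (kap J) g x * r x)"
    by (rule conv_duality(1)[OF g kap_rapid _ r, symmetric]) auto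
  finally show "lp_block chi rho (int J - 1) u r = (LINT x|lborel. conv (kap J) g x * r x)" .
qed

lemma lp_fun_represents:
  assumes u: "represents u g"
  shows "AE x in lebesgue. lp_fun chi rho (int J - 1) u x = conv (kap J) g x"
    "lp_fun chi rho (int J - 1) u \<in> borel_measurable lebesgue"
  using fun_of_represents[OF lp_block_represents[OF u]] by (auto simp: lp_fun_def)

end

section \<open>Reproducing formula and paraproducts\<close>

text \<open>Minkowski's inequality makes the sum of absolute values finite almost everywhere. The
  third bound keeps that sum in the same space, where it can serve as a dominating function.\<close>

lemma lnorm_suminf:
  fixes h :: "nat \<Rightarrow> 'a::euclidean_space \<Rightarrow> complex"
  assumes [measurable]: "\<And>J. h J \<in> borel_measurable borel" and s: "0 \<le> s" "s \<le> 1"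
    and fin: "(\<Sum>J. lnorm s (h J)) < top"
  shows "AE x in lborel. summable (\<lambda>J. norm (h J x))"
    and "lnorm s (\<lambda>x. \<Sum>J. h J x) \<le> (\<Sum>J. lnorm s (h J))"
    and "lnorm s (\<lambda>x. of_real (\<Sum>J. norm (h J x))) \<le> (\<Sum>J. lnorm s (h J))"
proof -
  have le: "rnorm lborel s (\<lambda>x. \<Sum>J. ennreal (norm (h J x))) \<le> (\<Sum>J. lnorm s (h J))"
    unfolding lnorm_def by (rule rnorm_suminf_le) (use s lborel.sigma_finite_measure_axioms in auto)
  then have "rnorm lborel s (\<lambda>x. \<Sum>J. ennreal (norm (h J x))) < top" using fin by (rule order_le_less_trans)
  then have "AE x in lborel. (\<Sum>J. ennreal (norm (h J x))) < top"
    by (intro rnorm_finite_imp_AE) auto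
  then show ae: "AE x in lborel. summable (\<lambda>J. norm (h J x))"
    by eventually_elim (auto intro!: summable_suminf_not_top simp: less_top)
  have "lnorm s (\<lambda>x. of_real (\<Sum>J. norm (h J x))) \<le> rnorm lborel s (\<lambda>x. \<Sum>J. ennreal (norm (h J x)))"
    unfolding lnorm_def
  proof (rule rnorm_mono_AE)
    show "AE x in lborel. ennreal (norm (complex_of_real (\<Sum>J. norm (h J x)))) \<le> (\<Sum>J. ennreal (norm (h J x)))"
      using ae by eventually_elim (simp add: suminf_nonneg suminf_ennreal2 abs_of_nonneg)
  qed (use s in auto)
  with le show "lnorm s (\<lambda>x. of_real (\<Sum>J. norm (h J x))) \<le> (\<Sum>J. lnorm s (h J))" by (rule order_trans[rotated])
  have "lnorm s (\<lambda>x. \<Sum>J. h J x) \<le> rnorm lborel s (\<lambda>x. \<Sum>J. ennreal (norm (h J x)))"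
    unfolding lnorm_def
  proof (rule rnorm_mono_AE)
    show "AE x in lborel. ennreal (norm (\<Sum>J. h J x)) \<le> (\<Sum>J. ennreal (norm (h J x)))"
      using ae
    proof eventually_elim
      case (elim x)
      then have "ennreal (norm (\<Sum>J. h J x)) \<le> ennreal (\<Sum>J. norm (h J x))"
        by (intro ennreal_leI summable_norm)
      also have "\<dots> = (\<Sum>J. ennreal (norm (h J x)))" using elim by (simp add: suminf_ennreal2)
      finally show ?case .
    qed
  qed (use s in auto)
  with le show "lnorm s (\<lambda>x. \<Sum>J. h J x) \<le> (\<Sum>J. lnorm s (h J))" by (rule order_trans[rotated])
qed

lemma lnorm_mult_le:
  assumes [measurable]: "f \<in> borel_measurable borel" "g \<in> borel_measurable borel" and "0 \<le> s" "0 \<le> t"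
  shows "lnorm (s + t) (\<lambda>x. f x * g x) \<le> lnorm s f * lnorm t g"
  using rnorm_mult_le[of "\<lambda>x. ennreal (norm (f x))" lborel "\<lambda>x. ennreal (norm (g x))" s t] assms
  by (simp add: lnorm_def norm_mult ennreal_mult)

lemma lnorm_sum_le:
  fixes h :: "'i \<Rightarrow> 'a::euclidean_space \<Rightarrow> complex"
  assumes "finite I" and [measurable]: "\<And>i. i \<in> I \<Longrightarrow> h i \<in> borel_measurable borel" and s: "0 \<le> s" "s \<le> 1"
  shows "lnorm s (\<lambda>x. \<Sum>i\<in>I. h i x) \<le> (\<Sum>i\<in>I. lnorm s (h i))"
proof -
  have "lnorm s (\<lambda>x. \<Sum>i\<in>I. h i x) \<le> rnorm lborel s (\<lambda>x. \<Sum>i\<in>I. ennreal (norm (h i x)))"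
    unfolding lnorm_def using s
    by (intro rnorm_mono_AE AE_I2) (auto intro!: ennreal_leI norm_sum simp: sum_ennreal)
  also have "\<dots> \<le> (\<Sum>i\<in>I. lnorm s (h i))"
    unfolding lnorm_def by (rule rnorm_sum_le) (use assms lborel.sigma_finite_measure_axioms in auto)
  finally show ?thesis .
qed

lemma lnorm_cong_AE:
  assumes "f \<in> borel_measurable borel" "g \<in> borel_measurable borel" "AE x in lborel. f x = g x" "0 \<le> s"
  shows "lnorm s f = lnorm s g"
  unfolding lnorm_def using assms by (intro rnorm_cong_AE) (auto elim!: eventually_mono)

lemma lnorm_add_le:
  assumes [measurable]: "f \<in> borel_measurable borel" "g \<in> borel_measurable borel" and s: "0 \<le> s" "s \<le> 1"
  shows "lnorm s (\<lambda>x. f x + g x) \<le> lnorm s f + lnorm s g"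
  using lnorm_sum_le[of "UNIV :: bool set" "\<lambda>b. if b then f else g" s] assms
  by (simp add: UNIV_bool add.commute)

lemma lnorm_minus: "lnorm s (\<lambda>x. - f x) = lnorm s f"
  by (simp add: lnorm_def)

lemma lnorm_diff_le:
  assumes [measurable]: "f \<in> borel_measurable borel" "g \<in> borel_measurable borel" and s: "0 \<le> s" "s \<le> 1"
  shows "lnorm s (\<lambda>x. f x - g x) \<le> lnorm s f + lnorm s g"
  using lnorm_add_le[of f "\<lambda>x. - g x" s] assms by (simp add: lnorm_minus)

context dyadic_setting
begin

definition B :: "nat \<Rightarrow> ('a \<Rightarrow> complex) \<Rightarrow> 'a \<Rightarrow> complex" where
  "B J g = conv (kap J) g"

text \<open>The low-frequency part \<open>S K g\<close> is the sum of the blocks \<open>B J g\<close> with \<open>J < K - 1\<close>.\<close>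

definition S :: "nat \<Rightarrow> ('a \<Rightarrow> complex) \<Rightarrow> 'a \<Rightarrow> complex" where
  "S K g = (if K < 2 then (\<lambda>_. 0) else conv (P (K - 2)) g)"

lemma B_borel [measurable]: "g \<in> borel_measurable borel \<Longrightarrow> B J g \<in> borel_measurable borel"
  unfolding B_def by measurable

lemma S_borel [measurable]: "g \<in> borel_measurable borel \<Longrightarrow> S K g \<in> borel_measurable borel"
  by (cases "K < 2") (auto simp: S_def intro!: conv_borel)

lemma B_sum:
  assumes g: "moderate g" shows "(\<Sum>J\<le>n. B J g x) = conv (P n) g x"
proof (induction n)
  case 0
  then show ?case by (simp add: B_def kap_0)
next
  case (Suc n)
  have "B (Suc n) g x = conv (P (Suc n)) g x - conv (P n) g x"
    unfolding B_def conv_def kap_Suc left_diff_distrib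
    by (intro Bochner_Integration.integral_diff conv_integrable[OF g P_rapid] P_borel)
  then show ?case using Suc by simp
qed

lemma S_eq:
  assumes g: "moderate g" shows "S K g x = (\<Sum>J | J + 1 < K. B J g x)"
proof (cases "K < 2")
  case False
  then have "{J. J + 1 < K} = {..K - 2}" by auto
  then show ?thesis using False by (simp add: S_def B_sum[OF g])
next
  case True
  then have "{J. J + 1 < K} = {}" by auto
  then show ?thesis using True by (simp add: S_def)
qed

text \<open>Duality moves the mollifier to \<phi>, and the mollified \<phi> converge pointwise. The
  majorant is their supremum over \<open>n\<close>, which still decreases rapidly and is hence
  integrable against the moderate function \<open>f\<close>.\<close>

lemma P_approx:
  fixes f \<phi> :: "'a \<Rightarrow> complex"
  assumes f: "moderate f" and \<phi>: "\<phi> \<in> schwartz"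
  shows "(\<lambda>n. LINT x|lborel. conv (P n) f x * \<phi> x) \<longlonglongrightarrow> (LINT x|lborel. f x * \<phi> x)"
proof -
  note \<phi>r = schwartz_rapid[OF \<phi>]
  note [measurable] = moderate_borel[OF f] \<phi>r(2) inv_fourier_borel[OF chi_test]
  let ?Q = "inv_fourier chi"
  have Q: "rapid ?Q" by (rule inv_fourier_rapid[OF chi_test])
  have cont: "continuous_on UNIV \<phi>" using \<phi> by (auto simp: schwartz_def intro: smooth_fun_continuous)
  define I where "I n y = (LINT z|lborel. ?Q z * \<phi> (y + z /\<^sub>R 2 ^ n))" for n y
  have [measurable]: "I n \<in> borel_measurable borel" for n unfolding I_def by measurable
  have eq: "(LINT x|lborel. conv (P n) f x * \<phi> x) = (LINT y|lborel. f y * I n y)" for n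
  proof -
    have "(LINT x|lborel. conv (P n) f x * \<phi> x) = (LINT y|lborel. f y * (LINT x|lborel. P n (x - y) * \<phi> x))"
      by (rule conv_duality(1)[OF f P_rapid _ \<phi>r(1)]) auto
    also have "(\<lambda>y. LINT x|lborel. P n (x - y) * \<phi> x) = I n"
    proof
      fix y
      have "(LINT x|lborel. P n (x - y) * \<phi> x) = inverse (2 ^ n) ^ DIM('a) *\<^sub>R
          (LINT z|lborel. P n (y + inverse (2 ^ n) *\<^sub>R z - y) * \<phi> (y + inverse (2 ^ n) *\<^sub>R z))"
        by (subst integral_lborel_affine(1)[of "inverse (2 ^ n)" _ y]) auto
      also have "\<dots> = inverse (2 ^ n) ^ DIM('a) *\<^sub>R (LINT z|lborel. of_real (2 ^ (n * DIM('a))) * (?Q z * \<phi> (y + z /\<^sub>R 2 ^ n)))"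
        by (simp add: P_def dilate_def mult.assoc)
      also have "\<dots> = inverse (2 ^ n) ^ DIM('a) *\<^sub>R (of_real (2 ^ (n * DIM('a))) * I n y)"
        by (simp only: Bochner_Integration.integral_mult_right_zero I_def)
      also have "\<dots> = I n y" by (simp add: scaleR_conv_of_real power_mult power_inverse)
      finally show "(LINT x|lborel. P n (x - y) * \<phi> x) = I n y" .
    qed
    finally show ?thesis .
  qed
  have bound: "\<exists>C. \<forall>n y. norm (I n y) \<le> C / (1 + norm y) ^ N" for N
  proof -
    obtain C where C: "C > 0" "\<And>x. norm (\<phi> x) \<le> C / (1 + norm x) ^ N" using rapid_ex[OF \<phi>r(1), of N] by blast
    \<comment> \<open>The kernel absorbs the weight produced by Peetre's inequality, uniformly in
      \<open>n\<close> because the factor inverse 2^n only shrinks \<open>z\<close>.\<close>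
    have Qr: "rapid (\<lambda>z. (1 + norm z) ^ N *\<^sub>R ?Q z)"
      unfolding rapid_def
    proof
      fix M
      obtain D where "\<And>x. (1 + norm x) ^ (M + N) * norm (?Q x) \<le> D" using Q by (auto simp: rapid_def)
      then show "\<exists>C. \<forall>x. (1 + norm x) ^ M * norm ((1 + norm x) ^ N *\<^sub>R ?Q x) \<le> C"
        by (intro exI[of _ D]) (simp add: power_add mult.assoc)
    qed
    have Qi: "integrable lborel (\<lambda>z. norm ((1 + norm z) ^ N *\<^sub>R ?Q z))"
      by (intro integrable_norm rapid_integrable[OF Qr]) measurable
    have "norm (I n y) \<le> C * (LINT z|lborel. norm ((1 + norm z) ^ N *\<^sub>R ?Q z)) / (1 + norm y) ^ N" for n y
    proof -
      have le: "norm (?Q z * \<phi> (y + z /\<^sub>R 2 ^ n)) \<le> (C / (1 + norm y) ^ N) * norm ((1 + norm z) ^ N *\<^sub>R ?Q z)" for z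
      proof -
        have "norm z / 2 ^ n \<le> norm z / 1" by (intro divide_left_mono) auto
        moreover have "norm (z /\<^sub>R 2 ^ n) = norm z / 2 ^ n" by (simp add: field_simps)
        ultimately have nz: "norm (z /\<^sub>R 2 ^ n) \<le> norm z" by simp
        have "1 + norm y \<le> (1 + norm (y - (y + z /\<^sub>R 2 ^ n))) * (1 + norm (y + z /\<^sub>R 2 ^ n))" by (rule peetre)
        also have "\<dots> \<le> (1 + norm z) * (1 + norm (y + z /\<^sub>R 2 ^ n))" using nz by (intro mult_right_mono) auto
        finally have "(1 + norm y) ^ N \<le> (1 + norm z) ^ N * (1 + norm (y + z /\<^sub>R 2 ^ n)) ^ N"
          unfolding power_mult_distrib[symmetric] by (intro power_mono) auto
        moreover have "(1 + norm y) ^ N > 0" "(1 + norm (y + z /\<^sub>R 2 ^ n)) ^ N > 0"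
          by (auto intro!: zero_less_power add_pos_nonneg)
        ultimately have "C / (1 + norm (y + z /\<^sub>R 2 ^ n)) ^ N \<le> C / (1 + norm y) ^ N * (1 + norm z) ^ N"
          using C(1) by (simp add: field_simps)
        then have "norm (\<phi> (y + z /\<^sub>R 2 ^ n)) \<le> C / (1 + norm y) ^ N * (1 + norm z) ^ N"
          by (rule order_trans[OF C(2)])
        then have "norm (?Q z) * norm (\<phi> (y + z /\<^sub>R 2 ^ n)) \<le> norm (?Q z) * (C / (1 + norm y) ^ N * (1 + norm z) ^ N)"
          by (rule mult_left_mono) simp
        then show ?thesis by (simp add: norm_mult mult_ac)
      qed
      have ib: "integrable lborel (\<lambda>z. (C / (1 + norm y) ^ N) * norm ((1 + norm z) ^ N *\<^sub>R ?Q z))"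
        using Qi by (rule integrable_mult_right)
      have ia: "integrable lborel (\<lambda>z. ?Q z * \<phi> (y + z /\<^sub>R 2 ^ n))"
        by (rule Bochner_Integration.integrable_bound[OF ib], measurable, intro AE_I2 order_trans[OF le])
           (simp only: real_norm_def abs_ge_self)
      have "norm (I n y) \<le> (LINT z|lborel. norm (?Q z * \<phi> (y + z /\<^sub>R 2 ^ n)))"
        unfolding I_def by (rule integral_norm_bound)
      also have "\<dots> \<le> (LINT z|lborel. (C / (1 + norm y) ^ N) * norm ((1 + norm z) ^ N *\<^sub>R ?Q z))"
        by (rule integral_mono[OF integrable_norm[OF ia] ib]) (rule le)
      also have "\<dots> = (C / (1 + norm y) ^ N) * (LINT z|lborel. norm ((1 + norm z) ^ N *\<^sub>R ?Q z))"
        by (rule Bochner_Integration.integral_mult_right_zero)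
      finally show ?thesis by simp
    qed
    then show ?thesis by blast
  qed
  obtain C0 where C0: "\<And>n y. norm (I n y) \<le> C0" using bound[of 0] by auto
  define r where "r y = (SUP n. norm (I n y))" for y
  have bdd: "bdd_above (range (\<lambda>n. norm (I n y)))" for y by (rule bdd_aboveI[of _ C0]) (auto simp: C0)
  have [measurable]: "r \<in> borel_measurable borel"
    unfolding r_def by (rule borel_measurable_cSUP) (use bdd in auto)
  have Ir: "norm (I n y) \<le> r y" for n y unfolding r_def by (rule cSUP_upper) (use bdd in auto)
  have rn: "0 \<le> r y" for y by (rule order_trans[OF norm_ge_zero Ir])
  have rr: "rapid (\<lambda>y. complex_of_real (r y))"
  proof (rule rapidI)
    fix N
    obtain C where "\<And>n y. norm (I n y) \<le> C / (1 + norm y) ^ N" using bound[of N] by blast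
    then have "r y \<le> C / (1 + norm y) ^ N" for y unfolding r_def by (intro cSUP_least) auto
    then show "\<exists>C. \<forall>x. norm (complex_of_real (r x)) \<le> C / (1 + norm x) ^ N" using rn by auto
  qed
  have lim: "(\<lambda>n. I n y) \<longlonglongrightarrow> \<phi> y" for y
  proof -
    obtain M where M: "M \<ge> 0" "\<And>x. norm (\<phi> x) \<le> M" using rapid_bounded[OF \<phi>r(1)] by blast
    have Qi: "integrable lborel ?Q" by (rule rapid_integrable[OF Q]) simp
    have "(\<lambda>n. I n y) \<longlonglongrightarrow> (LINT z|lborel. ?Q z * \<phi> y)"
      unfolding I_def
    proof (rule integral_dominated_convergence[where w="\<lambda>z. norm (?Q z) * M"])
      show "integrable lborel (\<lambda>z. norm (?Q z) * M)" by (intro integrable_mult_left integrable_norm Qi)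
      show "AE z in lborel. (\<lambda>n. ?Q z * \<phi> (y + z /\<^sub>R 2 ^ n)) \<longlonglongrightarrow> ?Q z * \<phi> y"
      proof (intro AE_I2 tendsto_mult tendsto_const)
        fix z :: 'a
        have "(\<lambda>n. y + inverse (2 ^ n) *\<^sub>R z) \<longlonglongrightarrow> y + 0 *\<^sub>R z"
          by (intro tendsto_intros LIMSEQ_inverse_realpow_zero) simp
        then show "(\<lambda>n. \<phi> (y + z /\<^sub>R 2 ^ n)) \<longlonglongrightarrow> \<phi> y"
          using continuous_on_tendsto_compose[OF cont, of "\<lambda>n. y + z /\<^sub>R 2 ^ n" y sequentially] by simp
      qed
      show "AE z in lborel. norm (?Q z * \<phi> (y + z /\<^sub>R 2 ^ n)) \<le> norm (?Q z) * M" for n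
        unfolding norm_mult by (intro AE_I2 mult_left_mono M) simp
    qed measurable
    moreover have "(LINT z|lborel. ?Q z) = 1"
      using P_integral[of 0] by (simp add: P_def dilate_def)
    ultimately show ?thesis by simp
  qed
  show ?thesis
    unfolding eq
  proof (rule integral_dominated_convergence[where w="\<lambda>y. norm (f y * of_real (r y))"])
    show "integrable lborel (\<lambda>y. norm (f y * of_real (r y)))"
      by (intro integrable_norm moderate_integrable[OF f rr]) measurable
    show "AE y in lborel. (\<lambda>n. f y * I n y) \<longlonglongrightarrow> f y * \<phi> y"
      by (intro AE_I2 tendsto_mult tendsto_const lim)
    show "AE y in lborel. norm (f y * I n y) \<le> norm (f y * of_real (r y))" for n
      unfolding norm_mult using Ir rn by (intro AE_I2 mult_left_mono) auto
  qed measurable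
qed

text \<open>The partial sums of the blocks are \<open>conv (P n) f\<close>. Summable norms make them
  converge almost everywhere under a common majorant, while \<open>P_approx\<close> gives
  convergence to \<open>f\<close> against Schwartz functions; the fundamental lemma identifies the
  two limits.\<close>

lemma reproducing_formula:
  fixes f :: "'a \<Rightarrow> complex"
  assumes f: "moderate f" and s: "0 \<le> s" "s \<le> 1" and fin: "(\<Sum>J. lnorm s (B J f)) < top"
  shows "AE x in lborel. f x = (\<Sum>J. B J f x)"
proof -
  note [measurable] = moderate_borel[OF f]
  have ae: "AE x in lborel. summable (\<lambda>J. norm (B J f x))" by (rule lnorm_suminf(1)[OF _ s fin]) simp
  let ?h = "\<lambda>x. \<Sum>J. B J f x" and ?w = "\<lambda>x. complex_of_real (\<Sum>J. norm (B J f x))"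
  have h: "moderate ?h"
    by (rule moderate_lnorm[OF _ order_le_less_trans[OF lnorm_suminf(2)[OF _ s fin] fin] s]) auto
  have w: "moderate ?w"
    by (rule moderate_lnorm[OF _ order_le_less_trans[OF lnorm_suminf(3)[OF _ s fin] fin] s]) auto
  have "AE x in lborel. f x - ?h x = 0"
  proof (rule fundamental_lemma)
    show "moderate (\<lambda>x. f x - ?h x)" by (rule moderate_diff[OF f h])
    fix \<phi> :: "'a \<Rightarrow> complex" assume \<phi>: "\<phi> \<in> schwartz"
    note \<phi>r = schwartz_rapid[OF \<phi>]
    note [measurable] = \<phi>r(2)
    have "(\<lambda>n. LINT x|lborel. conv (P n) f x * \<phi> x) \<longlonglongrightarrow> (LINT x|lborel. ?h x * \<phi> x)"
    proof (rule integral_dominated_convergence[where w="\<lambda>x. norm (?w x * \<phi> x)"])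
      show "integrable lborel (\<lambda>x. norm (?w x * \<phi> x))" by (intro integrable_norm moderate_integrable[OF w \<phi>r])
      show "AE x in lborel. (\<lambda>n. conv (P n) f x * \<phi> x) \<longlonglongrightarrow> ?h x * \<phi> x"
        using ae
      proof eventually_elim
        case (elim x)
        then have "(\<lambda>n. \<Sum>J\<le>n. B J f x) \<longlonglongrightarrow> ?h x" by (rule summable_LIMSEQ'[OF summable_norm_cancel])
        then show ?case unfolding B_sum[OF f] by (intro tendsto_mult tendsto_const)
      qed
      show "AE x in lborel. norm (conv (P n) f x * \<phi> x) \<le> norm (?w x * \<phi> x)" for n
        using ae
      proof eventually_elim
        case (elim x)
        have "norm (conv (P n) f x) \<le> (\<Sum>J\<le>n. norm (B J f x))"
          unfolding B_sum[OF f, symmetric] by (rule norm_sum)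
        also have "\<dots> \<le> (\<Sum>J. norm (B J f x))" by (rule sum_le_suminf[OF elim]) auto
        also have "\<dots> \<le> norm (?w x)" by simp
        finally show ?case unfolding norm_mult by (rule mult_right_mono) simp
      qed
    qed measurable
    with P_approx[OF f \<phi>] have "(LINT x|lborel. f x * \<phi> x) = (LINT x|lborel. ?h x * \<phi> x)"
      by (rule LIMSEQ_unique)
    then show "(LINT x|lborel. (f x - ?h x) * \<phi> x) = 0"
      using moderate_integrable[OF f \<phi>r] moderate_integrable[OF h \<phi>r] by (simp add: left_diff_distrib)
  qed
  then show ?thesis by eventually_elim simp
qed

lemma conv_lnorm_le_P: "\<exists>C. \<forall>n. (\<integral>\<^sup>+w. ennreal (norm (P n w)) \<partial>lborel) \<le> ennreal C"
proof -
  let ?Q = "inv_fourier chi"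
  note [measurable] = inv_fourier_borel[OF chi_test]
  have Q: "integrable lborel ?Q" by (rule rapid_integrable[OF inv_fourier_rapid[OF chi_test]]) simp
  have "(\<integral>\<^sup>+w. ennreal (norm (P n w)) \<partial>lborel) = ennreal (LINT z|lborel. norm (?Q z))" for n
  proof -
    have "(\<integral>\<^sup>+w. ennreal (norm (P n w)) \<partial>lborel)
        = ennreal (\<bar>inverse (2 ^ n)\<bar> ^ DIM('a)) * (\<integral>\<^sup>+z. ennreal (norm (P n (0 + inverse (2 ^ n) *\<^sub>R z))) \<partial>lborel)"
      by (rule nn_integral_lborel_affine) auto
    also have "(\<integral>\<^sup>+z. ennreal (norm (P n (0 + inverse (2 ^ n) *\<^sub>R z))) \<partial>lborel)
        = (\<integral>\<^sup>+z. ennreal (2 ^ (n * DIM('a))) * ennreal (norm (?Q z)) \<partial>lborel)"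
      by (intro nn_integral_cong) (simp add: P_def dilate_def norm_mult norm_power ennreal_mult)
    also have "\<dots> = ennreal (2 ^ (n * DIM('a))) * ennreal (LINT z|lborel. norm (?Q z))"
      using integrable_norm[OF Q] by (simp add: nn_integral_cmult nn_integral_eq_integral)
    also have "ennreal (\<bar>inverse (2 ^ n)\<bar> ^ DIM('a)) * \<dots> = ennreal (LINT z|lborel. norm (?Q z))"
      by (simp add: power_mult power_inverse flip: ennreal_mult)
    finally show ?thesis .
  qed
  then show ?thesis by (intro exI[of _ "LINT z|lborel. norm (?Q z)"]) simp
qed

lemma S_lnorm_le: "\<exists>C. \<forall>K g s. g \<in> borel_measurable borel \<longrightarrow> 0 \<le> s \<longrightarrow> s \<le> 1 \<longrightarrow> lnorm s (S K g) \<le> ennreal C * lnorm s g"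
proof -
  obtain C where C: "\<And>n. (\<integral>\<^sup>+w. ennreal (norm (P n w)) \<partial>lborel) \<le> ennreal C" using conv_lnorm_le_P by blast
  have "lnorm s (S K g) \<le> ennreal C * lnorm s g" if [measurable]: "g \<in> borel_measurable borel" and s: "0 \<le> s" "s \<le> 1" for K g s
  proof (cases "K < 2")
    case True
    have "lnorm s (\<lambda>_::'a. 0) = 0"
      using s by (cases "s = 0") (auto simp: lnorm_def rnorm_def intro!: antisym[OF esssup_I])
    then show ?thesis using True by (simp add: S_def)
  next
    case False
    have "lnorm s (conv (P (K - 2)) g) \<le> (\<integral>\<^sup>+w. ennreal (norm (P (K - 2) w)) \<partial>lborel) * lnorm s g"
      by (rule lnorm_conv_le) (use s in auto)
    also have "\<dots> \<le> ennreal C * lnorm s g" by (intro mult_right_mono C) simp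
    finally show ?thesis using False by (simp add: S_def)
  qed
  then show ?thesis by blast
qed

section \<open>The paraproduct as an almost everywhere convergent series\<close>

definition para :: "('a \<Rightarrow> complex) \<Rightarrow> ('a \<Rightarrow> complex) \<Rightarrow> 'a \<Rightarrow> complex" where
  "para g f x = (\<Sum>K. S K g x * B K f x)"

lemma para_borel [measurable]:
  assumes [measurable]: "g \<in> borel_measurable borel" "f \<in> borel_measurable borel"
  shows "para g f \<in> borel_measurable borel"
  unfolding para_def[abs_def] by measurable

lemma para_terms_le:
  assumes [measurable]: "g \<in> borel_measurable borel" "f \<in> borel_measurable borel"
    and st: "0 \<le> s" "0 \<le> t" "s + t \<le> 1"
    and C: "\<And>K. lnorm s (S K g) \<le> C * lnorm s g"
  shows "(\<Sum>K. lnorm (s + t) (\<lambda>x. S K g x * B K f x)) \<le> C * lnorm s g * (\<Sum>K. lnorm t (B K f))"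
proof -
  have "lnorm (s + t) (\<lambda>x. S K g x * B K f x) \<le> C * lnorm s g * lnorm t (B K f)" for K
  proof -
    have "lnorm (s + t) (\<lambda>x. S K g x * B K f x) \<le> lnorm s (S K g) * lnorm t (B K f)"
      by (rule lnorm_mult_le) (use st in auto)
    also have "\<dots> \<le> C * lnorm s g * lnorm t (B K f)" by (intro mult_right_mono C) simp
    finally show ?thesis .
  qed
  then have "(\<Sum>K. lnorm (s + t) (\<lambda>x. S K g x * B K f x)) \<le> (\<Sum>K. C * lnorm s g * lnorm t (B K f))"
    by (intro suminf_le) auto
  then show ?thesis by simp
qed

lemma para_terms_finite:
  assumes "g \<in> borel_measurable borel" "f \<in> borel_measurable borel"
    and st: "0 \<le> s" "0 \<le> t" "s + t \<le> 1"
    and g: "lnorm s g < top" and f: "(\<Sum>K. lnorm t (B K f)) < top"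
  shows "(\<Sum>K. lnorm (s + t) (\<lambda>x. S K g x * B K f x)) < top"
proof -
  obtain C where C: "\<And>K g s. g \<in> borel_measurable borel \<Longrightarrow> 0 \<le> s \<Longrightarrow> s \<le> 1 \<Longrightarrow> lnorm s (S K g) \<le> ennreal C * lnorm s g"
    using S_lnorm_le by blast
  have "(\<Sum>K. lnorm (s + t) (\<lambda>x. S K g x * B K f x)) \<le> ennreal C * lnorm s g * (\<Sum>K. lnorm t (B K f))"
    using st by (intro para_terms_le assms C) auto
  also have "\<dots> < top" using g f by (simp add: ennreal_mult_less_top)
  finally show ?thesis .
qed

text \<open>Summability of the block norms of both factors and Hoelder's inequality with exponents
  \<open>s\<close>, \<open>t\<close>, \<open>1 - (s + t)\<close> make the double series absolutely
  convergent after pairing with \<open>r\<close>. Sum and integral may then be exchanged, and the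
  inner finite sum over \<open>J\<close> is \<open>S K g\<close>.\<close>

theorem paraprod_represents:
  assumes u: "represents u g" and v: "represents v f"
    and st: "0 \<le> s" "0 \<le> t" "s + t \<le> 1"
    and gfin: "lnorm s g < top" and g: "(\<Sum>J. lnorm s (B J g)) < top" and f: "(\<Sum>K. lnorm t (B K f)) < top"
  shows "represents (paraprod chi rho u v) (para g f)"
  unfolding represents_def
proof (intro conjI allI impI)
  have gm: "moderate g" and fm: "moderate f" using u v by (auto simp: represents_def)
  note [measurable] = moderate_borel[OF gm] moderate_borel[OF fm]
  note pt = para_terms_finite[OF moderate_borel[OF gm] moderate_borel[OF fm] st gfin f]
  have pn: "lnorm (s + t) (para g f) < top"
    unfolding para_def[abs_def]
    by (rule order_le_less_trans[OF lnorm_suminf(2)[OF _ _ st(3) pt] pt]) (use st in auto)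
  show "moderate (para g f)" by (rule moderate_lnorm[OF _ pn _ st(3)]) (use st in auto)
  fix r :: "'a \<Rightarrow> complex" assume r: "rapid r" and [measurable]: "r \<in> borel_measurable borel"
  define h where "h i x = (case i of (K, J) \<Rightarrow> if J + 1 < K then B J g x * B K f x * r x else 0)" for i :: "nat \<times> nat" and x
  have h[measurable]: "h i \<in> borel_measurable borel" for i unfolding h_def by (cases i) simp
  have hm[measurable]: "(\<lambda>(i, x). h i x) \<in> borel_measurable (count_space UNIV \<Otimes>\<^sub>M lborel)"
    by (rule measurable_pair_measure_countable1) auto
  interpret pair_sigma_finite "count_space (UNIV :: (nat \<times> nat) set)" "lborel :: 'a measure"
    by (intro pair_sigma_finite.intro sigma_finite_measure_count_space_countable lborel.sigma_finite_measure_axioms) auto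
  have int: "integrable (count_space UNIV \<Otimes>\<^sub>M lborel) (\<lambda>(i, x). h i x)"
  proof (rule integrableI_bounded)
    let ?R = "lnorm (1 - (s + t)) r"
    have R: "?R < top" by (rule rapid_lnorm_finite[OF r]) (use st in auto)
    have le: "(\<integral>\<^sup>+x. ennreal (norm (h (K, J) x)) \<partial>lborel) \<le> lnorm t (B K f) * ?R * lnorm s (B J g)" for K J
    proof -
      have "(\<integral>\<^sup>+x. ennreal (norm (h (K, J) x)) \<partial>lborel) \<le> (\<integral>\<^sup>+x. ennreal (norm (B J g x * B K f x * r x)) \<partial>lborel)"
        by (intro nn_integral_mono) (auto simp: h_def)
      also have "\<dots> = lnorm ((s + t) + (1 - (s + t))) (\<lambda>x. (B J g x * B K f x) * r x)"
        by (simp add: lnorm_def rnorm_1)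
      also have "\<dots> \<le> lnorm (s + t) (\<lambda>x. B J g x * B K f x) * ?R"
        by (rule lnorm_mult_le) (use st in auto)
      also have "\<dots> \<le> lnorm s (B J g) * lnorm t (B K f) * ?R"
        by (intro mult_right_mono lnorm_mult_le) (use st in auto)
      finally show ?thesis by (simp add: mult_ac)
    qed
    have "(\<integral>\<^sup>+z. ennreal (norm (case z of (i, x) \<Rightarrow> h i x)) \<partial>(count_space UNIV \<Otimes>\<^sub>M lborel))
        = (\<integral>\<^sup>+i. \<integral>\<^sup>+x. ennreal (norm (h i x)) \<partial>lborel \<partial>count_space UNIV)"
      by (subst lborel.nn_integral_fst[symmetric]) auto
    also have "\<dots> = (\<integral>\<^sup>+K. \<integral>\<^sup>+J. (\<integral>\<^sup>+x. ennreal (norm (h (K, J) x)) \<partial>lborel) \<partial>count_space UNIV \<partial>count_space UNIV)"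
      by (subst nn_integral_fst_count_space) simp
    also have "\<dots> \<le> (\<integral>\<^sup>+K. \<integral>\<^sup>+J. lnorm t (B K f) * ?R * lnorm s (B J g) \<partial>count_space UNIV \<partial>count_space UNIV)"
      by (intro nn_integral_mono le)
    also have "\<dots> = (\<Sum>K. lnorm t (B K f)) * ?R * (\<Sum>J. lnorm s (B J g))"
      by (simp add: nn_integral_cmult nn_integral_multc nn_integral_count_space_nat)
    also have "\<dots> < \<infinity>" using R g f by (simp add: ennreal_mult_less_top)
    finally show "(\<integral>\<^sup>+z. ennreal (norm (case z of (i, x) \<Rightarrow> h i x)) \<partial>(count_space UNIV \<Otimes>\<^sub>M lborel)) < \<infinity>" .
  qed (rule hm)
  \<comment> \<open>The unordered sum in \<open>paraprod\<close> defaults to 0 for families that are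
    not summable. Absolute summability makes it an integral over the counting measure, to which
    Fubini applies.\<close>
  have sm: "Infinite_Set_Sum.abs_summable_on (\<lambda>i. LINT x|lborel. h i x) UNIV"
    unfolding Infinite_Set_Sum.abs_summable_on_def using integrable_fst'[OF int] by simp
  have "paraprod chi rho u v r = (\<Sum>\<^sub>\<infinity>i\<in>{(K, J). J + 1 < K}. LINT x|lborel. h i x)"
  proof -
    let ?T = "{(j, k). -1 \<le> j \<and> -1 \<le> k \<and> j < k - 1} :: (int \<times> int) set"
    let ?b = "\<lambda>(K, J). (int J - 1, int K - 1)"
    \<comment> \<open>With \<open>J = j + 1\<close> and \<open>K = k + 1\<close> the condition
      \<open>j < k - 1\<close> becomes \<open>J + 1 < K\<close>.\<close>
    have bij: "bij_betw ?b {(K, J). J + 1 < K} ?T"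
      by (rule bij_betw_byWitness[where f'="\<lambda>(j, k). (nat (k + 1), nat (j + 1))"]) auto
    have term_eq: "distr_of (\<lambda>x. lp_fun chi rho (int J - 1) u x * lp_fun chi rho (int K - 1) v x) r = (LINT x|lborel. h (K, J) x)"
      if "J + 1 < K" for K J
    proof -
      have "AE x in lebesgue. lp_fun chi rho (int J - 1) u x * lp_fun chi rho (int K - 1) v x = B J g x * B K f x"
        using lp_fun_represents(1)[OF u, of J] lp_fun_represents(1)[OF v, of K] unfolding B_def by eventually_elim simp
      moreover have "(\<lambda>x. lp_fun chi rho (int J - 1) u x * lp_fun chi rho (int K - 1) v x) \<in> borel_measurable lebesgue"
        using lp_fun_represents(2)[OF u, of J] lp_fun_represents(2)[OF v, of K] by simp
      ultimately show ?thesis using that by (subst distr_of_cong) (auto simp: h_def[abs_def])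
    qed
    have "paraprod chi rho u v r = infsum (\<lambda>(j, k). distr_of (\<lambda>x. lp_fun chi rho j u x * lp_fun chi rho k v x) r) ?T"
      by (simp add: paraprod_def)
    also have "\<dots> = infsum (\<lambda>i. (case ?b i of (j, k) \<Rightarrow> distr_of (\<lambda>x. lp_fun chi rho j u x * lp_fun chi rho k v x) r)) {(K, J). J + 1 < K}"
      by (rule infsum_reindex_bij_betw[OF bij, symmetric])
    also have "\<dots> = (\<Sum>\<^sub>\<infinity>i\<in>{(K, J). J + 1 < K}. LINT x|lborel. h i x)"
      by (rule infsum_cong) (auto simp: term_eq)
    finally show ?thesis .
  qed
  also have "\<dots> = (\<Sum>\<^sub>\<infinity>i. LINT x|lborel. h i x)"
    by (rule infsum_cong_neutral) (auto simp: h_def)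
  also have "\<dots> = (LINT i|count_space UNIV. LINT x|lborel. h i x)"
    using infsetsum_infsum[OF sm] by (simp add: infsetsum_def)
  also have "\<dots> = (LINT x|lborel. LINT i|count_space UNIV. h i x)"
    using Fubini_integral[OF int] by simp
  also have "\<dots> = (LINT x|lborel. para g f x * r x)"
  proof (rule integral_cong_AE)
    have sw: "integrable (lborel \<Otimes>\<^sub>M count_space UNIV) (\<lambda>(x, i). h i x)"
      using integrable_product_swap[OF int] by (simp add: case_prod_beta)
    show "(\<lambda>x. LINT i|count_space UNIV. h i x) \<in> borel_measurable lborel"
      using integrable_snd[OF int] by simp
    have "AE x in lborel. integrable (count_space UNIV) (\<lambda>i. h i x)"
      using AE_integrable_snd[OF int] by simp
    moreover have "AE x in lborel. summable (\<lambda>K. norm (S K g x * B K f x))"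
      by (rule lnorm_suminf(1)[OF _ _ st(3) pt]) (use st in auto)
    ultimately show "AE x in lborel. (LINT i|count_space UNIV. h i x) = para g f x * r x"
    proof eventually_elim
      case (elim x)
      from elim(1) have ab: "Infinite_Set_Sum.abs_summable_on (\<lambda>(K, J). h (K, J) x) (UNIV \<times> UNIV)" by (simp add: Infinite_Set_Sum.abs_summable_on_def case_prod_beta)
      have inner: "infsetsum (\<lambda>J. h (K, J) x) UNIV = S K g x * B K f x * r x" for K
      proof -
        have "infsetsum (\<lambda>J. h (K, J) x) UNIV = infsetsum (\<lambda>J. h (K, J) x) {J. J + 1 < K}"
          by (rule infsetsum_cong_neutral) (auto simp: h_def)
        also have "finite {J. J + 1 < K}" by (rule finite_subset[of _ "{..<K}"]) auto
        then have "infsetsum (\<lambda>J. h (K, J) x) {J. J + 1 < K} = (\<Sum>J | J + 1 < K. h (K, J) x)" by simp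
        also have "\<dots> = S K g x * B K f x * r x"
          by (simp add: h_def S_eq[OF gm] sum_distrib_right)
        finally show ?thesis .
      qed
      have "(LINT i|count_space UNIV. h i x) = infsetsum (\<lambda>(K, J). h (K, J) x) (UNIV \<times> UNIV)"
        by (simp add: infsetsum_def case_prod_beta)
      also have "\<dots> = infsetsum (\<lambda>K. infsetsum (\<lambda>J. h (K, J) x) UNIV) UNIV"
        by (rule infsetsum_Sigma'[symmetric]) (use ab in auto)
      also have "\<dots> = (\<Sum>K. S K g x * B K f x * r x)"
      proof -
        have "Infinite_Set_Sum.abs_summable_on (\<lambda>K. infsetsum (\<lambda>J. h (K, J) x) UNIV) UNIV"
          by (rule abs_summable_on_Sigma_project1'[of "\<lambda>K J. h (K, J) x" UNIV "\<lambda>_. UNIV"]) (use ab in auto)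
        then show ?thesis unfolding inner by (rule infsetsum_nat')
      qed
      also have "\<dots> = para g f x * r x"
      proof -
        have "summable (\<lambda>K. S K g x * B K f x)" using elim(2) by (rule summable_norm_cancel)
        then show ?thesis unfolding para_def by (rule suminf_mult2[symmetric])
      qed
      finally show ?case .
    qed
  qed measurable
  finally show "paraprod chi rho u v r = (LINT x|lborel. para g f x * r x)" .
qed

end

section \<open>Dyadic Schur kernels\<close>

text \<open>The outer measure of \<open>two_param_norm\<close>, on Borel instead of Lebesgue sets so
  that product measurability is available.\<close>

definition hmeas :: "'a::euclidean_space measure" where
  "hmeas = density lborel (\<lambda>h. ennreal (norm h powr (- real DIM('a))))"

lemma sets_hmeas [simp, measurable_cong]: "sets (hmeas :: 'a::euclidean_space measure) = sets borel"
  by (simp add: hmeas_def)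

lemma space_hmeas [simp]: "space (hmeas :: 'a::euclidean_space measure) = UNIV"
  by (simp add: hmeas_def)

lemma sigma_finite_hmeas: "sigma_finite_measure (hmeas :: 'a::euclidean_space measure)"
  unfolding hmeas_def
  by (subst sigma_finite_measure.sigma_finite_iff_density_finite[OF sigma_finite_lborel]) auto

definition dexp :: "real \<Rightarrow> int \<Rightarrow> ennreal" where
  "dexp \<epsilon> i = ennreal (2 powr (- \<epsilon> * \<bar>real_of_int i\<bar>))"

definition lg :: "'a::euclidean_space \<Rightarrow> int" where
  "lg h = \<lfloor>log 2 (norm h)\<rfloor>"

text \<open>Decays geometrically as 2^J |h| moves away from 1 in either direction. At
  \<open>h = 0\<close>, where \<open>lg\<close> carries no information, the value is set to
  0.\<close>

definition Psi :: "real \<Rightarrow> nat \<Rightarrow> 'a::euclidean_space \<Rightarrow> ennreal" where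
  "Psi \<epsilon> J h = (if h = 0 then 0 else dexp \<epsilon> (int J + lg h))"

lemma lg_measurable [measurable]: "lg \<in> measurable borel (count_space UNIV)"
  unfolding lg_def[abs_def] by measurable

lemma Psi_measurable [measurable]: "Psi \<epsilon> J \<in> borel_measurable borel"
  unfolding Psi_def[abs_def] by measurable

lemma lg_bounds:
  assumes "h \<noteq> 0" shows "2 powr real_of_int (lg h) \<le> norm h" "norm h < 2 powr (real_of_int (lg h) + 1)"
proof -
  have eq: "2 powr (log 2 (norm h)) = norm h" using assms by simp
  have "2 powr real_of_int (lg h) \<le> 2 powr (log 2 (norm h))" unfolding lg_def by (intro powr_mono) auto
  then show "2 powr real_of_int (lg h) \<le> norm h" by (simp only: eq)
  have "2 powr (log 2 (norm h)) < 2 powr (real_of_int (lg h) + 1)" unfolding lg_def by (intro powr_less_mono) linarith+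
  then show "norm h < 2 powr (real_of_int (lg h) + 1)" by (simp only: eq)
qed

text \<open>The enumeration 0, -1, 1, -2, 2, ... of the integers turns the two-sided sum of
  \<open>dexp\<close> into a geometric series.\<close>

lemma abs_int_decode: "real n / 2 \<le> \<bar>real_of_int (int_decode n)\<bar>"
proof (cases "even n")
  case True
  then obtain k where "n = 2 * k" by blast
  then show ?thesis by (simp add: int_decode_def sum_decode_def)
next
  case False
  then obtain k where "n = 2 * k + 1" by (rule oddE)
  then show ?thesis by (simp add: int_decode_def sum_decode_def)
qed

lemma dexp_sum:
  assumes "0 < \<epsilon>" shows "(\<integral>\<^sup>+i. dexp \<epsilon> i \<partial>count_space UNIV) < top"
proof -
  have "(\<integral>\<^sup>+i. dexp \<epsilon> i \<partial>count_space UNIV) = (\<integral>\<^sup>+n. dexp \<epsilon> (int_decode n) \<partial>count_space UNIV)"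
    by (rule nn_integral_bij_count_space[OF bij_int_decode, symmetric])
  also have "\<dots> \<le> (\<Sum>n. ennreal ((2 powr (- \<epsilon> / 2)) ^ n))"
    unfolding nn_integral_count_space_nat
  proof (intro suminf_le)
    fix n
    have "2 powr (- \<epsilon> * \<bar>real_of_int (int_decode n)\<bar>) \<le> 2 powr (- \<epsilon> * (real n / 2))"
      using assms abs_int_decode[of n] by (intro powr_mono) (auto simp: mult_le_cancel_left)
    also have "\<dots> = (2 powr (- \<epsilon> / 2)) ^ n" by (simp add: powr_realpow[symmetric] powr_powr)
    finally show "dexp \<epsilon> (int_decode n) \<le> ennreal ((2 powr (- \<epsilon> / 2)) ^ n)" unfolding dexp_def by (rule ennreal_leI)
  qed auto
  also have "\<dots> < top"
  proof -
    have "2 powr (- \<epsilon> / 2) < 2 powr (0::real)" using assms by (intro powr_less_mono) auto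
    then have "summable (\<lambda>n. (2 powr (- \<epsilon> / 2)) ^ n)" by (intro summable_geometric) simp
    then show ?thesis by (simp add: suminf_ennreal2)
  qed
  finally show ?thesis .
qed

lemma Psi_sum:
  "(\<integral>\<^sup>+J. Psi \<epsilon> J h \<partial>count_space UNIV) \<le> (\<integral>\<^sup>+i. dexp \<epsilon> i \<partial>count_space UNIV)"
proof (cases "h = 0")
  case False
  have inj: "inj (\<lambda>J. int J + lg h)" by (auto simp: inj_def)
  have "(\<integral>\<^sup>+J. Psi \<epsilon> J h \<partial>count_space UNIV) = (\<integral>\<^sup>+J. dexp \<epsilon> (int J + lg h) \<partial>count_space UNIV)"
    using False by (simp add: Psi_def)
  also have "\<dots> = (\<integral>\<^sup>+i. dexp \<epsilon> i \<partial>count_space (range (\<lambda>J. int J + lg h)))"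
    by (rule nn_integral_bij_count_space) (use inj in \<open>simp add: bij_betw_def\<close>)
  also have "\<dots> \<le> (\<integral>\<^sup>+i. dexp \<epsilon> i \<partial>count_space UNIV)"
    by (subst nn_integral_count_space_indicator, simp, intro nn_integral_mono) (auto simp: indicator_def)
  finally show ?thesis .
qed (simp add: Psi_def)

text \<open>Decompose into the dyadic shells \<open>lg h = i\<close>. The weight is taken at the
  inner radius 2^i and the volume at the outer radius 2^(i + 1), so every shell has mass at most 2^d
  times the volume of the unit ball, whatever \<open>i\<close> is.\<close>

lemma Psi_integral:
  "(\<integral>\<^sup>+h. Psi \<epsilon> J h \<partial>(hmeas :: 'a::euclidean_space measure)) \<le> ennreal (2 ^ DIM('a) * unit_ball_vol (real DIM('a))) * (\<integral>\<^sup>+i. dexp \<epsilon> i \<partial>count_space UNIV)"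
proof -
  let ?d = "real DIM('a)"
  let ?V = "2 ^ DIM('a) * unit_ball_vol (real DIM('a))"
  define g where "g h i = indicator {h. h \<noteq> 0 \<and> lg h = i} h * (dexp \<epsilon> (int J + i) * ennreal (2 powr (- ?d * real_of_int i)))"
    for h :: 'a and i :: int
  have [measurable]: "{h::'a. h \<noteq> 0 \<and> lg h = i} \<in> sets borel" for i
  proof -
    have "{h \<in> space borel. h \<noteq> (0::'a) \<and> lg h = i} \<in> sets borel" by measurable
    then show ?thesis by simp
  qed
  have [measurable]: "(\<lambda>h. g h i) \<in> borel_measurable borel" for i unfolding g_def by measurable
  have meas: "(\<lambda>(h, i). g h i) \<in> borel_measurable (lborel \<Otimes>\<^sub>M count_space UNIV)"
  proof -
    have "(\<lambda>(i, h). g h i) \<in> borel_measurable (count_space UNIV \<Otimes>\<^sub>M lborel)"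
      by (rule measurable_pair_measure_countable1) auto
    from measurable_pair_swap[OF this] show ?thesis by (simp add: case_prod_beta)
  qed
  interpret pair_sigma_finite "lborel :: 'a measure" "count_space (UNIV :: int set)"
    by (intro pair_sigma_finite.intro sigma_finite_measure_count_space_countable lborel.sigma_finite_measure_axioms) auto
  have "(\<integral>\<^sup>+h. Psi \<epsilon> J h \<partial>(hmeas :: 'a measure)) = (\<integral>\<^sup>+h. ennreal (norm h powr (- ?d)) * Psi \<epsilon> J h \<partial>(lborel :: 'a measure))"
    unfolding hmeas_def by (rule nn_integral_density) auto
  also have "\<dots> \<le> (\<integral>\<^sup>+h. \<integral>\<^sup>+i. g h i \<partial>count_space UNIV \<partial>lborel)"
  proof (rule nn_integral_mono)
    fix h :: 'a
    show "ennreal (norm h powr (- ?d)) * Psi \<epsilon> J h \<le> (\<integral>\<^sup>+i. g h i \<partial>count_space UNIV)"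
    proof (cases "h = 0")
      case False
      have "norm h powr (- ?d) \<le> (2 powr real_of_int (lg h)) powr (- ?d)"
        using lg_bounds(1)[OF False] by (intro powr_mono2') auto
      then have "norm h powr (- ?d) \<le> 2 powr (- ?d * real_of_int (lg h))" by (simp add: powr_powr mult.commute)
      then have "ennreal (norm h powr (- ?d)) * Psi \<epsilon> J h \<le> g h (lg h)"
        using False unfolding g_def Psi_def by (simp add: mult.commute) (intro mult_left_mono ennreal_leI, auto)
      also have "\<dots> = (\<integral>\<^sup>+i. g h i * indicator {lg h} i \<partial>count_space UNIV)" by simp
      also have "\<dots> \<le> (\<integral>\<^sup>+i. g h i \<partial>count_space UNIV)" by (intro nn_integral_mono) (auto simp: indicator_def)
      finally show ?thesis .
    qed (simp add: Psi_def)
  qed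
  also have "\<dots> = (\<integral>\<^sup>+i. \<integral>\<^sup>+h. g h i \<partial>lborel \<partial>count_space UNIV)"
    by (rule Fubini'[OF meas, symmetric])
  also have "\<dots> \<le> (\<integral>\<^sup>+i. ennreal ?V * dexp \<epsilon> (int J + i) \<partial>count_space UNIV)"
  proof (rule nn_integral_mono)
    fix i :: int
    have "emeasure lborel {h::'a. h \<noteq> 0 \<and> lg h = i} \<le> emeasure lborel (ball (0::'a) (2 powr (real_of_int i + 1)))"
      using lg_bounds(2) by (intro emeasure_mono) auto
    also have "\<dots> = ennreal (unit_ball_vol ?d * (2 powr (real_of_int i + 1)) ^ DIM('a))"
      by (rule emeasure_ball) simp
    finally have le: "emeasure lborel {h::'a. h \<noteq> 0 \<and> lg h = i} \<le> \<dots>" .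
    have "(\<integral>\<^sup>+h. g h i \<partial>lborel) = emeasure lborel {h::'a. h \<noteq> 0 \<and> lg h = i} * (dexp \<epsilon> (int J + i) * ennreal (2 powr (- ?d * real_of_int i)))"
      unfolding g_def by (simp add: nn_integral_multc)
    also have "\<dots> \<le> ennreal (unit_ball_vol ?d * (2 powr (real_of_int i + 1)) ^ DIM('a)) * (dexp \<epsilon> (int J + i) * ennreal (2 powr (- ?d * real_of_int i)))"
      by (intro mult_right_mono le) simp
    also have "\<dots> = ennreal (unit_ball_vol ?d * (2 powr (real_of_int i + 1)) ^ DIM('a) * 2 powr (- ?d * real_of_int i)) * dexp \<epsilon> (int J + i)"
      by (simp add: ennreal_mult mult_ac)
    also have "(2 powr (real_of_int i + 1)) ^ DIM('a) * 2 powr (- ?d * real_of_int i) = 2 ^ DIM('a)"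
    proof -
      have "(2 powr (real_of_int i + 1)) ^ DIM('a) = 2 powr ((real_of_int i + 1) * ?d)"
        by (simp add: powr_realpow[symmetric] powr_powr)
      then have "(2 powr (real_of_int i + 1)) ^ DIM('a) * 2 powr (- ?d * real_of_int i) = 2 powr ((real_of_int i + 1) * ?d + - ?d * real_of_int i)"
        by (simp only: powr_add)
      also have "(real_of_int i + 1) * ?d + - ?d * real_of_int i = ?d" by (simp add: algebra_simps)
      finally show ?thesis by (simp add: powr_realpow)
    qed
    then have "unit_ball_vol ?d * (2 powr (real_of_int i + 1)) ^ DIM('a) * 2 powr (- ?d * real_of_int i) = ?V"
      by (simp only: mult.assoc) (simp only: mult.commute)
    finally show "(\<integral>\<^sup>+h. g h i \<partial>lborel) \<le> ennreal ?V * dexp \<epsilon> (int J + i)" .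
  qed
  also have "\<dots> = ennreal ?V * (\<integral>\<^sup>+i. dexp \<epsilon> (int J + i) \<partial>count_space UNIV)" by (simp add: nn_integral_cmult)
  also have "(\<integral>\<^sup>+i. dexp \<epsilon> (int J + i) \<partial>count_space UNIV) = (\<integral>\<^sup>+i. dexp \<epsilon> i \<partial>count_space UNIV)"
    by (rule nn_integral_bij_count_space) (auto intro!: bij_betw_byWitness[where f'="\<lambda>i. i - int J"])
  finally show ?thesis .
qed

lemma Psi_bounds:
  fixes \<epsilon> :: real
  assumes "0 < \<epsilon>"
  shows "\<exists>C::real. (\<forall>h::'a::euclidean_space. (\<integral>\<^sup>+J. Psi \<epsilon> J h \<partial>count_space UNIV) \<le> ennreal C)
     \<and> (\<forall>J. (\<integral>\<^sup>+h. Psi \<epsilon> J h \<partial>(hmeas :: 'a measure)) \<le> ennreal C)"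
proof -
  obtain G where G: "(\<integral>\<^sup>+i. dexp \<epsilon> i \<partial>count_space UNIV) = ennreal G" "G \<ge> 0"
    using dexp_sum[OF assms] by (cases "\<integral>\<^sup>+i. dexp \<epsilon> i \<partial>count_space UNIV" rule: ennreal_cases) auto
  let ?V = "2 ^ DIM('a) * unit_ball_vol (real DIM('a))"
  have "(\<integral>\<^sup>+J. Psi \<epsilon> J h \<partial>count_space UNIV) \<le> ennreal (max G (?V * G))" for h :: 'a
    using Psi_sum[of \<epsilon> h] G by (auto intro: order_trans ennreal_leI)
  moreover have "(\<integral>\<^sup>+h. Psi \<epsilon> J h \<partial>(hmeas :: 'a measure)) \<le> ennreal (max G (?V * G))" for J
  proof -
    have "(\<integral>\<^sup>+h. Psi \<epsilon> J h \<partial>(hmeas :: 'a measure)) \<le> ennreal ?V * ennreal G" using Psi_integral[where 'a='a, of \<epsilon> J] G by simp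
    also have "\<dots> = ennreal (?V * G)" using G by (simp add: ennreal_mult)
    also have "\<dots> \<le> ennreal (max G (?V * G))" by (rule ennreal_leI) simp
    finally show ?thesis .
  qed
  ultimately show ?thesis by blast
qed

text \<open>Reduces the Schur test for a function of t = 2^J |h| to power bounds on both sides of t
  = 1. The factor \<open>2 powr \<epsilon>\<close> pays for rounding the logarithm of t to an
  integer.\<close>

lemma Psi_dominates:
  fixes h :: "'a::euclidean_space"
  assumes h: "h \<noteq> 0" and \<epsilon>: "0 < \<epsilon>"
    and small: "2 ^ J * norm h \<le> 1 \<Longrightarrow> x \<le> (2 ^ J * norm h) powr \<epsilon>"
    and large: "1 \<le> 2 ^ J * norm h \<Longrightarrow> x \<le> (2 ^ J * norm h) powr (- \<epsilon>)"
  shows "ennreal x \<le> ennreal (2 powr \<epsilon>) * Psi \<epsilon> J h"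
proof -
  let ?t = "2 ^ J * norm h" and ?i = "int J + lg h"
  have t: "2 powr real_of_int ?i \<le> ?t" "?t < 2 powr (real_of_int ?i + 1)" "0 < ?t"
    using lg_bounds[OF h] h by (simp_all add: powr_add powr_realpow mult.assoc)
  have "x \<le> 2 powr \<epsilon> * 2 powr (- \<epsilon> * \<bar>real_of_int ?i\<bar>)"
  proof (cases "0 \<le> ?i")
    case True
    then have "1 \<le> (2::real) powr real_of_int ?i" by (intro ge_one_powr_ge_zero) auto
    then have "x \<le> ?t powr (- \<epsilon>)" using t by (intro large) linarith
    also have "\<dots> \<le> (2 powr real_of_int ?i) powr (- \<epsilon>)" using t \<epsilon> by (intro powr_mono2') auto
    also have "\<dots> = 2 powr (- \<epsilon> * \<bar>real_of_int ?i\<bar>)" using True by (simp add: powr_powr mult.commute)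
    also have "\<dots> \<le> 2 powr \<epsilon> * \<dots>" 
      using \<epsilon> mult_right_mono[OF ge_one_powr_ge_zero[of 2 \<epsilon>], of "2 powr (- \<epsilon> * \<bar>real_of_int ?i\<bar>)"] by simp
    finally show ?thesis .
  next
    case False
    then have "real_of_int ?i + 1 \<le> 0" by linarith
    then have "2 powr (real_of_int ?i + 1) \<le> 2 powr (0::real)" by (intro powr_mono) auto
    then have "x \<le> ?t powr \<epsilon>" using t by (intro small) simp
    also have "\<dots> \<le> (2 powr (real_of_int ?i + 1)) powr \<epsilon>" using t \<epsilon> by (intro powr_mono2) auto
    also have "\<dots> = 2 powr \<epsilon> * 2 powr (- \<epsilon> * \<bar>real_of_int ?i\<bar>)"
      using False by (simp add: powr_powr powr_add[symmetric] algebra_simps)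
    finally show ?thesis .
  qed
  then show ?thesis using h by (simp add: Psi_def dexp_def ennreal_leI flip: ennreal_mult)
qed


section \<open>Smoothness weights and the kernels \<open>mint\<close> and \<open>kk\<close>\<close>

definition hpow :: "real \<Rightarrow> 'a::euclidean_space \<Rightarrow> ennreal" where
  "hpow \<alpha> h = ennreal (norm h powr (- \<alpha>))"

lemma hpow_measurable [measurable]: "hpow \<alpha> \<in> borel_measurable borel"
  unfolding hpow_def[abs_def] by measurable

lemma hpow_add: "hpow (\<alpha> + \<beta>) h = hpow \<alpha> h * hpow \<beta> h"
  by (simp add: hpow_def powr_add[symmetric] flip: ennreal_mult)

text \<open>Weighs by \<open>J = j + 1\<close> and therefore exceeds the weight in
  \<open>besov_norm\<close> by the factor \<open>2 powr \<alpha>\<close>.\<close>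

definition jpow :: "real \<Rightarrow> nat \<Rightarrow> ennreal" where
  "jpow \<alpha> J = ennreal (2 powr (real J * \<alpha>))"

lemma jpow_add: "jpow (\<alpha> + \<beta>) J = jpow \<alpha> J * jpow \<beta> J"
  by (simp add: jpow_def powr_add[symmetric] distrib_left flip: ennreal_mult)

lemma jpow_minus: "jpow (- \<alpha>) J * jpow \<alpha> J = 1"
  by (simp add: jpow_def powr_add[symmetric] flip: ennreal_mult)

lemma rnorm_schur_discrete:
  assumes "0 < \<epsilon>"
  shows "\<exists>C::real. \<forall>s f. 0 \<le> s \<longrightarrow> s \<le> 1 \<longrightarrow>
    rnorm (hmeas :: 'a::euclidean_space measure) s (\<lambda>h. \<Sum>J. Psi \<epsilon> J h * f J) \<le> ennreal C * rnorm (count_space UNIV) s f"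
    and "\<exists>C::real. \<forall>s f. 0 \<le> s \<longrightarrow> s \<le> 1 \<longrightarrow> f \<in> borel_measurable borel \<longrightarrow>
    rnorm (count_space UNIV) s (\<lambda>J. \<integral>\<^sup>+h. Psi \<epsilon> J h * f h \<partial>(hmeas :: 'a measure)) \<le> ennreal C * rnorm hmeas s f"
proof -
  obtain C where C: "\<And>h::'a. (\<integral>\<^sup>+J. Psi \<epsilon> J h \<partial>count_space UNIV) \<le> ennreal C"
    "\<And>J. (\<integral>\<^sup>+h. Psi \<epsilon> J h \<partial>(hmeas :: 'a measure)) \<le> ennreal C"
    using Psi_bounds[OF assms, where 'a='a] by blast
  have sc: "sigma_finite_measure (count_space (UNIV :: nat set))"
    by (rule sigma_finite_measure_count_space_countable) simp
  have m: "(\<lambda>(J, h). Psi \<epsilon> J h) \<in> borel_measurable (count_space UNIV \<Otimes>\<^sub>M (hmeas :: 'a measure))"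
    by (rule measurable_pair_measure_countable1) auto
  then have m': "(\<lambda>(h, J). Psi \<epsilon> J h) \<in> borel_measurable ((hmeas :: 'a measure) \<Otimes>\<^sub>M count_space UNIV)"
    using measurable_pair_swap[OF m] by (simp add: case_prod_beta)
  have "rnorm (hmeas :: 'a measure) s (\<lambda>h. \<Sum>J. Psi \<epsilon> J h * f J) \<le> ennreal C * rnorm (count_space UNIV) s f"
    if "0 \<le> s" "s \<le> 1" for s f
    using rnorm_schur[OF sigma_finite_hmeas sc m', of f "ennreal C" s] C that by (simp add: nn_integral_count_space_nat)
  then show "\<exists>C::real. \<forall>s f. 0 \<le> s \<longrightarrow> s \<le> 1 \<longrightarrow>
    rnorm (hmeas :: 'a measure) s (\<lambda>h. \<Sum>J. Psi \<epsilon> J h * f J) \<le> ennreal C * rnorm (count_space UNIV) s f" by blast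
  have "rnorm (count_space UNIV) s (\<lambda>J. \<integral>\<^sup>+h. Psi \<epsilon> J h * f h \<partial>(hmeas :: 'a measure)) \<le> ennreal C * rnorm hmeas s f"
    if "0 \<le> s" "s \<le> 1" "f \<in> borel_measurable borel" for s f
    using C that by (intro rnorm_schur[OF sc sigma_finite_hmeas m]) auto
  then show "\<exists>C::real. \<forall>s f. 0 \<le> s \<longrightarrow> s \<le> 1 \<longrightarrow> f \<in> borel_measurable borel \<longrightarrow>
    rnorm (count_space UNIV) s (\<lambda>J. \<integral>\<^sup>+h. Psi \<epsilon> J h * f h \<partial>(hmeas :: 'a measure)) \<le> ennreal C * rnorm hmeas s f" by blast
qed

definition mint :: "nat \<Rightarrow> 'a::euclidean_space \<Rightarrow> ennreal" where
  "mint J h = ennreal (min 1 (2 ^ J * norm h))"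

lemma mint_measurable [measurable]: "mint J \<in> borel_measurable borel"
  unfolding mint_def[abs_def] by measurable

text \<open>With t = 2^J |h| the weights combine to t^(-\<alpha>) min(1, t), which is t^(1 -
  \<alpha>) for small and t^(-\<alpha>) for large t. It decays on both sides precisely because 0 <
  \<alpha> < 1, with rate min(\<alpha>, 1 - \<alpha>), and Schur's test applies.\<close>

lemma mint_sum_le:
  assumes "0 < \<alpha>" "\<alpha> < 1"
  shows "\<exists>C::real. \<forall>s f. 0 \<le> s \<longrightarrow> s \<le> 1 \<longrightarrow>
    rnorm (hmeas :: 'a::euclidean_space measure) s (\<lambda>h. hpow \<alpha> h * (\<Sum>J. mint J h * f J))
      \<le> ennreal C * rnorm (count_space UNIV) s (\<lambda>J. jpow \<alpha> J * f J)"
proof -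
  define \<epsilon> where "\<epsilon> = min \<alpha> (1 - \<alpha>)"
  have \<epsilon>: "0 < \<epsilon>" using assms by (simp add: \<epsilon>_def)
  obtain C where C: "\<And>s f. 0 \<le> s \<Longrightarrow> s \<le> 1 \<Longrightarrow>
    rnorm (hmeas :: 'a measure) s (\<lambda>h. \<Sum>J. Psi \<epsilon> J h * f J) \<le> ennreal C * rnorm (count_space UNIV) s f"
    using rnorm_schur_discrete(1)[OF \<epsilon>, where 'a='a] by blast
  have le: "hpow \<alpha> h * mint J h \<le> ennreal (2 powr \<epsilon>) * Psi \<epsilon> J h * jpow \<alpha> J" for J and h :: 'a
  proof (cases "h = 0")
    case True then show ?thesis by (simp add: mint_def)
  next
    case False
    let ?t = "2 ^ J * norm h"
    have t: "0 < ?t" using False by simp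
    have main: "ennreal (?t powr (- \<alpha>) * min 1 ?t) \<le> ennreal (2 powr \<epsilon>) * Psi \<epsilon> J h"
    proof (rule Psi_dominates[OF False \<epsilon>])
      assume t1: "?t \<le> 1"
      then have "?t powr (- \<alpha>) * min 1 ?t = ?t powr (- \<alpha>) * ?t powr 1" using t by (simp add: min_def)
      also have "\<dots> = ?t powr (1 - \<alpha>)" by (simp only: powr_add[symmetric]) (simp add: algebra_simps)
      also have "\<dots> \<le> ?t powr \<epsilon>" using t t1 by (intro powr_mono') (auto simp: \<epsilon>_def)
      finally show "?t powr (- \<alpha>) * min 1 ?t \<le> ?t powr \<epsilon>" .
    next
      assume t1: "1 \<le> ?t"
      then have "?t powr (- \<alpha>) * min 1 ?t = ?t powr (- \<alpha>)" by (simp add: min_def)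
      also have "\<dots> \<le> ?t powr (- \<epsilon>)" using t1 by (intro powr_mono) (auto simp: \<epsilon>_def)
      finally show "?t powr (- \<alpha>) * min 1 ?t \<le> ?t powr (- \<epsilon>)" .
    qed
    have eq: "norm h powr (- \<alpha>) = ?t powr (- \<alpha>) * 2 powr (real J * \<alpha>)"
    proof -
      have "?t powr (- \<alpha>) = (2 powr real J) powr (- \<alpha>) * norm h powr (- \<alpha>)"
        by (simp add: powr_mult powr_realpow)
      then show ?thesis by (simp add: powr_powr powr_minus field_simps)
    qed
    have "ennreal (norm h powr (- \<alpha>)) * ennreal (min 1 ?t) = ennreal (?t powr (- \<alpha>) * min 1 ?t) * ennreal (2 powr (real J * \<alpha>))"
      unfolding eq using t by (simp add: mult_ac flip: ennreal_mult)
    also have "\<dots> \<le> ennreal (2 powr \<epsilon>) * Psi \<epsilon> J h * ennreal (2 powr (real J * \<alpha>))"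
      by (rule mult_right_mono[OF main]) simp
    finally have "ennreal (norm h powr (- \<alpha>)) * ennreal (min 1 ?t) \<le> \<dots>" .
    then show ?thesis by (simp add: hpow_def mint_def jpow_def)
  qed
  have "rnorm (hmeas :: 'a measure) s (\<lambda>h. hpow \<alpha> h * (\<Sum>J. mint J h * f J))
      \<le> ennreal (2 powr \<epsilon> * max 0 C) * rnorm (count_space UNIV) s (\<lambda>J. jpow \<alpha> J * f J)" if s: "0 \<le> s" "s \<le> 1" for s f
  proof -
    have "rnorm (hmeas :: 'a measure) s (\<lambda>h. hpow \<alpha> h * (\<Sum>J. mint J h * f J))
       \<le> rnorm (hmeas :: 'a measure) s (\<lambda>h. ennreal (2 powr \<epsilon>) * (\<Sum>J. Psi \<epsilon> J h * (jpow \<alpha> J * f J)))"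
    proof (intro rnorm_mono_AE AE_I2)
      fix h :: 'a
      have "hpow \<alpha> h * (\<Sum>J. mint J h * f J) = (\<Sum>J. hpow \<alpha> h * mint J h * f J)" by (simp add: mult.assoc)
      also have "\<dots> \<le> (\<Sum>J. ennreal (2 powr \<epsilon>) * Psi \<epsilon> J h * jpow \<alpha> J * f J)"
        by (intro suminf_le mult_right_mono le) auto
      finally show "hpow \<alpha> h * (\<Sum>J. mint J h * f J) \<le> ennreal (2 powr \<epsilon>) * (\<Sum>J. Psi \<epsilon> J h * (jpow \<alpha> J * f J))"
        by (simp add: mult.assoc)
    qed (use s in auto)
    also have "\<dots> \<le> ennreal (2 powr \<epsilon>) * rnorm (hmeas :: 'a measure) s (\<lambda>h. \<Sum>J. Psi \<epsilon> J h * (jpow \<alpha> J * f J))"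
      by (rule rnorm_cmult) (use s in auto)
    also have "\<dots> \<le> ennreal (2 powr \<epsilon>) * (ennreal (max 0 C) * rnorm (count_space UNIV) s (\<lambda>J. jpow \<alpha> J * f J))"
      by (intro mult_left_mono order_trans[OF C[OF s]] mult_right_mono ennreal_leI) auto
    finally show ?thesis by (simp add: ennreal_mult mult.assoc)
  qed
  then show ?thesis by blast
qed

text \<open>Common majorant of all kernels at scale 2^(-J). The exponent makes it integrable and
  leaves enough decay after multiplication by |w|^(\<alpha> + d) with \<alpha> < 1.\<close>

definition kk :: "nat \<Rightarrow> 'a::euclidean_space \<Rightarrow> real" where
  "kk J w = 2 ^ (J * DIM('a)) / (1 + 2 ^ J * norm w) ^ (2 * DIM('a) + 2)"

lemma kk_measurable [measurable]: "kk J \<in> borel_measurable borel"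
  unfolding kk_def[abs_def] by measurable

lemma kk_nonneg: "0 \<le> kk J w"
  by (simp add: kk_def)

lemma kk_minus: "kk J (- w) = kk J w"
  by (simp add: kk_def)

text \<open>The companion of \<open>mint_sum_le\<close> in the opposite direction, from functions of
  \<open>h\<close> to sequences. Writing dw as |w|^d dw / |w|^d leaves, with t = 2^J |w|, the kernel
  t^(\<alpha> + d) / (1 + t)^(2d + 2), which is at most t^\<alpha> for small and t^(-\<alpha>) for
  large t.\<close>

lemma kk_integral_le:
  assumes "0 < \<alpha>" "\<alpha> < 1"
  shows "\<exists>C::real. \<forall>s f. 0 \<le> s \<longrightarrow> s \<le> 1 \<longrightarrow> f \<in> borel_measurable borel \<longrightarrow>
    rnorm (count_space UNIV) s (\<lambda>J. jpow \<alpha> J * (\<integral>\<^sup>+w. ennreal (kk J w) * f w \<partial>(lborel :: 'a::euclidean_space measure)))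
      \<le> ennreal C * rnorm (hmeas :: 'a measure) s (\<lambda>h. hpow \<alpha> h * f h)"
proof -
  let ?d = "real DIM('a)"
  obtain C where C: "\<And>s f. 0 \<le> s \<Longrightarrow> s \<le> 1 \<Longrightarrow> f \<in> borel_measurable borel \<Longrightarrow>
    rnorm (count_space UNIV) s (\<lambda>J. \<integral>\<^sup>+h. Psi \<alpha> J h * f h \<partial>(hmeas :: 'a measure)) \<le> ennreal C * rnorm hmeas s f"
    using rnorm_schur_discrete(2)[OF assms(1), where 'a='a] by blast
  have le: "jpow \<alpha> J * ennreal (kk J w) \<le> ennreal (2 powr \<alpha>) * Psi \<alpha> J w * (hpow \<alpha> w * ennreal (norm w powr (- ?d)))"
    if w: "w \<noteq> 0" for J and w :: 'a
  proof -
    let ?t = "2 ^ J * norm w"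
    let ?x = "?t powr (\<alpha> + ?d) / (1 + ?t) ^ (2 * DIM('a) + 2)"
    have t: "0 < ?t" using w by simp
    have main: "ennreal ?x \<le> ennreal (2 powr \<alpha>) * Psi \<alpha> J w"
    proof (rule Psi_dominates[OF w assms(1)])
      assume t1: "?t \<le> 1"
      have "?x \<le> ?t powr (\<alpha> + ?d) / 1"
        using t by (intro divide_left_mono one_le_power) auto
      also have "\<dots> \<le> ?t powr \<alpha>" using t t1 by (simp, intro powr_mono') auto
      finally show "?x \<le> ?t powr \<alpha>" .
    next
      assume t1: "1 \<le> ?t"
      have "?x \<le> ?t powr (\<alpha> + ?d) / ?t ^ (2 * DIM('a) + 2)"
        using t by (intro divide_left_mono power_mono mult_pos_pos zero_less_power) auto
      also have "?t ^ (2 * DIM('a) + 2) = ?t powr (2 * ?d + 2)" using powr_realpow[OF t, of "2 * DIM('a) + 2"] by (simp add: algebra_simps)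
      also have "?t powr (\<alpha> + ?d) / ?t powr (2 * ?d + 2) = ?t powr (\<alpha> - ?d - 2)"
        by (simp only: powr_diff[symmetric]) (simp add: algebra_simps)
      also have "\<dots> \<le> ?t powr (- \<alpha>)" using t1 assms by (intro powr_mono) auto
      finally show "?x \<le> ?t powr (- \<alpha>)" .
    qed
    have eq: "2 powr (real J * \<alpha>) * kk J w = ?x * (norm w powr (- \<alpha>) * norm w powr (- ?d))"
    proof -
      have "?t powr (\<alpha> + ?d) = 2 powr (real J * (\<alpha> + ?d)) * norm w powr (\<alpha> + ?d)"
        by (simp add: powr_mult powr_realpow[symmetric] powr_powr)
      moreover have "norm w powr (\<alpha> + ?d) * (norm w powr (- \<alpha>) * norm w powr (- ?d)) = 1"
        using w by (simp add: powr_add[symmetric])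
      moreover have "2 powr (real J * (\<alpha> + ?d)) = 2 powr (real J * \<alpha>) * 2 ^ (J * DIM('a))"
        by (simp add: distrib_left powr_add powr_realpow[symmetric])
      ultimately show ?thesis by (simp add: kk_def mult_ac)
    qed
    have "ennreal (2 powr (real J * \<alpha>) * kk J w) = ennreal ?x * ennreal (norm w powr (- \<alpha>) * norm w powr (- ?d))"
      unfolding eq using t by (intro ennreal_mult) auto
    also have "\<dots> \<le> ennreal (2 powr \<alpha>) * Psi \<alpha> J w * ennreal (norm w powr (- \<alpha>) * norm w powr (- ?d))"
      by (rule mult_right_mono[OF main]) simp
    finally have "ennreal (2 powr (real J * \<alpha>) * kk J w) \<le> \<dots>" .
    then show ?thesis by (simp add: jpow_def hpow_def ennreal_mult kk_nonneg)
  qed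
  have "rnorm (count_space UNIV) s (\<lambda>J. jpow \<alpha> J * (\<integral>\<^sup>+w. ennreal (kk J w) * f w \<partial>(lborel :: 'a measure)))
      \<le> ennreal (2 powr \<alpha> * max 0 C) * rnorm (hmeas :: 'a measure) s (\<lambda>h. hpow \<alpha> h * f h)"
    if s: "0 \<le> s" "s \<le> 1" and [measurable]: "f \<in> borel_measurable borel" for s f
  proof -
    have "jpow \<alpha> J * (\<integral>\<^sup>+w. ennreal (kk J w) * f w \<partial>(lborel :: 'a measure))
       \<le> ennreal (2 powr \<alpha>) * (\<integral>\<^sup>+w. Psi \<alpha> J w * (hpow \<alpha> w * f w) \<partial>(hmeas :: 'a measure))" for J
    proof -
      have "jpow \<alpha> J * (\<integral>\<^sup>+w. ennreal (kk J w) * f w \<partial>(lborel :: 'a measure)) = (\<integral>\<^sup>+w. jpow \<alpha> J * ennreal (kk J w) * f w \<partial>lborel)"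
        by (simp add: nn_integral_cmult[symmetric] mult.assoc)
      also have "\<dots> \<le> (\<integral>\<^sup>+w. ennreal (norm w powr (- ?d)) * (ennreal (2 powr \<alpha>) * (Psi \<alpha> J w * (hpow \<alpha> w * f w))) \<partial>lborel)"
      proof (rule nn_integral_mono_AE)
        have "AE w in lborel. w \<noteq> (0::'a)" by (rule AE_lborel_singleton)
        then show "AE w in lborel. jpow \<alpha> J * ennreal (kk J w) * f w
            \<le> ennreal (norm (w::'a) powr (- ?d)) * (ennreal (2 powr \<alpha>) * (Psi \<alpha> J w * (hpow \<alpha> w * f w)))"
        proof eventually_elim
          case (elim w)
          have "jpow \<alpha> J * ennreal (kk J w) * f w \<le> ennreal (2 powr \<alpha>) * Psi \<alpha> J w * (hpow \<alpha> w * ennreal (norm w powr (- ?d))) * f w"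
            by (intro mult_right_mono le elim) simp
          then show ?case by (simp add: mult_ac)
        qed
      qed
      also have "\<dots> = (\<integral>\<^sup>+w. ennreal (2 powr \<alpha>) * (Psi \<alpha> J w * (hpow \<alpha> w * f w)) \<partial>(hmeas :: 'a measure))"
        unfolding hmeas_def by (rule nn_integral_density[symmetric]) auto
      also have "\<dots> = ennreal (2 powr \<alpha>) * (\<integral>\<^sup>+w. Psi \<alpha> J w * (hpow \<alpha> w * f w) \<partial>(hmeas :: 'a measure))"
        by (rule nn_integral_cmult) simp
      finally show ?thesis .
    qed
    then have "rnorm (count_space UNIV) s (\<lambda>J. jpow \<alpha> J * (\<integral>\<^sup>+w. ennreal (kk J w) * f w \<partial>(lborel :: 'a measure)))
      \<le> rnorm (count_space UNIV) s (\<lambda>J. ennreal (2 powr \<alpha>) * (\<integral>\<^sup>+w. Psi \<alpha> J w * (hpow \<alpha> w * f w) \<partial>(hmeas :: 'a measure)))"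
      using s by (intro rnorm_mono_AE AE_I2) auto
    also have "\<dots> \<le> ennreal (2 powr \<alpha>) * rnorm (count_space UNIV) s (\<lambda>J. \<integral>\<^sup>+w. Psi \<alpha> J w * (hpow \<alpha> w * f w) \<partial>(hmeas :: 'a measure))"
      by (rule rnorm_cmult) (use s in auto)
    also have "\<dots> \<le> ennreal (2 powr \<alpha>) * (ennreal (max 0 C) * rnorm (hmeas :: 'a measure) s (\<lambda>h. hpow \<alpha> h * f h))"
      by (intro mult_left_mono order_trans[OF C[OF s]] mult_right_mono ennreal_leI) auto
    finally show ?thesis by (simp add: ennreal_mult mult.assoc)
  qed
  then show ?thesis by blast
qed

section \<open>Triangular systems\<close>

text \<open>Back substitution for fixed \<open>b\<close>: the solution of X_a + (sum of
  \<open>F a m\<close> X_m over a < m < b) = \<open>R a b\<close>, that is (I + F)^(-1) R for the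
  strictly triangular \<open>F\<close>.\<close>

function lsolve :: "(nat \<Rightarrow> nat \<Rightarrow> complex) \<Rightarrow> (nat \<Rightarrow> nat \<Rightarrow> complex) \<Rightarrow> nat \<Rightarrow> nat \<Rightarrow> complex" where
  "lsolve F R a b = R a b - (\<Sum>m\<in>{a<..<b}. F a m * lsolve F R m b)"
  by pat_completeness auto
termination
  by (relation "Wellfounded.measure (\<lambda>(F, R, a, b). b - a)") auto

declare lsolve.simps [simp del]

lemma lsolve_induct [case_names less]:
  fixes a b :: nat
  assumes "\<And>a. a < b \<Longrightarrow> (\<And>m. a < m \<Longrightarrow> m < b \<Longrightarrow> Q m) \<Longrightarrow> Q a" and "a < b"
  shows "Q a"
  using assms(2)
proof (induction "b - a" arbitrary: a rule: less_induct)
  case less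
  show ?case by (rule assms(1)) (use less in auto)
qed

lemma lsolve_cong:
  assumes "a < b" "\<And>m. a \<le> m \<Longrightarrow> m < b \<Longrightarrow> R m b = R' m b"
    "\<And>m k. a \<le> m \<Longrightarrow> m < k \<Longrightarrow> k < b \<Longrightarrow> F m k = F' m k"
  shows "lsolve F R a b = lsolve F' R' a b"
  using assms
proof (induction a rule: lsolve_induct[of b])
  case (less a)
  have "(\<Sum>m\<in>{a<..<b}. F a m * lsolve F R m b) = (\<Sum>m\<in>{a<..<b}. F' a m * lsolve F' R' m b)"
    by (rule sum.cong) (use less in auto)
  then show ?case using less by (subst (1 2) lsolve.simps) simp
qed (use assms in auto)

lemma lsolve_sums:
  assumes "a < b" "\<And>m. a \<le> m \<Longrightarrow> m < b \<Longrightarrow> (\<lambda>J. R J m b) sums R' m b"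
  shows "(\<lambda>J. lsolve F (R J) a b) sums lsolve F R' a b"
  using assms
proof (induction a rule: lsolve_induct[of b])
  case (less a)
  have "(\<lambda>J. R J a b - (\<Sum>m\<in>{a<..<b}. F a m * lsolve F (R J) m b)) sums
      (R' a b - (\<Sum>m\<in>{a<..<b}. F a m * lsolve F R' m b))"
    by (intro sums_diff sums_sum sums_mult) (use less in auto)
  then show ?case by (subst (1 2) lsolve.simps)
qed (use assms in auto)

lemma lsolve_diff:
  assumes "a < b"
  shows "lsolve F (\<lambda>m b. R m b * c - R' m b * c') a b = lsolve F R a b * c - lsolve F R' a b * c'"
  using assms
proof (induction a rule: lsolve_induct[of b])
  case (less a)
  have "(\<Sum>m\<in>{a<..<b}. F a m * lsolve F (\<lambda>m b. R m b * c - R' m b * c') m b)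
      = (\<Sum>m\<in>{a<..<b}. F a m * (lsolve F R m b * c - lsolve F R' m b * c'))"
    by (rule sum.cong) (use less in auto)
  also have "\<dots> = (\<Sum>m\<in>{a<..<b}. F a m * lsolve F R m b) * c - (\<Sum>m\<in>{a<..<b}. F a m * lsolve F R' m b) * c'"
    by (simp only: sum_subtractf sum_distrib_right right_diff_distrib mult.assoc)
  finally have e: "(\<Sum>m\<in>{a<..<b}. F a m * lsolve F (\<lambda>m b. R m b * c - R' m b * c') m b) = \<dots>" .
  show ?case
    unfolding lsolve.simps[of F _ a b] e by (simp only: left_diff_distrib) simp
qed (use assms in auto)

text \<open>If \<open>F\<close> and \<open>G\<close> are the values at \<open>x\<close> and \<open>y\<close> of a unitriangular matrix function, the first
  factor below is the corresponding entry of \<open>F\<^sup>-\<^sup>1 G\<close> (Chen's relation).\<close>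

lemma lsolve_chen:
  assumes "a < b"
  shows "lsolve F R a b = lsolve G R a b + (\<Sum>m\<in>{a<..<b}. lsolve F (\<lambda>m b. G m b - F m b) a m * lsolve G R m b)"
  using assms
proof (induction a rule: lsolve_induct[of b])
  case (less a)
  let ?w = "lsolve F (\<lambda>m b. G m b - F m b)"
  let ?L = "\<lambda>m. lsolve G R m b"
  have IH: "lsolve F R m b = ?L m + (\<Sum>r\<in>{m<..<b}. ?w m r * ?L r)" if "a < m" "m < b" for m
    using less that by blast
  have swap: "(\<Sum>m\<in>{a<..<b}. F a m * (\<Sum>r\<in>{m<..<b}. ?w m r * ?L r)) = (\<Sum>r\<in>{a<..<b}. (\<Sum>m\<in>{a<..<r}. F a m * ?w m r) * ?L r)"
  proof -
    have "(\<Sum>m\<in>{a<..<b}. F a m * (\<Sum>r\<in>{m<..<b}. ?w m r * ?L r)) = (\<Sum>m\<in>{a<..<b}. \<Sum>r\<in>{r\<in>{a<..<b}. m < r}. F a m * ?w m r * ?L r)"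
      unfolding sum_distrib_left by (intro sum.cong) (auto simp: mult.assoc)
    also have "\<dots> = (\<Sum>r\<in>{a<..<b}. \<Sum>m\<in>{m\<in>{a<..<b}. m < r}. F a m * ?w m r * ?L r)"
      by (rule sum.swap_restrict) auto
    also have "\<dots> = (\<Sum>r\<in>{a<..<b}. (\<Sum>m\<in>{a<..<r}. F a m * ?w m r) * ?L r)"
      unfolding sum_distrib_right by (intro sum.cong) auto
    finally show ?thesis .
  qed
  have "(\<Sum>m\<in>{a<..<b}. F a m * lsolve F R m b) = (\<Sum>m\<in>{a<..<b}. F a m * ?L m) + (\<Sum>m\<in>{a<..<b}. F a m * (\<Sum>r\<in>{m<..<b}. ?w m r * ?L r))"
    unfolding sum.distrib[symmetric] by (intro sum.cong) (auto simp: IH distrib_left)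
  then have "lsolve F R a b = R a b - (\<Sum>m\<in>{a<..<b}. F a m * ?L m) - (\<Sum>r\<in>{a<..<b}. (\<Sum>m\<in>{a<..<r}. F a m * ?w m r) * ?L r)"
    by (subst lsolve.simps) (simp add: swap)
  \<comment> \<open>\<open>R\<close> is eliminated through the system with coefficients
    \<open>G\<close>, so that the differences \<open>G a m - F a m\<close> become the coefficients
    of \<open>?L m\<close>.\<close>
  also have "R a b = ?L a + (\<Sum>m\<in>{a<..<b}. G a m * ?L m)" by (subst lsolve.simps) simp
  also have "?L a + (\<Sum>m\<in>{a<..<b}. G a m * ?L m) - (\<Sum>m\<in>{a<..<b}. F a m * ?L m) - (\<Sum>r\<in>{a<..<b}. (\<Sum>m\<in>{a<..<r}. F a m * ?w m r) * ?L r)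
      = ?L a + (\<Sum>r\<in>{a<..<b}. (G a r - F a r - (\<Sum>m\<in>{a<..<r}. F a m * ?w m r)) * ?L r)"
    by (simp only: sum_subtractf left_diff_distrib) simp
  also have "\<dots> = ?L a + (\<Sum>r\<in>{a<..<b}. ?w a r * ?L r)"
    unfolding lsolve.simps[of F "\<lambda>m b. G m b - F m b" a] ..
  finally show ?case .
qed (use assms in auto)

context dyadic_setting
begin

section \<open>Kernel estimates\<close>

lemma P_bounds:
  "\<exists>C>0. (\<forall>J w. norm (P J w) \<le> C * kk J w) \<and>
     (\<forall>J w h. 2 ^ J * norm h \<le> 1 \<longrightarrow> norm (P J (w + h) - P J w) \<le> C * (2 ^ J * norm h) * kk J w)"
proof -
  define N where "N = 2 * DIM('a) + 2"
  have kkN: "kk J w = 2 ^ (J * DIM('a)) / (1 + 2 ^ J * norm w) ^ N" for J and w :: 'a by (simp only: kk_def N_def)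
  obtain C where C: "C > 0" "\<And>x. norm (inv_fourier chi x) \<le> C / (1 + norm x) ^ N"
    using rapid_ex[OF inv_fourier_rapid[OF chi_test], of N] by blast
  obtain D where D: "D > 0" "\<And>x h. norm h \<le> 1 \<Longrightarrow> norm (inv_fourier chi (x + h) - inv_fourier chi x) \<le> D * norm h / (1 + norm x) ^ N"
    using inv_fourier_lipschitz[OF chi_test, of N] by blast
  let ?M = "max C D"
  have "norm (P J w) \<le> ?M * kk J w" for J w
  proof -
    have "norm (P J w) \<le> 2 ^ (J * DIM('a)) * (C / (1 + norm (2 ^ J *\<^sub>R w)) ^ N)"
      using mult_left_mono[OF C(2)[of "2 ^ J *\<^sub>R w"], of "2 ^ (J * DIM('a))"] by (simp add: P_def dilate_def norm_mult norm_power)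
    also have "\<dots> = C * kk J w" by (simp add: kkN)
    also have "\<dots> \<le> ?M * kk J w" by (intro mult_right_mono kk_nonneg) simp
    finally show ?thesis .
  qed
  moreover have "norm (P J (w + h) - P J w) \<le> ?M * (2 ^ J * norm h) * kk J w" if h: "2 ^ J * norm h \<le> 1" for J w h
  proof -
    have "P J (w + h) - P J w = of_real (2 ^ (J * DIM('a))) * (inv_fourier chi (2 ^ J *\<^sub>R w + 2 ^ J *\<^sub>R h) - inv_fourier chi (2 ^ J *\<^sub>R w))"
      by (simp add: P_def dilate_def scaleR_add_right right_diff_distrib)
    then have "norm (P J (w + h) - P J w) = 2 ^ (J * DIM('a)) * norm (inv_fourier chi (2 ^ J *\<^sub>R w + 2 ^ J *\<^sub>R h) - inv_fourier chi (2 ^ J *\<^sub>R w))"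
      by (simp add: norm_mult norm_power)
    also have "\<dots> \<le> 2 ^ (J * DIM('a)) * (D * norm (2 ^ J *\<^sub>R h) / (1 + norm (2 ^ J *\<^sub>R w)) ^ N)"
      using h by (intro mult_left_mono D) auto
    also have "\<dots> = D * (2 ^ J * norm h) * kk J w" by (simp add: kkN)
    also have "\<dots> \<le> ?M * (2 ^ J * norm h) * kk J w" by (intro mult_right_mono kk_nonneg) auto
    finally show ?thesis .
  qed
  ultimately show ?thesis using C(1) by (intro exI[of _ ?M]) auto
qed

lemma kk_Suc: "kk J (w::'a) \<le> 2 ^ (2 * DIM('a) + 2) * kk (Suc J) w" "kk (Suc J) w \<le> 2 ^ DIM('a) * kk J w"
proof -
  define N where "N = 2 * DIM('a) + 2"
  have kkN: "kk J w = 2 ^ (J * DIM('a)) / (1 + 2 ^ J * norm w) ^ N" for J and w :: 'a by (simp only: kk_def N_def)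
  let ?u = "1 + 2 ^ J * norm w" and ?v = "1 + 2 ^ Suc J * norm w"
  have p: "0 < ?u" "0 < ?v" "0 < ?u ^ N" "0 < ?v ^ N" by (auto intro!: add_pos_nonneg zero_less_power)
  have "?v ^ N \<le> (2 * ?u) ^ N" by (intro power_mono) auto
  then have "?v ^ N \<le> 2 ^ N * ?u ^ N" by (simp only: power_mult_distrib)
  then have "1 / ?u ^ N \<le> 2 ^ N / ?v ^ N" using p by (simp add: field_simps)
  moreover have "(2::real) ^ (J * DIM('a)) \<le> 2 ^ (Suc J * DIM('a))" by (intro power_increasing) auto
  ultimately have "2 ^ (J * DIM('a)) * (1 / ?u ^ N) \<le> 2 ^ (Suc J * DIM('a)) * (2 ^ N / ?v ^ N)"
    using p by (intro mult_mono) auto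
  then show "kk J w \<le> 2 ^ (2 * DIM('a) + 2) * kk (Suc J) w"
    unfolding kkN N_def[symmetric] by (simp only: times_divide_eq_right mult_1_right mult.commute)
  have "?u ^ N \<le> ?v ^ N" by (intro power_mono add_left_mono mult_right_mono) auto
  then have "2 ^ (Suc J * DIM('a)) / ?v ^ N \<le> 2 ^ (Suc J * DIM('a)) / ?u ^ N"
    using p by (intro divide_left_mono mult_pos_pos) auto
  then show "kk (Suc J) w \<le> 2 ^ DIM('a) * kk J w" unfolding kkN by (simp add: power_add)
qed

lemma kk_scale: "kk J (inverse (2 ^ J) *\<^sub>R (w::'a)) = 2 ^ (J * DIM('a)) * kk 0 w"
proof -
  have e: "2 ^ J * norm (inverse (2 ^ J) *\<^sub>R w) = norm w" by simp
  show ?thesis unfolding kk_def by (simp only: e) simp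
qed

lemma kernel_bounds:
  "\<exists>C>0. (\<forall>J w. norm (kap J w) \<le> C * kk J w) \<and> (\<forall>J\<ge>2. \<forall>w. norm (P (J - 2) w) \<le> C * kk J w) \<and>
     (\<forall>J\<ge>2. \<forall>w h. 2 ^ J * norm h \<le> 1 \<longrightarrow> norm (P (J - 2) (w + h) - P (J - 2) w) \<le> C * (2 ^ J * norm h) * kk J w)"
proof -
  obtain C where C: "C > 0" "\<And>J w. norm (P J w) \<le> C * kk J w"
    "\<And>J w h. 2 ^ J * norm h \<le> 1 \<Longrightarrow> norm (P J (w + h) - P J w) \<le> C * (2 ^ J * norm h) * kk J w"
    using P_bounds by blast
  let ?c = "2 ^ (2 * DIM('a) + 2) :: real"
  \<comment> \<open>Each factor \<open>?c\<close> pays for one step of scale from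
    \<open>J - 2\<close> to \<open>J\<close>; the same constant covers the difference of two
    neighbouring kernels in \<open>kap J\<close>.\<close>
  let ?M = "C * ?c * ?c"
  have c1: "1 \<le> ?c" by (rule one_le_power) simp
  have two: "kk (J - 2) w \<le> ?c * ?c * kk J w" if "J \<ge> 2" for J and w :: 'a
  proof -
    have "kk (J - 2) w \<le> ?c * kk (Suc (J - 2)) w" by (rule kk_Suc)
    also have "\<dots> \<le> ?c * (?c * kk (Suc (Suc (J - 2))) w)" by (intro mult_left_mono kk_Suc) simp
    also have "Suc (Suc (J - 2)) = J" using that by simp
    finally show ?thesis by (simp only: mult.assoc)
  qed
  have "norm (kap J w) \<le> ?M * kk J w" for J w
  proof (cases J)
    case 0
    have "C * kk J w \<le> ?M * kk J w"
      using c1 C(1) mult_mono[of 1 ?c 1 ?c] by (intro mult_right_mono kk_nonneg) (simp add: mult.assoc del: power_add power_Suc)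
    then show ?thesis using C(2)[of J w] 0 by (simp add: kap_0 del: power_add power_Suc)
  next
    case (Suc i)
    have "norm (kap J w) \<le> norm (P J w) + norm (P i w)" unfolding Suc kap_Suc by (rule norm_triangle_ineq4)
    also have "\<dots> \<le> C * kk J w + C * (?c * kk J w)"
      using C(1) kk_Suc(1)[of i w] Suc by (intro add_mono C(2) order_trans[OF C(2)] mult_left_mono) auto
    also have "\<dots> = C * (1 + ?c) * kk J w" by (simp only: distrib_left distrib_right mult.assoc mult_1_right)
    also have "\<dots> \<le> C * (?c * ?c) * kk J w"
    proof (intro mult_right_mono mult_left_mono kk_nonneg)
      have "(2::real) ^ 2 \<le> ?c" by (intro power_increasing) auto
      then have "(4::real) \<le> ?c" by simp
      then have "4 * ?c \<le> ?c * ?c" by (intro mult_right_mono) auto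
      then show "1 + ?c \<le> ?c * ?c" using c1 by linarith
    qed (use C(1) in simp)
    finally show ?thesis by (simp only: mult.assoc)
  qed
  moreover have "norm (P (J - 2) w) \<le> ?M * kk J w" if "J \<ge> 2" for J w
  proof -
    have "C * kk (J - 2) w \<le> C * (?c * ?c * kk J w)" using C(1) by (intro mult_left_mono two that) simp
    with C(2)[of "J - 2" w] show ?thesis by (simp only: mult.assoc)
  qed
  moreover have "norm (P (J - 2) (w + h) - P (J - 2) w) \<le> ?M * (2 ^ J * norm h) * kk J w" if J: "J \<ge> 2" and h: "2 ^ J * norm h \<le> 1" for J w h
  proof -
    have le: "2 ^ (J - 2) * norm h \<le> 2 ^ J * norm h" by (intro mult_right_mono power_increasing) auto
    then have "norm (P (J - 2) (w + h) - P (J - 2) w) \<le> C * (2 ^ (J - 2) * norm h) * kk (J - 2) w" using h by (intro C(3)) simp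
    also have "\<dots> \<le> C * (2 ^ J * norm h) * (?c * ?c * kk J w)"
      using C(1) le kk_nonneg two[OF J] by (intro mult_mono) auto
    finally show ?thesis by (simp only: mult_ac)
  qed
  moreover have "?M > 0" using C(1) by simp
  ultimately show ?thesis by (intro exI[of _ ?M]) blast
qed

text \<open>The modulus of continuity of the kernel in L^1: the Lipschitz bound when 2^(J + 1) |h|
  \<le> 1, the triangle inequality otherwise.\<close>

lemma P_difference_integral:
  "\<exists>C>0. \<forall>J h. (\<integral>\<^sup>+w. ennreal (norm (P (Suc J) (w + h) - P (Suc J) w)) \<partial>lborel) \<le> ennreal C * mint J h"
proof -
  obtain C where C: "C > 0" "\<And>J w. norm (P J w) \<le> C * kk J w"
    "\<And>J w h. 2 ^ J * norm h \<le> 1 \<Longrightarrow> norm (P J (w + h) - P J w) \<le> C * (2 ^ J * norm h) * kk J w"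
    using P_bounds by blast
  have kk0: "(\<integral>\<^sup>+w. ennreal (kk J w) \<partial>(lborel :: 'a measure)) = (\<integral>\<^sup>+w. ennreal (kk 0 w) \<partial>(lborel :: 'a measure))" for J
  proof -
    have "(\<integral>\<^sup>+w. ennreal (kk J w) \<partial>(lborel :: 'a measure))
      = ennreal (\<bar>inverse (2 ^ J)\<bar> ^ DIM('a)) * (\<integral>\<^sup>+w. ennreal (kk J (0 + inverse (2 ^ J) *\<^sub>R w)) \<partial>(lborel :: 'a measure))"
      by (rule nn_integral_lborel_affine) auto
    also have "\<dots> = (\<integral>\<^sup>+w. ennreal (\<bar>inverse (2 ^ J)\<bar> ^ DIM('a)) * ennreal (kk J (0 + inverse (2 ^ J) *\<^sub>R w)) \<partial>(lborel :: 'a measure))"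
      by (simp add: nn_integral_cmult)
    also have "\<dots> = (\<integral>\<^sup>+w. ennreal (kk 0 w) \<partial>(lborel :: 'a measure))"
    proof (intro nn_integral_cong)
      fix w :: 'a
      have "\<bar>inverse (2 ^ J)\<bar> ^ DIM('a) * (2 ^ (J * DIM('a)) * kk 0 w) = kk 0 w"
        by (simp add: power_mult power_inverse)
      then show "ennreal (\<bar>inverse (2 ^ J)\<bar> ^ DIM('a)) * ennreal (kk J (0 + inverse (2 ^ J) *\<^sub>R w)) = ennreal (kk 0 w)"
        using kk_nonneg[of 0 w] by (simp only: add_0 kk_scale) (simp flip: ennreal_mult)
    qed
    finally show ?thesis .
  qed
  have "integrable lborel (kk 0 :: 'a \<Rightarrow> real)"
  proof (rule Bochner_Integration.integrable_bound[OF rapid_weight_integrable])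
    have "1 / (1 + norm w) ^ (2 * DIM('a) + 2) \<le> 1 / (1 + norm w) ^ (2 * DIM('a))" for w :: 'a
      by (intro divide_left_mono power_increasing mult_pos_pos zero_less_power) (auto intro: add_pos_nonneg)
    then show "AE w in lborel. norm (kk 0 w) \<le> norm (1 / (1 + norm (w::'a)) ^ (2 * DIM('a)))"
      by (simp add: kk_def del: power_add)
  qed simp
  then have i: "(\<integral>\<^sup>+w. ennreal (kk 0 w) \<partial>(lborel :: 'a measure)) = ennreal (LINT w|lborel. kk 0 (w::'a))"
    by (rule nn_integral_eq_integral[OF _ AE_I2[OF kk_nonneg]])
  define G where "G = (LINT w|lborel. kk 0 (w::'a))"
  have G: "(\<integral>\<^sup>+w. ennreal (kk 0 w) \<partial>(lborel :: 'a measure)) = ennreal G" "0 \<le> G"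
    using i by (auto simp: G_def kk_nonneg)
  have km: "(\<lambda>w. ennreal (kk J w)) \<in> borel_measurable (lborel :: 'a measure)" for J by simp
  have "(\<integral>\<^sup>+w. ennreal (norm (P (Suc J) (w + h) - P (Suc J) w)) \<partial>lborel) \<le> ennreal (4 * C * G + 1) * mint J h" for J h
  proof (cases "2 ^ Suc J * norm h \<le> 1")
    case True
    have "(\<integral>\<^sup>+w. ennreal (norm (P (Suc J) (w + h) - P (Suc J) w)) \<partial>lborel)
        \<le> (\<integral>\<^sup>+w. ennreal (C * (2 ^ Suc J * norm h)) * ennreal (kk (Suc J) w) \<partial>(lborel :: 'a measure))"
    proof (intro nn_integral_mono)
      fix w
      have "ennreal (norm (P (Suc J) (w + h) - P (Suc J) w)) \<le> ennreal (C * (2 ^ Suc J * norm h) * kk (Suc J) w)"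
        by (rule ennreal_leI[OF C(3)[OF True]])
      also have "\<dots> = ennreal (C * (2 ^ Suc J * norm h)) * ennreal (kk (Suc J) w)"
        using C(1) kk_nonneg by (intro ennreal_mult) auto
      finally show "ennreal (norm (P (Suc J) (w + h) - P (Suc J) w)) \<le> \<dots>" .
    qed
    also have "\<dots> = ennreal (C * (2 ^ Suc J * norm h)) * ennreal G"
      unfolding nn_integral_cmult[OF km] kk0[of "Suc J"] G(1) ..
    also have "\<dots> = ennreal (C * (2 ^ Suc J * norm h) * G)"
      using C(1) G(2) by (intro ennreal_mult[symmetric]) auto
    also have "\<dots> \<le> ennreal ((4 * C * G + 1) * (2 ^ J * norm h))"
    proof (intro ennreal_leI)
      have "C * (2 ^ Suc J * norm h) * G = 2 * (C * G) * (2 ^ J * norm h)" by simp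
      also have "\<dots> \<le> (4 * C * G + 1) * (2 ^ J * norm h)" using C(1) G(2) by (intro mult_right_mono) auto
      finally show "C * (2 ^ Suc J * norm h) * G \<le> \<dots>" .
    qed
    also have "\<dots> = ennreal (4 * C * G + 1) * ennreal (2 ^ J * norm h)"
      using C(1) G(2) by (intro ennreal_mult) auto
    also have "ennreal (2 ^ J * norm h) = mint J h"
    proof -
      have "0 \<le> 2 ^ J * norm h" "2 * (2 ^ J * norm h) \<le> 1" using True by simp_all
      then have "min 1 (2 ^ J * norm h) = 2 ^ J * norm h" by linarith
      then show ?thesis by (simp only: mint_def)
    qed
    finally show ?thesis .
  next
    case False
    have "(\<integral>\<^sup>+w. ennreal (norm (P (Suc J) (w + h) - P (Suc J) w)) \<partial>lborel)
       \<le> (\<integral>\<^sup>+w. ennreal (norm (P (Suc J) (w + h))) + ennreal (norm (P (Suc J) w)) \<partial>lborel)"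
      by (intro nn_integral_mono) (simp add: norm_triangle_ineq4 ennreal_leI flip: ennreal_plus)
    also have "\<dots> = (\<integral>\<^sup>+w. ennreal (norm (P (Suc J) w)) \<partial>lborel) + (\<integral>\<^sup>+w. ennreal (norm (P (Suc J) w)) \<partial>lborel)"
      using nn_integral_lborel_affine[of 1 "\<lambda>w. ennreal (norm (P (Suc J) w))" h]
      by (simp add: nn_integral_add add.commute)
    also have "\<dots> \<le> ennreal (C * G) + ennreal (C * G)"
    proof -
      have "(\<integral>\<^sup>+w. ennreal (norm (P (Suc J) w)) \<partial>lborel) \<le> (\<integral>\<^sup>+w. ennreal C * ennreal (kk (Suc J) w) \<partial>(lborel :: 'a measure))"
        using C(1,2) by (intro nn_integral_mono) (simp add: kk_nonneg flip: ennreal_mult)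
      also have "\<dots> = ennreal C * ennreal G"
        unfolding nn_integral_cmult[OF km] kk0[of "Suc J"] G(1) ..
      also have "\<dots> = ennreal (C * G)" using C(1) G(2) by (intro ennreal_mult[symmetric]) auto
      finally show ?thesis by (intro add_mono)
    qed
    also have "\<dots> \<le> ennreal ((4 * C * G + 1) * (1 / 2))"
      using C(1) G(2) by (simp add: ennreal_leI flip: ennreal_plus)
    also have "\<dots> \<le> ennreal (4 * C * G + 1) * mint J h"
    proof -
      have "1 / 2 \<le> min 1 (2 ^ J * norm h)" using False by simp
      then have "(4 * C * G + 1) * (1 / 2) \<le> (4 * C * G + 1) * min 1 (2 ^ J * norm h)"
        using C(1) G(2) by (intro mult_left_mono) auto
      then have "ennreal ((4 * C * G + 1) * (1 / 2)) \<le> ennreal ((4 * C * G + 1) * min 1 (2 ^ J * norm h))" by (rule ennreal_leI)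
      also have "\<dots> = ennreal (4 * C * G + 1) * mint J h"
        unfolding mint_def using C(1) G(2) by (intro ennreal_mult) auto
      finally show ?thesis .
    qed
    finally show ?thesis .
  qed
  \<comment> \<open>The Lipschitz case costs \<open>2 * C * G\<close>. The other case costs twice as
    much, because there \<open>mint J h\<close> is only known to be at least 1/2. The summand 1
    keeps the constant positive.\<close>
  then show ?thesis using C(1) G(2) by (intro exI[of _ "4 * C * G + 1"]) (auto intro: add_nonneg_pos)
qed

end

section \<open>Scaling, integration and measurability of triangular systems\<close>

lemma lsolve_mult:
  assumes "a < b"
  shows "lsolve F (\<lambda>m b. R m b * c) a b = lsolve F R a b * c"
  using lsolve_diff[OF assms, of F R c R 0] by simp

lemma lsolve_integral:
  fixes R :: "'w \<Rightarrow> nat \<Rightarrow> nat \<Rightarrow> complex"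
  assumes "a < b" "\<And>m. a \<le> m \<Longrightarrow> m < b \<Longrightarrow> integrable M (\<lambda>w. R w m b)"
  shows "integrable M (\<lambda>w. lsolve F (R w) a b) \<and>
    (LINT w|M. lsolve F (R w) a b) = lsolve F (\<lambda>m b. LINT w|M. R w m b) a b"
  using assms
proof (induction a rule: lsolve_induct[of b])
  case (less a)
  have IH: "integrable M (\<lambda>w. lsolve F (R w) m b)"
    "(LINT w|M. lsolve F (R w) m b) = lsolve F (\<lambda>m b. LINT w|M. R w m b) m b" if "a < m" "m < b" for m
    using less that by auto
  have i: "integrable M (\<lambda>w. R w a b)" "integrable M (\<lambda>w. \<Sum>m\<in>{a<..<b}. F a m * lsolve F (R w) m b)"
    using less IH by (auto intro!: Bochner_Integration.integrable_sum)
  have "(LINT w|M. (\<Sum>m\<in>{a<..<b}. F a m * lsolve F (R w) m b)) = (\<Sum>m\<in>{a<..<b}. F a m * lsolve F (\<lambda>m b. LINT w|M. R w m b) m b)"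
    using IH by (subst Bochner_Integration.integral_sum) auto
  with i show ?case
    unfolding lsolve.simps[of F _ a b] by (simp add: Bochner_Integration.integral_diff)
qed (use assms in auto)

text \<open>The last unknown equals 1; substituting it moves the column \<open>F m k\<close> to the
  right-hand side. The system with one more index thus becomes the system for the increment
  \<open>G - F\<close>, which is how the coefficients \<open>AA\<close> are recognised as averages
  of \<open>om\<close>.\<close>

lemma lsolve_unit:
  assumes "a < k"
  shows "lsolve F (\<lambda>m b. if m = k then 1 else G m) a (Suc k) = lsolve F (\<lambda>m b. G m - F m b) a k"
  using assms
proof (induction a rule: lsolve_induct[of k])
  case (less a)
  have set: "{a<..<Suc k} = insert k {a<..<k}" using less by auto
  have "lsolve F (\<lambda>m b. if m = k then 1 else G m) k (Suc k) = 1"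
  proof -
    have "{k<..<Suc k} = {}" by auto
    then show ?thesis by (subst lsolve.simps) simp
  qed
  moreover have "(\<Sum>m\<in>{a<..<k}. F a m * lsolve F (\<lambda>m b. if m = k then 1 else G m) m (Suc k))
      = (\<Sum>m\<in>{a<..<k}. F a m * lsolve F (\<lambda>m b. G m - F m b) m k)"
    using less by (intro sum.cong) auto
  ultimately show ?case
    using less unfolding lsolve.simps[of F _ a] set by simp
qed (use assms in auto)

lemma lsolve_measurable [measurable (raw)]:
  assumes [measurable]: "\<And>m k. (\<lambda>\<omega>. F \<omega> m k) \<in> borel_measurable M" "\<And>m k. (\<lambda>\<omega>. R \<omega> m k) \<in> borel_measurable M"
  shows "(\<lambda>\<omega>. lsolve (F \<omega>) (R \<omega>) a b) \<in> borel_measurable M"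
proof (induction "b - a" arbitrary: a rule: less_induct)
  case less
  have [measurable]: "(\<lambda>\<omega>. lsolve (F \<omega>) (R \<omega>) m b) \<in> borel_measurable M" if "m \<in> {a<..<b}" for m
    using less that by auto
  show ?case by (subst lsolve.simps) measurable
qed

context dyadic_setting
begin

section \<open>Increments of blocks\<close>

lemma conv_translate:
  fixes k g :: "'a \<Rightarrow> complex"
  assumes g: "moderate g" and k: "rapid k" and [measurable]: "k \<in> borel_measurable borel"
  shows "integrable lborel (\<lambda>w. k (h - w) * g (x + w))" "conv k g (x + h) = (LINT w|lborel. k (h - w) * g (x + w))"
proof -
  have [measurable]: "g \<in> borel_measurable borel" by (rule moderate_borel[OF g])
  have m: "(\<lambda>y. k (x + h - y) * g y) \<in> borel_measurable borel" by measurable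
  have e: "(\<lambda>w. k (x + h - (x + 1 *\<^sub>R w)) * g (x + 1 *\<^sub>R w)) = (\<lambda>w. k (h - w) * g (x + w))" by simp
  show "integrable lborel (\<lambda>w. k (h - w) * g (x + w))"
    using conv_integrable[OF g k assms(3), of "x + h"] integral_lborel_affine(2)[of 1, OF _ m, of x] unfolding e by simp
  show "conv k g (x + h) = (LINT w|lborel. k (h - w) * g (x + w))"
    using integral_lborel_affine(1)[of 1, OF _ m, of x] unfolding e conv_def by simp
qed

lemma B_moderate: "moderate g \<Longrightarrow> moderate (B J g)"
  unfolding B_def by (intro moderate_conv kap_rapid kap_borel)

lemma B_reproduce:
  assumes g: "moderate g" shows "B J g x = conv (P (Suc J)) (B J g) x"
proof -
  have "conv (P (Suc J)) (B J g) x = conv (conv (P (Suc J)) (kap J)) g x"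
    unfolding B_def by (rule conv_assoc[OF g P_rapid P_borel kap_rapid kap_borel])
  also have "conv (P (Suc J)) (kap J) = kap J" unfolding conv_def P_kap ..
  finally show ?thesis by (simp add: B_def)
qed

text \<open>A Bernstein-type bound: in \<open>B_reproduce\<close> the increment falls on the kernel
  \<open>P (Suc J)\<close>, whose L^1 modulus of continuity is of size
  \<open>mint J h\<close>.\<close>

lemma B_difference_le:
  "\<exists>C<top. \<forall>J h s g. moderate g \<longrightarrow> 0 \<le> s \<longrightarrow> s \<le> 1 \<longrightarrow>
     lnorm s (\<lambda>x. B J g (x + h) - B J g x) \<le> C * mint J h * lnorm s (B J g)"
proof -
  obtain C where C: "\<And>J h. (\<integral>\<^sup>+w. ennreal (norm (P (Suc J) (w + h) - P (Suc J) w)) \<partial>lborel) \<le> ennreal C * mint J h"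
    using P_difference_integral by blast
  have "lnorm s (\<lambda>x. B J g (x + h) - B J g x) \<le> ennreal C * mint J h * lnorm s (B J g)"
    if g: "moderate g" and s: "0 \<le> s" "s \<le> 1" for J h s g
  proof -
    note G = B_moderate[OF g, of J]
    note [measurable] = moderate_borel[OF G]
    have "B J g (x + h) - B J g x = conv (\<lambda>w. P (Suc J) (w + h) - P (Suc J) w) (B J g) x" for x
    proof -
      have "B J g (x + h) - B J g x = conv (P (Suc J)) (B J g) (x + h) - conv (P (Suc J)) (B J g) x"
        using B_reproduce[OF g, of J "x + h"] B_reproduce[OF g, of J x] by simp
      also have "\<dots> = (LINT y|lborel. P (Suc J) (x + h - y) * B J g y - P (Suc J) (x - y) * B J g y)"
        unfolding conv_def by (rule Bochner_Integration.integral_diff[symmetric]; rule conv_integrable[OF G P_rapid P_borel])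
      also have "\<dots> = conv (\<lambda>w. P (Suc J) (w + h) - P (Suc J) w) (B J g) x"
        unfolding conv_def by (intro Bochner_Integration.integral_cong) (auto simp: algebra_simps)
      finally show ?thesis .
    qed
    then have "lnorm s (\<lambda>x. B J g (x + h) - B J g x) = lnorm s (conv (\<lambda>w. P (Suc J) (w + h) - P (Suc J) w) (B J g))"
      by simp
    also have "\<dots> \<le> (\<integral>\<^sup>+w. ennreal (norm (P (Suc J) (w + h) - P (Suc J) w)) \<partial>lborel) * lnorm s (B J g)"
      by (rule lnorm_conv_le) (use s in auto)
    also have "\<dots> \<le> ennreal C * mint J h * lnorm s (B J g)" by (intro mult_right_mono C) simp
    finally show ?thesis .
  qed
  then show ?thesis by (intro exI[of _ "ennreal C"]) auto
qed

end

text \<open>Every term of the weighted sequence is at most its norm, whatever the exponent, and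
  dividing by the weight leaves a geometric series. Positive smoothness thus makes block norms
  summable.\<close>

lemma geometric_le_rnorm:
  assumes "0 < \<alpha>"
  shows "\<exists>C<top. \<forall>s e. 0 \<le> s \<longrightarrow> (\<Sum>J. e J) \<le> C * rnorm (count_space UNIV) s (\<lambda>J. jpow \<alpha> J * e J)"
proof -
  let ?C = "\<Sum>J. jpow (- \<alpha>) J"
  have j: "jpow (- \<alpha>) J = ennreal ((2 powr (- \<alpha>)) ^ J)" for J
    by (simp add: jpow_def powr_powr mult.commute flip: powr_realpow)
  have "2 powr (- \<alpha>) < (2::real) powr 0" using assms by (intro powr_less_mono) auto
  then have sm: "summable (\<lambda>J. (2 powr (- \<alpha>)) ^ J :: real)" by (intro summable_geometric) simp
  have "?C < top" unfolding j by (simp add: suminf_ennreal_eq[OF _ summable_sums[OF sm]])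
  moreover have "(\<Sum>J. e J) \<le> ?C * rnorm (count_space UNIV) s (\<lambda>J. jpow \<alpha> J * e J)" if "0 \<le> s" for s and e :: "nat \<Rightarrow> ennreal"
  proof -
    have "e J \<le> jpow (- \<alpha>) J * rnorm (count_space UNIV) s (\<lambda>J. jpow \<alpha> J * e J)" for J
    proof -
      have "e J = jpow (- \<alpha>) J * (jpow \<alpha> J * e J)" by (simp only: mult.assoc[symmetric] jpow_minus mult_1_left)
      also have "\<dots> \<le> jpow (- \<alpha>) J * rnorm (count_space UNIV) s (\<lambda>J. jpow \<alpha> J * e J)"
        by (intro mult_left_mono le_rnorm_count_space[where e = "\<lambda>J. jpow \<alpha> J * e J"]) (use that in auto)
      finally show ?thesis .
    qed
    then have "(\<Sum>J. e J) \<le> (\<Sum>J. jpow (- \<alpha>) J * rnorm (count_space UNIV) s (\<lambda>J. jpow \<alpha> J * e J))"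
      by (intro suminf_le) auto
    then show ?thesis by simp
  qed
  ultimately show ?thesis by blast
qed

lemma rnorm_count_space_single:
  fixes c :: ennreal
  assumes "0 \<le> s"
  shows "rnorm (count_space UNIV) s (\<lambda>J::nat. if J = i then c else 0) \<le> c"
proof (cases "s = 0")
  case True
  then show ?thesis unfolding rnorm_def by (auto intro!: esssup_I)
next
  case False
  have "(\<lambda>J. ennpowr (if J = i then c else 0) (1 / s)) = (\<lambda>J. ennpowr c (1 / s) * indicator {i} J)"
    by (auto simp: fun_eq_iff)
  then have "rnorm (count_space UNIV) s (\<lambda>J::nat. if J = i then c else 0) = ennpowr (ennpowr c (1 / s)) s"
    using False unfolding rnorm_def by (simp add: nn_integral_cmult_indicator)
  then show ?thesis using False by (simp add: ennpowr_ennpowr)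
qed

definition isum :: "(nat \<Rightarrow> real) \<Rightarrow> nat \<Rightarrow> nat \<Rightarrow> real" where
  "isum c a b = (\<Sum>i\<in>{a<..b}. c i)"

lemma isum_self [simp]: "isum c a a = 0"
  by (simp add: isum_def)

lemma isum_add: "a \<le> m \<Longrightarrow> m \<le> b \<Longrightarrow> isum c a m + isum c m b = isum c a b"
  unfolding isum_def by (subst sum.union_disjoint[symmetric]) (auto intro!: sum.cong simp: ivl_disj_un)

lemma isum_Suc: "a \<le> k \<Longrightarrow> isum c a (Suc k) = isum c a k + c (Suc k)"
proof -
  assume "a \<le> k"
  then have "{a<..Suc k} = insert (Suc k) {a<..k}" by auto
  then show ?thesis by (simp add: isum_def)
qed

context dyadic_setting
begin

section \<open>The iterated remainder\<close>

text \<open>Below \<open>Fp f a b\<close> is the function \<open>(f\<^bsub>a+1\<^esub>, \<dots>, f\<^bsub>b\<^esub>)\<^sup>\<prec>\<close> and \<open>om f a b\<close> is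
  \<open>\<omega>\<^bsub>a+1\<dots>b\<^esub>\<^sup>\<prec>\<close>; half-open index ranges make the recursions matrix identities.\<close>

primrec Fp :: "(nat \<Rightarrow> 'a \<Rightarrow> complex) \<Rightarrow> nat \<Rightarrow> nat \<Rightarrow> 'a \<Rightarrow> complex" where
  "Fp f a 0 = (\<lambda>_. 0)"
| "Fp f a (Suc b) = (if a = b then f (Suc b) else para (Fp f a b) (f (Suc b)))"

definition om :: "(nat \<Rightarrow> 'a \<Rightarrow> complex) \<Rightarrow> nat \<Rightarrow> nat \<Rightarrow> 'a \<Rightarrow> 'a \<Rightarrow> complex" where
  "om f a b x y = lsolve (\<lambda>m k. Fp f m k x) (\<lambda>m k. Fp f m k y - Fp f m k x) a b"

text \<open>Right-hand sides of the system after a block of the last factor has been split off: a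
  single factor has coefficient 1, a paraproduct has the low-frequency part of everything before its
  last factor.\<close>

definition EE :: "(nat \<Rightarrow> 'a \<Rightarrow> complex) \<Rightarrow> nat \<Rightarrow> 'a \<Rightarrow> nat \<Rightarrow> nat \<Rightarrow> complex" where
  "EE f J y m b = (if b = Suc m then 1 else S J (Fp f m (b - 1)) y)"

text \<open>The coefficient of \<open>B J (f (Suc k)) y\<close> in the block expansion of \<open>om f a (Suc k) x y\<close>.\<close>

definition AA :: "(nat \<Rightarrow> 'a \<Rightarrow> complex) \<Rightarrow> nat \<Rightarrow> nat \<Rightarrow> nat \<Rightarrow> 'a \<Rightarrow> 'a \<Rightarrow> complex" where
  "AA f J a k x y = lsolve (\<lambda>m k. Fp f m k x) (EE f J y) a (Suc k)"

lemma Fp_borel: "(\<And>i. f i \<in> borel_measurable borel) \<Longrightarrow> Fp f a b \<in> borel_measurable borel"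
  by (induction b) (auto intro: para_borel)

lemma om_measurable:
  assumes f: "\<And>i. f i \<in> borel_measurable borel" and [measurable]: "X \<in> borel_measurable M" "Y \<in> borel_measurable M"
  shows "(\<lambda>w. om f a b (X w) (Y w)) \<in> borel_measurable M"
proof -
  have [measurable]: "Fp f m k \<in> borel_measurable borel" for m k by (rule Fp_borel[OF f])
  show ?thesis unfolding om_def by measurable
qed

lemma AA_measurable:
  assumes f: "\<And>i. f i \<in> borel_measurable borel" and [measurable]: "X \<in> borel_measurable M" "Y \<in> borel_measurable M"
  shows "(\<lambda>w. AA f J a k (X w) (Y w)) \<in> borel_measurable M"
proof -
  have [measurable]: "Fp f m k \<in> borel_measurable borel" for m k by (rule Fp_borel[OF f])
  have [measurable]: "(\<lambda>w. EE f J (Y w) m k) \<in> borel_measurable M" for m k unfolding EE_def by measurable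
  show ?thesis unfolding AA_def by measurable
qed

lemma Fp_difference:
  assumes "a < b"
  shows "Fp f a b y - Fp f a b x = om f a b x y + (\<Sum>m\<in>{a<..<b}. Fp f a m x * om f m b x y)"
  unfolding om_def lsolve.simps[of _ _ a b] by simp

lemma AA_diag [simp]: "AA f J k k x y = 1"
proof -
  have "{k<..<Suc k} = {}" by auto
  then show ?thesis by (simp add: AA_def EE_def lsolve.simps[of _ _ k])
qed

text \<open>In front of the blocks 0 and 1 there is no low-frequency part, \<open>S J = 0\<close>,
  so the second variable drops out. These two coefficients are not mollifications of
  \<open>om\<close> and are bounded on their own.\<close>

lemma AA_low: "J < 2 \<Longrightarrow> AA f J a k x y = AA f J a k x z"
  unfolding AA_def by (rule arg_cong[where f = "\<lambda>R. lsolve _ R _ _"]) (auto simp: fun_eq_iff EE_def S_def)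

lemma AA_low_rec:
  assumes "J < 2" "a < k"
  shows "AA f J a k x y = - (\<Sum>m\<in>{a<..k}. Fp f a m x * AA f J m k x y)"
proof -
  have "{a<..<Suc k} = {a<..k}" by auto
  then show ?thesis unfolding AA_def using assms by (subst lsolve.simps) (simp add: EE_def S_def)
qed

text \<open>Integrate the triangular system against \<open>P (J - 2)\<close>. The kernel has
  integral 1 and keeps the entry 1, while it turns \<open>Fp f m k\<close> into its low-frequency
  part; by \<open>lsolve_unit\<close> the integrand is the kernel times \<open>om\<close>.\<close>

lemma AA_eq:
  assumes J: "2 \<le> J" and ak: "a < k" and mod: "\<And>m. a \<le> m \<Longrightarrow> m < k \<Longrightarrow> moderate (Fp f m k)"
  shows "integrable lborel (\<lambda>w. P (J - 2) (h - w) * om f a k x (x + w))"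
    and "AA f J a k x (x + h) = (LINT w|lborel. P (J - 2) (h - w) * om f a k x (x + w))"
proof -
  let ?p = "\<lambda>w. P (J - 2) (h - w)"
  let ?F = "\<lambda>m k. Fp f m k x"
  let ?R = "\<lambda>w m b. (if m = k then 1 else Fp f m k (x + w)) * ?p w"
  have one: "integrable lborel ?p" "(LINT w|lborel. ?p w) = 1"
    using integral_lborel_affine[of "-1" "P (J - 2)" h] rapid_integrable[OF P_rapid P_borel, of "J - 2"] P_integral[of "J - 2"]
    by simp_all
  have R: "integrable lborel (\<lambda>w. ?R w m (Suc k)) \<and> (LINT w|lborel. ?R w m (Suc k)) = EE f J (x + h) m (Suc k)"
    if m: "a \<le> m" "m < Suc k" for m
  proof (cases "m = k")
    case True
    then show ?thesis using one by (simp add: EE_def)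
  next
    case False
    then have "m < k" using m by simp
    from conv_translate[where h = h and x = x, OF mod[OF m(1) this] P_rapid[of "J - 2"] P_borel] show ?thesis
      using False J \<open>m < k\<close> by (simp add: EE_def S_def mult.commute)
  qed
  have L: "lsolve ?F (?R w) a (Suc k) = ?p w * om f a k x (x + w)" for w
    unfolding lsolve_mult[OF less_SucI[OF ak], of ?F "\<lambda>m b. if m = k then 1 else Fp f m k (x + w)" "?p w"]
    by (simp only: mult.commute lsolve_unit[OF ak, of ?F "\<lambda>m. Fp f m k (x + w)"] om_def)
       (rule arg_cong[where f = "(*) (?p w)"], rule lsolve_cong[OF ak], auto)
  have I: "integrable lborel (\<lambda>w. lsolve ?F (?R w) a (Suc k))"
    "(LINT w|lborel. lsolve ?F (?R w) a (Suc k)) = lsolve ?F (\<lambda>m b. LINT w|lborel. ?R w m b) a (Suc k)"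
    using lsolve_integral[of a "Suc k" lborel ?R ?F] R ak by auto
  show "integrable lborel (\<lambda>w. P (J - 2) (h - w) * om f a k x (x + w))" using I(1) by (simp only: L)
  show "AA f J a k x (x + h) = (LINT w|lborel. P (J - 2) (h - w) * om f a k x (x + w))"
    unfolding L[symmetric] I(2) AA_def by (rule lsolve_cong) (use R ak in auto)
qed

text \<open>For fixed \<open>x\<close> the solution is linear in the right-hand side, so the block
  expansions at \<open>x\<close> and at \<open>x + h\<close> carry over to the remainder.\<close>

lemma om_block_sums:
  assumes f: "\<And>i. moderate (f i)" and ab: "a \<le> k"
    and sums: "AE z in lborel. \<forall>m\<in>{a..k}. (\<lambda>J. EE f J z m (Suc k) * B J (f (Suc k)) z) sums Fp f m (Suc k) z"
  shows "AE x in lborel. (\<lambda>J. AA f J a k x (x + h) * B J (f (Suc k)) (x + h) - AA f J a k x x * B J (f (Suc k)) x)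
    sums om f a (Suc k) x (x + h)"
  using sums AE_lborel_translate[OF sums, of h]
proof eventually_elim
  case (elim x)
  let ?F = "\<lambda>m k. Fp f m k x" and ?b = "Suc k"
  let ?R = "\<lambda>J m b. EE f J (x + h) m b * B J (f ?b) (x + h) - EE f J x m b * B J (f ?b) x"
  have "(\<lambda>J. lsolve ?F (?R J) a ?b) sums lsolve ?F (\<lambda>m k. Fp f m k (x + h) - Fp f m k x) a ?b"
  proof (rule lsolve_sums)
    fix m assume "a \<le> m" "m < Suc k"
    then have "m \<in> {a..k}" by simp
    with elim show "(\<lambda>J. ?R J m ?b) sums (Fp f m ?b (x + h) - Fp f m ?b x)" by (intro sums_diff) blast+
  qed (use ab in simp)
  moreover have "lsolve ?F (?R J) a ?b = AA f J a k x (x + h) * B J (f ?b) (x + h) - AA f J a k x x * B J (f ?b) x" for J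
    unfolding AA_def by (rule lsolve_diff) (use ab in auto)
  ultimately show ?case by (simp add: om_def)
qed

lemma AA_chen:
  assumes "a \<le> k"
  shows "AA f J a k x y = AA f J a k y y + (\<Sum>m\<in>{a<..k}. om f a m x y * AA f J m k y y)"
proof -
  have "{a<..<Suc k} = {a<..k}" by auto
  then show ?thesis unfolding AA_def om_def
    using lsolve_chen[of a "Suc k" "\<lambda>m k. Fp f m k x" "EE f J y" "\<lambda>m k. Fp f m k y"] assms by simp
qed

end

lemma lnorm_sums_le:
  fixes h :: "nat \<Rightarrow> 'a::euclidean_space \<Rightarrow> complex"
  assumes h[measurable]: "\<And>J. h J \<in> borel_measurable borel" "g \<in> borel_measurable borel" and s: "0 \<le> s" "s \<le> 1"
    and sums: "AE x in lborel. (\<lambda>J. h J x) sums g x"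
  shows "lnorm s g \<le> (\<Sum>J. lnorm s (h J))"
proof (cases "(\<Sum>J. lnorm s (h J)) < top")
  case True
  have "AE x in lborel. g x = (\<Sum>J. h J x)"
    using sums by eventually_elim (rule sums_unique)
  then have "lnorm s g = lnorm s (\<lambda>x. \<Sum>J. h J x)" by (intro lnorm_cong_AE s) measurable
  also have "\<dots> \<le> (\<Sum>J. lnorm s (h J))" by (rule lnorm_suminf(2)[OF h(1) s True])
  finally show ?thesis .
qed (auto simp: not_less top_unique)

context dyadic_setting
begin

text \<open>The constants are fixed by choice once and for all, so that they can enter
  \<open>coef\<close> and bounds that are uniform in \<open>f\<close>.\<close>

definition ckern :: real where
  "ckern = (SOME C. C > 0 \<and> (\<forall>J w. norm (kap J w) \<le> C * kk J w) \<and> (\<forall>J\<ge>2. \<forall>w. norm (P (J - 2) w) \<le> C * kk J w) \<and>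
     (\<forall>J\<ge>2. \<forall>w h. 2 ^ J * norm h \<le> 1 \<longrightarrow> norm (P (J - 2) (w + h) - P (J - 2) w) \<le> C * (2 ^ J * norm h) * kk J w))"

lemma ckern: "ckern > 0" "norm (kap J w) \<le> ckern * kk J w" "2 \<le> J \<Longrightarrow> norm (P (J - 2) w) \<le> ckern * kk J w"
  "2 \<le> J \<Longrightarrow> 2 ^ J * norm h \<le> 1 \<Longrightarrow> norm (P (J - 2) (w + h) - P (J - 2) w) \<le> ckern * (2 ^ J * norm h) * kk J w"
  using someI_ex[OF kernel_bounds, folded ckern_def] by blast+

definition cbern :: ennreal where
  "cbern = (SOME C. C < top \<and> (\<forall>J h s g. moderate g \<longrightarrow> 0 \<le> s \<longrightarrow> s \<le> 1 \<longrightarrow>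
     lnorm s (\<lambda>x. B J g (x + h) - B J g x) \<le> C * mint J h * lnorm s (B J g)))"

lemma cbern: "cbern < top" "moderate g \<Longrightarrow> 0 \<le> s \<Longrightarrow> s \<le> 1 \<Longrightarrow>
     lnorm s (\<lambda>x. B J g (x + h) - B J g x) \<le> cbern * mint J h * lnorm s (B J g)"
  using someI_ex[OF B_difference_le, folded cbern_def] by blast+

lemma lnorm_kk_le:
  fixes H :: "'a \<Rightarrow> 'a \<Rightarrow> complex"
  assumes m[measurable]: "m \<in> borel_measurable borel" and H: "(\<lambda>(x, w). H x w) \<in> borel_measurable (lborel \<Otimes>\<^sub>M lborel)"
    and N[measurable]: "N \<in> borel_measurable borel" and s: "0 \<le> s" "s \<le> 1"
    and le: "\<And>w. norm (m w) \<le> C * kk J w" "0 \<le> C" "\<And>w. lnorm s (\<lambda>x. H x w) \<le> N w"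
  shows "lnorm s (\<lambda>x. LINT w|lborel. m w * H x w) \<le> ennreal C * (\<integral>\<^sup>+w. ennreal (kk J w) * N w \<partial>lborel)"
proof -
  have "lnorm s (\<lambda>x. LINT w|lborel. m w * H x w) \<le> (\<integral>\<^sup>+w. ennreal (norm (m w)) * lnorm s (\<lambda>x. H x w) \<partial>lborel)"
    by (rule lnorm_kernel_le[OF m H s])
  also have "\<dots> \<le> (\<integral>\<^sup>+w. ennreal C * (ennreal (kk J w) * N w) \<partial>lborel)"
  proof (intro nn_integral_mono)
    fix w
    have "ennreal (norm (m w)) * lnorm s (\<lambda>x. H x w) \<le> ennreal (C * kk J w) * N w"
      by (intro mult_mono ennreal_leI le) auto
    also have "ennreal (C * kk J w) = ennreal C * ennreal (kk J w)" by (intro ennreal_mult le kk_nonneg)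
    finally show "ennreal (norm (m w)) * lnorm s (\<lambda>x. H x w) \<le> ennreal C * (ennreal (kk J w) * N w)" by (simp only: mult.assoc)
  qed
  also have "\<dots> = ennreal C * (\<integral>\<^sup>+w. ennreal (kk J w) * N w \<partial>lborel)"
    by (rule nn_integral_cmult) simp
  finally show ?thesis .
qed

end

text \<open>\<sigma> and \<tau> play the roles of the reciprocals of \<open>p\<close> and
  \<open>q\<close>. Since all entries are nonnegative, the bounds on the full sums pass to every
  subinterval of indices, as the induction over subintervals requires.\<close>

locale besov_exponents = dyadic_setting chi rho
  for chi rho :: "'a::euclidean_space \<Rightarrow> complex" +
  fixes n :: nat and \<alpha> \<sigma> \<tau> :: "nat \<Rightarrow> real"
  assumes \<alpha>_pos: "\<And>i. i \<in> {1..n} \<Longrightarrow> 0 < \<alpha> i" and \<alpha>_sum: "isum \<alpha> 0 n < 1"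
    and \<sigma>_nonneg: "\<And>i. i \<in> {1..n} \<Longrightarrow> 0 \<le> \<sigma> i" and \<sigma>_sum: "isum \<sigma> 0 n \<le> 1"
    and \<tau>_nonneg: "\<And>i. i \<in> {1..n} \<Longrightarrow> 0 \<le> \<tau> i" and \<tau>_sum: "isum \<tau> 0 n \<le> 1"
begin

lemma \<sigma>_bounds: "b \<le> n \<Longrightarrow> 0 \<le> isum \<sigma> a b" "b \<le> n \<Longrightarrow> isum \<sigma> a b \<le> 1"
proof -
  assume b: "b \<le> n"
  show "0 \<le> isum \<sigma> a b" unfolding isum_def using b by (intro sum_nonneg \<sigma>_nonneg) auto
  have "isum \<sigma> a b \<le> isum \<sigma> 0 n" unfolding isum_def using b by (intro sum_mono2) (auto intro: \<sigma>_nonneg)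
  then show "isum \<sigma> a b \<le> 1" using \<sigma>_sum by simp
qed

lemma \<tau>_bounds: "b \<le> n \<Longrightarrow> 0 \<le> isum \<tau> a b" "b \<le> n \<Longrightarrow> isum \<tau> a b \<le> 1"
proof -
  assume b: "b \<le> n"
  show "0 \<le> isum \<tau> a b" unfolding isum_def using b by (intro sum_nonneg \<tau>_nonneg) auto
  have "isum \<tau> a b \<le> isum \<tau> 0 n" unfolding isum_def using b by (intro sum_mono2) (auto intro: \<tau>_nonneg)
  then show "isum \<tau> a b \<le> 1" using \<tau>_sum by simp
qed

lemma \<alpha>_bounds: "a < b \<Longrightarrow> b \<le> n \<Longrightarrow> 0 < isum \<alpha> a b" "b \<le> n \<Longrightarrow> isum \<alpha> a b < 1"
proof -
  show "0 < isum \<alpha> a b" if "a < b" "b \<le> n" unfolding isum_def using that by (intro sum_pos \<alpha>_pos) auto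
  have "isum \<alpha> a b \<le> isum \<alpha> 0 n" if "b \<le> n" unfolding isum_def using that by (intro sum_mono2) (auto intro!: less_imp_le[OF \<alpha>_pos])
  then show "isum \<alpha> a b < 1" if "b \<le> n" using that \<alpha>_sum by force
qed

definition bes :: "(nat \<Rightarrow> 'a \<Rightarrow> complex) \<Rightarrow> nat \<Rightarrow> ennreal" where
  "bes f i = rnorm (count_space UNIV) (\<tau> i) (\<lambda>J. jpow (\<alpha> i) J * lnorm (\<sigma> i) (B J (f i)))"

text \<open>Moderation is demanded at every index, so that \<open>Fp\<close>, \<open>om\<close> and
  \<open>AA\<close> are measurable for all index pairs; outside {1..n} the zero function can be
  inserted.\<close>

definition adm :: "(nat \<Rightarrow> 'a \<Rightarrow> complex) \<Rightarrow> bool" where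
  "adm f \<longleftrightarrow> (\<forall>i. moderate (f i)) \<and> (\<forall>i\<in>{1..n}. bes f i < top)"

definition Bp :: "nat \<Rightarrow> nat \<Rightarrow> (nat \<Rightarrow> 'a \<Rightarrow> complex) \<Rightarrow> ennreal" where
  "Bp a b f = (\<Prod>i\<in>{a<..b}. bes f i)"

definition NN :: "(nat \<Rightarrow> 'a \<Rightarrow> complex) \<Rightarrow> nat \<Rightarrow> nat \<Rightarrow> 'a \<Rightarrow> ennreal" where
  "NN f a b h = lnorm (isum \<sigma> a b) (\<lambda>x. om f a b x (x + h))"

text \<open>A bound for the \<open>L\<^sup>p\<close> norm of \<open>AA f J a k x x\<close> that does not lose the smoothness in \<open>J\<close>.\<close>

definition coef :: "(nat \<Rightarrow> 'a \<Rightarrow> complex) \<Rightarrow> nat \<Rightarrow> nat \<Rightarrow> nat \<Rightarrow> ennreal" where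
  "coef f J a k = (if J < 2 \<or> a = k then lnorm (isum \<sigma> a k) (\<lambda>x. AA f J a k x x)
     else ennreal ckern * (\<integral>\<^sup>+w. ennreal (kk J w) * NN f a k w \<partial>lborel))"

section \<open>Norms of the coefficients and of single blocks of the remainder\<close>

lemma adm_borel: "adm f \<Longrightarrow> f i \<in> borel_measurable borel"
  by (simp add: adm_def moderate_borel)

lemma NN_measurable:
  assumes "adm f" shows "NN f a b \<in> borel_measurable borel"
proof -
  have [measurable]: "(\<lambda>p. om f a b (snd p) (snd p + fst p)) \<in> borel_measurable (borel \<Otimes>\<^sub>M lborel)"
    by (rule om_measurable[OF adm_borel[OF assms]]; measurable)
  show ?thesis unfolding NN_def[abs_def] lnorm_def
    by (rule rnorm_borel_measurable[OF lborel.sigma_finite_measure_axioms]) (simp add: split_beta')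
qed

text \<open>Both bounds integrate \<open>om\<close> against a kernel below a multiple of
  \<open>kk J\<close>. For the increment the multiple has the extra factor 2^J |h|, which equals
  \<open>mint J h\<close> in the range where that kernel bound holds.\<close>

lemma AA_lnorm_le:
  assumes f: "adm f" and k: "a \<le> k" "k \<le> n" and mod: "\<And>m. a \<le> m \<Longrightarrow> m < k \<Longrightarrow> moderate (Fp f m k)"
  shows "lnorm (isum \<sigma> a k) (\<lambda>x. AA f J a k x x) \<le> coef f J a k"
    and "2 ^ J * norm h \<le> 1 \<Longrightarrow> lnorm (isum \<sigma> a k) (\<lambda>x. AA f J a k x (x + h) - AA f J a k x x) \<le> mint J h * coef f J a k"
proof -
  have H: "(\<lambda>(x, w). om f a k x (x + w)) \<in> borel_measurable (lborel \<Otimes>\<^sub>M lborel)"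
    unfolding split_beta' by (rule om_measurable[OF adm_borel[OF f]]; measurable)
  have main: "lnorm (isum \<sigma> a k) (\<lambda>x. LINT w|lborel. m w * om f a k x (x + w)) \<le> ennreal C * (\<integral>\<^sup>+w. ennreal (kk J w) * NN f a k w \<partial>lborel)"
    if "m \<in> borel_measurable borel" "\<And>w. norm (m w) \<le> C * kk J w" "0 \<le> C" for m C
    by (rule lnorm_kk_le[OF that(1) H NN_measurable[OF f] \<sigma>_bounds[OF k(2)] that(2,3)]) (simp add: NN_def)
  show "lnorm (isum \<sigma> a k) (\<lambda>x. AA f J a k x x) \<le> coef f J a k"
  proof (cases "J < 2 \<or> a = k")
    case False
    then have J: "2 \<le> J" "a < k" using k by auto
    have "AA f J a k x x = (LINT w|lborel. P (J - 2) (0 - w) * om f a k x (x + w))" for x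
      using AA_eq(2)[OF J mod, of x 0] by simp
    moreover have "lnorm (isum \<sigma> a k) (\<lambda>x. LINT w|lborel. P (J - 2) (0 - w) * om f a k x (x + w))
        \<le> ennreal ckern * (\<integral>\<^sup>+w. ennreal (kk J w) * NN f a k w \<partial>lborel)"
    proof (rule main)
      show "norm (P (J - 2) (0 - w)) \<le> ckern * kk J w" for w using ckern(3)[OF J(1), of "- w"] by (simp add: kk_minus)
    qed (use ckern(1) in auto)
    ultimately show ?thesis using False by (simp add: coef_def)
  qed (simp add: coef_def)
  show "lnorm (isum \<sigma> a k) (\<lambda>x. AA f J a k x (x + h) - AA f J a k x x) \<le> mint J h * coef f J a k" if h: "2 ^ J * norm h \<le> 1"
  proof (cases "J < 2 \<or> a = k")
    case True
    then have "AA f J a k x (x + h) - AA f J a k x x = 0" for x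
      using AA_low[of J f a k x "x + h" x] by auto
    then have "lnorm (isum \<sigma> a k) (\<lambda>x. AA f J a k x (x + h) - AA f J a k x x) = lnorm (isum \<sigma> a k) (\<lambda>x::'a. 0)" by simp
    also have "\<dots> \<le> 0" using rnorm_cmult[of "\<lambda>_. 0" lborel "isum \<sigma> a k" 0] \<sigma>_bounds[OF k(2)] by (simp add: lnorm_def)
    finally show ?thesis by simp
  next
    case False
    then have J: "2 \<le> J" "a < k" using k by auto
    let ?m = "\<lambda>w. P (J - 2) (h - w) - P (J - 2) (0 - w)"
    have "AA f J a k x (x + h) - AA f J a k x x = (LINT w|lborel. ?m w * om f a k x (x + w))" for x
    proof -
      have e: "AA f J a k x x = (LINT w|lborel. P (J - 2) (0 - w) * om f a k x (x + w))"
        using AA_eq(2)[OF J mod, of x 0] by simp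
      have e': "AA f J a k x (x + h) = (LINT w|lborel. P (J - 2) (h - w) * om f a k x (x + w))"
        by (rule AA_eq(2)[OF J]) (rule mod)
      show ?thesis
        unfolding e e' left_diff_distrib
        by (rule Bochner_Integration.integral_diff[symmetric]; rule AA_eq(1)[OF J]; rule mod; assumption)
    qed
    moreover have "lnorm (isum \<sigma> a k) (\<lambda>x. LINT w|lborel. ?m w * om f a k x (x + w))
        \<le> ennreal (ckern * (2 ^ J * norm h)) * (\<integral>\<^sup>+w. ennreal (kk J w) * NN f a k w \<partial>lborel)"
    proof (rule main)
      show "norm (?m w) \<le> ckern * (2 ^ J * norm h) * kk J w" for w
        using ckern(4)[OF J(1) h, of "- w"] by (simp add: kk_minus)
    qed (use ckern(1) in auto)
    moreover have "ennreal (ckern * (2 ^ J * norm h)) = mint J h * ennreal ckern"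
      using h ckern(1) by (simp add: mint_def min_absorb2 ennreal_mult'' mult.commute)
    ultimately show ?thesis using False by (simp add: coef_def mult.assoc)
  qed
qed

lemma block_lnorm_le:
  assumes f: "adm f" and k: "a \<le> k" "Suc k \<le> n" and mod: "\<And>m. a \<le> m \<Longrightarrow> m < k \<Longrightarrow> moderate (Fp f m k)"
  shows "lnorm (isum \<sigma> a (Suc k)) (\<lambda>x. AA f J a k x (x + h) * B J (f (Suc k)) (x + h) - AA f J a k x x * B J (f (Suc k)) x)
    \<le> (2 + cbern) * (mint J h * (coef f J a k * lnorm (\<sigma> (Suc k)) (B J (f (Suc k)))))
      + (\<Sum>m\<in>{a<..k}. NN f a m h * (mint J h * (coef f J m k * lnorm (\<sigma> (Suc k)) (B J (f (Suc k))))))"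
    (is "lnorm ?s ?T \<le> (2 + cbern) * (?i * (?c * ?d)) + ?M")
proof -
  let ?r = "isum \<sigma> a k" and ?t = "\<sigma> (Suc k)" and ?b = "B J (f (Suc k))" and ?A = "AA f J"
  have st: "?s = ?r + ?t" by (rule isum_Suc[OF k(1)])
  have kn: "k \<le> n" using k by simp
  note r = \<sigma>_bounds[OF kn, of a] and s = \<sigma>_bounds[OF k(2), of a]
  have t: "0 \<le> ?t" "?t \<le> 1" using \<sigma>_nonneg[of "Suc k"] k s r st by auto
  have fm: "moderate (f (Suc k))" using f by (simp add: adm_def)
  note [measurable] = adm_borel[OF f] AA_measurable[OF adm_borel[OF f]] om_measurable[OF adm_borel[OF f]]
  have Am[measurable]: "(\<lambda>x. ?A m k x x) \<in> borel_measurable borel" "(\<lambda>x. ?A m k x (x + h)) \<in> borel_measurable borel"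
     "(\<lambda>x. ?A m k (x + h) (x + h)) \<in> borel_measurable borel" for m
    by (rule AA_measurable[OF adm_borel[OF f]]; measurable)+
  have om[measurable]: "(\<lambda>x. om f a m x (x + h)) \<in> borel_measurable borel" for m
    by (rule om_measurable[OF adm_borel[OF f]]; measurable)
  have A1: "lnorm (isum \<sigma> m k) (\<lambda>x. ?A m k x x) \<le> coef f J m k" if "a \<le> m" "m \<le> k" for m
    using that by (intro AA_lnorm_le f kn mod) auto
  have A1': "lnorm (isum \<sigma> m k) (\<lambda>x. ?A m k (x + h) (x + h)) \<le> coef f J m k" if "a \<le> m" "m \<le> k" for m
    using lnorm_translate[OF Am(1)[of m], of "isum \<sigma> m k" h] A1[OF that] by simp
  have b: "lnorm ?t (\<lambda>x. ?b (x + h)) = ?d" by (rule lnorm_translate) measurable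
  show ?thesis
  proof (cases "2 ^ J * norm h \<le> 1")
    case True
    have "lnorm ?s ?T = lnorm ?s (\<lambda>x. (?A a k x (x + h) - ?A a k x x) * ?b (x + h) + ?A a k x x * (?b (x + h) - ?b x))"
      by (rule arg_cong[where f = "lnorm ?s"]) (simp add: fun_eq_iff algebra_simps)
    also have "\<dots> \<le> lnorm ?s (\<lambda>x. (?A a k x (x + h) - ?A a k x x) * ?b (x + h)) + lnorm ?s (\<lambda>x. ?A a k x x * (?b (x + h) - ?b x))"
      using s by (intro lnorm_add_le) measurable
    also have "\<dots> \<le> lnorm ?r (\<lambda>x. ?A a k x (x + h) - ?A a k x x) * lnorm ?t (\<lambda>x. ?b (x + h))
        + lnorm ?r (\<lambda>x. ?A a k x x) * lnorm ?t (\<lambda>x. ?b (x + h) - ?b x)"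
      unfolding st using r t by (intro add_mono lnorm_mult_le) measurable
    also have "\<dots> \<le> (?i * ?c) * ?d + ?c * (cbern * ?i * ?d)"
      unfolding b using k kn mod True t
      by (intro add_mono mult_mono AA_lnorm_le(2) A1 f cbern(2)[OF fm]) auto
    \<comment> \<open>Small |h| costs \<open>1 + cbern\<close> and large |h| costs 2; the constant
      \<open>2 + cbern\<close> serves both.\<close>
    also have "\<dots> = (1 + cbern) * (?i * (?c * ?d))" by (simp add: distrib_left distrib_right mult_ac)
    also have "\<dots> \<le> (2 + cbern) * (?i * (?c * ?d)) + ?M"
      by (intro add_increasing2 mult_right_mono add_mono) auto
    finally show ?thesis .
  next
    case False
    then have i: "?i = 1" by (simp add: mint_def)
    \<comment> \<open>At this distance only diagonal values of \<open>AA\<close> are controlled by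
      \<open>coef\<close>. Chen's relation expresses the coefficient at (x, x + h) through those at
      (x + h, x + h), whose norms agree with those at (x, x) by translation invariance.\<close>
    have "lnorm ?s ?T = lnorm ?s (\<lambda>x. (?A a k (x + h) (x + h) * ?b (x + h) - ?A a k x x * ?b x)
        + (\<Sum>m\<in>{a<..k}. (om f a m x (x + h) * ?A m k (x + h) (x + h)) * ?b (x + h)))"
    proof (rule arg_cong[where f = "lnorm ?s"], rule ext)
      fix x
      show "?T x = (?A a k (x + h) (x + h) * ?b (x + h) - ?A a k x x * ?b x)
        + (\<Sum>m\<in>{a<..k}. (om f a m x (x + h) * ?A m k (x + h) (x + h)) * ?b (x + h))"
        unfolding sum_distrib_right[symmetric] AA_chen[OF k(1), of f J x "x + h"] by (simp only: distrib_right) simp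
    qed
    also have "\<dots> \<le> lnorm ?s (\<lambda>x. ?A a k (x + h) (x + h) * ?b (x + h) - ?A a k x x * ?b x)
       + lnorm ?s (\<lambda>x. \<Sum>m\<in>{a<..k}. (om f a m x (x + h) * ?A m k (x + h) (x + h)) * ?b (x + h))"
      using s by (intro lnorm_add_le) measurable
    also have "\<dots> \<le> (lnorm ?s (\<lambda>x. ?A a k (x + h) (x + h) * ?b (x + h)) + lnorm ?s (\<lambda>x. ?A a k x x * ?b x))
       + (\<Sum>m\<in>{a<..k}. lnorm ?s (\<lambda>x. (om f a m x (x + h) * ?A m k (x + h) (x + h)) * ?b (x + h)))"
      using s by (intro add_mono lnorm_diff_le lnorm_sum_le) measurable
    also have "\<dots> \<le> (?c * ?d + ?c * ?d) + (\<Sum>m\<in>{a<..k}. NN f a m h * (coef f J m k * ?d))"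
    proof (intro add_mono sum_mono)
      show "lnorm ?s (\<lambda>x. ?A a k (x + h) (x + h) * ?b (x + h)) \<le> ?c * ?d"
        unfolding st using r t k
        by (intro order_trans[OF lnorm_mult_le] mult_mono A1') (auto simp: b)
      show "lnorm ?s (\<lambda>x. ?A a k x x * ?b x) \<le> ?c * ?d"
        unfolding st using r t k by (intro order_trans[OF lnorm_mult_le] mult_mono A1) auto
      fix m assume "m \<in> {a<..k}"
      then have m: "a \<le> m" "m \<le> k" "m \<le> n" using k by auto
      note rr = \<sigma>_bounds[OF m(3), of a] \<sigma>_bounds[OF kn, of m]
      have e: "?s = (isum \<sigma> a m + isum \<sigma> m k) + ?t" unfolding st isum_add[OF m(1,2)] ..
      have "lnorm ?s (\<lambda>x. (om f a m x (x + h) * ?A m k (x + h) (x + h)) * ?b (x + h))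
        \<le> lnorm (isum \<sigma> a m + isum \<sigma> m k) (\<lambda>x. om f a m x (x + h) * ?A m k (x + h) (x + h)) * lnorm ?t (\<lambda>x. ?b (x + h))"
        unfolding e using rr t by (intro lnorm_mult_le) auto
      also have "\<dots> \<le> (NN f a m h * coef f J m k) * ?d"
        unfolding b NN_def using rr m by (intro mult_right_mono order_trans[OF lnorm_mult_le] mult_left_mono A1') auto
      finally show "lnorm ?s (\<lambda>x. (om f a m x (x + h) * ?A m k (x + h) (x + h)) * ?b (x + h)) \<le> NN f a m h * (coef f J m k * ?d)"
        by (simp only: mult.assoc)
    qed
    also have "?c * ?d + ?c * ?d = 2 * (?c * ?d)" by (rule mult_2[symmetric])
    also have "2 * (?c * ?d) + (\<Sum>m\<in>{a<..k}. NN f a m h * (coef f J m k * ?d)) \<le> (2 + cbern) * (?i * (?c * ?d)) + ?M"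
      unfolding i mult_1_left by (intro add_right_mono mult_right_mono) (auto simp: add_increasing2)
    finally show ?thesis .
  qed
qed

lemma NN_le:
  assumes f: "adm f" and k: "a \<le> k" "Suc k \<le> n" and mod: "\<And>m. a \<le> m \<Longrightarrow> m < k \<Longrightarrow> moderate (Fp f m k)"
    and sums: "AE z in lborel. \<forall>m\<in>{a..k}. (\<lambda>J. EE f J z m (Suc k) * B J (f (Suc k)) z) sums Fp f m (Suc k) z"
  shows "NN f a (Suc k) h \<le> (2 + cbern) * (\<Sum>J. mint J h * (coef f J a k * lnorm (\<sigma> (Suc k)) (B J (f (Suc k)))))
      + (\<Sum>m\<in>{a<..k}. NN f a m h * (\<Sum>J. mint J h * (coef f J m k * lnorm (\<sigma> (Suc k)) (B J (f (Suc k))))))"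
proof -
  let ?T = "\<lambda>J x. AA f J a k x (x + h) * B J (f (Suc k)) (x + h) - AA f J a k x x * B J (f (Suc k)) x"
  note [measurable] = adm_borel[OF f]
  have Am[measurable]: "(\<lambda>x. AA f J m k x x) \<in> borel_measurable borel" "(\<lambda>x. AA f J m k x (x + h)) \<in> borel_measurable borel" for m J
    by (rule AA_measurable[OF adm_borel[OF f]]; measurable)+
  have om[measurable]: "(\<lambda>x. om f a m x (x + h)) \<in> borel_measurable borel" for m
    by (rule om_measurable[OF adm_borel[OF f]]; measurable)
  have "NN f a (Suc k) h \<le> (\<Sum>J. lnorm (isum \<sigma> a (Suc k)) (?T J))"
    unfolding NN_def
  proof (rule lnorm_sums_le)
    show "AE x in lborel. (\<lambda>J. ?T J x) sums om f a (Suc k) x (x + h)"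
      by (rule om_block_sums[OF _ k(1) sums]) (use f in \<open>simp add: adm_def\<close>)
  qed (use \<sigma>_bounds[OF k(2)] in auto)
  also have "\<dots> \<le> (\<Sum>J. (2 + cbern) * (mint J h * (coef f J a k * lnorm (\<sigma> (Suc k)) (B J (f (Suc k)))))
      + (\<Sum>m\<in>{a<..k}. NN f a m h * (mint J h * (coef f J m k * lnorm (\<sigma> (Suc k)) (B J (f (Suc k)))))))"
    by (intro suminf_le summableI block_lnorm_le f k mod)
  also have "\<dots> = (2 + cbern) * (\<Sum>J. mint J h * (coef f J a k * lnorm (\<sigma> (Suc k)) (B J (f (Suc k)))))
      + (\<Sum>m\<in>{a<..k}. NN f a m h * (\<Sum>J. mint J h * (coef f J m k * lnorm (\<sigma> (Suc k)) (B J (f (Suc k))))))"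
    by (simp add: suminf_add[symmetric] suminf_sum)
  finally show ?thesis .
qed

end

context dyadic_setting
begin

section \<open>Almost everywhere block expansions, and blocks as averages of increments\<close>

lemma para_sums:
  assumes g: "moderate g" and f: "moderate f"
    and st: "0 \<le> s" "0 \<le> t" "s + t \<le> 1"
    and gfin: "lnorm s g < top" and ffin: "(\<Sum>K. lnorm t (B K f)) < top"
  shows "AE z in lborel. (\<lambda>J. S J g z * B J f z) sums para g f z"
proof -
  note [measurable] = moderate_borel[OF g] moderate_borel[OF f]
  have "AE z in lborel. summable (\<lambda>J. norm (S J g z * B J f z))"
    by (rule lnorm_suminf(1)[OF _ _ _ para_terms_finite[OF _ _ st gfin ffin]]) (use st in \<open>auto simp: moderate_borel g f\<close>)
  then show ?thesis
    unfolding para_def by eventually_elim (rule summable_sums[OF summable_norm_cancel])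
qed

lemma reproducing_sums:
  assumes f: "moderate f" and s: "0 \<le> s" "s \<le> 1" and fin: "(\<Sum>J. lnorm s (B J f)) < top"
  shows "AE z in lborel. (\<lambda>J. B J f z) sums f z"
proof -
  note [measurable] = moderate_borel[OF f]
  have "AE z in lborel. summable (\<lambda>J. norm (B J f z))"
    by (rule lnorm_suminf(1)[OF _ s fin]) measurable
  with reproducing_formula[OF f s fin] show ?thesis
    by eventually_elim (metis summable_norm_cancel summable_sums)
qed

lemma kap_integral:
  assumes "J \<noteq> 0" shows "(LINT w|lborel. kap J w) = 0"
proof -
  obtain i where J: "J = Suc i" using assms by (cases J) auto
  show ?thesis unfolding J kap_Suc
    by (subst Bochner_Integration.integral_diff) (auto intro: rapid_integrable[OF P_rapid P_borel] simp: P_integral)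
qed

text \<open>For \<open>J \<noteq> 0\<close> the kernel has mean zero, so the value at
  \<open>x\<close> may be subtracted. This converts bounds on increments into bounds on
  blocks.\<close>

lemma B_eq_difference:
  assumes g: "moderate g" and J: "J \<noteq> 0"
  shows "B J g x = (LINT w|lborel. kap J (0 - w) * (g (x + w) - g x))"
proof -
  have k: "integrable lborel (\<lambda>w. kap J (0 - w))" "(LINT w|lborel. kap J (0 - w)) = 0"
    using integral_lborel_affine[of "-1" "kap J" 0] rapid_integrable[OF kap_rapid kap_borel, of J] kap_integral[OF J] by simp_all
  note t = conv_translate[OF g kap_rapid kap_borel, where h = 0 and x = x]
  have "(LINT w|lborel. kap J (0 - w) * (g (x + w) - g x)) = (LINT w|lborel. kap J (0 - w) * g (x + w)) - (LINT w|lborel. kap J (0 - w) * g x)"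
    unfolding right_diff_distrib using t(1) k(1) by (intro Bochner_Integration.integral_diff) auto
  also have "\<dots> = B J g x" using t(2)[of J] k(2) by (simp add: B_def)
  finally show ?thesis ..
qed

end

context besov_exponents
begin

section \<open>Uniform bounds\<close>

text \<open>A relation between functionals of the whole family \<open>f\<close>: the constant is
  uniform over all admissible families, and bounds compose without naming it.\<close>

definition lesssim :: "((nat \<Rightarrow> 'a \<Rightarrow> complex) \<Rightarrow> ennreal) \<Rightarrow> ((nat \<Rightarrow> 'a \<Rightarrow> complex) \<Rightarrow> ennreal) \<Rightarrow> bool" where
  "lesssim X Y \<longleftrightarrow> (\<exists>C<top. \<forall>f. adm f \<longrightarrow> X f \<le> C * Y f)"

lemma lesssimI: "C < top \<Longrightarrow> (\<And>f. adm f \<Longrightarrow> X f \<le> C * Y f) \<Longrightarrow> lesssim X Y"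
  unfolding lesssim_def by blast

lemma lesssim_le: "(\<And>f. adm f \<Longrightarrow> X f \<le> Y f) \<Longrightarrow> lesssim X Y"
  by (rule lesssimI[of 1]) auto

lemma lesssim_mono:
  assumes "lesssim X Y" "\<And>f. adm f \<Longrightarrow> X' f \<le> X f" shows "lesssim X' Y"
  using assms unfolding lesssim_def by (meson order_trans)

lemma lesssim_trans:
  assumes "lesssim X Y" "lesssim Y Z" shows "lesssim X Z"
proof -
  obtain C D where C: "C < top" "\<And>f. adm f \<Longrightarrow> X f \<le> C * Y f" and D: "D < top" "\<And>f. adm f \<Longrightarrow> Y f \<le> D * Z f"
    using assms unfolding lesssim_def by blast
  show ?thesis
  proof (rule lesssimI)
    show "C * D < top" using C D by (simp add: ennreal_mult_less_top)
    fix f assume f: "adm f"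
    have "X f \<le> C * Y f" by (rule C(2)[OF f])
    also have "\<dots> \<le> C * (D * Z f)" by (intro mult_left_mono D(2) f) simp
    finally show "X f \<le> C * D * Z f" by (simp only: mult.assoc)
  qed
qed

lemma lesssim_mult:
  assumes "lesssim X Y" "lesssim X' Y'" shows "lesssim (\<lambda>f. X f * X' f) (\<lambda>f. Y f * Y' f)"
proof -
  obtain C D where C: "C < top" "\<And>f. adm f \<Longrightarrow> X f \<le> C * Y f" and D: "D < top" "\<And>f. adm f \<Longrightarrow> X' f \<le> D * Y' f"
    using assms unfolding lesssim_def by blast
  show ?thesis
  proof (rule lesssimI)
    show "C * D < top" using C D by (simp add: ennreal_mult_less_top)
    fix f assume f: "adm f"
    have "X f * X' f \<le> (C * Y f) * (D * Y' f)" by (intro mult_mono C(2) D(2) f) auto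
    then show "X f * X' f \<le> C * D * (Y f * Y' f)" by (simp only: mult_ac)
  qed
qed

lemma lesssim_cmult: "c < top \<Longrightarrow> lesssim X Y \<Longrightarrow> lesssim (\<lambda>f. c * X f) Y"
  using lesssim_trans[OF lesssimI[of c "\<lambda>f. c * X f" X]] by simp

lemma lesssim_add:
  assumes "lesssim X Y" "lesssim X' Y" shows "lesssim (\<lambda>f. X f + X' f) Y"
proof -
  obtain C D where C: "C < top" "\<And>f. adm f \<Longrightarrow> X f \<le> C * Y f" and D: "D < top" "\<And>f. adm f \<Longrightarrow> X' f \<le> D * Y f"
    using assms unfolding lesssim_def by blast
  show ?thesis
  proof (rule lesssimI)
    show "C + D < top" using C D by simp
    show "X f + X' f \<le> (C + D) * Y f" if "adm f" for f
      unfolding distrib_right by (intro add_mono C(2) D(2) that)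
  qed
qed

lemma lesssim_sum:
  assumes "finite I" "\<And>i. i \<in> I \<Longrightarrow> lesssim (X i) Y" shows "lesssim (\<lambda>f. \<Sum>i\<in>I. X i f) Y"
  using assms
proof (induction I)
  case empty
  then show ?case by (simp add: lesssim_le)
qed (simp add: lesssim_add)

lemma Bp_self [simp]: "Bp a a f = 1"
  by (simp add: Bp_def)

lemma Bp_mult: "a \<le> m \<Longrightarrow> m \<le> b \<Longrightarrow> Bp a m f * Bp m b f = Bp a b f"
  unfolding Bp_def by (subst prod.union_disjoint[symmetric]) (auto intro!: prod.cong simp: ivl_disj_un)

lemma Bp_Suc: "a \<le> k \<Longrightarrow> Bp a (Suc k) f = Bp a k f * bes f (Suc k)"
proof -
  assume "a \<le> k"
  then have "{a<..Suc k} = insert (Suc k) {a<..k}" by auto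
  then show ?thesis by (simp add: Bp_def mult.commute)
qed

lemma lesssim_finite:
  assumes "lesssim X (Bp a b)" "adm f" "b \<le> n" shows "X f < top"
proof -
  obtain C where C: "C < top" "X f \<le> C * Bp a b f" using assms unfolding lesssim_def by blast
  have prods: "(\<Prod>i\<in>I. bes f i) < top" if "finite I" "I \<subseteq> {1..n}" for I
    using that assms(2) by (induction I) (auto simp: adm_def ennreal_mult_less_top)
  have "Bp a b f < top" unfolding Bp_def by (rule prods) (use assms(3) in auto)
  then have "C * Bp a b f < top" using C(1) by (simp add: ennreal_mult_less_top)
  with C(2) show ?thesis by (rule order_le_less_trans)
qed

lemma lesssim_Bp_mult:
  assumes "lesssim X (Bp a m)" "lesssim Y (Bp m b)" "a \<le> m" "m \<le> b"
  shows "lesssim (\<lambda>f. X f * Y f) (Bp a b)"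
  using lesssim_mult[OF assms(1,2)] by (simp add: Bp_mult[OF assms(3,4)] cong del: if_cong)

text \<open>The norm of \<open>Fp\<close> makes the next paraproduct converge, the remainder bound
  controls the coefficients of the next remainder, and the sum of the block norms is what identifies
  the series \<open>para\<close> with the functional \<open>paraprod\<close>.\<close>

definition good :: "nat \<Rightarrow> nat \<Rightarrow> bool" where
  "good a b \<longleftrightarrow> lesssim (\<lambda>f. lnorm (isum \<sigma> a b) (Fp f a b)) (Bp a b) \<and>
     lesssim (\<lambda>f. \<Sum>J. lnorm (isum \<sigma> a b) (B J (Fp f a b))) (Bp a b) \<and>
     lesssim (\<lambda>f. rnorm hmeas (isum \<tau> a b) (\<lambda>h. hpow (isum \<alpha> a b) h * NN f a b h)) (Bp a b)"

lemma lesssim_moderate: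
  assumes "lesssim (\<lambda>f. lnorm (isum \<sigma> a b) (Fp f a b)) (Bp a b)" "b \<le> n" "adm f"
  shows "moderate (Fp f a b)"
  by (rule moderate_lnorm[OF Fp_borel[OF adm_borel[OF assms(3)]] lesssim_finite[OF assms(1,3,2)] \<sigma>_bounds[OF assms(2)]])

lemma blocks_lesssim:
  assumes "k < n"
  shows "lesssim (\<lambda>f. \<Sum>J. lnorm (\<sigma> (Suc k)) (B J (f (Suc k)))) (Bp k (Suc k))"
proof -
  have i: "Suc k \<in> {1..n}" using assms by auto
  obtain C where C: "C < top" "\<And>s (e :: nat \<Rightarrow> ennreal). 0 \<le> s \<Longrightarrow> (\<Sum>J. e J) \<le> C * rnorm (count_space UNIV) s (\<lambda>J. jpow (\<alpha> (Suc k)) J * e J)"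
    using geometric_le_rnorm[OF \<alpha>_pos[OF i]] by blast
  show ?thesis
    by (rule lesssimI[OF C(1)]) (use C(2)[OF \<tau>_nonneg[OF i]] in \<open>simp add: Bp_Suc bes_def\<close>)
qed

text \<open>For the two lowest blocks the coefficient is a polynomial in values of \<open>Fp\<close>
  at \<open>x\<close>; along the recursion \<open>AA_low_rec\<close> Hoelder's inequality bounds
  each product.\<close>

lemma AA_low_lesssim:
  assumes J: "J < 2" and k: "m \<le> k" "k \<le> n"
    and IH: "\<And>a b. m \<le> a \<Longrightarrow> a < b \<Longrightarrow> b \<le> k \<Longrightarrow> good a b"
  shows "lesssim (\<lambda>f. lnorm (isum \<sigma> m k) (\<lambda>x. AA f J m k x x)) (Bp m k)"
  using k(1) IH
proof (induction "k - m" arbitrary: m rule: less_induct)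
  case less
  show ?case
  proof (cases "m = k")
    case True
    show ?thesis
      by (rule lesssim_le) (use rnorm_const_le_1[of lborel] in \<open>simp add: True lnorm_def one_ennreal_def\<close>)
  next
    case False
    then have mk: "m < k" using less by simp
    have "lesssim (\<lambda>f. \<Sum>r\<in>{m<..k}. lnorm (isum \<sigma> m r) (Fp f m r) * lnorm (isum \<sigma> r k) (\<lambda>x. AA f J r k x x)) (Bp m k)"
    proof (rule lesssim_sum)
      fix r assume r: "r \<in> {m<..k}"
      show "lesssim (\<lambda>f. lnorm (isum \<sigma> m r) (Fp f m r) * lnorm (isum \<sigma> r k) (\<lambda>x. AA f J r k x x)) (Bp m k)"
      proof (rule lesssim_Bp_mult)
        show "lesssim (\<lambda>f. lnorm (isum \<sigma> m r) (Fp f m r)) (Bp m r)" using less.prems(2)[of m r] r by (simp add: good_def)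
        show "lesssim (\<lambda>f. lnorm (isum \<sigma> r k) (\<lambda>x. AA f J r k x x)) (Bp r k)" by (rule less.hyps) (use r less.prems in auto)
      qed (use r in auto)
    qed simp
    then show ?thesis
    proof (rule lesssim_mono)
      fix f assume f: "adm f"
      have [measurable]: "Fp f m r \<in> borel_measurable borel" for r by (rule Fp_borel[OF adm_borel[OF f]])
      have [measurable]: "(\<lambda>x. AA f J r k x x) \<in> borel_measurable borel" for r
        by (rule AA_measurable[OF adm_borel[OF f]]; measurable)
      have "lnorm (isum \<sigma> m k) (\<lambda>x. AA f J m k x x) = lnorm (isum \<sigma> m k) (\<lambda>x. \<Sum>r\<in>{m<..k}. Fp f m r x * AA f J r k x x)"
        by (subst AA_low_rec[OF J mk]) (rule lnorm_minus)
      also have "\<dots> \<le> (\<Sum>r\<in>{m<..k}. lnorm (isum \<sigma> m k) (\<lambda>x. Fp f m r x * AA f J r k x x))"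
        using \<sigma>_bounds[OF k(2)] by (intro lnorm_sum_le) auto
      also have "\<dots> \<le> (\<Sum>r\<in>{m<..k}. lnorm (isum \<sigma> m r) (Fp f m r) * lnorm (isum \<sigma> r k) (\<lambda>x. AA f J r k x x))"
      proof (rule sum_mono)
        fix r assume r: "r \<in> {m<..k}"
        then have e: "isum \<sigma> m k = isum \<sigma> m r + isum \<sigma> r k" by (simp add: isum_add)
        show "lnorm (isum \<sigma> m k) (\<lambda>x. Fp f m r x * AA f J r k x x) \<le> lnorm (isum \<sigma> m r) (Fp f m r) * lnorm (isum \<sigma> r k) (\<lambda>x. AA f J r k x x)"
          unfolding e using \<sigma>_bounds[of r m] \<sigma>_bounds[OF k(2), of r] r k by (intro lnorm_mult_le) auto
      qed
      finally show "lnorm (isum \<sigma> m k) (\<lambda>x. AA f J m k x x) \<le> \<dots>" .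
    qed
  qed
qed

section \<open>Weighted bounds for the coefficient sequences\<close>

lemma sigma_finite_count: "sigma_finite_measure (count_space (UNIV :: nat set))"
  by (rule sigma_finite_measure_count_space_countable) simp

lemma kk_NN_lesssim:
  assumes mb: "m < b" "b \<le> n"
    and V: "lesssim (\<lambda>f. rnorm hmeas (isum \<tau> m b) (\<lambda>h. hpow (isum \<alpha> m b) h * NN f m b h)) (Bp m b)"
  shows "lesssim (\<lambda>f. rnorm (count_space UNIV) (isum \<tau> m b) (\<lambda>J. jpow (isum \<alpha> m b) J * (\<integral>\<^sup>+w. ennreal (kk J w) * NN f m b w \<partial>lborel))) (Bp m b)"
    and "lesssim (\<lambda>f. \<Sum>J. \<integral>\<^sup>+w. ennreal (kk J w) * NN f m b w \<partial>lborel) (Bp m b)"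
proof -
  note \<alpha> = \<alpha>_bounds(1)[OF mb] \<alpha>_bounds(2)[OF mb(2), of m] and \<tau> = \<tau>_bounds[OF mb(2), of m]
  obtain C :: real where C: "\<And>s f. 0 \<le> s \<Longrightarrow> s \<le> 1 \<Longrightarrow> f \<in> borel_measurable borel \<Longrightarrow>
    rnorm (count_space UNIV) s (\<lambda>J. jpow (isum \<alpha> m b) J * (\<integral>\<^sup>+w. ennreal (kk J w) * f w \<partial>(lborel :: 'a measure)))
      \<le> ennreal C * rnorm (hmeas :: 'a measure) s (\<lambda>h. hpow (isum \<alpha> m b) h * f h)"
    using kk_integral_le[OF \<alpha>] by blast
  show 1: "lesssim (\<lambda>f. rnorm (count_space UNIV) (isum \<tau> m b) (\<lambda>J. jpow (isum \<alpha> m b) J * (\<integral>\<^sup>+w. ennreal (kk J w) * NN f m b w \<partial>lborel))) (Bp m b)"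
    by (rule lesssim_trans[OF lesssimI[of "ennreal C"] V]) (auto intro!: C \<tau> NN_measurable)
  obtain D where D: "D < top" "\<And>s (e :: nat \<Rightarrow> ennreal). 0 \<le> s \<Longrightarrow> (\<Sum>J. e J) \<le> D * rnorm (count_space UNIV) s (\<lambda>J. jpow (isum \<alpha> m b) J * e J)"
    using geometric_le_rnorm[OF \<alpha>(1)] by blast
  show "lesssim (\<lambda>f. \<Sum>J. \<integral>\<^sup>+w. ennreal (kk J w) * NN f m b w \<partial>lborel) (Bp m b)"
    by (rule lesssim_trans[OF lesssimI[OF D(1)] 1]) (rule D(2)[OF \<tau>(1)])
qed

lemma coef_lesssim:
  assumes k: "m \<le> k" "k \<le> n"
    and IH: "\<And>a b. m \<le> a \<Longrightarrow> a < b \<Longrightarrow> b \<le> k \<Longrightarrow> good a b"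
  shows "lesssim (\<lambda>f. rnorm (count_space UNIV) (isum \<tau> m k) (\<lambda>J. jpow (isum \<alpha> m k) J * coef f J m k)) (Bp m k)"
proof (cases "m = k")
  \<comment> \<open>On an empty index range all exponents are 0 and the coefficient is the constant
    1, of sup norm at most 1.\<close>
  case True
  show ?thesis
  proof (rule lesssim_le)
    fix f
    have "rnorm (count_space UNIV) 0 (\<lambda>J. jpow 0 J * coef f J k k) \<le> rnorm (count_space UNIV) 0 (\<lambda>J::nat. 1)"
      by (rule rnorm_mono_AE) (use rnorm_const_le_1[of "lborel :: 'a measure"] in \<open>auto simp: coef_def jpow_def lnorm_def\<close>)
    then show "rnorm (count_space UNIV) (isum \<tau> m k) (\<lambda>J. jpow (isum \<alpha> m k) J * coef f J m k) \<le> Bp m k f"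
      using rnorm_const_le_1[of "count_space (UNIV :: nat set)"] by (simp add: True)
  qed
next
  case False
  then have mk: "m < k" using k by simp
  note \<tau> = \<tau>_bounds[OF k(2), of m]
  let ?low = "\<lambda>i f. lnorm (isum \<sigma> m k) (\<lambda>x. AA f i m k x x)"
  let ?j = "jpow (isum \<alpha> m k)"
  let ?I = "\<lambda>f J. \<integral>\<^sup>+w. ennreal (kk J w) * NN f m k w \<partial>(lborel :: 'a measure)"
  have V: "lesssim (\<lambda>f. rnorm hmeas (isum \<tau> m k) (\<lambda>h. hpow (isum \<alpha> m k) h * NN f m k h)) (Bp m k)"
    using IH[of m k] mk by (simp add: good_def)
  \<comment> \<open>The indices 0 and 1 enter as two sequences with a single nonzero entry, so their
    weights are mere constants; all other indices are covered by the kernel bound.\<close>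
  have "lesssim (\<lambda>f. (?j 0 * ?low 0 f + ?j 1 * ?low 1 f) + ennreal ckern * rnorm (count_space UNIV) (isum \<tau> m k) (\<lambda>J. ?j J * ?I f J)) (Bp m k)"
    by (intro lesssim_add lesssim_cmult AA_low_lesssim kk_NN_lesssim k mk V IH) (auto simp: jpow_def)
  then show ?thesis
  proof (rule lesssim_mono)
    fix f
    let ?s = "\<lambda>i J. if J = i then ?j i * ?low i f else 0"
    have "rnorm (count_space UNIV) (isum \<tau> m k) (\<lambda>J. ?j J * coef f J m k)
       \<le> rnorm (count_space UNIV) (isum \<tau> m k) (\<lambda>J. (?s 0 J + ?s 1 J) + ennreal ckern * (?j J * ?I f J))"
    proof (rule rnorm_mono_AE)
      have "?j J * coef f J m k \<le> (?s 0 J + ?s 1 J) + ennreal ckern * (?j J * ?I f J)" for J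
      proof (cases "J < 2")
        case True
        then have "J = 0 \<or> J = 1" by auto
        then show ?thesis by (auto simp: coef_def)
      qed (use mk in \<open>simp add: coef_def mult_ac\<close>)
      then show "AE J in count_space UNIV. ?j J * coef f J m k \<le> (?s 0 J + ?s 1 J) + ennreal ckern * (?j J * ?I f J)" by simp
    qed (use \<tau> in auto)
    also have "\<dots> \<le> rnorm (count_space UNIV) (isum \<tau> m k) (\<lambda>J. ?s 0 J + ?s 1 J) + rnorm (count_space UNIV) (isum \<tau> m k) (\<lambda>J. ennreal ckern * (?j J * ?I f J))"
      using \<tau> by (intro rnorm_add_le sigma_finite_count) auto
    also have "\<dots> \<le> (rnorm (count_space UNIV) (isum \<tau> m k) (?s 0) + rnorm (count_space UNIV) (isum \<tau> m k) (?s 1)) + ennreal ckern * rnorm (count_space UNIV) (isum \<tau> m k) (\<lambda>J. ?j J * ?I f J)"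
      using \<tau> by (intro add_mono rnorm_add_le rnorm_cmult sigma_finite_count) auto
    also have "\<dots> \<le> (?j 0 * ?low 0 f + ?j 1 * ?low 1 f) + ennreal ckern * rnorm (count_space UNIV) (isum \<tau> m k) (\<lambda>J. ?j J * ?I f J)"
      using \<tau> by (intro add_mono rnorm_count_space_single order.refl)
    finally show "rnorm (count_space UNIV) (isum \<tau> m k) (\<lambda>J. ?j J * coef f J m k) \<le> \<dots>" .
  qed
qed

text \<open>The weight of order \<open>isum \<alpha> m (Suc k)\<close> splits between the
  coefficient and the block, and Hoelder's inequality for sequences separates them. Through
  \<open>mint_sum_le\<close> this is where the total order must lie strictly between 0 and
  1.\<close>

lemma mint_coef_lesssim:
  assumes k: "m \<le> k" "Suc k \<le> n"
    and IH: "\<And>a b. m \<le> a \<Longrightarrow> a < b \<Longrightarrow> b \<le> k \<Longrightarrow> good a b"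
  shows "lesssim (\<lambda>f. rnorm hmeas (isum \<tau> m (Suc k)) (\<lambda>h::'a. hpow (isum \<alpha> m (Suc k)) h *
     (\<Sum>J. mint J h * (coef f J m k * lnorm (\<sigma> (Suc k)) (B J (f (Suc k))))))) (Bp m (Suc k))"
proof -
  let ?b = "Suc k"
  let ?d = "\<lambda>f J. lnorm (\<sigma> ?b) (B J (f ?b))"
  have kn: "k \<le> n" and i: "?b \<in> {1..n}" using k by auto
  note \<alpha> = \<alpha>_bounds(1)[OF le_imp_less_Suc[OF k(1)] k(2)] \<alpha>_bounds(2)[OF k(2), of m]
  obtain C :: real where C: "\<And>s f. 0 \<le> s \<Longrightarrow> s \<le> 1 \<Longrightarrow> rnorm (hmeas :: 'a measure) s (\<lambda>h. hpow (isum \<alpha> m ?b) h * (\<Sum>J. mint J h * f J))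
      \<le> ennreal C * rnorm (count_space UNIV) s (\<lambda>J. jpow (isum \<alpha> m ?b) J * f J)"
    using mint_sum_le[OF \<alpha>] by blast
  have "lesssim (\<lambda>f. rnorm (count_space UNIV) (isum \<tau> m k) (\<lambda>J. jpow (isum \<alpha> m k) J * coef f J m k) *
     rnorm (count_space UNIV) (\<tau> ?b) (\<lambda>J. jpow (\<alpha> ?b) J * ?d f J)) (Bp m ?b)"
    using lesssim_mult[OF coef_lesssim[OF k(1) kn IH] lesssim_le[of "\<lambda>f. bes f ?b", OF order.refl]]
    by (simp add: Bp_Suc[OF k(1), abs_def] bes_def)
  then have V: "lesssim (\<lambda>f. rnorm (count_space UNIV) (isum \<tau> m ?b) (\<lambda>J. jpow (isum \<alpha> m ?b) J * (coef f J m k * ?d f J))) (Bp m ?b)"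
  proof (rule lesssim_mono)
    fix f
    have "(\<lambda>J. jpow (isum \<alpha> m ?b) J * (coef f J m k * ?d f J)) = (\<lambda>J. (jpow (isum \<alpha> m k) J * coef f J m k) * (jpow (\<alpha> ?b) J * ?d f J))"
      by (simp add: isum_Suc[OF k(1)] jpow_add mult_ac)
    then show "rnorm (count_space UNIV) (isum \<tau> m ?b) (\<lambda>J. jpow (isum \<alpha> m ?b) J * (coef f J m k * ?d f J))
      \<le> rnorm (count_space UNIV) (isum \<tau> m k) (\<lambda>J. jpow (isum \<alpha> m k) J * coef f J m k) * rnorm (count_space UNIV) (\<tau> ?b) (\<lambda>J. jpow (\<alpha> ?b) J * ?d f J)"
      unfolding isum_Suc[OF k(1), of \<tau>] using \<tau>_bounds[OF kn, of m] \<tau>_nonneg[OF i] by (simp only:) (intro rnorm_mult_le; simp)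
  qed
  show ?thesis
    by (rule lesssim_trans[OF lesssimI[of "ennreal C"] V]) (auto intro!: C \<tau>_bounds[OF k(2)])
qed

text \<open>In \<open>NN_le\<close> each term of the sum is a product of a function attached to (a,
  m] and one attached to (m, k + 1]. Smoothness weights and exponents add up along this splitting,
  so Hoelder's inequality for \<open>hmeas\<close> separates the factors.\<close>

lemma remainder_lesssim:
  assumes k: "a \<le> k" "Suc k \<le> n"
    and IH: "\<And>a' b'. a \<le> a' \<Longrightarrow> a' < b' \<Longrightarrow> b' \<le> Suc k \<Longrightarrow> b' - a' < Suc k - a \<Longrightarrow> good a' b'"
  shows "lesssim (\<lambda>f. rnorm hmeas (isum \<tau> a (Suc k)) (\<lambda>h. hpow (isum \<alpha> a (Suc k)) h * NN f a (Suc k) h)) (Bp a (Suc k))"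
proof -
  let ?b = "Suc k"
  let ?d = "\<lambda>f J. lnorm (\<sigma> ?b) (B J (f ?b))"
  let ?M = "\<lambda>f m (h::'a). \<Sum>J. mint J h * (coef f J m k * ?d f J)"
  let ?rn = "\<lambda>a b g. rnorm (hmeas :: 'a measure) (isum \<tau> a b) (\<lambda>h. hpow (isum \<alpha> a b) h * g h)"
  have kn: "k \<le> n" and i: "?b \<in> {1..n}" using k by auto
  note \<tau> = \<tau>_bounds[OF k(2), of a]
  have IH': "good a' b'" if "a \<le> a'" "a' < b'" "b' \<le> k" for a' b' using that by (intro IH) auto
  have goodL: "lesssim (\<lambda>f. lnorm (isum \<sigma> a' b') (Fp f a' b')) (Bp a' b')" if "good a' b'" for a' b'
    using that by (simp add: good_def)
  have low: "NN f a ?b h \<le> (2 + cbern) * ?M f a h + (\<Sum>m\<in>{a<..k}. NN f a m h * ?M f m h)" if f: "adm f" for f h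
  proof (rule NN_le[OF f k])
    show mod: "moderate (Fp f m k)" if "a \<le> m" "m < k" for m
      by (rule lesssim_moderate[OF goodL[OF IH'] kn f]) (use that in auto)
    have fm: "moderate (f ?b)" using f by (simp add: adm_def)
    have t: "0 \<le> \<sigma> ?b" "\<sigma> ?b \<le> 1" using \<sigma>_nonneg[OF i] \<sigma>_bounds[OF k(2), of k] by (auto simp: isum_Suc)
    have kn': "k < n" using k by simp
    note bf = lesssim_finite[OF blocks_lesssim[OF kn'] f k(2)]
    have "AE z in lborel. (\<lambda>J. EE f J z m ?b * B J (f ?b) z) sums Fp f m ?b z" if m: "m \<in> {a..k}" for m
    proof (cases "m = k")
      case True
      then show ?thesis using reproducing_sums[OF fm t bf] by (simp add: EE_def)
    next
      case False
      then have m': "a \<le> m" "m < k" using m by auto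
      have fin: "lnorm (isum \<sigma> m k) (Fp f m k) < top"
        by (rule lesssim_finite[OF goodL[OF IH'] f kn]) (use m' in auto)
      have st: "isum \<sigma> m k + \<sigma> ?b \<le> 1" using \<sigma>_bounds[OF k(2), of m] m' by (simp add: isum_Suc)
      show ?thesis using para_sums[OF mod[OF m'] fm \<sigma>_bounds(1)[OF kn] t(1) st fin bf] False by (simp add: EE_def)
    qed
    then show "AE z in lborel. \<forall>m\<in>{a..k}. (\<lambda>J. EE f J z m ?b * B J (f ?b) z) sums Fp f m ?b z"
      by (subst AE_ball_countable) auto
  qed
  have "lesssim (\<lambda>f. (2 + cbern) * ?rn a ?b (?M f a) + (\<Sum>m\<in>{a<..k}. ?rn a m (NN f a m) * ?rn m ?b (?M f m))) (Bp a ?b)"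
  proof (intro lesssim_add lesssim_cmult lesssim_sum)
    show "lesssim (\<lambda>f. ?rn a ?b (?M f a)) (Bp a ?b)" by (rule mint_coef_lesssim[OF k IH'])
    fix m assume m: "m \<in> {a<..k}"
    show "lesssim (\<lambda>f. ?rn a m (NN f a m) * ?rn m ?b (?M f m)) (Bp a ?b)"
    proof (rule lesssim_Bp_mult)
      show "lesssim (\<lambda>f. ?rn a m (NN f a m)) (Bp a m)" using IH'[of a m] m by (simp add: good_def)
      show "lesssim (\<lambda>f. ?rn m ?b (?M f m)) (Bp m ?b)" by (rule mint_coef_lesssim) (use m k IH' in auto)
    qed (use m in auto)
  qed (use cbern(1) in auto)
  then show ?thesis
  proof (rule lesssim_mono)
    fix f assume f: "adm f"
    note [measurable] = NN_measurable[OF f]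
    have Mm: "(\<lambda>h. hpow \<beta> h * ?M f m h) \<in> borel_measurable hmeas" for \<beta> m by measurable
    have Nm: "(\<lambda>h. hpow \<beta> h * NN f a m h) \<in> borel_measurable hmeas" for \<beta> m by measurable
    have "?rn a ?b (NN f a ?b) \<le> rnorm hmeas (isum \<tau> a ?b) (\<lambda>h. (2 + cbern) * (hpow (isum \<alpha> a ?b) h * ?M f a h)
        + (\<Sum>m\<in>{a<..k}. (hpow (isum \<alpha> a m) h * NN f a m h) * (hpow (isum \<alpha> m ?b) h * ?M f m h)))"
    proof (intro rnorm_mono_AE AE_I2)
      fix h
      have "hpow (isum \<alpha> a ?b) h * NN f a ?b h \<le> hpow (isum \<alpha> a ?b) h * ((2 + cbern) * ?M f a h + (\<Sum>m\<in>{a<..k}. NN f a m h * ?M f m h))"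
        by (intro mult_left_mono low f) simp
      also have "\<dots> = (2 + cbern) * (hpow (isum \<alpha> a ?b) h * ?M f a h) + (\<Sum>m\<in>{a<..k}. hpow (isum \<alpha> a ?b) h * (NN f a m h * ?M f m h))"
        unfolding distrib_left sum_distrib_left by (simp only: mult.left_commute)
      also have "(\<Sum>m\<in>{a<..k}. hpow (isum \<alpha> a ?b) h * (NN f a m h * ?M f m h))
          = (\<Sum>m\<in>{a<..k}. (hpow (isum \<alpha> a m) h * NN f a m h) * (hpow (isum \<alpha> m ?b) h * ?M f m h))"
      proof (rule sum.cong)
        fix m assume "m \<in> {a<..k}"
        then have "isum \<alpha> a ?b = isum \<alpha> a m + isum \<alpha> m ?b" by (simp add: isum_add)
        then show "hpow (isum \<alpha> a ?b) h * (NN f a m h * ?M f m h) = (hpow (isum \<alpha> a m) h * NN f a m h) * (hpow (isum \<alpha> m ?b) h * ?M f m h)"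
          by (simp only: hpow_add mult_ac)
      qed simp
      finally show "hpow (isum \<alpha> a ?b) h * NN f a ?b h \<le> (2 + cbern) * (hpow (isum \<alpha> a ?b) h * ?M f a h)
        + (\<Sum>m\<in>{a<..k}. (hpow (isum \<alpha> a m) h * NN f a m h) * (hpow (isum \<alpha> m ?b) h * ?M f m h))" .
    qed (use \<tau> in auto)
    also have "\<dots> \<le> rnorm hmeas (isum \<tau> a ?b) (\<lambda>h. (2 + cbern) * (hpow (isum \<alpha> a ?b) h * ?M f a h))
        + rnorm hmeas (isum \<tau> a ?b) (\<lambda>h. \<Sum>m\<in>{a<..k}. (hpow (isum \<alpha> a m) h * NN f a m h) * (hpow (isum \<alpha> m ?b) h * ?M f m h))"
      using \<tau> by (intro rnorm_add_le sigma_finite_hmeas) measurable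
    also have "\<dots> \<le> (2 + cbern) * ?rn a ?b (?M f a)
        + (\<Sum>m\<in>{a<..k}. rnorm hmeas (isum \<tau> a ?b) (\<lambda>h. (hpow (isum \<alpha> a m) h * NN f a m h) * (hpow (isum \<alpha> m ?b) h * ?M f m h)))"
      using \<tau> by (intro add_mono rnorm_cmult rnorm_sum_le sigma_finite_hmeas borel_measurable_times Mm Nm) auto
    also have "\<dots> \<le> (2 + cbern) * ?rn a ?b (?M f a) + (\<Sum>m\<in>{a<..k}. ?rn a m (NN f a m) * ?rn m ?b (?M f m))"
    proof (intro add_left_mono sum_mono)
      fix m assume m: "m \<in> {a<..k}"
      then have e: "isum \<tau> a ?b = isum \<tau> a m + isum \<tau> m ?b" by (simp add: isum_add)
      show "rnorm hmeas (isum \<tau> a ?b) (\<lambda>h. (hpow (isum \<alpha> a m) h * NN f a m h) * (hpow (isum \<alpha> m ?b) h * ?M f m h))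
        \<le> ?rn a m (NN f a m) * ?rn m ?b (?M f m)"
        unfolding e using \<tau>_bounds[of m a] \<tau>_bounds[OF k(2), of m] m kn by (intro rnorm_mult_le Mm Nm) auto
    qed
    finally show "?rn a ?b (NN f a ?b) \<le> (2 + cbern) * ?rn a ?b (?M f a) + (\<Sum>m\<in>{a<..k}. ?rn a m (NN f a m) * ?rn m ?b (?M f m))" .
  qed
qed

text \<open>Summability comes from the last factor, whose order is positive; the low-frequency parts
  of the left factor are bounded uniformly in \<open>K\<close>.\<close>

lemma Fp_lesssim:
  assumes k: "a \<le> k" "Suc k \<le> n" and IH: "a < k \<Longrightarrow> good a k"
  shows "lesssim (\<lambda>f. lnorm (isum \<sigma> a (Suc k)) (Fp f a (Suc k))) (Bp a (Suc k))"
proof -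
  let ?b = "Suc k" let ?Bf = "\<lambda>f. \<Sum>J. lnorm (\<sigma> ?b) (B J (f ?b))"
  have kn: "k \<le> n" "k < n" and i: "?b \<in> {1..n}" using k by auto
  have t: "0 \<le> \<sigma> ?b" "\<sigma> ?b \<le> 1" using \<sigma>_nonneg[OF i] \<sigma>_bounds[OF k(2), of k] by (auto simp: isum_Suc)
  note bl = blocks_lesssim[OF kn(2)]
  show ?thesis
  proof (cases "a = k")
    case True
    have "lesssim ?Bf (Bp a ?b)" using bl True by simp
    then show ?thesis
    proof (rule lesssim_mono)
      fix f assume f: "adm f"
      then have fm: "moderate (f ?b)" by (simp add: adm_def)
      note [measurable] = adm_borel[OF f]
      have "lnorm (\<sigma> ?b) (f ?b) \<le> ?Bf f"
        by (rule lnorm_sums_le[OF _ _ t reproducing_sums[OF fm t lesssim_finite[OF bl f k(2)]]]) measurable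
      then show "lnorm (isum \<sigma> a ?b) (Fp f a ?b) \<le> ?Bf f"
        using True by (simp add: isum_Suc)
    qed
  next
    case False
    then have ak: "a < k" using k by simp
    have L: "lesssim (\<lambda>f. lnorm (isum \<sigma> a k) (Fp f a k)) (Bp a k)" using IH[OF ak] by (simp add: good_def)
    obtain C :: real where C: "\<And>K g s. g \<in> borel_measurable borel \<Longrightarrow> 0 \<le> s \<Longrightarrow> s \<le> 1 \<Longrightarrow> lnorm s (S K g) \<le> ennreal C * lnorm s g"
      using S_lnorm_le by blast
    have st: "isum \<sigma> a ?b = isum \<sigma> a k + \<sigma> ?b" by (rule isum_Suc[OF k(1)])
    note s = \<sigma>_bounds[OF kn(1), of a] \<sigma>_bounds[OF k(2), of a]
    have "lesssim (\<lambda>f. ennreal C * (lnorm (isum \<sigma> a k) (Fp f a k) * ?Bf f)) (Bp a ?b)"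
      by (intro lesssim_cmult lesssim_Bp_mult[OF L bl]) (use k in auto)
    then show ?thesis
    proof (rule lesssim_mono)
      fix f assume f: "adm f"
      have [measurable]: "Fp f a k \<in> borel_measurable borel" by (rule Fp_borel[OF adm_borel[OF f]])
      note [measurable] = adm_borel[OF f]
      have fm: "moderate (f ?b)" using f by (simp add: adm_def)
      have "lnorm (isum \<sigma> a ?b) (Fp f a ?b) = lnorm (isum \<sigma> a ?b) (para (Fp f a k) (f ?b))" using False by simp
      also have "\<dots> \<le> (\<Sum>K. lnorm (isum \<sigma> a ?b) (\<lambda>x. S K (Fp f a k) x * B K (f ?b) x))"
      proof (rule lnorm_sums_le)
        show "AE x in lborel. (\<lambda>J. S J (Fp f a k) x * B J (f ?b) x) sums para (Fp f a k) (f ?b) x"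
          by (rule para_sums[OF lesssim_moderate[OF L kn(1) f] fm s(1) t(1) _ lesssim_finite[OF L f kn(1)] lesssim_finite[OF bl f k(2)]])
             (use s st in simp)
      qed (use s in auto)
      also have "\<dots> \<le> ennreal C * lnorm (isum \<sigma> a k) (Fp f a k) * ?Bf f"
        unfolding st by (rule para_terms_le[OF _ _ s(1) t(1)]) (use s st C in auto)
      finally show "lnorm (isum \<sigma> a ?b) (Fp f a ?b) \<le> ennreal C * (lnorm (isum \<sigma> a k) (Fp f a k) * ?Bf f)"
        by (simp only: mult.assoc)
    qed
  qed
qed

text \<open>A block of index \<open>J \<noteq> 0\<close> averages increments of \<open>Fp\<close>,
  and by \<open>Fp_difference\<close> an increment is the remainder plus products of
  \<open>Fp\<close> with remainders over shorter intervals. The latter have lower but still positive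
  order, which is enough for a finite sum over \<open>J\<close>. Block 0 has no cancellation and is
  bounded by the norm itself.\<close>

lemma Fp_blocks_lesssim:
  assumes k: "a < k" "Suc k \<le> n"
    and IH: "\<And>a' b'. a \<le> a' \<Longrightarrow> a' < b' \<Longrightarrow> b' \<le> Suc k \<Longrightarrow> b' - a' < Suc k - a \<Longrightarrow> good a' b'"
    and L: "lesssim (\<lambda>f. lnorm (isum \<sigma> a (Suc k)) (Fp f a (Suc k))) (Bp a (Suc k))"
    and V: "lesssim (\<lambda>f. rnorm hmeas (isum \<tau> a (Suc k)) (\<lambda>h. hpow (isum \<alpha> a (Suc k)) h * NN f a (Suc k) h)) (Bp a (Suc k))"
  shows "lesssim (\<lambda>f. \<Sum>J. lnorm (isum \<sigma> a (Suc k)) (B J (Fp f a (Suc k)))) (Bp a (Suc k))"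
proof -
  let ?b = "Suc k"
  let ?s = "isum \<sigma> a ?b" and ?F = "\<lambda>f. Fp f a ?b"
  let ?K = "\<lambda>f m J. \<integral>\<^sup>+w. ennreal (kk J w) * NN f m ?b w \<partial>(lborel :: 'a measure)"
  let ?N = "\<lambda>f w. NN f a ?b w + (\<Sum>m\<in>{a<..<?b}. lnorm (isum \<sigma> a m) (Fp f a m) * NN f m ?b w)"
  note s = \<sigma>_bounds[OF k(2), of a]
  define C where "C = (\<integral>\<^sup>+w. ennreal (norm (kap 0 w)) \<partial>lborel)"
  have C: "C < top"
    using rapid_integrable[OF kap_rapid kap_borel, of 0] by (simp add: C_def integrable_iff_bounded)
  have "lesssim (\<lambda>f. C * lnorm ?s (?F f) + ennreal ckern * ((\<Sum>J. ?K f a J) + (\<Sum>m\<in>{a<..<?b}. lnorm (isum \<sigma> a m) (Fp f a m) * (\<Sum>J. ?K f m J)))) (Bp a ?b)"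
  proof (intro lesssim_add lesssim_cmult lesssim_sum C L)
    show "lesssim (\<lambda>f. \<Sum>J. ?K f a J) (Bp a ?b)" by (rule kk_NN_lesssim(2)[OF _ k(2) V]) (use k in simp)
    fix m assume m: "m \<in> {a<..<?b}"
    then have "m - a < ?b - a" "?b - m < ?b - a" by auto
    then have good: "good a m" "good m ?b" using IH[of a m] IH[of m ?b] m by auto
    show "lesssim (\<lambda>f. lnorm (isum \<sigma> a m) (Fp f a m) * (\<Sum>J. ?K f m J)) (Bp a ?b)"
    proof (rule lesssim_Bp_mult)
      show "lesssim (\<lambda>f. lnorm (isum \<sigma> a m) (Fp f a m)) (Bp a m)" using good(1) by (simp add: good_def)
      show "lesssim (\<lambda>f. \<Sum>J. ?K f m J) (Bp m ?b)"
        by (rule kk_NN_lesssim(2)[OF _ k(2)]) (use good(2) m in \<open>auto simp: good_def\<close>)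
    qed (use m in auto)
  qed auto
  then show ?thesis
  proof (rule lesssim_mono)
    fix f assume f: "adm f"
    note [measurable] = NN_measurable[OF f]
    have Fm[measurable]: "Fp f m j \<in> borel_measurable borel" for m j by (rule Fp_borel[OF adm_borel[OF f]])
    have om[measurable]: "(\<lambda>x. om f m j x (x + w)) \<in> borel_measurable borel" for m j w
      by (rule om_measurable[OF adm_borel[OF f]]; measurable)
    have mod: "moderate (?F f)" by (rule lesssim_moderate[OF L k(2) f])
    have diff: "lnorm ?s (\<lambda>x. ?F f (x + w) - ?F f x) \<le> ?N f w" for w
    proof -
      have "lnorm ?s (\<lambda>x. ?F f (x + w) - ?F f x) = lnorm ?s (\<lambda>x. om f a ?b x (x + w) + (\<Sum>m\<in>{a<..<?b}. Fp f a m x * om f m ?b x (x + w)))"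
        by (subst Fp_difference) (use k in auto)
      also have "\<dots> \<le> lnorm ?s (\<lambda>x. om f a ?b x (x + w)) + lnorm ?s (\<lambda>x. \<Sum>m\<in>{a<..<?b}. Fp f a m x * om f m ?b x (x + w))"
        using s by (intro lnorm_add_le) measurable
      also have "\<dots> \<le> NN f a ?b w + (\<Sum>m\<in>{a<..<?b}. lnorm ?s (\<lambda>x. Fp f a m x * om f m ?b x (x + w)))"
        unfolding NN_def using s by (intro add_mono lnorm_sum_le) auto
      also have "\<dots> \<le> ?N f w"
      proof (intro add_left_mono sum_mono)
        fix m assume m: "m \<in> {a<..<?b}"
        then have e: "?s = isum \<sigma> a m + isum \<sigma> m ?b" by (simp add: isum_add)
        show "lnorm ?s (\<lambda>x. Fp f a m x * om f m ?b x (x + w)) \<le> lnorm (isum \<sigma> a m) (Fp f a m) * NN f m ?b w"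
          unfolding e NN_def using \<sigma>_bounds[of m a] \<sigma>_bounds[OF k(2), of m] m k by (intro lnorm_mult_le) auto
      qed
      finally show ?thesis .
    qed
    have high: "lnorm ?s (B J (?F f)) \<le> ennreal ckern * (\<integral>\<^sup>+w. ennreal (kk J w) * ?N f w \<partial>lborel)" if J: "J \<noteq> 0" for J
    proof -
      have "lnorm ?s (B J (?F f)) = lnorm ?s (\<lambda>x. LINT w|lborel. kap J (0 - w) * (?F f (x + w) - ?F f x))"
        by (rule arg_cong[where f = "lnorm ?s"], rule ext, rule B_eq_difference[OF mod J])
      also have "\<dots> \<le> ennreal ckern * (\<integral>\<^sup>+w. ennreal (kk J w) * ?N f w \<partial>lborel)"
      proof (rule lnorm_kk_le[OF _ _ _ s])
        show "norm (kap J (0 - w)) \<le> ckern * kk J w" for w using ckern(2)[of J "- w"] by (simp add: kk_minus)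
        show "lnorm ?s (\<lambda>x. ?F f (x + w) - ?F f x) \<le> ?N f w" for w by (rule diff)
        show "(\<lambda>(x, w). ?F f (x + w) - ?F f x) \<in> borel_measurable (lborel \<Otimes>\<^sub>M lborel)"
          by measurable
        show "0 \<le> ckern" using ckern(1) by simp
        show "(\<lambda>w. kap J (0 - w)) \<in> borel_measurable borel" "?N f \<in> borel_measurable borel" by measurable
      qed
      finally show ?thesis .
    qed
    have int: "(\<integral>\<^sup>+w. ennreal (kk J w) * ?N f w \<partial>lborel) = ?K f a J + (\<Sum>m\<in>{a<..<?b}. lnorm (isum \<sigma> a m) (Fp f a m) * ?K f m J)" for J
    proof -
      have "(\<integral>\<^sup>+w. ennreal (kk J w) * ?N f w \<partial>lborel)
        = (\<integral>\<^sup>+w. ennreal (kk J w) * NN f a ?b w + (\<Sum>m\<in>{a<..<?b}. lnorm (isum \<sigma> a m) (Fp f a m) * (ennreal (kk J w) * NN f m ?b w)) \<partial>(lborel :: 'a measure))"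
        unfolding distrib_left sum_distrib_left by (simp only: mult.left_commute)
      also have "\<dots> = ?K f a J + (\<Sum>m\<in>{a<..<?b}. lnorm (isum \<sigma> a m) (Fp f a m) * ?K f m J)"
        by (simp add: nn_integral_add nn_integral_sum nn_integral_cmult del: Fp.simps)
      finally show ?thesis .
    qed
    have zero: "lnorm ?s (B 0 (?F f)) \<le> C * lnorm ?s (?F f)"
      unfolding B_def C_def by (rule lnorm_conv_le[OF _ _ s]) measurable
    have "(\<Sum>J. lnorm ?s (B J (?F f))) \<le> (\<Sum>J. (if J = 0 then C * lnorm ?s (?F f) else 0) + ennreal ckern * (?K f a J + (\<Sum>m\<in>{a<..<?b}. lnorm (isum \<sigma> a m) (Fp f a m) * ?K f m J)))"
    proof (intro suminf_le summableI)
      fix J show "lnorm ?s (B J (?F f)) \<le> (if J = 0 then C * lnorm ?s (?F f) else 0) + ennreal ckern * (?K f a J + (\<Sum>m\<in>{a<..<?b}. lnorm (isum \<sigma> a m) (Fp f a m) * ?K f m J))"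
        using zero high[of J, unfolded int] by (cases "J = 0") (auto simp del: Fp.simps intro: add_increasing2)
    qed
    also have "\<dots> = (\<Sum>J::nat. if J = 0 then C * lnorm ?s (?F f) else 0) + ennreal ckern * ((\<Sum>J. ?K f a J) + (\<Sum>m\<in>{a<..<?b}. lnorm (isum \<sigma> a m) (Fp f a m) * (\<Sum>J. ?K f m J)))"
      by (simp add: suminf_add[symmetric] suminf_sum del: Fp.simps)
    also have "(\<Sum>J::nat. if J = 0 then C * lnorm ?s (?F f) else 0) = C * lnorm ?s (?F f)"
      by (subst suminf_finite[of "{0}"]) auto
    finally show "(\<Sum>J. lnorm ?s (B J (?F f))) \<le> C * lnorm ?s (?F f) + ennreal ckern * ((\<Sum>J. ?K f a J) + (\<Sum>m\<in>{a<..<?b}. lnorm (isum \<sigma> a m) (Fp f a m) * (\<Sum>J. ?K f m J)))" .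
  qed
qed

text \<open>Strong induction on the length \<open>b - a\<close>. The remainder over (a, b] is
  reduced to strictly shorter intervals first, and its bound then controls the blocks of
  \<open>Fp\<close> over the same interval.\<close>

theorem good_all:
  assumes "a < b" "b \<le> n" shows "good a b"
  using assms
proof (induction "b - a" arbitrary: a b rule: less_induct)
  case less
  obtain k where b: "b = Suc k" using less.prems by (cases b) auto
  have k: "a \<le> k" "Suc k \<le> n" using less.prems b by auto
  have IH: "good a' b'" if "a \<le> a'" "a' < b'" "b' \<le> Suc k" "b' - a' < Suc k - a" for a' b'
    by (rule less.hyps) (use that b k in auto)
  have L: "lesssim (\<lambda>f. lnorm (isum \<sigma> a (Suc k)) (Fp f a (Suc k))) (Bp a (Suc k))"
    by (rule Fp_lesssim[OF k]) (use IH in auto)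
  have V: "lesssim (\<lambda>f. rnorm hmeas (isum \<tau> a (Suc k)) (\<lambda>h. hpow (isum \<alpha> a (Suc k)) h * NN f a (Suc k) h)) (Bp a (Suc k))"
    by (rule remainder_lesssim[OF k IH])
  have "lesssim (\<lambda>f. \<Sum>J. lnorm (isum \<sigma> a (Suc k)) (B J (Fp f a (Suc k)))) (Bp a (Suc k))"
  proof (cases "a = k")
    case True
    then show ?thesis using blocks_lesssim[of k] k by (simp add: isum_Suc)
  next
    case False
    then show ?thesis using k by (intro Fp_blocks_lesssim IH L V) auto
  qed
  with L V show ?case unfolding b good_def by blast
qed

end

section \<open>Transfer to distributions\<close>

lemma rnorm_lebesgue_cong:
  fixes F G :: "'a::euclidean_space \<Rightarrow> complex"
  assumes G[measurable]: "G \<in> borel_measurable borel" and ae: "AE x in lebesgue. F x = G x" and "0 \<le> s"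
  shows "rnorm lebesgue s (\<lambda>x. ennreal (norm (F x))) = lnorm s G"
proof -
  have Gm[measurable]: "G \<in> borel_measurable lebesgue" by (rule measurable_completion) simp
  have Fm[measurable]: "F \<in> borel_measurable lebesgue"
    by (rule borel_measurable_AE[OF Gm]) (use ae in \<open>auto elim: eventually_mono\<close>)
  have "rnorm lebesgue s (\<lambda>x. ennreal (norm (F x))) = rnorm lebesgue s (\<lambda>x. ennreal (norm (G x)))"
    using ae by (intro rnorm_cong_AE \<open>0 \<le> s\<close>) (measurable, auto elim: eventually_mono)
  also have "\<dots> = lnorm s G"
    unfolding lnorm_def by (rule rnorm_completion) measurable
  finally show ?thesis .
qed

lemma inverse_ennreal_le_1:
  assumes "1 / P \<le> (1::ennreal)" shows "1 \<le> P"
proof (cases P rule: ennreal_cases)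
  case (real r)
  show ?thesis
  proof (cases "r = 0")
    case False
    then have r: "0 < r" using real by simp
    have "1 / P = ennreal (1 / r)" using divide_ennreal[of 1 r] r real by simp
    then have "1 / r \<le> 1" using assms by (simp flip: ennreal_1)
    then have "1 \<le> r" using r by (simp add: field_simps)
    then show ?thesis using real ennreal_leI[of 1 r] by simp
  qed (use real assms in \<open>simp add: ennreal_divide_zero top_unique\<close>)
qed simp

lemma enn2real_inverse_sum:
  assumes "1 / P = (\<Sum>i\<in>I. 1 / p i)" "\<And>i. i \<in> I \<Longrightarrow> 1 \<le> p i"
  shows "enn2real (1 / P) = (\<Sum>i\<in>I. enn2real (1 / p i))"
proof -
  have "1 / p i < top" if "i \<in> I" for i
    using enn2real_inverse_bounds(2)[OF assms(2)[OF that]] by (metis ennreal_less_top)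
  then show ?thesis unfolding assms(1) by (subst enn2real_sum) auto
qed

text \<open>Lowering the left index by one turns the closed ranges of the recursion into half-open
  ones, and the recursion becomes the triangular system.\<close>

lemma para_remainder_eq_lsolve:
  assumes "a < l"
  shows "para_remainder chi rho f (Suc a) l x y = lsolve (\<lambda>m k. iter_para_fun chi rho f (Suc m) k x)
    (\<lambda>m k. iter_para_fun chi rho f (Suc m) k y - iter_para_fun chi rho f (Suc m) k x) a l"
  using assms
proof (induction a rule: lsolve_induct[of l])
  case (less a)
  have "{Suc a..<l} = {a<..<l}" by auto
  then show ?case
    unfolding para_remainder.simps[of _ _ _ "Suc a"] lsolve.simps[of _ _ a]
    using less by (auto intro!: sum.cong)
qed (use assms in auto)

lemma iter_paraprod_Suc:
  "k \<le> l \<Longrightarrow> iter_paraprod chi rho u k (Suc l) = paraprod chi rho (iter_paraprod chi rho u k l) (u (Suc l))"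
  by (simp add: iter_paraprod_def)

lemma (in dyadic_setting) besov_norm_eq:
  assumes u: "represents u g" and p: "1 \<le> p" and q: "1 \<le> q"
  shows "rnorm (count_space UNIV) (enn2real (1 / q)) (\<lambda>J. jpow \<alpha> J * lnorm (enn2real (1 / p)) (B J g))
     \<le> ennreal (2 powr \<alpha>) * besov_norm chi rho \<alpha> p q u"
proof -
  let ?s = "enn2real (1 / p)" and ?t = "enn2real (1 / q)"
  let ?F = "\<lambda>j. ennreal (2 powr (real_of_int j * \<alpha>)) * Lnorm lebesgue p (\<lambda>x. ennreal (norm (lp_fun chi rho j u x)))"
  have s: "0 \<le> ?s" "0 \<le> ?t" by simp_all
  have [measurable]: "g \<in> borel_measurable borel" using u moderate_borel by (auto simp: represents_def)
  have block: "Lnorm lebesgue p (\<lambda>x. ennreal (norm (lp_fun chi rho (int J - 1) u x))) = lnorm ?s (B J g)" for J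
    unfolding Lnorm_eq_rnorm[OF p] B_def
    by (rule rnorm_lebesgue_cong[OF _ lp_fun_represents(1)[OF u] s(1)]) measurable
  have jp: "jpow \<alpha> J * lnorm ?s (B J g) = ennreal (2 powr \<alpha>) * ?F (int J - 1)" for J
  proof -
    have "jpow \<alpha> J = ennreal (2 powr \<alpha>) * ennreal (2 powr (real_of_int (int J - 1) * \<alpha>))"
      by (simp add: jpow_def algebra_simps flip: ennreal_mult powr_add)
    then show ?thesis unfolding block by (simp only: mult.assoc)
  qed
  have bij: "bij_betw (\<lambda>J. int J - 1) UNIV {-1..}"
    by (rule bij_betwI[of _ _ _ "\<lambda>j. nat (j + 1)"]) auto
  have "rnorm (count_space UNIV) ?t (\<lambda>J. jpow \<alpha> J * lnorm ?s (B J g)) \<le> ennreal (2 powr \<alpha>) * rnorm (count_space UNIV) ?t (\<lambda>J. ?F (int J - 1))"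
    unfolding jp by (rule rnorm_cmult) (use s in auto)
  also have "rnorm (count_space UNIV) ?t (\<lambda>J. ?F (int J - 1)) = rnorm (distr (count_space UNIV) (count_space {-1..}) (\<lambda>J. int J - 1)) ?t ?F"
    by (rule rnorm_distr[symmetric]) auto
  also have "\<dots> = besov_norm chi rho \<alpha> p q u"
    unfolding distr_bij_count_space[OF bij] besov_norm_def Lnorm_eq_rnorm[OF q] ..
  finally show ?thesis .
qed

context besov_exponents
begin

lemma good_bounds:
  assumes "good a b" "adm f" "b \<le> n"
  shows "moderate (Fp f a b)" "lnorm (isum \<sigma> a b) (Fp f a b) < top" "(\<Sum>J. lnorm (isum \<sigma> a b) (B J (Fp f a b))) < top"
proof -
  show "moderate (Fp f a b)" by (rule lesssim_moderate[OF _ assms(3,2)]) (use assms(1) in \<open>simp add: good_def\<close>)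
  show "lnorm (isum \<sigma> a b) (Fp f a b) < top" "(\<Sum>J. lnorm (isum \<sigma> a b) (B J (Fp f a b))) < top"
    by (rule lesssim_finite[where a = a, OF _ assms(2,3)]; use assms(1) in \<open>simp add: good_def\<close>)+
qed

text \<open>Representation against rapidly decreasing functions is passed from one paraproduct to
  the next; the uniform bounds \<open>good_all\<close> supply the summability that each step
  demands.\<close>

lemma iter_paraprod_represents:
  assumes f: "adm f" and u: "\<And>i. i \<in> {1..n} \<Longrightarrow> represents (u i) (f i)" and "a < l" "l \<le> n"
  shows "represents (iter_paraprod chi rho u (Suc a) l) (Fp f a l)"
  using assms(3,4)
proof (induction l)
  case (Suc l)
  show ?case
  proof (cases "a = l")
    case True
    then show ?thesis using u[of "Suc l"] Suc.prems by (simp add: iter_paraprod_def)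
  next
    case False
    then have al: "a < l" "l \<le> n" "l < n" using Suc.prems by auto
    have st: "0 \<le> \<sigma> (Suc l)" "isum \<sigma> a l + \<sigma> (Suc l) \<le> 1"
      using \<sigma>_nonneg[of "Suc l"] \<sigma>_bounds[OF Suc.prems(2), of a] al Suc.prems by (auto simp: isum_Suc)
    have "represents (paraprod chi rho (iter_paraprod chi rho u (Suc a) l) (u (Suc l))) (para (Fp f a l) (f (Suc l)))"
      by (rule paraprod_represents[OF Suc.IH[OF al(1,2)] _ \<sigma>_bounds(1)[OF al(2)] st
            good_bounds(2,3)[OF good_all[OF al(1,2)] f al(2)] lesssim_finite[OF blocks_lesssim[OF al(3)] f]])
         (use u al in auto)
    then show ?thesis using False al by (simp add: iter_paraprod_Suc)
  qed
qed simp

theorem remainder_bound: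
  "\<exists>C<top. \<forall>f. adm f \<longrightarrow> rnorm hmeas (isum \<tau> 0 n) (\<lambda>h. hpow (isum \<alpha> 0 n) h * NN f 0 n h) \<le> C * Bp 0 n f"
  if "1 \<le> n"
  using good_all[of 0 n] that by (simp add: good_def lesssim_def)

end

text \<open>Both strips over a null set are null in the product. It transfers almost everywhere
  equality of the functions of one variable to joint measurability of the remainder.\<close>

lemma AE_lebesgue_prod:
  fixes Q :: "'a::euclidean_space \<Rightarrow> bool"
  assumes "AE x in lebesgue. Q x"
  shows "AE z in (lebesgue :: ('a \<times> 'a) measure). Q (fst z) \<and> Q (snd z)"
proof -
  have "AE x in lborel. Q x" using assms by (simp add: AE_completion_iff)
  then obtain N where N: "{x \<in> space lborel. \<not> Q x} \<subseteq> N" "emeasure lborel N = 0" "N \<in> sets lborel" by (rule AE_E)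
  then have N0: "N \<in> null_sets lborel" by (simp add: null_sets_def)
  have null: "N \<times> UNIV \<in> null_sets (lborel \<Otimes>\<^sub>M lborel)"
    by (rule lborel.times_in_null_sets1[OF N0]) simp
  have null': "(UNIV :: 'a set) \<times> N \<in> null_sets (lborel \<Otimes>\<^sub>M lborel)"
    by (rule lborel.times_in_null_sets2[OF _ N0]) simp
  have "AE z in lborel \<Otimes>\<^sub>M lborel. Q (fst z) \<and> Q (snd z)"
    by (rule AE_I'[OF null_sets.Un[OF null null']]) (use N(1) in auto)
  then show ?thesis unfolding AE_completion_iff lborel_prod .
qed

theorem theorem3p1:
  fixes chi rho :: "'a::euclidean_space \<Rightarrow> complex"
    and n :: nat
    and \<alpha> :: "nat \<Rightarrow> real"
    and p q :: "nat \<Rightarrow> ennreal"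
    and P Q :: ennreal
  assumes "dyadic_partition chi rho"
    and "n \<ge> 1"
    and "\<And>i. i \<in> {1..n} \<Longrightarrow> 0 < \<alpha> i \<and> \<alpha> i < 1"
    and "\<And>i. i \<in> {1..n} \<Longrightarrow> 1 \<le> p i"
    and "\<And>i. i \<in> {1..n} \<Longrightarrow> 1 \<le> q i"
    and "(\<Sum>i=1..n. \<alpha> i) < 1"
    and "1 / P = (\<Sum>i=1..n. 1 / p i)" and "1 / P \<le> 1"
    and "1 / Q = (\<Sum>i=1..n. 1 / q i)" and "1 / Q \<le> 1"
  shows "\<exists>C::real. \<forall>f :: nat \<Rightarrow> 'a \<Rightarrow> complex.
           (\<forall>i\<in>{1..n}. regular_fun (f i) \<and> distr_of (f i) \<in> besov chi rho (\<alpha> i) (p i) (q i)) \<longrightarrow>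
           para_remainder chi rho f 1 n \<in> two_param (\<Sum>i=1..n. \<alpha> i) P Q \<and>
           two_param_norm (\<Sum>i=1..n. \<alpha> i) P Q (para_remainder chi rho f 1 n)
             \<le> ennreal C * (\<Prod>i=1..n. besov_norm chi rho (\<alpha> i) (p i) (q i) (distr_of (f i)))"
proof -
  define \<sigma> where "\<sigma> i = enn2real (1 / p i)" for i
  define \<tau> where "\<tau> i = enn2real (1 / q i)" for i
  let ?\<alpha> = "\<Sum>i=1..n. \<alpha> i"
  have set: "{0<..n} = {1..n}" by auto
  have PQ: "1 \<le> P" "1 \<le> Q" using assms(8,10) by (auto intro: inverse_ennreal_le_1)
  have \<sigma>: "enn2real (1 / P) = isum \<sigma> 0 n" and \<tau>: "enn2real (1 / Q) = isum \<tau> 0 n" and \<alpha>: "isum \<alpha> 0 n = ?\<alpha>"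
    using enn2real_inverse_sum[OF assms(7) assms(4)] enn2real_inverse_sum[OF assms(9) assms(5)]
    by (simp_all add: isum_def set \<sigma>_def \<tau>_def)
  interpret besov_exponents chi rho n \<alpha> \<sigma> \<tau>
  proof unfold_locales
    show "isum \<sigma> 0 n \<le> 1" "isum \<tau> 0 n \<le> 1"
      using enn2real_inverse_bounds(1)[OF PQ(1)] enn2real_inverse_bounds(1)[OF PQ(2)] \<sigma> \<tau> by auto
  qed (use assms \<alpha> in \<open>auto simp: \<sigma>_def \<tau>_def\<close>)
  obtain C where C: "C < top" "\<And>f. adm f \<Longrightarrow> rnorm hmeas (isum \<tau> 0 n) (\<lambda>h. hpow (isum \<alpha> 0 n) h * NN f 0 n h) \<le> C * Bp 0 n f"
    using remainder_bound[OF assms(2)] by blast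
  \<comment> \<open>The powers of 2 compensate the index shift \<open>J = j + 1\<close> in the
    weights.\<close>
  define D where "D = C * (\<Prod>i=1..n. ennreal (2 powr \<alpha> i))"
  have "(\<Prod>i=1..n. ennreal (2 powr \<alpha> i)) = ennreal (\<Prod>i=1..n. 2 powr \<alpha> i)" by (rule prod_ennreal) simp
  then have D: "D < top" using C(1) by (simp add: D_def ennreal_mult_less_top)
  show ?thesis
  proof (intro exI[of _ "enn2real D"] allI impI)
    fix f :: "nat \<Rightarrow> 'a \<Rightarrow> complex"
    assume f: "\<forall>i\<in>{1..n}. regular_fun (f i) \<and> distr_of (f i) \<in> besov chi rho (\<alpha> i) (p i) (q i)"
    let ?bn = "\<lambda>i. besov_norm chi rho (\<alpha> i) (p i) (q i) (distr_of (f i))"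
    have "\<exists>g. moderate g \<and> (i \<in> {1..n} \<longrightarrow> (AE x in lebesgue. f i x = g x))" for i
    proof (cases "i \<in> {1..n}")
      case True
      then show ?thesis using f regular_fun_moderate by blast
    next
      case False
      \<comment> \<open>Indices outside {1..n} receive the zero function, since \<open>adm\<close>
        speaks of all indices.\<close>
      have "moderate (\<lambda>_::'a. 0)" by (simp add: moderate_def)
      with False show ?thesis by blast
    qed
    then obtain g where g: "\<And>i. moderate (g i)" "\<And>i. i \<in> {1..n} \<Longrightarrow> AE x in lebesgue. f i x = g i x" by metis
    have rep: "represents (distr_of (f i)) (g i)" if "i \<in> {1..n}" for i
      using f that by (intro represents_distr_of g) auto
    have bes: "bes g i \<le> ennreal (2 powr \<alpha> i) * ?bn i" if "i \<in> {1..n}" for i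
      unfolding bes_def \<sigma>_def \<tau>_def by (rule besov_norm_eq[OF rep assms(4,5)]) (rule that)+
    have bn: "?bn i < top" if "i \<in> {1..n}" for i using f that by (auto simp: besov_def)
    have adm: "adm g"
      unfolding adm_def using g(1) by (auto intro!: order_le_less_trans[OF bes] simp: ennreal_mult_less_top bn)
    \<comment> \<open>The functions picked by \<open>fun_of\<close> are known only almost
      everywhere; as there are finitely many index pairs, one set of full measure serves them
      all.\<close>
    have "AE x in lebesgue. \<forall>i\<in>{..<n} \<times> {..n}. fst i < snd i \<longrightarrow> iter_para_fun chi rho f (Suc (fst i)) (snd i) x = Fp g (fst i) (snd i) x"
    proof (intro AE_finite_allI)
      fix i assume "i \<in> {..<n} \<times> {..n}"
      then obtain a b where i: "i = (a, b)" "a < n" "b \<le> n" by auto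
      show "AE x in lebesgue. fst i < snd i \<longrightarrow> iter_para_fun chi rho f (Suc (fst i)) (snd i) x = Fp g (fst i) (snd i) x"
      proof (cases "a < b")
        case ab: True
        show ?thesis
        proof (cases "b = Suc a")
          case True
          then show ?thesis using g(2)[of b] i by (simp add: iter_para_fun_def)
        next
          case False
          show ?thesis
            using fun_of_represents(1)[OF iter_paraprod_represents[OF adm rep ab i(3)]] False i(1)
            by (auto simp: iter_para_fun_def elim: eventually_mono)
        qed
      qed (simp add: i)
    qed simp
    then have good: "AE x in lebesgue. \<forall>a b. a < b \<longrightarrow> b \<le> n \<longrightarrow> iter_para_fun chi rho f (Suc a) b x = Fp g a b x"
      by eventually_elim auto
    define G where "G x \<longleftrightarrow> (\<forall>a b. a < b \<longrightarrow> b \<le> n \<longrightarrow> iter_para_fun chi rho f (Suc a) b x = Fp g a b x)" for x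
    have GAE: "AE x in lebesgue. G x" using good by (simp add: G_def)
    let ?\<omega> = "para_remainder chi rho f 1 n"
    have eq: "?\<omega> x y = om g 0 n x y" if "G x" "G y" for x y
      unfolding One_nat_def para_remainder_eq_lsolve[OF less_le_trans[OF zero_less_one assms(2)]] om_def
      by (rule lsolve_cong) (use that assms(2) in \<open>auto simp: G_def\<close>)
    \<comment> \<open>For every fixed \<open>h\<close> both \<open>x\<close> and
      \<open>x + h\<close> lie in the good set for almost all \<open>x\<close>, so the inner norms
      agree for all \<open>h\<close> and no exceptional set in \<open>h\<close> arises.\<close>
    have inner: "Lnorm lebesgue P (\<lambda>x. ennreal (norm (?\<omega> x (x + h)))) = NN g 0 n h" for h
    proof -
      have "AE x in lborel. G x" using GAE by (simp add: AE_completion_iff)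
      from this AE_lborel_translate[OF this, of h] have "AE x in lborel. ?\<omega> x (x + h) = om g 0 n x (x + h)"
        by eventually_elim (rule eq)
      then have ae: "AE x in lebesgue. ?\<omega> x (x + h) = om g 0 n x (x + h)" by (rule AE_completion)
      have om: "(\<lambda>x. om g 0 n x (x + h)) \<in> borel_measurable borel"
        by (rule om_measurable[OF adm_borel[OF adm]]; measurable)
      show ?thesis
        unfolding Lnorm_eq_rnorm[OF PQ(1)] \<sigma> NN_def
        by (rule rnorm_lebesgue_cong[OF om ae]) (rule \<sigma>_bounds(1)[OF order.refl])
    qed
    have "two_param_norm ?\<alpha> P Q ?\<omega> = rnorm hmeas (isum \<tau> 0 n) (\<lambda>h. hpow (isum \<alpha> 0 n) h * NN g 0 n h)"
      unfolding two_param_norm_def inner Lnorm_eq_rnorm[OF PQ(2)] \<tau> hmeas_def hpow_def \<alpha>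
      by (rule rnorm_density_completion) (use NN_measurable[OF adm] in measurable)
    also have "\<dots> \<le> C * Bp 0 n g" by (rule C(2)[OF adm])
    also have "\<dots> \<le> C * (\<Prod>i=1..n. ennreal (2 powr \<alpha> i) * ?bn i)"
      unfolding Bp_def set by (intro mult_left_mono prod_mono_ennreal bes) auto
    also have "\<dots> = D * (\<Prod>i=1..n. ?bn i)" by (simp add: D_def prod.distrib mult.assoc)
    also have "D = ennreal (enn2real D)" using D by simp
    finally have bound: "two_param_norm ?\<alpha> P Q ?\<omega> \<le> ennreal (enn2real D) * (\<Prod>i=1..n. ?bn i)" .
    have "(\<Prod>i\<in>I. ?bn i) < top" if "finite I" "I \<subseteq> {1..n}" for I
      using that by (induction I) (auto simp: ennreal_mult_less_top bn)
    from this[of "{1..n}"] have "ennreal (enn2real D) * (\<Prod>i=1..n. ?bn i) < top" by (simp add: ennreal_mult_less_top)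
    with bound have fin: "two_param_norm ?\<alpha> P Q ?\<omega> < top" by (rule order_le_less_trans)
    \<comment> \<open>\<open>om g\<close> is Borel in both variables, and completeness of the
      Lebesgue measure transfers measurability to the almost everywhere equal remainder of
      \<open>f\<close>.\<close>
    have "(\<lambda>(x, y). om g 0 n x y) \<in> borel_measurable (lebesgue :: ('a \<times> 'a) measure)"
    proof (rule measurable_completion)
      show "(\<lambda>(x, y). om g 0 n x y) \<in> borel_measurable (lborel :: ('a \<times> 'a) measure)"
        unfolding split_beta' by (rule om_measurable[OF adm_borel[OF adm]]) (auto simp: borel_prod[symmetric])
    qed
    then have "(\<lambda>(x, y). ?\<omega> x y) \<in> borel_measurable (lebesgue :: ('a \<times> 'a) measure)"
    proof (rule borel_measurable_AE)
      show "AE z in lebesgue. (case z of (x, y) \<Rightarrow> om g 0 n x y) = (case z of (x, y) \<Rightarrow> ?\<omega> x y)"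
        using AE_lebesgue_prod[OF GAE] by eventually_elim (auto simp: eq simp del: One_nat_def)
    qed
    with fin bound show "?\<omega> \<in> two_param ?\<alpha> P Q \<and> two_param_norm ?\<alpha> P Q ?\<omega> \<le> ennreal (enn2real D) * (\<Prod>i=1..n. ?bn i)"
      by (simp add: two_param_def)
  qed
qed

end
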